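(* For a category $\mathcal X$, the following conditions are equivalent: (a) $\mathcal X$ is regular, protomodular, and has stable coequalizers of equivalence relations; (b) $\mathcal X$ is a semi-localization of an exact protomodular category $\mathcal C$; (c) $\mathcal X$ is a semi-localization of an exact protomodular category $\mathcal C$, and the units of the reflection are regular epimorphisms (i.e. every component $\eta_C$ is a regular epimorphism in $\mathcal C$); (d) $\mathcal X$ is regular, is a semi-localization of its exact completion $\mathcal X_{\mathrm{ex/reg}}$ as a regular category, and $\mathcal X_{\mathrm{ex/reg}}$ is protomodular.
   Context: Regular category: has finite limits, coequalizers of kernel pairs, and pullback-stable regular epimorphisms. Exact (Barr-exact) category: a regular category in which every equivalence relation is a kernel pair. Protomodular: a category with pullbacks is protomodular if, for every split epimorphism $p\colon E\to B$ with section $s\colon B\to E$ and every $f\colon A\to B$, with pullback $D=A\times_B E$ and projection $g\colon D\to E$, the pair $(g,s)$ is jointly strongly epimorphic (every monomorphism into $E$ through which both $g$ and $s$ factorize is invertible). Stable coequalizers of equivalence relations: every equivalence relation $R\rightrightarrows X$ has a coequalizer $q\colon X\to Q$, and for every $f\colon Y\to Q$, if $q'\colon X'\to Y$ is the pullback of $q$ along $f$ and $S\rightrightarrows X'$ is the equivalence relation obtained by pulling back $R\to Q$ along $f$, then $q'$ is the coequalizer of $S\rightrightarrows X'$. Semi-localization: a full reflective subcategory $U\colon\mathcal X\to\mathcal C$, with reflector $L\colon\mathcal C\to\mathcal X$ and unit $\eta$, is a semi-localization of $\mathcal C$ if $L$ is semi-left-exact: for every object $Q$ of $\mathcal C$ and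 every $f\colon X\to LQ$ in $\mathcal X$, $L$ preserves the pullback of $Uf\colon UX\to ULQ$ along $\eta_Q\colon Q\to ULQ$. A category is said to be a semi-localization of $\mathcal C$ if it is equivalent to such a subcategory. Exact completion: for a regular category $\mathcal X$, $\mathcal X_{\mathrm{ex/reg}}$ is its exact completion as a regular category, i.e. the value at $\mathcal X$ of the left biadjoint to the inclusion of the 2-category of exact categories into that of regular categories, regular functors (preserving finite limits and regular epimorphisms) and natural transformations. Explicitly, objects are pairs $(X,R)$ with $R$ an equivalence relation on $X\in\mathcal X$; a morphism $(X,R)\to(Y,S)$ is a relation $\varphi$ from $X$ to $Y$ with $S\varphi R=\varphi$, $R\le\varphi^\circ\varphi$ and $\varphi\varphi^\circ\le S$, where $\varphi^\circ$ is the opposite relation; composition is that of relations, and the identity of $(X,R)$ is $R$. The category $\mathcal X$ is regarded as a full subcategory of $\mathcal X_{\mathrm{ex/reg}}$ via the fully faithful unit $X\mapsto (X,1_X)$; in (d), "is a semi-localization" refers to this embedding. *)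

theory Defs
  imports Main
begin

section \<open>Categories, functors, natural transformations\<close>

text \<open>\<open>Comp g f\<close> is the composite ``first \<open>f\<close>, then \<open>g\<close>''. The values of the operations
  outside the carrier sets \<open>Obj\<close> and \<open>Arr\<close> are irrelevant.\<close>

record ('o, 'a) cat =
  Obj :: "'o set"
  Arr :: "'a set"
  Dom :: "'a \<Rightarrow> 'o"
  Cod :: "'a \<Rightarrow> 'o"
  Ident :: "'o \<Rightarrow> 'a"
  Comp :: "'a \<Rightarrow> 'a \<Rightarrow> 'a"  (infixr \<open>\<cdot>\<index>\<close> 70)

definition hom :: "('o, 'a) cat \<Rightarrow> 'o \<Rightarrow> 'o \<Rightarrow> 'a set" where
  "hom C A B = {f \<in> Arr C. Dom C f = A \<and> Cod C f = B}"

locale category =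
  fixes C :: "('o, 'a) cat" (structure)
  assumes dom_obj: "f \<in> Arr C \<Longrightarrow> Dom C f \<in> Obj C"
    and cod_obj: "f \<in> Arr C \<Longrightarrow> Cod C f \<in> Obj C"
    and ident_hom: "A \<in> Obj C \<Longrightarrow> Ident C A \<in> hom C A A"
    and comp_hom: "f \<in> hom C A B \<Longrightarrow> g \<in> hom C B D \<Longrightarrow> g \<cdot> f \<in> hom C A D"
    and comp_assoc: "f \<in> hom C A B \<Longrightarrow> g \<in> hom C B D \<Longrightarrow> h \<in> hom C D E \<Longrightarrow>
      h \<cdot> (g \<cdot> f) = (h \<cdot> g) \<cdot> f"
    and ident_left: "f \<in> hom C A B \<Longrightarrow> Ident C B \<cdot> f = f"
    and ident_right: "f \<in> hom C A B \<Longrightarrow> f \<cdot> Ident C A = f"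

definition full_subcat :: "('o, 'a) cat \<Rightarrow> 'o set \<Rightarrow> ('o, 'a) cat" where
  "full_subcat C S = C\<lparr>Obj := S, Arr := {f \<in> Arr C. Dom C f \<in> S \<and> Cod C f \<in> S}\<rparr>"

record ('o, 'a, 'p, 'b) fctr =
  ObjMap :: "'o \<Rightarrow> 'p"
  ArrMap :: "'a \<Rightarrow> 'b"

definition is_functor :: "('o, 'a) cat \<Rightarrow> ('p, 'b) cat \<Rightarrow> ('o, 'a, 'p, 'b) fctr \<Rightarrow> bool" where
  "is_functor C D F \<longleftrightarrow> category C \<and> category D \<and>
    (\<forall>A \<in> Obj C. ObjMap F A \<in> Obj D) \<and>
    (\<forall>A B. \<forall>f \<in> hom C A B. ArrMap F f \<in> hom D (ObjMap F A) (ObjMap F B)) \<and>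
    (\<forall>A \<in> Obj C. ArrMap F (Ident C A) = Ident D (ObjMap F A)) \<and>
    (\<forall>A B E. \<forall>f \<in> hom C A B. \<forall>g \<in> hom C B E.
      ArrMap F (g \<cdot>\<^bsub>C\<^esub> f) = ArrMap F g \<cdot>\<^bsub>D\<^esub> ArrMap F f)"

definition id_functor :: "('o, 'a, 'o, 'a) fctr" where
  "id_functor = \<lparr>ObjMap = (\<lambda>A. A), ArrMap = (\<lambda>f. f)\<rparr>"

definition comp_functor ::
  "('p, 'b, 'q, 'c) fctr \<Rightarrow> ('o, 'a, 'p, 'b) fctr \<Rightarrow> ('o, 'a, 'q, 'c) fctr" where
  "comp_functor G F = \<lparr>ObjMap = ObjMap G \<circ> ObjMap F, ArrMap = ArrMap G \<circ> ArrMap F\<rparr>"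

definition fully_faithful :: "('o, 'a) cat \<Rightarrow> ('p, 'b) cat \<Rightarrow> ('o, 'a, 'p, 'b) fctr \<Rightarrow> bool" where
  "fully_faithful C D F \<longleftrightarrow> is_functor C D F \<and>
    (\<forall>A \<in> Obj C. \<forall>B \<in> Obj C.
      bij_betw (ArrMap F) (hom C A B) (hom D (ObjMap F A) (ObjMap F B)))"

definition nat_trans :: "('o, 'a) cat \<Rightarrow> ('p, 'b) cat \<Rightarrow> ('o, 'a, 'p, 'b) fctr \<Rightarrow>
    ('o, 'a, 'p, 'b) fctr \<Rightarrow> ('o \<Rightarrow> 'b) \<Rightarrow> bool" where
  "nat_trans C D F G \<tau> \<longleftrightarrow> is_functor C D F \<and> is_functor C D G \<and>
    (\<forall>A \<in> Obj C. \<tau> A \<in> hom D (ObjMap F A) (ObjMap G A)) \<and>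
    (\<forall>A B. \<forall>f \<in> hom C A B. \<tau> B \<cdot>\<^bsub>D\<^esub> ArrMap F f = ArrMap G f \<cdot>\<^bsub>D\<^esub> \<tau> A)"

definition is_iso :: "('o, 'a) cat \<Rightarrow> 'a \<Rightarrow> bool" where
  "is_iso C f \<longleftrightarrow> f \<in> Arr C \<and> (\<exists>g \<in> hom C (Cod C f) (Dom C f).
    g \<cdot>\<^bsub>C\<^esub> f = Ident C (Dom C f) \<and> f \<cdot>\<^bsub>C\<^esub> g = Ident C (Cod C f))"

definition naturally_isomorphic :: "('o, 'a) cat \<Rightarrow> ('p, 'b) cat \<Rightarrow>
    ('o, 'a, 'p, 'b) fctr \<Rightarrow> ('o, 'a, 'p, 'b) fctr \<Rightarrow> bool" where
  "naturally_isomorphic C D F G \<longleftrightarrow>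
    (\<exists>\<tau>. nat_trans C D F G \<tau> \<and> (\<forall>A \<in> Obj C. is_iso D (\<tau> A)))"

definition equivalent_cats :: "('o, 'a) cat \<Rightarrow> ('p, 'b) cat \<Rightarrow> bool" where
  "equivalent_cats C D \<longleftrightarrow> (\<exists>F G. is_functor C D F \<and> is_functor D C G \<and>
    naturally_isomorphic C C (comp_functor G F) id_functor \<and>
    naturally_isomorphic D D (comp_functor F G) id_functor)"


section \<open>Limits, coequalizers, classes of arrows\<close>

definition is_cone :: "('j, 'i) cat \<Rightarrow> ('o, 'a) cat \<Rightarrow> ('j, 'i, 'o, 'a) fctr \<Rightarrow>
    'o \<Rightarrow> ('j \<Rightarrow> 'a) \<Rightarrow> bool" where
  "is_cone J C D A \<pi> \<longleftrightarrow> A \<in> Obj C \<and>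
    (\<forall>j \<in> Obj J. \<pi> j \<in> hom C A (ObjMap D j)) \<and>
    (\<forall>u \<in> Arr J. ArrMap D u \<cdot>\<^bsub>C\<^esub> \<pi> (Dom J u) = \<pi> (Cod J u))"

definition is_limit :: "('j, 'i) cat \<Rightarrow> ('o, 'a) cat \<Rightarrow> ('j, 'i, 'o, 'a) fctr \<Rightarrow>
    'o \<Rightarrow> ('j \<Rightarrow> 'a) \<Rightarrow> bool" where
  "is_limit J C D A \<pi> \<longleftrightarrow> is_cone J C D A \<pi> \<and>
    (\<forall>B \<sigma>. is_cone J C D B \<sigma> \<longrightarrow>
      (\<exists>!h. h \<in> hom C B A \<and> (\<forall>j \<in> Obj J. \<pi> j \<cdot>\<^bsub>C\<^esub> h = \<sigma> j)))"

text \<open>Every finite category is isomorphic to one whose objects and arrows are natural numbers,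
  so restricting the index categories to \<open>(nat, nat) cat\<close> loses no generality.\<close>

definition has_finite_limits :: "('o, 'a) cat \<Rightarrow> bool" where
  "has_finite_limits C \<longleftrightarrow>
    (\<forall>(J :: (nat, nat) cat) D. finite (Obj J) \<and> finite (Arr J) \<and> is_functor J C D \<longrightarrow>
      (\<exists>A \<pi>. is_limit J C D A \<pi>))"

text \<open>\<open>is_pullback C f g p q\<close>: the square \<open>f p = g q\<close> is a pullback, so \<open>p\<close> is the pullback
  of \<open>g\<close> along \<open>f\<close>.\<close>

definition is_pullback :: "('o, 'a) cat \<Rightarrow> 'a \<Rightarrow> 'a \<Rightarrow> 'a \<Rightarrow> 'a \<Rightarrow> bool" where
  "is_pullback C f g p q \<longleftrightarrow>
    f \<in> Arr C \<and> g \<in> Arr C \<and> Cod C f = Cod C g \<and>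
    p \<in> Arr C \<and> q \<in> Arr C \<and> Dom C p = Dom C q \<and> Cod C p = Dom C f \<and> Cod C q = Dom C g \<and>
    f \<cdot>\<^bsub>C\<^esub> p = g \<cdot>\<^bsub>C\<^esub> q \<and>
    (\<forall>T. \<forall>u \<in> hom C T (Dom C f). \<forall>v \<in> hom C T (Dom C g). f \<cdot>\<^bsub>C\<^esub> u = g \<cdot>\<^bsub>C\<^esub> v \<longrightarrow>
      (\<exists>!h. h \<in> hom C T (Dom C p) \<and> p \<cdot>\<^bsub>C\<^esub> h = u \<and> q \<cdot>\<^bsub>C\<^esub> h = v))"

definition has_pullbacks :: "('o, 'a) cat \<Rightarrow> bool" where
  "has_pullbacks C \<longleftrightarrow>
    (\<forall>f \<in> Arr C. \<forall>g \<in> Arr C. Cod C f = Cod C g \<longrightarrow> (\<exists>p q. is_pullback C f g p q))"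

definition is_kernel_pair :: "('o, 'a) cat \<Rightarrow> 'a \<Rightarrow> 'a \<Rightarrow> 'a \<Rightarrow> bool" where
  "is_kernel_pair C f p q \<longleftrightarrow> is_pullback C f f p q"

definition is_coequalizer :: "('o, 'a) cat \<Rightarrow> 'a \<Rightarrow> 'a \<Rightarrow> 'a \<Rightarrow> bool" where
  "is_coequalizer C f g q \<longleftrightarrow>
    f \<in> Arr C \<and> g \<in> Arr C \<and> Dom C f = Dom C g \<and> Cod C f = Cod C g \<and>
    q \<in> Arr C \<and> Dom C q = Cod C f \<and> q \<cdot>\<^bsub>C\<^esub> f = q \<cdot>\<^bsub>C\<^esub> g \<and>
    (\<forall>T. \<forall>u \<in> hom C (Cod C f) T. u \<cdot>\<^bsub>C\<^esub> f = u \<cdot>\<^bsub>C\<^esub> g \<longrightarrow>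
      (\<exists>!h. h \<in> hom C (Cod C q) T \<and> h \<cdot>\<^bsub>C\<^esub> q = u))"

definition is_regular_epi :: "('o, 'a) cat \<Rightarrow> 'a \<Rightarrow> bool" where
  "is_regular_epi C q \<longleftrightarrow> (\<exists>f g. is_coequalizer C f g q)"

definition is_mono :: "('o, 'a) cat \<Rightarrow> 'a \<Rightarrow> bool" where
  "is_mono C m \<longleftrightarrow> m \<in> Arr C \<and>
    (\<forall>T. \<forall>u \<in> hom C T (Dom C m). \<forall>v \<in> hom C T (Dom C m).
      m \<cdot>\<^bsub>C\<^esub> u = m \<cdot>\<^bsub>C\<^esub> v \<longrightarrow> u = v)"

definition jointly_strongly_epic :: "('o, 'a) cat \<Rightarrow> 'a \<Rightarrow> 'a \<Rightarrow> bool" where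
  "jointly_strongly_epic C g s \<longleftrightarrow> g \<in> Arr C \<and> s \<in> Arr C \<and> Cod C g = Cod C s \<and>
    (\<forall>m. is_mono C m \<and> Cod C m = Cod C g \<and>
        (\<exists>g' \<in> hom C (Dom C g) (Dom C m). m \<cdot>\<^bsub>C\<^esub> g' = g) \<and>
        (\<exists>s' \<in> hom C (Dom C s) (Dom C m). m \<cdot>\<^bsub>C\<^esub> s' = s) \<longrightarrow> is_iso C m)"


section \<open>Internal relations\<close>

text \<open>A span \<open>(r1, r2)\<close> from \<open>A\<close> to \<open>B\<close> that is jointly monic represents a relation.\<close>

definition is_mono_span :: "('o, 'a) cat \<Rightarrow> 'o \<Rightarrow> 'o \<Rightarrow> 'a \<times> 'a \<Rightarrow> bool" where
  "is_mono_span C A B r \<longleftrightarrow>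
    (\<exists>R. fst r \<in> hom C R A \<and> snd r \<in> hom C R B \<and>
      (\<forall>T. \<forall>u \<in> hom C T R. \<forall>v \<in> hom C T R.
        fst r \<cdot>\<^bsub>C\<^esub> u = fst r \<cdot>\<^bsub>C\<^esub> v \<and> snd r \<cdot>\<^bsub>C\<^esub> u = snd r \<cdot>\<^bsub>C\<^esub> v \<longrightarrow> u = v))"

text \<open>Equivalence relations are defined by generalized elements: every hom-set into \<open>A\<close>
  carries an ordinary equivalence relation.\<close>

definition is_equivalence_relation :: "('o, 'a) cat \<Rightarrow> 'o \<Rightarrow> 'a \<times> 'a \<Rightarrow> bool" where
  "is_equivalence_relation C A r \<longleftrightarrow> is_mono_span C A A r \<and>
    (\<forall>T \<in> Obj C. equiv (hom C T A)
      {(fst r \<cdot>\<^bsub>C\<^esub> x, snd r \<cdot>\<^bsub>C\<^esub> x) | x. x \<in> hom C T (Dom C (fst r))})"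

definition span_le :: "('o, 'a) cat \<Rightarrow> 'a \<times> 'a \<Rightarrow> 'a \<times> 'a \<Rightarrow> bool" where
  "span_le C r s \<longleftrightarrow> (\<exists>h \<in> hom C (Dom C (fst r)) (Dom C (fst s)).
    fst s \<cdot>\<^bsub>C\<^esub> h = fst r \<and> snd s \<cdot>\<^bsub>C\<^esub> h = snd r)"

text \<open>A relation proper, i.e. a subobject of \<open>A \<times> B\<close>, is the whole isomorphism class of
  jointly monic spans that represent it.\<close>

type_synonym 'a irel = "('a \<times> 'a) set"

definition span_class :: "('o, 'a) cat \<Rightarrow> 'o \<Rightarrow> 'o \<Rightarrow> 'a \<times> 'a \<Rightarrow> 'a irel" where
  "span_class C A B r = {s. is_mono_span C A B s \<and> span_le C r s \<and> span_le C s r}"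

definition relations :: "('o, 'a) cat \<Rightarrow> 'o \<Rightarrow> 'o \<Rightarrow> 'a irel set" where
  "relations C A B = span_class C A B ` {r. is_mono_span C A B r}"

definition rel_le :: "('o, 'a) cat \<Rightarrow> 'a irel \<Rightarrow> 'a irel \<Rightarrow> bool" where
  "rel_le C \<phi> \<psi> \<longleftrightarrow> (\<exists>r \<in> \<phi>. \<exists>s \<in> \<psi>. span_le C r s)"

definition rel_opp :: "'a irel \<Rightarrow> 'a irel" where
  "rel_opp \<phi> = {(y, x). (x, y) \<in> \<phi>}"

text \<open>\<open>rel_comp C \<psi> \<phi>\<close> is the composite ``first \<open>\<phi>\<close>, then \<open>\<psi>\<close>'': pull back the inner legs, then
  take the jointly monic part of a (regular epi, jointly monic) factorization of the outer span.
  Collecting all such factorizations yields a full isomorphism class.\<close>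

definition rel_comp :: "('o, 'a) cat \<Rightarrow> 'a irel \<Rightarrow> 'a irel \<Rightarrow> 'a irel" where
  "rel_comp C \<psi> \<phi> = {t. is_mono_span C (Cod C (fst t)) (Cod C (snd t)) t \<and>
    (\<exists>r \<in> \<phi>. \<exists>s \<in> \<psi>. \<exists>p q e. is_pullback C (snd r) (fst s) p q \<and> is_regular_epi C e \<and>
      e \<in> hom C (Dom C p) (Dom C (fst t)) \<and>
      fst t \<cdot>\<^bsub>C\<^esub> e = fst r \<cdot>\<^bsub>C\<^esub> p \<and> snd t \<cdot>\<^bsub>C\<^esub> e = snd s \<cdot>\<^bsub>C\<^esub> q)}"

text \<open>The graph of \<open>f\<close>; the graph of an identity is the discrete equivalence relation.\<close>

definition rel_graph :: "('o, 'a) cat \<Rightarrow> 'a \<Rightarrow> 'a irel" where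
  "rel_graph C f = span_class C (Dom C f) (Cod C f) (Ident C (Dom C f), f)"


section \<open>Regular, exact and protomodular categories\<close>

locale regular_category = category +
  assumes finite_limits: "has_finite_limits C"
    and kernel_pair_coequalizer:
      "is_kernel_pair C f p q \<Longrightarrow> \<exists>e. is_coequalizer C p q e"
    and regular_epi_stable:
      "is_regular_epi C e \<Longrightarrow> is_pullback C f e e' f' \<Longrightarrow> is_regular_epi C e'"

locale exact_category = regular_category +
  assumes equivalence_relation_effective:
    "is_equivalence_relation C A (r1, r2) \<Longrightarrow> \<exists>f. is_kernel_pair C f r1 r2"

locale protomodular_category = category +
  assumes pullbacks: "has_pullbacks C"
    and protomodular:
      "p \<in> hom C E B \<Longrightarrow> s \<in> hom C B E \<Longrightarrow> p \<cdot> s = Ident C B \<Longrightarrow> f \<in> hom C A B \<Longrightarrow>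
        is_pullback C f p d g \<Longrightarrow> jointly_strongly_epic C g s"

text \<open>In the stability condition \<open>S\<close> is the pullback of \<open>q r1 = q r2 : R \<rightarrow> Q\<close> along \<open>f\<close>,
  with projections \<open>y : S \<rightarrow> Y\<close> and \<open>k : S \<rightarrow> R\<close>; its two legs \<open>s1, s2 : S \<rightarrow> X'\<close> are the arrows
  induced by \<open>r1\<close> and \<open>r2\<close> between the pullbacks.\<close>

definition stable_coequalizers_of_equivalence_relations :: "('o, 'a) cat \<Rightarrow> bool" where
  "stable_coequalizers_of_equivalence_relations C \<longleftrightarrow>
    (\<forall>A r1 r2. is_equivalence_relation C A (r1, r2) \<longrightarrow>
      (\<exists>q. is_coequalizer C r1 r2 q) \<and>
      (\<forall>q f q' f' y k s1 s2.
        is_coequalizer C r1 r2 q \<and>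
        is_pullback C f q q' f' \<and>
        is_pullback C f (q \<cdot>\<^bsub>C\<^esub> r1) y k \<and>
        s1 \<in> hom C (Dom C y) (Dom C q') \<and> q' \<cdot>\<^bsub>C\<^esub> s1 = y \<and> f' \<cdot>\<^bsub>C\<^esub> s1 = r1 \<cdot>\<^bsub>C\<^esub> k \<and>
        s2 \<in> hom C (Dom C y) (Dom C q') \<and> q' \<cdot>\<^bsub>C\<^esub> s2 = y \<and> f' \<cdot>\<^bsub>C\<^esub> s2 = r2 \<cdot>\<^bsub>C\<^esub> k \<longrightarrow>
        is_coequalizer C s1 s2 q'))"


section \<open>Semi-localizations\<close>

text \<open>\<open>S\<close> is the set of objects of the full subcategory. The inclusion acts as the identity
  and is left implicit, so the reflector \<open>L\<close> is used both as a functor into the subcategory and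
  as an endofunctor of \<open>C\<close>.\<close>

definition is_reflection :: "('o, 'a) cat \<Rightarrow> 'o set \<Rightarrow> ('o, 'a, 'o, 'a) fctr \<Rightarrow>
    ('o \<Rightarrow> 'a) \<Rightarrow> bool" where
  "is_reflection C S L \<eta> \<longleftrightarrow> S \<subseteq> Obj C \<and> is_functor C (full_subcat C S) L \<and>
    nat_trans C C id_functor L \<eta> \<and>
    (\<forall>Q \<in> Obj C. \<forall>X \<in> S. \<forall>f \<in> hom C Q X.
      \<exists>!h. h \<in> hom C (ObjMap L Q) X \<and> h \<cdot>\<^bsub>C\<^esub> \<eta> Q = f)"

definition semi_left_exact :: "('o, 'a) cat \<Rightarrow> 'o set \<Rightarrow> ('o, 'a, 'o, 'a) fctr \<Rightarrow>
    ('o \<Rightarrow> 'a) \<Rightarrow> bool" where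
  "semi_left_exact C S L \<eta> \<longleftrightarrow>
    (\<forall>Q \<in> Obj C. \<forall>X \<in> S. \<forall>f \<in> hom C X (ObjMap L Q). \<forall>p q.
      is_pullback C f (\<eta> Q) p q \<longrightarrow>
      is_pullback (full_subcat C S) (ArrMap L f) (ArrMap L (\<eta> Q)) (ArrMap L p) (ArrMap L q))"

definition semi_localization_subcat :: "('o, 'a) cat \<Rightarrow> 'o set \<Rightarrow>
    ('o, 'a, 'o, 'a) fctr \<Rightarrow> ('o \<Rightarrow> 'a) \<Rightarrow> bool" where
  "semi_localization_subcat C S L \<eta> \<longleftrightarrow> is_reflection C S L \<eta> \<and> semi_left_exact C S L \<eta>"

definition is_semi_localization :: "('o, 'a) cat \<Rightarrow> ('p, 'b) cat \<Rightarrow> bool" where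
  "is_semi_localization X C \<longleftrightarrow>
    (\<exists>S L \<eta>. semi_localization_subcat C S L \<eta> \<and> equivalent_cats X (full_subcat C S))"

definition is_semi_localization_regepi_units :: "('o, 'a) cat \<Rightarrow> ('p, 'b) cat \<Rightarrow> bool" where
  "is_semi_localization_regepi_units X C \<longleftrightarrow>
    (\<exists>S L \<eta>. semi_localization_subcat C S L \<eta> \<and> equivalent_cats X (full_subcat C S) \<and>
      (\<forall>Q \<in> Obj C. is_regular_epi C (\<eta> Q)))"

text \<open>The variant for a prescribed embedding \<open>U\<close>, which identifies \<open>X\<close> with the full
  subcategory of \<open>C\<close> on the objects \<open>U A\<close>.\<close>

definition is_semi_localization_via :: "('o, 'a) cat \<Rightarrow> ('p, 'b) cat \<Rightarrow>
    ('o, 'a, 'p, 'b) fctr \<Rightarrow> bool" where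
  "is_semi_localization_via X C U \<longleftrightarrow> fully_faithful X C U \<and>
    (\<exists>L \<eta>. semi_localization_subcat C (ObjMap U ` Obj X) L \<eta>)"


section \<open>The exact completion of a regular category\<close>

type_synonym ('o, 'a) ex_obj = "'o \<times> 'a irel"
type_synonym ('o, 'a) ex_arr = "('o, 'a) ex_obj \<times> 'a irel \<times> ('o, 'a) ex_obj"

definition ex_objs :: "('o, 'a) cat \<Rightarrow> ('o, 'a) ex_obj set" where
  "ex_objs X = {(A, R). A \<in> Obj X \<and> R \<in> relations X A A \<and>
    (\<exists>r \<in> R. is_equivalence_relation X A r)}"

definition ex_arrs :: "('o, 'a) cat \<Rightarrow> ('o, 'a) ex_arr set" where
  "ex_arrs X = {((A, R), \<phi>, (B, S)).
    (A, R) \<in> ex_objs X \<and> (B, S) \<in> ex_objs X \<and> \<phi> \<in> relations X A B \<and>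
    rel_comp X S (rel_comp X \<phi> R) = \<phi> \<and>
    rel_le X R (rel_comp X (rel_opp \<phi>) \<phi>) \<and>
    rel_le X (rel_comp X \<phi> (rel_opp \<phi>)) S}"

definition ex_reg :: "('o, 'a) cat \<Rightarrow> (('o, 'a) ex_obj, ('o, 'a) ex_arr) cat" where
  "ex_reg X = \<lparr>Obj = ex_objs X, Arr = ex_arrs X,
    Dom = (\<lambda>(a, \<phi>, b). a), Cod = (\<lambda>(a, \<phi>, b). b),
    Ident = (\<lambda>(A, R). ((A, R), R, (A, R))),
    Comp = (\<lambda>(b, \<psi>, c) (a, \<phi>, b'). (a, rel_comp X \<psi> \<phi>, c))\<rparr>"

definition ex_embedding :: "('o, 'a) cat \<Rightarrow> ('o, 'a, ('o, 'a) ex_obj, ('o, 'a) ex_arr) fctr" where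
  "ex_embedding X =
    (let U = (\<lambda>A. (A, rel_graph X (Ident X A)))
     in \<lparr>ObjMap = U, ArrMap = (\<lambda>f. (U (Dom X f), rel_graph X f, U (Cod X f)))\<rparr>)"


section \<open>The conditions to be compared\<close>

text \<open>Quantification over categories inside a formula needs fixed types of objects and arrows,
  so \<open>condition_b\<close> and \<open>condition_c\<close> take these types as a parameter. The types of
  \<open>ex_reg X\<close> are always large enough for a witness; an arbitrary choice of types (possibly too
  small for a witness to exist) is only meaningful with these conditions as hypotheses.\<close>

definition condition_a :: "('o, 'a) cat \<Rightarrow> bool" where
  "condition_a X \<longleftrightarrow> regular_category X \<and> protomodular_category X \<and>
    stable_coequalizers_of_equivalence_relations X"

definition condition_b :: "('p, 'b) cat itself \<Rightarrow> ('o, 'a) cat \<Rightarrow> bool" where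
  "condition_b _ X \<longleftrightarrow> (\<exists>C :: ('p, 'b) cat.
    exact_category C \<and> protomodular_category C \<and> is_semi_localization X C)"

definition condition_c :: "('p, 'b) cat itself \<Rightarrow> ('o, 'a) cat \<Rightarrow> bool" where
  "condition_c _ X \<longleftrightarrow> (\<exists>C :: ('p, 'b) cat.
    exact_category C \<and> protomodular_category C \<and> is_semi_localization_regepi_units X C)"

definition condition_d :: "('o, 'a) cat \<Rightarrow> bool" where
  "condition_d X \<longleftrightarrow> regular_category X \<and>
    is_semi_localization_via X (ex_reg X) (ex_embedding X) \<and>
    protomodular_category (ex_reg X)"

end

theory Submission
  imports Defs
begin

text \<open>Condition (b) gives (a) because, over an exact category \<open>C\<close>, the coequalizer in \<open>X\<close> of an
  equivalence relation is its quotient in \<open>C\<close> followed by the unit \<open>\<eta>: Q \<rightarrow> LQ\<close>; quotients in \<open>C\<close> are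
  stable, and semi-left-exactness says that units are stable along arrows of \<open>X\<close>. Regularity of \<open>X\<close>
  then comes for free.

  For (a) to (c) and (d), the exact completion is treated like a category of sheaves for the regular
  topology: arrows are glued from functional relations on points \<open>x: T \<rightarrow> P\<close> with \<open>T\<close> in \<open>X\<close>, where
  \<open>T\<close> may be replaced by a cover, that is, a regular epimorphism of \<open>X\<close> onto it. In this language
  exactness is routine, and protomodularity is inherited from \<open>X\<close> because a split epimorphism of the
  exact completion is, locally, covered by a split epimorphism of \<open>X\<close>. The reflection of a quotient
  of \<open>A\<close> is the coequalizer in \<open>X\<close> of the same equivalence relation, and stability of
  these coequalizers is exactly semi-left-exactness.\<close>

section \<open>Pullbacks, coequalizers and internal relations\<close>

text \<open>Spans, kernel pairs and relations are compared through their generalized elements: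
  \<open>in_span\<close> plays the role of membership. Since a composite of relations is an image, a
  middle element exists only after a change of stage along a regular epimorphism, which forces the
  passage to covers; \<open>in_span_local\<close>, by which membership descends again, is what makes
  it harmless. The exact completion enters the categorical arguments only through a few axioms, so
  that work with isomorphism classes of spans is confined to the verification of these axioms.
  Semi-left-exactness is freed from the chosen reflector: since the reflector inverts the units, it
  preserves the pullback of a unit along \<open>f\<close> exactly if the projection to the domain of
  \<open>f\<close> is again a universal arrow. In this form stability of units meets stability of
  coequalizers. Regularity of \<open>X\<close> is free because a regular epimorphism is the
  coequalizer of its kernel pair, an equivalence relation, so that its stability is a special case
  of the stability of coequalizers.\<close>

definition in_span :: "('o, 'a) cat \<Rightarrow> 'a \<times> 'a \<Rightarrow> 'o \<Rightarrow> 'a \<Rightarrow> 'a \<Rightarrow> bool" where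
  "in_span C r T a b \<longleftrightarrow> (\<exists>x \<in> hom C T (Dom C (fst r)). fst r \<cdot>\<^bsub>C\<^esub> x = a \<and> snd r \<cdot>\<^bsub>C\<^esub> x = b)"

context category
begin

lemma hom_objs: "f \<in> hom C A B \<Longrightarrow> A \<in> Obj C \<and> B \<in> Obj C"
  using dom_obj cod_obj by (auto simp: hom_def)

lemma hom_dom: "f \<in> hom C A B \<Longrightarrow> Dom C f = A"
  and hom_cod: "f \<in> hom C A B \<Longrightarrow> Cod C f = B"
  and hom_arr: "f \<in> hom C A B \<Longrightarrow> f \<in> Arr C"
  by (auto simp: hom_def)

lemma arr_hom: "f \<in> Arr C \<Longrightarrow> f \<in> hom C (Dom C f) (Cod C f)"
  by (simp add: hom_def)

text \<open>Composition is lawful only on matching arrows, so associativity cannot serve as an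
  unconditional rewrite rule. This lemma and \<open>comp_square\<close> push an equation of
  composites past a further arrow \<open>x\<close> and carry the typing along.\<close>

lemma comp_reassoc:
  "g \<cdot> f = k \<Longrightarrow> x \<in> hom C T A \<Longrightarrow> f \<in> hom C A B \<Longrightarrow> g \<in> hom C B D \<Longrightarrow> g \<cdot> (f \<cdot> x) = k \<cdot> x"
  by (simp add: comp_assoc)

lemma comp_square:
  "g \<cdot> f = g' \<cdot> f' \<Longrightarrow> x \<in> hom C T A \<Longrightarrow> f \<in> hom C A B \<Longrightarrow> g \<in> hom C B D \<Longrightarrow>
    f' \<in> hom C A B' \<Longrightarrow> g' \<in> hom C B' D \<Longrightarrow> g \<cdot> (f \<cdot> x) = g' \<cdot> (f' \<cdot> x)"
  using comp_assoc[of x T A f B g D] comp_assoc[of x T A f' B' g' D] by simp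

lemma pullbackI:
  assumes "f \<in> hom C A Z" "g \<in> hom C B Z" "p \<in> hom C P A" "q \<in> hom C P B" "f \<cdot> p = g \<cdot> q"
    and "\<And>T u v. u \<in> hom C T A \<Longrightarrow> v \<in> hom C T B \<Longrightarrow> f \<cdot> u = g \<cdot> v \<Longrightarrow>
      \<exists>h \<in> hom C T P. p \<cdot> h = u \<and> q \<cdot> h = v"
    and "\<And>T h k. h \<in> hom C T P \<Longrightarrow> k \<in> hom C T P \<Longrightarrow> p \<cdot> h = p \<cdot> k \<Longrightarrow> q \<cdot> h = q \<cdot> k \<Longrightarrow> h = k"
  shows "is_pullback C f g p q"
proof -
  have "\<exists>!h. h \<in> hom C T P \<and> p \<cdot> h = u \<and> q \<cdot> h = v"
    if "u \<in> hom C T A" "v \<in> hom C T B" "f \<cdot> u = g \<cdot> v" for T u v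
    using assms(6)[OF that] assms(7) by metis
  moreover have "f \<in> Arr C" "Dom C f = A" "Cod C f = Z" "g \<in> Arr C" "Dom C g = B" "Cod C g = Z"
    "p \<in> Arr C" "Dom C p = P" "Cod C p = A" "q \<in> Arr C" "Dom C q = P" "Cod C q = B"
    using assms(1-4) by (auto simp: hom_def)
  ultimately show ?thesis using assms(5) unfolding is_pullback_def by simp
qed

lemma pullback_homs:
  assumes "is_pullback C f g p q" "f \<in> hom C A Z" "g \<in> hom C B Z'"
  shows "p \<in> hom C (Dom C p) A" "q \<in> hom C (Dom C p) B" "Z' = Z" "f \<cdot> p = g \<cdot> q"
  using assms by (auto simp: is_pullback_def hom_def)

lemma pullback_lift:
  assumes "is_pullback C f g p q" "p \<in> hom C P A" "q \<in> hom C P B"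
    "u \<in> hom C T A" "v \<in> hom C T B" "f \<cdot> u = g \<cdot> v"
  shows "\<exists>h \<in> hom C T P. p \<cdot> h = u \<and> q \<cdot> h = v"
proof -
  have "Dom C f = A" "Dom C g = B" "Dom C p = P"
    using assms(1-3) by (auto simp: is_pullback_def hom_def)
  then show ?thesis using assms unfolding is_pullback_def by blast
qed

lemma pullback_unique:
  assumes "is_pullback C f g p q" "p \<in> hom C P A" "q \<in> hom C P B"
    "h \<in> hom C T P" "k \<in> hom C T P" "p \<cdot> h = p \<cdot> k" "q \<cdot> h = q \<cdot> k"
  shows "h = k"
proof -
  have D: "Dom C f = A" "Dom C g = B" "Dom C p = P"
    and H: "f \<in> hom C A (Cod C f)" "g \<in> hom C B (Cod C f)" and e: "f \<cdot> p = g \<cdot> q"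
    using assms(1-3) by (auto simp: is_pullback_def hom_def)
  have u: "p \<cdot> h \<in> hom C T A" "q \<cdot> h \<in> hom C T B" using assms comp_hom by blast+
  have "f \<cdot> (p \<cdot> h) = g \<cdot> (q \<cdot> h)"
    by (rule comp_square[OF e assms(4,2) H(1) assms(3) H(2)])
  then have "\<exists>!x. x \<in> hom C T P \<and> p \<cdot> x = p \<cdot> h \<and> q \<cdot> x = q \<cdot> h"
    using assms(1) u D unfolding is_pullback_def by blast
  then show ?thesis using assms by metis
qed

lemma has_pullbacksE:
  assumes "has_pullbacks C" "f \<in> hom C A Z" "g \<in> hom C B Z"
  obtains P p q where "is_pullback C f g p q" "p \<in> hom C P A" "q \<in> hom C P B" "f \<cdot> p = g \<cdot> q"
proof -
  obtain p q where P: "is_pullback C f g p q"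
    using assms(1) hom_arr[OF assms(2)] hom_arr[OF assms(3)] hom_cod[OF assms(2)] hom_cod[OF assms(3)]
    unfolding has_pullbacks_def by metis
  show ?thesis using that[OF P pullback_homs(1,2,4)[OF P assms(2,3)]] .
qed

lemma coequalizerI:
  assumes "f \<in> hom C R A" "g \<in> hom C R A" "q \<in> hom C A Q" "q \<cdot> f = q \<cdot> g"
    and "\<And>T u. u \<in> hom C A T \<Longrightarrow> u \<cdot> f = u \<cdot> g \<Longrightarrow> \<exists>h \<in> hom C Q T. h \<cdot> q = u"
    and "\<And>T h k. h \<in> hom C Q T \<Longrightarrow> k \<in> hom C Q T \<Longrightarrow> h \<cdot> q = k \<cdot> q \<Longrightarrow> h = k"
  shows "is_coequalizer C f g q"
proof -
  have "\<exists>!h. h \<in> hom C Q T \<and> h \<cdot> q = u" if "u \<in> hom C A T" "u \<cdot> f = u \<cdot> g" for T u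
    using assms(5)[OF that] assms(6) by metis
  moreover have "f \<in> Arr C" "Dom C f = R" "Cod C f = A" "g \<in> Arr C" "Dom C g = R" "Cod C g = A"
    "q \<in> Arr C" "Dom C q = A" "Cod C q = Q"
    using assms(1-3) by (auto simp: hom_def)
  ultimately show ?thesis using assms(4) unfolding is_coequalizer_def by simp
qed

lemma coequalizer_homs:
  assumes "is_coequalizer C f g q" "q \<in> hom C A Q"
  shows "f \<in> hom C (Dom C f) A" "g \<in> hom C (Dom C f) A" "q \<cdot> f = q \<cdot> g"
  using assms by (auto simp: is_coequalizer_def hom_def)

lemma coequalizer_hom:
  assumes "is_coequalizer C f g q" "f \<in> hom C R A"
  shows "q \<in> hom C A (Cod C q)"
  using assms by (auto simp: is_coequalizer_def hom_def)

lemma coequalizer_factor: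
  assumes "is_coequalizer C f g q" "q \<in> hom C A Q" "u \<in> hom C A T" "u \<cdot> f = u \<cdot> g"
  shows "\<exists>h \<in> hom C Q T. h \<cdot> q = u"
proof -
  have "Cod C f = A" "Cod C q = Q" using assms(1,2) by (auto simp: is_coequalizer_def hom_def)
  then show ?thesis using assms(1,3,4) unfolding is_coequalizer_def by blast
qed

lemma coequalizer_epi:
  assumes "is_coequalizer C f g q" "q \<in> hom C A Q" "h \<in> hom C Q T" "k \<in> hom C Q T" "h \<cdot> q = k \<cdot> q"
  shows "h = k"
proof -
  note H = coequalizer_homs[OF assms(1,2)]
  have "h \<cdot> q \<in> hom C A T" using assms comp_hom by blast
  moreover have "(h \<cdot> q) \<cdot> f = (h \<cdot> q) \<cdot> g"
    using comp_assoc[OF H(1) assms(2,3)] comp_assoc[OF H(2) assms(2,3)] H(3) by simp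
  moreover have "Cod C f = A" "Cod C q = Q"
    using assms(1,2) by (auto simp: is_coequalizer_def hom_def)
  ultimately have "\<exists>!x. x \<in> hom C Q T \<and> x \<cdot> q = h \<cdot> q"
    using assms(1) unfolding is_coequalizer_def by blast
  then show ?thesis using assms by metis
qed

lemma regular_epi_hom: "is_regular_epi C e \<Longrightarrow> e \<in> hom C (Dom C e) (Cod C e)"
  by (auto simp: is_regular_epi_def is_coequalizer_def hom_def)

lemma regular_epi_epi:
  assumes "is_regular_epi C e" "e \<in> hom C A Q" "h \<in> hom C Q T" "k \<in> hom C Q T" "h \<cdot> e = k \<cdot> e"
  shows "h = k"
  using assms coequalizer_epi unfolding is_regular_epi_def by blast

lemma monoI:
  assumes "m \<in> hom C A B"
    and "\<And>T u v. u \<in> hom C T A \<Longrightarrow> v \<in> hom C T A \<Longrightarrow> m \<cdot> u = m \<cdot> v \<Longrightarrow> u = v"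
  shows "is_mono C m"
  using assms by (auto simp: is_mono_def hom_def)

lemma mono_cancel:
  assumes "is_mono C m" "m \<in> hom C A B" "u \<in> hom C T A" "v \<in> hom C T A" "m \<cdot> u = m \<cdot> v"
  shows "u = v"
  using assms by (auto simp: is_mono_def hom_def)

lemma isoI:
  assumes "f \<in> hom C A B" "g \<in> hom C B A" "g \<cdot> f = Ident C A" "f \<cdot> g = Ident C B"
  shows "is_iso C f"
  using assms by (auto simp: is_iso_def hom_def)

lemma isoE:
  assumes "is_iso C f" "f \<in> hom C A B"
  obtains g where "g \<in> hom C B A" "g \<cdot> f = Ident C A" "f \<cdot> g = Ident C B"
  using assms by (auto simp: is_iso_def hom_def)

lemma mono_split_epi_iso:
  assumes "is_mono C m" "m \<in> hom C A B" "k \<in> hom C B A" "m \<cdot> k = Ident C B"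
  shows "is_iso C m"
proof (rule isoI[OF assms(2,3) _ assms(4)])
  have "A \<in> Obj C" using hom_objs[OF assms(2)] by simp
  then have "Ident C A \<in> hom C A A" by (rule ident_hom)
  moreover have "m \<cdot> (k \<cdot> m) = m \<cdot> Ident C A"
    using comp_assoc[OF assms(2,3,2)] assms(4) ident_left[OF assms(2)] ident_right[OF assms(2)] by simp
  ultimately show "k \<cdot> m = Ident C A"
    using mono_cancel[OF assms(1,2) comp_hom[OF assms(2,3)]] by blast
qed

text \<open>A regular epimorphism is strong: \<open>e\<close> coequalizes some pair, hence so does
  \<open>m\<close> after \<open>u\<close>, and \<open>m\<close> cancels. The second equation follows
  because \<open>e\<close> is epic.\<close>

lemma regular_epi_lift_mono:
  assumes "is_regular_epi C e" "e \<in> hom C A Q" "m \<in> hom C M N" "is_mono C m"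
    "u \<in> hom C A M" "v \<in> hom C Q N" "m \<cdot> u = v \<cdot> e"
  shows "\<exists>h \<in> hom C Q M. h \<cdot> e = u \<and> m \<cdot> h = v"
proof -
  obtain f g where c: "is_coequalizer C f g e" using assms(1) by (auto simp: is_regular_epi_def)
  note H = coequalizer_homs[OF c assms(2)]
  have "m \<cdot> (u \<cdot> f) = v \<cdot> (e \<cdot> f)" "m \<cdot> (u \<cdot> g) = v \<cdot> (e \<cdot> g)"
    using comp_square[OF assms(7)] assms H by blast+
  then have "u \<cdot> f = u \<cdot> g"
    using mono_cancel[OF assms(4,3)] H comp_hom[OF _ assms(5)] by metis
  then obtain h where h: "h \<in> hom C Q M" "h \<cdot> e = u"
    using coequalizer_factor[OF c assms(2,5)] by blast
  have "(m \<cdot> h) \<cdot> e = v \<cdot> e" using h assms comp_assoc by metis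
  then have "m \<cdot> h = v"
    using regular_epi_epi[OF assms(1,2) comp_hom[OF h(1) assms(3)] assms(6)] by blast
  then show ?thesis using h by blast
qed

lemma iso_comp_coequalizer:
  assumes c: "is_coequalizer C f g q" and q: "q \<in> hom C A Q" and i: "is_iso C i" "i \<in> hom C Q Q'"
  shows "is_coequalizer C f g (i \<cdot> q)"
proof -
  obtain j where j: "j \<in> hom C Q' Q" "j \<cdot> i = Ident C Q" "i \<cdot> j = Ident C Q'"
    using isoE[OF i] by blast
  note H = coequalizer_homs[OF c q]
  show ?thesis
  proof (rule coequalizerI)
    show "f \<in> hom C (Dom C f) A" "g \<in> hom C (Dom C f) A" "i \<cdot> q \<in> hom C A Q'"
      using H q i comp_hom by blast+
    show "(i \<cdot> q) \<cdot> f = (i \<cdot> q) \<cdot> g"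
      using comp_assoc[OF H(1) q i(2)] comp_assoc[OF H(2) q i(2)] H(3) by simp
  next
    fix T u assume u: "u \<in> hom C A T" "u \<cdot> f = u \<cdot> g"
    then obtain h where h: "h \<in> hom C Q T" "h \<cdot> q = u" using coequalizer_factor[OF c q] by blast
    have "j \<cdot> (i \<cdot> q) = q" using comp_reassoc[OF j(2) q i(2) j(1)] ident_left[OF q] by simp
    then have "(h \<cdot> j) \<cdot> (i \<cdot> q) = u"
      using comp_assoc[OF comp_hom[OF q i(2)] j(1) h(1)] h(2) by simp
    then show "\<exists>h \<in> hom C Q' T. h \<cdot> (i \<cdot> q) = u" using comp_hom[OF j(1) h(1)] by blast
  next
    fix T h k assume hk: "h \<in> hom C Q' T" "k \<in> hom C Q' T" "h \<cdot> (i \<cdot> q) = k \<cdot> (i \<cdot> q)"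
    then have "h \<cdot> i = k \<cdot> i"
      using coequalizer_epi[OF c q comp_hom[OF i(2)] comp_hom[OF i(2)]] comp_assoc[OF q i(2)] by metis
    then have "h \<cdot> (i \<cdot> j) = k \<cdot> (i \<cdot> j)" using comp_assoc[OF j(1) i(2)] hk by metis
    then show "h = k" using j(3) hk(1,2) ident_right by metis
  qed
qed

lemma iso_comp_regular_epi:
  "is_regular_epi C q \<Longrightarrow> q \<in> hom C A Q \<Longrightarrow> is_iso C i \<Longrightarrow> i \<in> hom C Q Q' \<Longrightarrow> is_regular_epi C (i \<cdot> q)"
  using iso_comp_coequalizer unfolding is_regular_epi_def by blast

section \<open>Jointly monic spans seen through generalized elements\<close>

lemma mono_spanI:
  assumes "r1 \<in> hom C R A" "r2 \<in> hom C R B"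
    and "\<And>T u v. u \<in> hom C T R \<Longrightarrow> v \<in> hom C T R \<Longrightarrow> r1 \<cdot> u = r1 \<cdot> v \<Longrightarrow> r2 \<cdot> u = r2 \<cdot> v \<Longrightarrow> u = v"
  shows "is_mono_span C A B (r1, r2)"
  using assms unfolding is_mono_span_def by auto

lemma mono_span_homs:
  assumes "is_mono_span C A B r"
  shows "fst r \<in> hom C (Dom C (fst r)) A" "snd r \<in> hom C (Dom C (fst r)) B"
  using assms unfolding is_mono_span_def by (auto simp: hom_def)

lemma mono_span_cancel:
  assumes "is_mono_span C A B r" "u \<in> hom C T (Dom C (fst r))" "v \<in> hom C T (Dom C (fst r))"
    "fst r \<cdot> u = fst r \<cdot> v" "snd r \<cdot> u = snd r \<cdot> v"
  shows "u = v"
  using assms unfolding is_mono_span_def by (metis hom_dom)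

lemma in_span_homs:
  assumes "is_mono_span C A B r" "in_span C r T a b"
  shows "a \<in> hom C T A" "b \<in> hom C T B"
  using assms mono_span_homs comp_hom unfolding in_span_def by metis+

lemma in_span_comp:
  assumes "is_mono_span C A B r" "in_span C r T a b" "t \<in> hom C T' T"
  shows "in_span C r T' (a \<cdot> t) (b \<cdot> t)"
proof -
  note H = mono_span_homs[OF assms(1)]
  obtain x where x: "x \<in> hom C T (Dom C (fst r))" "fst r \<cdot> x = a" "snd r \<cdot> x = b"
    using assms(2) by (auto simp: in_span_def)
  then have "fst r \<cdot> (x \<cdot> t) = a \<cdot> t" "snd r \<cdot> (x \<cdot> t) = b \<cdot> t"
    using comp_reassoc assms(3) H by blast+
  then show ?thesis using comp_hom[OF assms(3) x(1)] by (auto simp: in_span_def)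
qed

lemma in_span_legs: "is_mono_span C A B r \<Longrightarrow> in_span C r (Dom C (fst r)) (fst r) (snd r)"
  using mono_span_homs[of A B r] hom_objs ident_hom ident_right unfolding in_span_def by metis

text \<open>The witness \<open>x\<close> over the cover agrees on the pair that \<open>e\<close>
  coequalizes, since both legs of \<open>r\<close> agree there and are jointly monic; so it factors
  through \<open>e\<close>. This descent of membership underlies every local argument.\<close>

lemma in_span_local:
  assumes r: "is_mono_span C A B r" and e: "is_regular_epi C e" "e \<in> hom C T' T"
    and a: "a \<in> hom C T A" and b: "b \<in> hom C T B" and s: "in_span C r T' (a \<cdot> e) (b \<cdot> e)"
  shows "in_span C r T a b"
proof -
  note H = mono_span_homs[OF r]
  obtain f g where c: "is_coequalizer C f g e" using e(1) by (auto simp: is_regular_epi_def)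
  note E = coequalizer_homs[OF c e(2)]
  obtain x where x: "x \<in> hom C T' (Dom C (fst r))" "fst r \<cdot> x = a \<cdot> e" "snd r \<cdot> x = b \<cdot> e"
    using s by (auto simp: in_span_def)
  have xf: "x \<cdot> f \<in> hom C (Dom C f) (Dom C (fst r))" "x \<cdot> g \<in> hom C (Dom C f) (Dom C (fst r))"
    using E x comp_hom by blast+
  have "fst r \<cdot> (x \<cdot> f) = fst r \<cdot> (x \<cdot> g)"
    using comp_square[OF x(2) E(1) x(1) H(1) e(2) a] comp_square[OF x(2) E(2) x(1) H(1) e(2) a] E(3)
    by simp
  moreover have "snd r \<cdot> (x \<cdot> f) = snd r \<cdot> (x \<cdot> g)"
    using comp_square[OF x(3) E(1) x(1) H(2) e(2) b] comp_square[OF x(3) E(2) x(1) H(2) e(2) b] E(3)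
    by simp
  ultimately have "x \<cdot> f = x \<cdot> g" using mono_span_cancel[OF r xf] by blast
  then obtain y where y: "y \<in> hom C T (Dom C (fst r))" "y \<cdot> e = x"
    using coequalizer_factor[OF c e(2) x(1)] by blast
  have "(fst r \<cdot> y) \<cdot> e = a \<cdot> e" "(snd r \<cdot> y) \<cdot> e = b \<cdot> e"
    using comp_assoc[OF e(2) y(1) H(1)] comp_assoc[OF e(2) y(1) H(2)] y(2) x by simp_all
  then have "fst r \<cdot> y = a" "snd r \<cdot> y = b"
    using regular_epi_epi[OF e] comp_hom[OF y(1)] H a b by blast+
  then show ?thesis using y(1) by (auto simp: in_span_def)
qed

text \<open>Yoneda for subobjects: the legs of \<open>r\<close> form its generic element, and the
  factorization is the witness that this element lies in \<open>s\<close>.\<close>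

lemma span_le_iff:
  assumes r: "is_mono_span C A B r" and s: "is_mono_span C A B s"
  shows "span_le C r s \<longleftrightarrow> (\<forall>T a b. in_span C r T a b \<longrightarrow> in_span C s T a b)"
proof
  assume "span_le C r s"
  then have "in_span C s (Dom C (fst r)) (fst r) (snd r)" by (simp add: span_le_def in_span_def)
  then show "\<forall>T a b. in_span C r T a b \<longrightarrow> in_span C s T a b"
    using in_span_comp[OF s] unfolding in_span_def[of C r] by blast
next
  assume "\<forall>T a b. in_span C r T a b \<longrightarrow> in_span C s T a b"
  then show "span_le C r s"
    using in_span_legs[OF r] by (simp add: span_le_def in_span_def)
qed

lemma equivalence_relation_iff:
  "is_equivalence_relation C A r \<longleftrightarrow> is_mono_span C A A r \<and>
    (\<forall>T a. a \<in> hom C T A \<longrightarrow> in_span C r T a a) \<and>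
    (\<forall>T a b. in_span C r T a b \<longrightarrow> in_span C r T b a) \<and>
    (\<forall>T a b c. in_span C r T a b \<longrightarrow> in_span C r T b c \<longrightarrow> in_span C r T a c)"
proof (cases "is_mono_span C A A r")
  case True
  have *: "{(fst r \<cdot> x, snd r \<cdot> x) | x. x \<in> hom C T (Dom C (fst r))} = {(a, b). in_span C r T a b}"
    for T by (auto simp: in_span_def)
  have "in_span C r T a b \<Longrightarrow> T \<in> Obj C" for T a b
    unfolding in_span_def using hom_objs by blast
  moreover have "equiv (hom C T A) {(a, b). in_span C r T a b} \<longleftrightarrow>
    (\<forall>a. a \<in> hom C T A \<longrightarrow> in_span C r T a a) \<and>
    (\<forall>a b. in_span C r T a b \<longrightarrow> in_span C r T b a) \<and>
    (\<forall>a b c. in_span C r T a b \<longrightarrow> in_span C r T b c \<longrightarrow> in_span C r T a c)" for T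
    unfolding equiv_def refl_on_def sym_def trans_def subset_iff
    using in_span_homs[OF True] by simp blast
  ultimately show ?thesis
    unfolding is_equivalence_relation_def * using True hom_objs by meson
qed (simp add: is_equivalence_relation_def)

text \<open>Relations given by equality of values under \<open>\<phi>\<close> satisfy the three laws
  for free. Kernel pairs arise this way, and so does the equality of points of the exact completion
  pulled back to an object of \<open>X\<close>.\<close>

lemma equivalence_relation_eqI:
  assumes "is_mono_span C A A r"
    and "\<And>T a b. a \<in> hom C T A \<Longrightarrow> b \<in> hom C T A \<Longrightarrow> in_span C r T a b \<longleftrightarrow> \<phi> T a = \<phi> T b"
  shows "is_equivalence_relation C A r"
  unfolding equivalence_relation_iff using assms in_span_homs[OF assms(1)] by metis

section \<open>Kernel pairs and their coequalizers\<close>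

lemma kernel_pair_in_span:
  assumes "is_kernel_pair C f p q" "f \<in> hom C A B" "a \<in> hom C T A" "b \<in> hom C T A"
  shows "in_span C (p, q) T a b \<longleftrightarrow> f \<cdot> a = f \<cdot> b"
proof -
  note P = assms(1)[unfolded is_kernel_pair_def]
  note H = pullback_homs[OF P assms(2,2)]
  show ?thesis
    using pullback_lift[OF P H(1,2) assms(3,4)] comp_square[OF H(4) _ H(1) assms(2) H(2) assms(2)]
    unfolding in_span_def by auto
qed

lemma kernel_pair_mono_span:
  assumes "is_kernel_pair C f p q" "f \<in> hom C A B"
  shows "is_mono_span C A A (p, q)"
proof -
  note P = assms(1)[unfolded is_kernel_pair_def]
  note H = pullback_homs[OF P assms(2,2)]
  show ?thesis using mono_spanI[OF H(1,2)] pullback_unique[OF P H(1,2)] by blast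
qed

lemma kernel_pair_equivalence_relation:
  assumes "is_kernel_pair C f p q" "f \<in> hom C A B"
  shows "is_equivalence_relation C A (p, q)"
  using equivalence_relation_eqI[OF kernel_pair_mono_span[OF assms], of "\<lambda>T a. f \<cdot> a"]
    kernel_pair_in_span[OF assms] by blast

lemma kernel_pairI:
  assumes "is_mono_span C A A (p, q)" "f \<in> hom C A B"
    and "\<And>T a b. a \<in> hom C T A \<Longrightarrow> b \<in> hom C T A \<Longrightarrow> in_span C (p, q) T a b \<longleftrightarrow> f \<cdot> a = f \<cdot> b"
  shows "is_kernel_pair C f p q"
proof -
  note H = mono_span_homs[OF assms(1), simplified]
  have "f \<cdot> p = f \<cdot> q" using in_span_legs[OF assms(1)] assms(3)[OF H] by simp
  moreover have "\<exists>h\<in>hom C T (Dom C p). p \<cdot> h = u \<and> q \<cdot> h = v"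
    if "u \<in> hom C T A" "v \<in> hom C T A" "f \<cdot> u = f \<cdot> v" for T u v
    using assms(3)[OF that(1,2)] that(3) by (simp add: in_span_def)
  ultimately show ?thesis unfolding is_kernel_pair_def
    using pullbackI[OF assms(2,2) H] mono_span_cancel[OF assms(1)] by auto
qed

text \<open>The pair \<open>f\<close>, \<open>g\<close> factors through the kernel pair of
  \<open>e\<close>, so an arrow that identifies \<open>p\<close> and \<open>q\<close> also
  identifies \<open>f\<close> and \<open>g\<close>. Thus the kernel pair can replace an arbitrary
  coequalized pair.\<close>

lemma coequalizer_of_kernel_pair:
  assumes c: "is_coequalizer C f g e" and k: "is_kernel_pair C e p q"
  shows "is_coequalizer C p q e"
proof -
  have e: "e \<in> hom C (Dom C e) (Cod C e)"
    using c by (auto simp: is_coequalizer_def hom_def)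
  note H = coequalizer_homs[OF c e]
  note P = k[unfolded is_kernel_pair_def]
  note K = pullback_homs[OF P e e]
  obtain h where h: "h \<in> hom C (Dom C f) (Dom C p)" "p \<cdot> h = f" "q \<cdot> h = g"
    using pullback_lift[OF P K(1,2) H] by blast
  show ?thesis
  proof (rule coequalizerI[OF K(1,2) e K(4)])
    fix T u assume u: "u \<in> hom C (Dom C e) T" "u \<cdot> p = u \<cdot> q"
    have "u \<cdot> f = u \<cdot> g" using comp_square[OF u(2) h(1) K(1) u(1) K(2) u(1)] h by simp
    then show "\<exists>h\<in>hom C (Cod C e) T. h \<cdot> e = u" using coequalizer_factor[OF c e u(1)] by blast
  qed (use coequalizer_epi[OF c e] in blast)
qed

text \<open>\<open>f\<close> factors through \<open>e\<close>, so \<open>e\<close> identifies at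
  most what \<open>f\<close> identifies, and it identifies \<open>p\<close> with \<open>q\<close> by
  construction. An effective equivalence relation is therefore the kernel pair of its own
  quotient.\<close>

lemma kernel_pair_of_coequalizer:
  assumes k: "is_kernel_pair C f p q" and c: "is_coequalizer C p q e"
  shows "is_kernel_pair C e p q"
proof -
  have f: "f \<in> hom C (Dom C f) (Cod C f)" and e: "e \<in> hom C (Dom C f) (Cod C e)"
    using k c by (auto simp: is_kernel_pair_def is_pullback_def is_coequalizer_def hom_def)
  note P = k[unfolded is_kernel_pair_def]
  note K = pullback_homs[OF P f f]
  obtain h where h: "h \<in> hom C (Cod C e) (Cod C f)" "h \<cdot> e = f"
    using coequalizer_factor[OF c e f K(4)] by blast
  have ee: "e \<cdot> p = e \<cdot> q" using coequalizer_homs[OF c e] by simp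
  show ?thesis
  proof (rule kernel_pairI[OF kernel_pair_mono_span[OF k f] e])
    fix T a b assume a: "a \<in> hom C T (Dom C f)" "b \<in> hom C T (Dom C f)"
    have "e \<cdot> a = e \<cdot> b \<Longrightarrow> f \<cdot> a = f \<cdot> b" using comp_assoc[OF _ e h(1)] a h(2) by metis
    moreover have "in_span C (p, q) T a b \<Longrightarrow> e \<cdot> a = e \<cdot> b"
      unfolding in_span_def using comp_square[OF ee _ K(1) e K(2) e] by auto
    ultimately show "in_span C (p, q) T a b \<longleftrightarrow> e \<cdot> a = e \<cdot> b"
      using kernel_pair_in_span[OF k f a] by blast
  qed
qed

lemma equivalence_relation_in_span_coequalizer:
  assumes "is_coequalizer C r1 r2 q" "q \<in> hom C A Q" "in_span C (r1, r2) T a b"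
  shows "q \<cdot> a = q \<cdot> b"
  using assms(3) comp_square[OF coequalizer_homs(3)[OF assms(1,2)] _ coequalizer_homs(1)[OF assms(1,2)]
      assms(2) coequalizer_homs(2)[OF assms(1,2)] assms(2)]
  unfolding in_span_def by auto

end

section \<open>Finite limits from pullbacks and a terminal object\<close>

text \<open>For the exact completion only pullbacks and a terminal object are constructed by hand;
  limits of arbitrary finite diagrams, which regularity asks for, are derived here once.\<close>

locale finitely_complete = category +
  assumes pullbacks: "has_pullbacks C"
    and terminal: "\<exists>t \<in> Obj C. \<forall>T \<in> Obj C. \<exists>!h. h \<in> hom C T t"
begin

lemma pullbackE:
  assumes "f \<in> hom C A Z" "g \<in> hom C B Z"
  obtains P p q where "is_pullback C f g p q" "p \<in> hom C P A" "q \<in> hom C P B" "f \<cdot> p = g \<cdot> q"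
  by (rule has_pullbacksE[OF pullbacks assms], rule that)

text \<open>The pullback over the terminal object; every square over it commutes, so no condition on
  \<open>u\<close> and \<open>v\<close> remains.\<close>

lemma productE:
  assumes "A \<in> Obj C" "B \<in> Obj C"
  obtains W p q where "p \<in> hom C W A" "q \<in> hom C W B"
    "\<forall>T. \<forall>u \<in> hom C T A. \<forall>v \<in> hom C T B. \<exists>h \<in> hom C T W. p \<cdot> h = u \<and> q \<cdot> h = v"
    "is_mono_span C A B (p, q)"
proof -
  obtain t where t: "t \<in> Obj C" "\<And>T. T \<in> Obj C \<Longrightarrow> \<exists>!h. h \<in> hom C T t" using terminal by blast
  obtain f g where fg: "f \<in> hom C A t" "g \<in> hom C B t" using t assms by blast
  obtain W p q where P: "is_pullback C f g p q" "p \<in> hom C W A" "q \<in> hom C W B"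
    by (rule pullbackE[OF fg], rule that)
  have "f \<cdot> u = g \<cdot> v" if "u \<in> hom C T A" "v \<in> hom C T B" for T u v
    using t(2)[of T] hom_objs[OF that(1)] comp_hom that fg by blast
  then have "\<forall>T. \<forall>u \<in> hom C T A. \<forall>v \<in> hom C T B. \<exists>h \<in> hom C T W. p \<cdot> h = u \<and> q \<cdot> h = v"
    using pullback_lift[OF P] by blast
  moreover have "is_mono_span C A B (p, q)"
    using mono_spanI[OF P(2,3)] pullback_unique[OF P] by blast
  ultimately show thesis using that[OF P(2,3)] by blast
qed

text \<open>The pullback of the pairing of \<open>u\<close> and \<open>v\<close> along the diagonal
  of \<open>B\<close>.\<close>

lemma equalizerE:
  assumes u: "u \<in> hom C A B" and v: "v \<in> hom C A B"
  obtains E e where "e \<in> hom C E A" "u \<cdot> e = v \<cdot> e" "is_mono C e"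
    "\<forall>T. \<forall>x \<in> hom C T A. u \<cdot> x = v \<cdot> x \<longrightarrow> (\<exists>h \<in> hom C T E. e \<cdot> h = x)"
proof -
  have B: "B \<in> Obj C" using hom_objs[OF u] by simp
  obtain W p q where W: "p \<in> hom C W B" "q \<in> hom C W B"
    "\<forall>T. \<forall>u \<in> hom C T B. \<forall>v \<in> hom C T B. \<exists>h \<in> hom C T W. p \<cdot> h = u \<and> q \<cdot> h = v"
    "is_mono_span C B B (p, q)" by (rule productE[OF B B], rule that)
  obtain w where w: "w \<in> hom C A W" "p \<cdot> w = u" "q \<cdot> w = v" using W(3)[rule_format, OF u v] by blast
  obtain d where d: "d \<in> hom C B W" "p \<cdot> d = Ident C B" "q \<cdot> d = Ident C B"
    using W(3)[rule_format, OF ident_hom[OF B] ident_hom[OF B]] by blast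
  obtain E e k where P: "is_pullback C w d e k" "e \<in> hom C E A" "k \<in> hom C E B" "w \<cdot> e = d \<cdot> k"
    by (rule pullbackE[OF w(1) d(1)], rule that)
  \<comment> \<open>Equality with a diagonal element is tested by the projections \<open>p\<close>
    and \<open>q\<close> of the product, which both turn the right side into
    \<open>u \<cdot> x\<close>.\<close>
  have iff: "u \<cdot> x = v \<cdot> x \<longleftrightarrow> w \<cdot> x = d \<cdot> (u \<cdot> x)" if x: "x \<in> hom C T A" for T x
  proof -
    have ux: "u \<cdot> x \<in> hom C T B" using comp_hom[OF x u] .
    have 1: "p \<cdot> (w \<cdot> x) = u \<cdot> x" "q \<cdot> (w \<cdot> x) = v \<cdot> x"
      using comp_reassoc[OF _ x w(1)] w W(1,2) by blast+
    have 2: "p \<cdot> (d \<cdot> (u \<cdot> x)) = u \<cdot> x" "q \<cdot> (d \<cdot> (u \<cdot> x)) = u \<cdot> x"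
      using comp_reassoc[OF _ ux d(1)] d W(1,2) ident_left[OF ux] by metis+
    show ?thesis
      using mono_span_cancel[OF W(4), simplified] 1 2 hom_dom[OF W(1)] comp_hom[OF x w(1)]
        comp_hom[OF ux d(1)] by metis
  qed
  have "w \<cdot> e = d \<cdot> (u \<cdot> e)"
  proof -
    have "p \<cdot> (w \<cdot> e) = u \<cdot> e" using comp_reassoc[OF w(2) P(2) w(1) W(1)] .
    moreover have "p \<cdot> (d \<cdot> k) = k" using comp_reassoc[OF d(2) P(3) d(1) W(1)] ident_left[OF P(3)] by simp
    ultimately show ?thesis using P(4) by simp
  qed
  then have "u \<cdot> e = v \<cdot> e" using iff[OF P(2)] by simp
  moreover have "\<exists>h \<in> hom C T E. e \<cdot> h = x" if "x \<in> hom C T A" "u \<cdot> x = v \<cdot> x" for T x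
    using pullback_lift[OF P(1-3) that(1) comp_hom[OF that(1) u]] iff[OF that(1)] that(2) by blast
  moreover have "is_mono C e"
  proof (rule monoI[OF P(2)])
    fix T x y assume xy: "x \<in> hom C T E" "y \<in> hom C T E" "e \<cdot> x = e \<cdot> y"
    have "d \<cdot> (k \<cdot> x) = d \<cdot> (k \<cdot> y)"
      using comp_square[OF P(4) xy(1) P(2) w(1) P(3) d(1)] comp_square[OF P(4) xy(2) P(2) w(1) P(3) d(1)]
        xy(3) by simp
    \<comment> \<open>\<open>p\<close> is a retraction of the diagonal \<open>d\<close>, so the
      second projection \<open>k\<close> is recovered from the first.\<close>
    then have "p \<cdot> (d \<cdot> (k \<cdot> x)) = p \<cdot> (d \<cdot> (k \<cdot> y))" by simp
    then have "k \<cdot> x = k \<cdot> y"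
      using comp_reassoc[OF d(2) _ d(1) W(1)] ident_left comp_hom[OF _ P(3)] xy(1,2) by metis
    then show "x = y" using pullback_unique[OF P(1-3) xy(1,2) xy(3)] by blast
  qed
  ultimately show thesis by (intro that[OF P(2)]) blast+
qed

text \<open>Both spans are paired into one product and pulled back there, so an element of the
  pullback is a common element of the two relations.\<close>

lemma mono_span_intersection:
  assumes r: "is_mono_span C A B r" and s: "is_mono_span C A B s"
  obtains t where "is_mono_span C A B t"
    "\<And>T a b. in_span C t T a b \<longleftrightarrow> in_span C r T a b \<and> in_span C s T a b"
proof -
  note R = mono_span_homs[OF r] and S = mono_span_homs[OF s]
  have AB: "A \<in> Obj C" "B \<in> Obj C" using hom_objs R by blast+
  obtain W p q where W: "p \<in> hom C W A" "q \<in> hom C W B"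
    "\<forall>T. \<forall>u \<in> hom C T A. \<forall>v \<in> hom C T B. \<exists>h \<in> hom C T W. p \<cdot> h = u \<and> q \<cdot> h = v"
    "is_mono_span C A B (p, q)" by (rule productE[OF AB], rule that)
  obtain f where f: "f \<in> hom C (Dom C (fst r)) W" "p \<cdot> f = fst r" "q \<cdot> f = snd r"
    using W(3)[rule_format, OF R] by blast
  obtain g where g: "g \<in> hom C (Dom C (fst s)) W" "p \<cdot> g = fst s" "q \<cdot> g = snd s"
    using W(3)[rule_format, OF S] by blast
  obtain P x y where P: "is_pullback C f g x y" "x \<in> hom C P (Dom C (fst r))" "y \<in> hom C P (Dom C (fst s))"
    "f \<cdot> x = g \<cdot> y" by (rule pullbackE[OF f(1) g(1)], rule that)
  have r1: "p \<cdot> (f \<cdot> u) = fst r \<cdot> u" "q \<cdot> (f \<cdot> u) = snd r \<cdot> u" if "u \<in> hom C T (Dom C (fst r))" for T u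
    using comp_reassoc[OF f(2) that f(1) W(1)] comp_reassoc[OF f(3) that f(1) W(2)] by auto
  have s1: "p \<cdot> (g \<cdot> u) = fst s \<cdot> u" "q \<cdot> (g \<cdot> u) = snd s \<cdot> u" if "u \<in> hom C T (Dom C (fst s))" for T u
    using comp_reassoc[OF g(2) that g(1) W(1)] comp_reassoc[OF g(3) that g(1) W(2)] by auto
  let ?t = "(fst r \<cdot> x, snd r \<cdot> x)"
  have t: "fst r \<cdot> x \<in> hom C P A" "snd r \<cdot> x \<in> hom C P B" using P R comp_hom by blast+
  have rs: "fst r \<cdot> x = fst s \<cdot> y" "snd r \<cdot> x = snd s \<cdot> y"
    using r1[OF P(2)] s1[OF P(3)] P(4) by simp_all
  have t1: "(fst r \<cdot> x) \<cdot> z = fst r \<cdot> (x \<cdot> z)" "(snd r \<cdot> x) \<cdot> z = snd r \<cdot> (x \<cdot> z)"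
     "(fst r \<cdot> x) \<cdot> z = fst s \<cdot> (y \<cdot> z)" "(snd r \<cdot> x) \<cdot> z = snd s \<cdot> (y \<cdot> z)" if "z \<in> hom C T P" for T z
    using rs comp_assoc[OF that P(2)] comp_assoc[OF that P(3)] R S by simp_all
  have ms: "is_mono_span C A B ?t"
  proof (rule mono_spanI[OF t])
    fix T u v assume uv: "u \<in> hom C T P" "v \<in> hom C T P" and e: "(fst r \<cdot> x) \<cdot> u = (fst r \<cdot> x) \<cdot> v"
      "(snd r \<cdot> x) \<cdot> u = (snd r \<cdot> x) \<cdot> v"
    have "x \<cdot> u = x \<cdot> v"
      using mono_span_cancel[OF r comp_hom[OF uv(1) P(2)] comp_hom[OF uv(2) P(2)]] e t1 uv by simp
    moreover have "y \<cdot> u = y \<cdot> v"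
      using mono_span_cancel[OF s comp_hom[OF uv(1) P(3)] comp_hom[OF uv(2) P(3)]] e t1 uv by simp
    ultimately show "u = v" using pullback_unique[OF P(1-3) uv] by blast
  qed
  have "in_span C ?t T a b \<longleftrightarrow> in_span C r T a b \<and> in_span C s T a b" for T a b
  proof
    assume "in_span C ?t T a b"
    then obtain z where z: "z \<in> hom C T P" "(fst r \<cdot> x) \<cdot> z = a" "(snd r \<cdot> x) \<cdot> z = b"
      using t hom_dom by (auto simp: in_span_def)
    then show "in_span C r T a b \<and> in_span C s T a b"
      unfolding in_span_def using t1[OF z(1)] comp_hom[OF z(1)] P(2,3) by metis
  next
    assume "in_span C r T a b \<and> in_span C s T a b"
    then obtain u v where u: "u \<in> hom C T (Dom C (fst r))" "fst r \<cdot> u = a" "snd r \<cdot> u = b"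
      and v: "v \<in> hom C T (Dom C (fst s))" "fst s \<cdot> v = a" "snd s \<cdot> v = b"
      unfolding in_span_def by blast
    have "f \<cdot> u = g \<cdot> v"
      using mono_span_cancel[OF W(4), simplified] r1[OF u(1)] s1[OF v(1)] hom_dom[OF W(1)] u v
        comp_hom[OF u(1) f(1)] comp_hom[OF v(1) g(1)] by metis
    then obtain h where h: "h \<in> hom C T P" "x \<cdot> h = u" using pullback_lift[OF P(1-3) u(1) v(1)] by blast
    then show "in_span C ?t T a b"
      unfolding in_span_def using t1[OF h(1)] u hom_dom[OF t(1)] by force
  qed
  then show thesis using that[OF ms] by blast
qed

text \<open>Products over a growing set of objects, followed by one equalizer for each arrow of the
  diagram. In \<open>?cone I U\<close> the components range over \<open>I\<close> and only the
  arrows in \<open>U\<close> impose a condition, which gives both inductions their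
  hypothesis.\<close>

lemma finite_limit:
  fixes J :: "('j, 'i) cat"
  assumes fin: "finite (Obj J)" "finite (Arr J)" and D: "is_functor J C D"
  shows "\<exists>A \<pi>. is_limit J C D A \<pi>"
proof -
  let ?cone = "\<lambda>I U B \<sigma>. B \<in> Obj C \<and> (\<forall>j \<in> I. \<sigma> j \<in> hom C B (ObjMap D j)) \<and>
    (\<forall>u \<in> U. ArrMap D u \<cdot> \<sigma> (Dom J u) = \<sigma> (Cod J u))"
  let ?lim = "\<lambda>I U. \<exists>A \<pi>. ?cone I U A \<pi> \<and>
    (\<forall>B \<sigma>. ?cone I U B \<sigma> \<longrightarrow> (\<exists>h \<in> hom C B A. \<forall>j \<in> I. \<pi> j \<cdot> h = \<sigma> j)) \<and>
    (\<forall>B h k. h \<in> hom C B A \<longrightarrow> k \<in> hom C B A \<longrightarrow> (\<forall>j \<in> I. \<pi> j \<cdot> h = \<pi> j \<cdot> k) \<longrightarrow> h = k)"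
  interpret J: category J using D by (simp add: is_functor_def)
  have Dobj: "j \<in> Obj J \<Longrightarrow> ObjMap D j \<in> Obj C" for j using D by (simp add: is_functor_def)
  have Darr: "u \<in> Arr J \<Longrightarrow> ArrMap D u \<in> hom C (ObjMap D (Dom J u)) (ObjMap D (Cod J u))" for u
    using D J.arr_hom unfolding is_functor_def by blast
  have products: "I \<subseteq> Obj J \<longrightarrow> ?lim I {}" if "finite I" for I
    using that
  proof (induction I rule: finite_induct)
    case empty
    obtain t where "t \<in> Obj C" "\<forall>T \<in> Obj C. \<exists>!h. h \<in> hom C T t" using terminal by blast
    then show ?case using hom_objs by (intro impI exI[of _ t]) auto
  next
    case (insert i I)
    show ?case
    proof
      assume I: "insert i I \<subseteq> Obj J"
      then obtain A \<pi> where A: "?cone I {} A \<pi>"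
        and ex: "\<And>B \<sigma>. ?cone I {} B \<sigma> \<Longrightarrow> \<exists>h \<in> hom C B A. \<forall>j \<in> I. \<pi> j \<cdot> h = \<sigma> j"
        and un: "\<And>B h k. h \<in> hom C B A \<Longrightarrow> k \<in> hom C B A \<Longrightarrow> (\<forall>j \<in> I. \<pi> j \<cdot> h = \<pi> j \<cdot> k) \<Longrightarrow> h = k"
        using insert.IH by auto
      \<comment> \<open>The product of the limit over \<open>I\<close> with the one new
        object.\<close>
      obtain W p q where W: "p \<in> hom C W A" "q \<in> hom C W (ObjMap D i)"
        "\<forall>T. \<forall>u \<in> hom C T A. \<forall>v \<in> hom C T (ObjMap D i). \<exists>h \<in> hom C T W. p \<cdot> h = u \<and> q \<cdot> h = v"
        "is_mono_span C A (ObjMap D i) (p, q)" by (rule productE[OF A(1)[THEN conjunct1] Dobj[of i]], use I in simp, rule that)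
      let ?\<pi> = "\<lambda>j. if j = i then q else \<pi> j \<cdot> p"
      have assoc: "?\<pi> j \<cdot> h = \<pi> j \<cdot> (p \<cdot> h)" if "j \<in> I" "h \<in> hom C B W" for j h B
        using comp_assoc[OF that(2) W(1)] A that insert.hyps by auto
      have c: "?cone (insert i I) {} W ?\<pi>" using A W comp_hom hom_objs[OF W(1)] by auto
      have e: "\<exists>h \<in> hom C B W. \<forall>j \<in> insert i I. ?\<pi> j \<cdot> h = \<sigma> j" if s: "?cone (insert i I) {} B \<sigma>" for B \<sigma>
      proof -
        obtain k where k: "k \<in> hom C B A" "\<forall>j \<in> I. \<pi> j \<cdot> k = \<sigma> j" using ex[of B \<sigma>] s by auto
        obtain h where h: "h \<in> hom C B W" "p \<cdot> h = k" "q \<cdot> h = \<sigma> i" using W(3)[rule_format, OF k(1), of "\<sigma> i"] s by blast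
        then show ?thesis using assoc k by (intro bexI[OF _ h(1)]) auto
      qed
      have u: "h = k" if hk: "h \<in> hom C B W" "k \<in> hom C B W" "\<forall>j \<in> insert i I. ?\<pi> j \<cdot> h = ?\<pi> j \<cdot> k" for B h k
      proof -
        have "p \<cdot> h = p \<cdot> k"
          using un[OF comp_hom[OF hk(1) W(1)] comp_hom[OF hk(2) W(1)]] hk assoc by auto
        moreover have "q \<cdot> h = q \<cdot> k" using hk(3) by simp
        ultimately show ?thesis using mono_span_cancel[OF W(4)] hk hom_dom[OF W(1)] by simp
      qed
      show "?lim (insert i I) {}"
        by (rule exI[of _ W], rule exI[of _ ?\<pi>], intro conjI allI impI; (rule c[THEN conjunct1]
          | rule c[THEN conjunct2, THEN conjunct1] | rule c[THEN conjunct2, THEN conjunct2] | rule e | rule u); assumption)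
    qed
  qed
  have "U \<subseteq> Arr J \<longrightarrow> ?lim (Obj J) U" if "finite U" for U
    using that
  proof (induction U rule: finite_induct)
    case empty
    then show ?case using products[OF fin(1)] by simp
  next
    case (insert w U)
    show ?case
    proof
      assume U: "insert w U \<subseteq> Arr J"
      then obtain A \<pi> where A: "?cone (Obj J) U A \<pi>"
        and ex: "\<And>B \<sigma>. ?cone (Obj J) U B \<sigma> \<Longrightarrow> \<exists>h \<in> hom C B A. \<forall>j \<in> Obj J. \<pi> j \<cdot> h = \<sigma> j"
        and un: "\<And>B h k. h \<in> hom C B A \<Longrightarrow> k \<in> hom C B A \<Longrightarrow> (\<forall>j \<in> Obj J. \<pi> j \<cdot> h = \<pi> j \<cdot> k) \<Longrightarrow> h = k"
        using insert.IH by auto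
      have w: "w \<in> Arr J" "Dom J w \<in> Obj J" "Cod J w \<in> Obj J" using U J.dom_obj J.cod_obj by auto
      have \<pi>w: "\<pi> (Dom J w) \<in> hom C A (ObjMap D (Dom J w))" "\<pi> (Cod J w) \<in> hom C A (ObjMap D (Cod J w))"
        using A w by auto
      note w' = comp_hom[OF \<pi>w(1) Darr[OF w(1)]]
      \<comment> \<open>Equalizing the two arrows to the object at \<open>Cod J w\<close> imposes
        the condition for \<open>w\<close>. The old conditions survive composition with
        \<open>e\<close>, and uniqueness survives because \<open>e\<close> is monic.\<close>
      obtain E e where E: "e \<in> hom C E A" "(ArrMap D w \<cdot> \<pi> (Dom J w)) \<cdot> e = \<pi> (Cod J w) \<cdot> e" "is_mono C e"
        "\<forall>T. \<forall>x \<in> hom C T A. (ArrMap D w \<cdot> \<pi> (Dom J w)) \<cdot> x = \<pi> (Cod J w) \<cdot> x \<longrightarrow>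
          (\<exists>h \<in> hom C T E. e \<cdot> h = x)"
        by (rule equalizerE[OF w' \<pi>w(2)], rule that)
      let ?\<pi> = "\<lambda>j. \<pi> j \<cdot> e"
      have assoc: "?\<pi> j \<cdot> h = \<pi> j \<cdot> (e \<cdot> h)" if "j \<in> Obj J" "h \<in> hom C B E" for j h B
        using comp_assoc[OF that(2) E(1)] A that by auto
      have assoc2: "ArrMap D u \<cdot> (\<pi> (Dom J u) \<cdot> x) = (ArrMap D u \<cdot> \<pi> (Dom J u)) \<cdot> x"
        if "u \<in> Arr J" "x \<in> hom C B A" for u x B
        using comp_assoc[OF that(2) _ Darr[OF that(1)]] A J.dom_obj[OF that(1)] by blast
      have c: "?cone (Obj J) (insert w U) E ?\<pi>"
      proof (intro conjI ballI)
        show "E \<in> Obj C" using hom_objs[OF E(1)] by simp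
      next
        fix j assume "j \<in> Obj J" then show "?\<pi> j \<in> hom C E (ObjMap D j)" using A E(1) comp_hom by blast
      next
        fix u assume u: "u \<in> insert w U"
        then show "ArrMap D u \<cdot> ?\<pi> (Dom J u) = ?\<pi> (Cod J u)"
          using assoc2[of u, OF _ E(1)] E(2) A U by auto
      qed
      have e: "\<exists>h \<in> hom C B E. \<forall>j \<in> Obj J. ?\<pi> j \<cdot> h = \<sigma> j" if s: "?cone (Obj J) (insert w U) B \<sigma>" for B \<sigma>
      proof -
        obtain k where k: "k \<in> hom C B A" "\<forall>j \<in> Obj J. \<pi> j \<cdot> k = \<sigma> j" using ex[of B \<sigma>] s by auto
        have "(ArrMap D w \<cdot> \<pi> (Dom J w)) \<cdot> k = \<pi> (Cod J w) \<cdot> k"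
          using assoc2[OF w(1) k(1)] k(2) s w by auto
        then obtain h where h: "h \<in> hom C B E" "e \<cdot> h = k" using E(4)[rule_format, OF k(1)] by blast
        then show ?thesis using assoc k by (intro bexI[OF _ h(1)]) auto
      qed
      have u: "h = k" if hk: "h \<in> hom C B E" "k \<in> hom C B E" "\<forall>j \<in> Obj J. ?\<pi> j \<cdot> h = ?\<pi> j \<cdot> k" for B h k
      proof -
        have "e \<cdot> h = e \<cdot> k"
          using un[OF comp_hom[OF hk(1) E(1)] comp_hom[OF hk(2) E(1)]] hk assoc by auto
        then show ?thesis using mono_cancel[OF E(3,1)] hk by simp
      qed
      show "?lim (Obj J) (insert w U)"
        by (rule exI[of _ E], rule exI[of _ ?\<pi>], intro conjI allI impI; (rule c[THEN conjunct1]
          | rule c[THEN conjunct2, THEN conjunct1] | rule c[THEN conjunct2, THEN conjunct2] | rule e | rule u); assumption)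
    qed
  qed
  from this[OF fin(2)] obtain A \<pi> where A: "?cone (Obj J) (Arr J) A \<pi>"
        and ex: "\<And>B \<sigma>. ?cone (Obj J) (Arr J) B \<sigma> \<Longrightarrow> \<exists>h \<in> hom C B A. \<forall>j \<in> Obj J. \<pi> j \<cdot> h = \<sigma> j"
        and un: "\<And>B h k. h \<in> hom C B A \<Longrightarrow> k \<in> hom C B A \<Longrightarrow> (\<forall>j \<in> Obj J. \<pi> j \<cdot> h = \<pi> j \<cdot> k) \<Longrightarrow> h = k"
    by auto
  have "is_limit J C D A \<pi>"
    unfolding is_limit_def is_cone_def
  proof (intro conjI allI impI)
    fix B \<sigma>
    assume "B \<in> Obj C \<and> (\<forall>j \<in> Obj J. \<sigma> j \<in> hom C B (ObjMap D j)) \<and>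
      (\<forall>u \<in> Arr J. ArrMap D u \<cdot> \<sigma> (Dom J u) = \<sigma> (Cod J u))"
    then obtain h where h: "h \<in> hom C B A" "\<forall>j \<in> Obj J. \<pi> j \<cdot> h = \<sigma> j" using ex by blast
    then show "\<exists>!h. h \<in> hom C B A \<and> (\<forall>j \<in> Obj J. \<pi> j \<cdot> h = \<sigma> j)"
      using un[of _ B] by (intro ex1I[of _ h]) auto
  qed (use A in auto)
  then show ?thesis by blast
qed

lemma finite_limits: "has_finite_limits C"
  unfolding has_finite_limits_def using finite_limit by blast

end

text \<open>Applied to the empty diagram, on which the values of the functor are arbitrary.\<close>

lemma (in category) finite_limits_terminal:
  assumes "has_finite_limits C"
  shows "\<exists>t \<in> Obj C. \<forall>T \<in> Obj C. \<exists>!h. h \<in> hom C T t"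
proof -
  define J :: "(nat, nat) cat" where
    "J = \<lparr>Obj = {}, Arr = {}, Dom = id, Cod = id, Ident = id, Comp = (\<lambda>g f. f)\<rparr>"
  define D :: "(nat, nat, _, _) fctr" where
    "D = \<lparr>ObjMap = (\<lambda>_. Dom C undefined), ArrMap = (\<lambda>_. Ident C undefined)\<rparr>"
  have "category J" by unfold_locales (auto simp: J_def hom_def)
  then have "is_functor J C D" using category_axioms by (auto simp: is_functor_def J_def hom_def)
  then obtain A \<pi> where "is_limit J C D A \<pi>"
    using assms unfolding has_finite_limits_def by (force simp: J_def)
  then have "A \<in> Obj C" "\<forall>B. B \<in> Obj C \<longrightarrow> (\<exists>!h. h \<in> hom C B A)"
    by (auto simp: is_limit_def is_cone_def J_def)
  then show ?thesis by blast
qed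

lemma (in category) finite_limits_pullbacks:
  assumes "has_finite_limits C"
  shows "has_pullbacks C"
  unfolding has_pullbacks_def
proof (intro ballI impI)
  fix f g assume f: "f \<in> Arr C" and g: "g \<in> Arr C" and fg: "Cod C f = Cod C g"
  \<comment> \<open>The cospan 0 -> 2 <- 1: arrows below 3 are identities, 3 and 4 are the two legs.
    No two legs are composable, so in a composite at least one factor is an identity and
    \<open>Comp\<close> returns the other.\<close>
  define J :: "(nat, nat) cat" where
    "J = \<lparr>Obj = {0, 1, 2}, Arr = {0, 1, 2, 3, 4},
      Dom = (\<lambda>u. if u = 3 then 0 else if u = 4 then 1 else u), Cod = (\<lambda>u. if 3 \<le> u then 2 else u),
      Ident = id, Comp = (\<lambda>v u. if v < 3 then u else v)\<rparr>"
  define D :: "(nat, nat, _, _) fctr" where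
    "D = \<lparr>ObjMap = (\<lambda>j. if j = 0 then Dom C f else if j = 1 then Dom C g else Cod C f),
      ArrMap = (\<lambda>u. if u = 3 then f else if u = 4 then g else
        Ident C (if u = 0 then Dom C f else if u = 1 then Dom C g else Cod C f))\<rparr>"
  have J: "category J" by unfold_locales (auto simp: J_def hom_def)
  have obj: "Dom C f \<in> Obj C" "Dom C g \<in> Obj C" "Cod C g \<in> Obj C" using f g dom_obj cod_obj by auto
  have id: "A \<in> Obj C \<Longrightarrow> Ident C A \<in> Arr C \<and> Dom C (Ident C A) = A \<and> Cod C (Ident C A) = A" for A
    using ident_hom by (auto simp: hom_def)
  have idl: "h \<in> Arr C \<Longrightarrow> Cod C h = B \<Longrightarrow> Ident C B \<cdot> h = h"
    and idr: "h \<in> Arr C \<Longrightarrow> Dom C h = B \<Longrightarrow> h \<cdot> Ident C B = h" for h B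
    using ident_left ident_right by (auto simp: hom_def)
  have "is_functor J C D"
    unfolding is_functor_def
    using J category_axioms obj f g fg id idl idr by (auto simp: J_def D_def hom_def)
  then obtain A \<pi> where lim: "is_limit J C D A \<pi>"
    using assms unfolding has_finite_limits_def by (force simp: J_def)
  have \<pi>: "\<pi> 0 \<in> hom C A (Dom C f)" "\<pi> 1 \<in> hom C A (Dom C g)" "f \<cdot> \<pi> 0 = \<pi> 2" "g \<cdot> \<pi> 1 = \<pi> 2"
    using lim by (auto simp: is_limit_def is_cone_def J_def D_def)
  have "is_pullback C f g (\<pi> 0) (\<pi> 1)"
  proof (rule pullbackI[OF arr_hom[OF f] _ \<pi>(1,2)])
    show "g \<in> hom C (Dom C g) (Cod C f)" "f \<cdot> \<pi> 0 = g \<cdot> \<pi> 1" using g fg \<pi> by (auto simp: hom_def)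
  next
    fix T u v assume uv: "u \<in> hom C T (Dom C f)" "v \<in> hom C T (Dom C g)" "f \<cdot> u = g \<cdot> v"
    let ?\<sigma> = "\<lambda>j :: nat. if j = 0 then u else if j = 1 then v else f \<cdot> u"
    have fu: "f \<cdot> u \<in> hom C T (Cod C g)" using comp_hom[OF uv(1) arr_hom[OF f]] fg by simp
    have "is_cone J C D T ?\<sigma>"
      using uv fu fg hom_objs[OF uv(1)] ident_left[OF uv(1)] ident_left[OF uv(2)] ident_left[OF fu]
      by (auto simp: is_cone_def J_def D_def)
    then obtain h where "h \<in> hom C T A" "\<forall>j \<in> Obj J. \<pi> j \<cdot> h = ?\<sigma> j"
      using lim unfolding is_limit_def by blast
    then show "\<exists>h \<in> hom C T A. \<pi> 0 \<cdot> h = u \<and> \<pi> 1 \<cdot> h = v" by (auto simp: J_def)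
  next
    fix T h k assume hk: "h \<in> hom C T A" "k \<in> hom C T A" "\<pi> 0 \<cdot> h = \<pi> 0 \<cdot> k" "\<pi> 1 \<cdot> h = \<pi> 1 \<cdot> k"
    have c: "is_cone J C D A \<pi>" using lim by (simp add: is_limit_def)
    have \<pi>2: "\<pi> 2 \<in> hom C A (Cod C f)" using comp_hom[OF \<pi>(1) arr_hom[OF f]] \<pi> by simp
    have 2: "\<pi> 2 \<cdot> h = \<pi> 2 \<cdot> k"
      using comp_reassoc[OF \<pi>(3) hk(1) \<pi>(1) arr_hom[OF f]] comp_reassoc[OF \<pi>(3) hk(2) \<pi>(1) arr_hom[OF f]] hk
      by simp
    have "is_cone J C D T (\<lambda>j. \<pi> j \<cdot> h)"
      using c hk(1) hom_objs[OF hk(1)] comp_hom[OF hk(1) \<pi>(1)] comp_hom[OF hk(1) \<pi>(2)] comp_hom[OF hk(1) \<pi>2]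
        fg comp_reassoc[OF \<pi>(3) hk(1) \<pi>(1) arr_hom[OF f]]
        comp_reassoc[OF \<pi>(4) hk(1) \<pi>(2), of "Cod C g"] g idl
      by (auto simp: is_cone_def J_def D_def hom_def)
    then have "\<exists>!x. x \<in> hom C T A \<and> (\<forall>j \<in> Obj J. \<pi> j \<cdot> x = \<pi> j \<cdot> h)"
      using lim unfolding is_limit_def by blast
    moreover have "\<forall>j \<in> Obj J. \<pi> j \<cdot> k = \<pi> j \<cdot> h" using hk 2 by (auto simp: J_def)
    ultimately show "h = k" using hk by blast
  qed
  then show "\<exists>p q. is_pullback C f g p q" by blast
qed

sublocale regular_category \<subseteq> finitely_complete
  using finite_limits finite_limits_pullbacks finite_limits_terminal by unfold_locales blast+

section \<open>Regular epimorphisms as covers\<close>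

definition covers :: "('o, 'a) cat \<Rightarrow> 'o \<Rightarrow> 'o \<Rightarrow> 'a set" where
  "covers C A B = {e \<in> hom C A B. is_regular_epi C e}"

lemma coversI: "is_regular_epi C e \<Longrightarrow> e \<in> hom C A B \<Longrightarrow> e \<in> covers C A B"
  and cover_hom: "e \<in> covers C A B \<Longrightarrow> e \<in> hom C A B"
  and cover_regular_epi: "e \<in> covers C A B \<Longrightarrow> is_regular_epi C e"
  by (simp_all add: covers_def)

context category
begin

lemma cover_epi:
  "e \<in> covers C A B \<Longrightarrow> h \<in> hom C B T \<Longrightarrow> k \<in> hom C B T \<Longrightarrow> h \<cdot> e = k \<cdot> e \<Longrightarrow> h = k"
  using regular_epi_epi by (auto simp: covers_def)

lemma cover_ident: "A \<in> Obj C \<Longrightarrow> Ident C A \<in> covers C A A"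
proof (rule coversI)
  assume A: "A \<in> Obj C"
  note i = ident_hom[OF A]
  show "Ident C A \<in> hom C A A" by (rule i)
  have "is_coequalizer C (Ident C A) (Ident C A) (Ident C A)"
    by (rule coequalizerI[OF i i i refl]) (use ident_right in auto)
  then show "is_regular_epi C (Ident C A)" by (auto simp: is_regular_epi_def)
qed

lemma mono_span_local:
  assumes "is_mono_span C A B r" "e \<in> covers C T' T" "a \<in> hom C T A" "b \<in> hom C T B"
    "in_span C r T' (a \<cdot> e) (b \<cdot> e)"
  shows "in_span C r T a b"
  using in_span_local[OF assms(1) cover_regular_epi[OF assms(2)] cover_hom[OF assms(2)] assms(3-5)] .

text \<open>The lifting property turns the factorization of a cover through \<open>m\<close> into a
  section of \<open>m\<close>.\<close>

lemma mono_cover_iso: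
  assumes "is_mono C m" "m \<in> hom C M N" "e \<in> covers C T N" "h \<in> hom C T M" "m \<cdot> h = e"
  shows "is_iso C m"
proof -
  have N: "N \<in> Obj C" using hom_objs[OF assms(2)] by simp
  obtain k where "k \<in> hom C N M" "m \<cdot> k = Ident C N"
    using regular_epi_lift_mono[OF cover_regular_epi[OF assms(3)] cover_hom[OF assms(3)] assms(2,1,4)
        ident_hom[OF N]] assms(5) ident_left[OF cover_hom[OF assms(3)]] by auto
  then show ?thesis by (rule mono_split_epi_iso[OF assms(1,2)])
qed

end

context regular_category
begin

text \<open>Elements of \<open>B\<close> lift along a cover only after a change of stage; this is
  stability of regular epimorphisms in the language of generalized elements.\<close>

lemma cover_pullback:
  assumes "e \<in> covers C A B" "t \<in> hom C T B"
  obtains T' e' t' where "e' \<in> covers C T' T" "t' \<in> hom C T' A" "e \<cdot> t' = t \<cdot> e'"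
proof -
  obtain P p q where P: "is_pullback C t e p q" "p \<in> hom C P T" "q \<in> hom C P A" "t \<cdot> p = e \<cdot> q"
    by (rule pullbackE[OF assms(2) cover_hom[OF assms(1)]], rule that)
  then have "is_regular_epi C p" using regular_epi_stable[OF cover_regular_epi[OF assms(1)]] by blast
  then show thesis using that[OF coversI[OF _ P(2)] P(3)] P(4) by simp
qed

text \<open>The quotient of the kernel pair. That the comparison \<open>m\<close> is monic needs
  stability: two elements of \<open>I\<close> are lifted to \<open>A\<close> over a common cover,
  where having the same image under \<open>f\<close> puts them in the kernel pair.\<close>

lemma image_factorization:
  assumes f: "f \<in> hom C A B"
  obtains I c m where "c \<in> covers C A I" "m \<in> hom C I B" "is_mono C m" "m \<cdot> c = f"
proof -
  obtain P p q where P: "is_pullback C f f p q" "p \<in> hom C P A" "q \<in> hom C P A" "f \<cdot> p = f \<cdot> q"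
    by (rule pullbackE[OF f f], rule that)
  then have k: "is_kernel_pair C f p q" by (simp add: is_kernel_pair_def)
  then obtain c where c: "is_coequalizer C p q c" using kernel_pair_coequalizer by blast
  define I where "I = Cod C c"
  have cA: "c \<in> hom C A I" unfolding I_def by (rule coequalizer_hom[OF c P(2)])
  have cc: "c \<in> covers C A I" using c cA by (auto simp: covers_def is_regular_epi_def)
  obtain m where m: "m \<in> hom C I B" "m \<cdot> c = f" using coequalizer_factor[OF c cA f P(4)] by blast
  have "is_mono C m"
  proof (rule monoI[OF m(1)])
    fix T u v assume u: "u \<in> hom C T I" and v: "v \<in> hom C T I" and e: "m \<cdot> u = m \<cdot> v"
    obtain T1 e1 x where 1: "e1 \<in> covers C T1 T" "x \<in> hom C T1 A" "c \<cdot> x = u \<cdot> e1"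
      by (rule cover_pullback[OF cc u], rule that)
    have ve1: "v \<cdot> e1 \<in> hom C T1 I" using comp_hom[OF cover_hom[OF 1(1)] v] .
    \<comment> \<open>A second cover over the first, so that both lifts live at the one stage
      \<open>T2\<close>.\<close>
    obtain T2 e2 y where 2: "e2 \<in> covers C T2 T1" "y \<in> hom C T2 A" "c \<cdot> y = (v \<cdot> e1) \<cdot> e2"
      by (rule cover_pullback[OF cc ve1], rule that)
    note e1 = cover_hom[OF 1(1)] and e2 = cover_hom[OF 2(1)]
    have x2: "x \<cdot> e2 \<in> hom C T2 A" using comp_hom[OF e2 1(2)] .
    have cx: "c \<cdot> (x \<cdot> e2) = (u \<cdot> e1) \<cdot> e2" using comp_reassoc[OF 1(3) e2 1(2) cA] .
    have "f \<cdot> (x \<cdot> e2) = m \<cdot> (c \<cdot> (x \<cdot> e2))" "f \<cdot> y = m \<cdot> (c \<cdot> y)"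
      using comp_assoc[OF x2 cA m(1)] comp_assoc[OF 2(2) cA m(1)] m(2) by simp_all
    moreover have "m \<cdot> ((u \<cdot> e1) \<cdot> e2) = m \<cdot> ((v \<cdot> e1) \<cdot> e2)"
      using comp_assoc[OF comp_hom[OF e2 e1]] comp_assoc[OF e2 e1] u v m(1) e by metis
    ultimately have "f \<cdot> (x \<cdot> e2) = f \<cdot> y" using cx 2(3) by simp
    then have "c \<cdot> (x \<cdot> e2) = c \<cdot> y"
      using kernel_pair_in_span[OF k f x2 2(2)] equivalence_relation_in_span_coequalizer[OF c cA] by blast
    then have "u \<cdot> e1 = v \<cdot> e1"
      using cx 2(3) cover_epi[OF 2(1) comp_hom[OF e1 u] ve1] by simp
    then show "u = v" by (rule cover_epi[OF 1(1) u v])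
  qed
  then show thesis using that[OF cc m(1) _ m(2)] by blast
qed

text \<open>The image of the composite is everything: \<open>e'\<close> lifts into it because
  \<open>e\<close> is strong, and then \<open>mono_cover_iso\<close> applies.\<close>

lemma cover_comp:
  assumes "e \<in> covers C A B" "e' \<in> covers C B D"
  shows "e' \<cdot> e \<in> covers C A D"
proof -
  note e = cover_hom[OF assms(1)] and e' = cover_hom[OF assms(2)]
  obtain I c m where I: "c \<in> covers C A I" "m \<in> hom C I D" "is_mono C m" "m \<cdot> c = e' \<cdot> e"
    by (rule image_factorization[OF comp_hom[OF e e']], rule that)
  obtain h where h: "h \<in> hom C B I" "h \<cdot> e = c" "m \<cdot> h = e'"
    using regular_epi_lift_mono[OF cover_regular_epi[OF assms(1)] e I(2,3) cover_hom[OF I(1)] e' I(4)] by blast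
  have "is_iso C m" using mono_cover_iso[OF I(3,2) assms(2) h(1,3)] .
  then show ?thesis
    using iso_comp_regular_epi[OF cover_regular_epi[OF I(1)] cover_hom[OF I(1)] _ I(2)] I(4)
      comp_hom[OF e e'] by (simp add: covers_def)
qed

lemma cover_refine:
  assumes "e1 \<in> covers C T1 T" "e2 \<in> covers C T2 T"
  obtains T' x y where "x \<in> covers C T' T1" "y \<in> hom C T' T2" "e1 \<cdot> x = e2 \<cdot> y" "e1 \<cdot> x \<in> covers C T' T"
proof -
  obtain T' x y where "x \<in> covers C T' T1" "y \<in> hom C T' T2" "e2 \<cdot> y = e1 \<cdot> x"
    by (rule cover_pullback[OF assms(2) cover_hom[OF assms(1)]], rule that)
  then show thesis using that cover_comp[OF _ assms(1)] by simp
qed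

text \<open>The image of the induced arrow from \<open>P\<close> into the product of
  \<open>A\<close> and \<open>B\<close>, followed by the projections.\<close>

lemma image_span:
  assumes s: "s1 \<in> hom C P A" "s2 \<in> hom C P B"
  obtains t e where "is_mono_span C A B t" "e \<in> covers C P (Dom C (fst t))"
    "fst t \<cdot> e = s1" "snd t \<cdot> e = s2"
proof -
  have AB: "A \<in> Obj C" "B \<in> Obj C" using hom_objs s by blast+
  obtain W p q where W: "p \<in> hom C W A" "q \<in> hom C W B"
    "\<forall>T. \<forall>u \<in> hom C T A. \<forall>v \<in> hom C T B. \<exists>h \<in> hom C T W. p \<cdot> h = u \<and> q \<cdot> h = v"
    "is_mono_span C A B (p, q)" by (rule productE[OF AB], rule that)
  obtain f where f: "f \<in> hom C P W" "p \<cdot> f = s1" "q \<cdot> f = s2" using W(3) s by blast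
  obtain I c m where I: "c \<in> covers C P I" "m \<in> hom C I W" "is_mono C m" "m \<cdot> c = f"
    by (rule image_factorization[OF f(1)], rule that)
  have t: "p \<cdot> m \<in> hom C I A" "q \<cdot> m \<in> hom C I B" using I W comp_hom by blast+
  have "is_mono_span C A B (p \<cdot> m, q \<cdot> m)"
  proof (rule mono_spanI[OF t])
    fix T u v assume uv: "u \<in> hom C T I" "v \<in> hom C T I" "(p \<cdot> m) \<cdot> u = (p \<cdot> m) \<cdot> v" "(q \<cdot> m) \<cdot> u = (q \<cdot> m) \<cdot> v"
    then have "m \<cdot> u = m \<cdot> v"
      using mono_span_cancel[OF W(4), of "m \<cdot> u" T "m \<cdot> v"] hom_dom[OF W(1)] comp_hom[OF _ I(2)]
        comp_assoc[OF _ I(2) W(1)] comp_assoc[OF _ I(2) W(2)] by simp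
    then show "u = v" using mono_cancel[OF I(3,2) uv(1,2)] by simp
  qed
  moreover have "(p \<cdot> m) \<cdot> c = s1" "(q \<cdot> m) \<cdot> c = s2"
    using comp_assoc[OF cover_hom[OF I(1)] I(2) W(1)] comp_assoc[OF cover_hom[OF I(1)] I(2) W(2)] I(4) f
    by simp_all
  ultimately show thesis using that[of "(p \<cdot> m, q \<cdot> m)" c] I(1) hom_dom[OF t(1)] by simp
qed

text \<open>The existential quantifier of regular logic: a preimage in \<open>P\<close> exists only
  over a cover of the stage \<open>T\<close>, and conversely membership over a cover descends by
  \<open>mono_span_local\<close>.\<close>

lemma in_image_span:
  assumes s: "s1 \<in> hom C P A" "s2 \<in> hom C P B"
    and t: "is_mono_span C A B t" "e \<in> covers C P (Dom C (fst t))" "fst t \<cdot> e = s1" "snd t \<cdot> e = s2"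
    and ab: "a \<in> hom C T A" "b \<in> hom C T B"
  shows "in_span C t T a b \<longleftrightarrow>
    (\<exists>T' d x. d \<in> covers C T' T \<and> x \<in> hom C T' P \<and> s1 \<cdot> x = a \<cdot> d \<and> s2 \<cdot> x = b \<cdot> d)"
proof
  note H = mono_span_homs[OF t(1)] and e = cover_hom[OF t(2)]
  {
    assume "in_span C t T a b"
    then obtain y where y: "y \<in> hom C T (Dom C (fst t))" "fst t \<cdot> y = a" "snd t \<cdot> y = b"
      by (auto simp: in_span_def)
    obtain T' d x where d: "d \<in> covers C T' T" "x \<in> hom C T' P" "e \<cdot> x = y \<cdot> d"
      by (rule cover_pullback[OF t(2) y(1)], rule that)
    have "s1 \<cdot> x = a \<cdot> d" "s2 \<cdot> x = b \<cdot> d"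
      using comp_assoc[OF d(2) e H(1)] comp_assoc[OF d(2) e H(2)] t(3,4) d(3)
        comp_assoc[OF cover_hom[OF d(1)] y(1) H(1)] comp_assoc[OF cover_hom[OF d(1)] y(1) H(2)] y by simp_all
    then show "\<exists>T' d x. d \<in> covers C T' T \<and> x \<in> hom C T' P \<and> s1 \<cdot> x = a \<cdot> d \<and> s2 \<cdot> x = b \<cdot> d"
      using d by blast
  next
    assume "\<exists>T' d x. d \<in> covers C T' T \<and> x \<in> hom C T' P \<and> s1 \<cdot> x = a \<cdot> d \<and> s2 \<cdot> x = b \<cdot> d"
    then obtain T' d x where d: "d \<in> covers C T' T" "x \<in> hom C T' P" "s1 \<cdot> x = a \<cdot> d" "s2 \<cdot> x = b \<cdot> d"
      by blast
    have "in_span C t T' (a \<cdot> d) (b \<cdot> d)"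
      unfolding in_span_def
      using comp_hom[OF d(2) e] comp_assoc[OF d(2) e H(1)] comp_assoc[OF d(2) e H(2)] t(3,4) d(3,4) by force
    then show "in_span C t T a b" by (rule mono_span_local[OF t(1) d(1) ab])
  }
qed

end

text \<open>A regular epimorphism is the coequalizer of its kernel pair, which is an equivalence
  relation; the hypothesis then identifies its pullback as the coequalizer of the pulled-back
  relation. Kernel pairs have coequalizers for the same reason.\<close>

lemma (in finitely_complete) stable_coequalizers_regular:
  assumes st: "stable_coequalizers_of_equivalence_relations C"
  shows "regular_category C"
proof unfold_locales
  show "has_finite_limits C" by (rule finite_limits)
next
  fix f p q assume k: "is_kernel_pair C f p q"
  then have "is_equivalence_relation C (Dom C f) (p, q)"
    using kernel_pair_equivalence_relation[OF k arr_hom] by (simp add: is_kernel_pair_def is_pullback_def)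
  then show "\<exists>e. is_coequalizer C p q e"
    using st unfolding stable_coequalizers_of_equivalence_relations_def by blast
next
  fix e f e' f' assume e: "is_regular_epi C e" and P: "is_pullback C f e e' f'"
  define A Q Y where "A = Dom C e" and "Q = Cod C e" and "Y = Dom C f"
  have eh: "e \<in> hom C A Q" using regular_epi_hom[OF e] by (simp add: A_def Q_def)
  have f: "f \<in> hom C Y Q" using P by (auto simp: is_pullback_def hom_def Y_def Q_def)
  note H = pullback_homs[OF P f eh]
  obtain K r1 r2 where R: "is_pullback C e e r1 r2" "r1 \<in> hom C K A" "r2 \<in> hom C K A" "e \<cdot> r1 = e \<cdot> r2"
    by (rule pullbackE[OF eh eh], rule that)
  then have k: "is_kernel_pair C e r1 r2" by (simp add: is_kernel_pair_def)
  have c: "is_coequalizer C r1 r2 e"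
    using e coequalizer_of_kernel_pair[OF _ k] by (auto simp: is_regular_epi_def)
  have er: "e \<cdot> r1 \<in> hom C K Q" using comp_hom[OF R(2) eh] .
  \<comment> \<open>The kernel pair of \<open>e\<close>, lying over \<open>Q\<close> by
    \<open>e \<cdot> r1\<close>, is pulled back along \<open>f\<close>; its legs into the pullback
    of \<open>e\<close> are the arrows \<open>s1\<close> and \<open>s2\<close> below.\<close>
  obtain S y l where S: "is_pullback C f (e \<cdot> r1) y l" "y \<in> hom C S Y" "l \<in> hom C S K" "f \<cdot> y = (e \<cdot> r1) \<cdot> l"
    by (rule pullbackE[OF f er], rule that)
  have l: "r1 \<cdot> l \<in> hom C S A" "r2 \<cdot> l \<in> hom C S A" using comp_hom[OF S(3)] R by blast+
  have "f \<cdot> y = e \<cdot> (r1 \<cdot> l)" "f \<cdot> y = e \<cdot> (r2 \<cdot> l)"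
    using S(4) comp_assoc[OF S(3) R(2) eh] comp_assoc[OF S(3) R(3) eh] R(4) by simp_all
  then obtain s1 s2 where "s1 \<in> hom C S (Dom C e')" "e' \<cdot> s1 = y" "f' \<cdot> s1 = r1 \<cdot> l"
    and "s2 \<in> hom C S (Dom C e')" "e' \<cdot> s2 = y" "f' \<cdot> s2 = r2 \<cdot> l"
    using pullback_lift[OF P H(1,2) S(2)] l by metis
  moreover have "Dom C y = S" using hom_dom[OF S(2)] .
  ultimately have "is_coequalizer C s1 s2 e'"
    using st kernel_pair_equivalence_relation[OF k eh] c P S(1)
    unfolding stable_coequalizers_of_equivalence_relations_def by blast
  then show "is_regular_epi C e'" by (auto simp: is_regular_epi_def)
qed

section \<open>Semi-localizations of exact protomodular categories\<close>

text \<open>The reflection of a single object \<open>Q\<close>, up to isomorphism and without a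
  chosen functor. In this form units can be recognized among arbitrary arrows, for instance among
  pullbacks of units.\<close>

definition universal_arrow :: "('o, 'a) cat \<Rightarrow> 'o set \<Rightarrow> 'o \<Rightarrow> 'o \<Rightarrow> 'a \<Rightarrow> bool" where
  "universal_arrow C S Q A \<eta> \<longleftrightarrow> A \<in> S \<and> \<eta> \<in> hom C Q A \<and>
    (\<forall>B \<in> S. \<forall>f \<in> hom C Q B. \<exists>!h. h \<in> hom C A B \<and> h \<cdot>\<^bsub>C\<^esub> \<eta> = f)"

lemma (in category) jointly_strongly_epicD:
  assumes "jointly_strongly_epic C g s" "is_mono C m" "m \<in> hom C M E"
    "g' \<in> hom C D M" "m \<cdot> g' = g" "s' \<in> hom C B M" "m \<cdot> s' = s"
  shows "is_iso C m"
proof -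
  have "g \<in> hom C D E" "s \<in> hom C B E" using comp_hom assms(3-7) by blast+
  then have "Dom C g = D" "Cod C g = E" "Dom C s = B" "Dom C m = M" "Cod C m = E"
    using assms(3) by (auto simp: hom_def)
  then show ?thesis using assms unfolding jointly_strongly_epic_def by blast
qed

lemma (in category) jointly_strongly_epicI:
  assumes "g \<in> hom C D E" "s \<in> hom C B E"
    and "\<And>M m g' s'. is_mono C m \<Longrightarrow> m \<in> hom C M E \<Longrightarrow> g' \<in> hom C D M \<Longrightarrow> m \<cdot> g' = g \<Longrightarrow>
      s' \<in> hom C B M \<Longrightarrow> m \<cdot> s' = s \<Longrightarrow> is_iso C m"
  shows "jointly_strongly_epic C g s"
  unfolding jointly_strongly_epic_def
proof (intro conjI allI impI; (elim conjE bexE)?)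
  show "g \<in> Arr C" "s \<in> Arr C" "Cod C g = Cod C s" using assms(1,2) by (auto simp: hom_def)
next
  fix m g' s' assume m: "is_mono C m" "Cod C m = Cod C g"
    and g': "g' \<in> hom C (Dom C g) (Dom C m)" "m \<cdot> g' = g"
    and s': "s' \<in> hom C (Dom C s) (Dom C m)" "m \<cdot> s' = s"
  have "m \<in> hom C (Dom C m) E" using m assms(1) by (auto simp: is_mono_def hom_def)
  then show "is_iso C m"
    using assms(3)[OF m(1)] g' s' hom_dom[OF assms(1)] hom_dom[OF assms(2)] by blast
qed

text \<open>\<open>X\<close> is kept as a category with its own types next to \<open>C\<close>, so
  that the same results serve for a subcategory given only up to equivalence and for the embedding
  into the exact completion.\<close>

locale full_embedding = X: category X + C: category C
  for X :: "('o, 'a) cat" and C :: "('p, 'b) cat" (structure) +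
  fixes U :: "('o, 'a, 'p, 'b) fctr"
  assumes fully_faithful: "fully_faithful X C U"
begin

abbreviation UO where "UO \<equiv> ObjMap U"
abbreviation UA where "UA \<equiv> ArrMap U"

lemma U_obj: "A \<in> Obj X \<Longrightarrow> UO A \<in> Obj C"
  and U_hom: "f \<in> hom X A B \<Longrightarrow> UA f \<in> hom C (UO A) (UO B)"
  and U_ident: "A \<in> Obj X \<Longrightarrow> UA (Ident X A) = Ident C (UO A)"
  and U_comp: "f \<in> hom X A B \<Longrightarrow> g \<in> hom X B D \<Longrightarrow> UA (g \<cdot>\<^bsub>X\<^esub> f) = UA g \<cdot> UA f"
  using fully_faithful by (auto simp: fully_faithful_def is_functor_def)

lemma U_bij: "A \<in> Obj X \<Longrightarrow> B \<in> Obj X \<Longrightarrow> bij_betw UA (hom X A B) (hom C (UO A) (UO B))"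
  using fully_faithful by (simp add: fully_faithful_def)

lemma U_full: "A \<in> Obj X \<Longrightarrow> B \<in> Obj X \<Longrightarrow> u \<in> hom C (UO A) (UO B) \<Longrightarrow> \<exists>f \<in> hom X A B. UA f = u"
  using U_bij[of A B] unfolding bij_betw_def by (metis imageE)

lemma U_faithful: "f \<in> hom X A B \<Longrightarrow> g \<in> hom X A B \<Longrightarrow> UA f = UA g \<Longrightarrow> f = g"
  using U_bij[of A B] X.hom_objs[of f A B] unfolding bij_betw_def inj_on_def by blast

lemma U_comp_eq_iff:
  assumes "f \<in> hom X A B" "g \<in> hom X B D" "f' \<in> hom X A B'" "g' \<in> hom X B' D"
  shows "UA g \<cdot> UA f = UA g' \<cdot> UA f' \<longleftrightarrow> g \<cdot>\<^bsub>X\<^esub> f = g' \<cdot>\<^bsub>X\<^esub> f'"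
  using U_comp[OF assms(1,2)] U_comp[OF assms(3,4)] U_faithful X.comp_hom assms by metis

abbreviation universal where "universal \<equiv> universal_arrow C (UO ` Obj X)"

lemma universal_hom: "universal Q (UO A) \<eta> \<Longrightarrow> \<eta> \<in> hom C Q (UO A)"
  by (simp add: universal_arrow_def)

lemma universal_factor:
  assumes "universal Q (UO A) \<eta>" "A \<in> Obj X" "B \<in> Obj X" "f \<in> hom C Q (UO B)"
  shows "\<exists>h \<in> hom X A B. UA h \<cdot> \<eta> = f"
proof -
  obtain k where "k \<in> hom C (UO A) (UO B)" "k \<cdot> \<eta> = f"
    using assms unfolding universal_arrow_def by blast
  then show ?thesis using U_full[OF assms(2,3)] by blast
qed

lemma universal_ext:
  assumes "universal Q (UO A) \<eta>" "h \<in> hom X A B" "k \<in> hom X A B" "UA h \<cdot> \<eta> = UA k \<cdot> \<eta>"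
  shows "h = k"
proof -
  have "B \<in> Obj X" using X.hom_objs assms(2) by blast
  then have "\<exists>!x. x \<in> hom C (UO A) (UO B) \<and> x \<cdot> \<eta> = UA h \<cdot> \<eta>"
    using assms(1) C.comp_hom[OF universal_hom[OF assms(1)] U_hom[OF assms(2)]]
    unfolding universal_arrow_def by blast
  then have "UA h = UA k" using U_hom assms by metis
  then show ?thesis using U_faithful assms by blast
qed

lemma universalI:
  assumes "A \<in> Obj X" "\<eta> \<in> hom C Q (UO A)"
    and "\<And>B f. B \<in> Obj X \<Longrightarrow> f \<in> hom C Q (UO B) \<Longrightarrow> \<exists>h \<in> hom X A B. UA h \<cdot> \<eta> = f"
    and "\<And>B h k. h \<in> hom X A B \<Longrightarrow> k \<in> hom X A B \<Longrightarrow> UA h \<cdot> \<eta> = UA k \<cdot> \<eta> \<Longrightarrow> h = k"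
  shows "universal Q (UO A) \<eta>"
proof -
  have "\<exists>!h. h \<in> hom C (UO A) (UO B) \<and> h \<cdot> \<eta> = f" if B: "B \<in> Obj X" and f: "f \<in> hom C Q (UO B)" for B f
  proof -
    obtain h where h: "h \<in> hom X A B" "UA h \<cdot> \<eta> = f" using assms(3)[OF B f] by blast
    show ?thesis
    proof (rule ex1I[of _ "UA h"])
      show "UA h \<in> hom C (UO A) (UO B) \<and> UA h \<cdot> \<eta> = f" using h U_hom by blast
    next
      fix k assume k: "k \<in> hom C (UO A) (UO B) \<and> k \<cdot> \<eta> = f"
      then obtain l where "l \<in> hom X A B" "UA l = k" using U_full[OF assms(1) B] by blast
      then show "k = UA h" using assms(4)[of l B h] h k by simp
    qed
  qed
  then show ?thesis using assms(1,2) unfolding universal_arrow_def by blast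
qed

end

text \<open>Semi-left-exactness without a reflector, for arbitrary universal arrows instead of
  chosen units. \<open>semi_left_exact_iff\<close> and \<open>semi_localization_embedding\<close>
  connect it with the definition.\<close>

locale semi_left_exact_embedding = full_embedding +
  assumes reflection: "Q \<in> Obj C \<Longrightarrow> \<exists>A \<in> Obj X. \<exists>\<eta>. universal Q (UO A) \<eta>"
    and universal_stable: "A \<in> Obj X \<Longrightarrow> universal Q (UO A) \<eta> \<Longrightarrow> Y \<in> Obj X \<Longrightarrow> f \<in> hom C (UO Y) (UO A) \<Longrightarrow>
      is_pullback C f \<eta> p q \<Longrightarrow> universal (Dom C p) (UO Y) p"
begin

text \<open>The test object \<open>T\<close> lies in \<open>C\<close>, where joint monicity in
  \<open>X\<close> says nothing directly. Both arrows factor through the reflection of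
  \<open>T\<close>, and there the cancellation takes place in \<open>X\<close>.\<close>

lemma U_mono_span:
  assumes r: "is_mono_span X A B (r1, r2)"
  shows "is_mono_span C (UO A) (UO B) (UA r1, UA r2)"
proof -
  define R where "R = Dom X r1"
  have H: "r1 \<in> hom X R A" "r2 \<in> hom X R B" using X.mono_span_homs[OF r] by (auto simp: R_def)
  show ?thesis
  proof (rule C.mono_spanI[OF U_hom[OF H(1)] U_hom[OF H(2)]])
    fix T h k assume hk: "h \<in> hom C T (UO R)" "k \<in> hom C T (UO R)"
      "UA r1 \<cdot> h = UA r1 \<cdot> k" "UA r2 \<cdot> h = UA r2 \<cdot> k"
    have R: "R \<in> Obj X" using X.hom_objs[OF H(1)] by simp
    obtain T' \<eta> where T: "T' \<in> Obj X" "universal T (UO T') \<eta>" using reflection C.hom_objs hk by blast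
    note \<eta> = universal_hom[OF T(2)]
    obtain h' where h': "h' \<in> hom X T' R" "UA h' \<cdot> \<eta> = h" using universal_factor[OF T(2,1) R hk(1)] by blast
    obtain k' where k': "k' \<in> hom X T' R" "UA k' \<cdot> \<eta> = k" using universal_factor[OF T(2,1) R hk(2)] by blast
    have *: "UA (r1 \<cdot>\<^bsub>X\<^esub> x) \<cdot> \<eta> = UA r1 \<cdot> (UA x \<cdot> \<eta>)" "UA (r2 \<cdot>\<^bsub>X\<^esub> x) \<cdot> \<eta> = UA r2 \<cdot> (UA x \<cdot> \<eta>)"
      if x: "x \<in> hom X T' R" for x
      using C.comp_assoc[OF \<eta> U_hom[OF x] U_hom[OF H(1)]] C.comp_assoc[OF \<eta> U_hom[OF x] U_hom[OF H(2)]]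
        U_comp[OF x H(1)] U_comp[OF x H(2)] by simp_all
    have "r1 \<cdot>\<^bsub>X\<^esub> h' = r1 \<cdot>\<^bsub>X\<^esub> k'"
      using universal_ext[OF T(2) X.comp_hom[OF h'(1) H(1)] X.comp_hom[OF k'(1) H(1)]] * h' k' hk by simp
    moreover have "r2 \<cdot>\<^bsub>X\<^esub> h' = r2 \<cdot>\<^bsub>X\<^esub> k'"
      using universal_ext[OF T(2) X.comp_hom[OF h'(1) H(2)] X.comp_hom[OF k'(1) H(2)]] * h' k' hk by simp
    ultimately have "h' = k'" using X.mono_span_cancel[OF r, of h' T' k'] h'(1) k'(1) R_def by simp
    then show "h = k" using h' k' by simp
  qed
qed

text \<open>A right adjoint preserves limits: a cone with vertex \<open>T\<close> extends along the
  universal arrow of \<open>T\<close> to a cone in \<open>X\<close>.\<close>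

lemma U_pullback:
  assumes P: "is_pullback X f g p q"
  shows "is_pullback C (UA f) (UA g) (UA p) (UA q)"
proof -
  define A B Z where "A = Dom X f" and "B = Dom X g" and "Z = Cod X f"
  have f: "f \<in> hom X A Z" and g: "g \<in> hom X B Z"
    using P by (auto simp: is_pullback_def hom_def A_def B_def Z_def)
  define W where "W = Dom X p"
  note H = X.pullback_homs[OF P f g, folded W_def]
  have objs: "A \<in> Obj X" "B \<in> Obj X" using X.hom_objs f g by blast+
  show ?thesis
  proof (rule C.pullbackI[OF U_hom[OF f] U_hom[OF g] U_hom[OF H(1)] U_hom[OF H(2)]])
    show "UA f \<cdot> UA p = UA g \<cdot> UA q" using U_comp_eq_iff H f g by blast
  next
    fix T u v assume u: "u \<in> hom C T (UO A)" and v: "v \<in> hom C T (UO B)" and e: "UA f \<cdot> u = UA g \<cdot> v"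
    obtain T' \<eta> where T: "T' \<in> Obj X" "universal T (UO T') \<eta>" using reflection C.hom_objs u by blast
    note \<eta> = universal_hom[OF T(2)]
    obtain u' where u': "u' \<in> hom X T' A" "UA u' \<cdot> \<eta> = u" using universal_factor[OF T(2,1) objs(1) u] by blast
    obtain v' where v': "v' \<in> hom X T' B" "UA v' \<cdot> \<eta> = v" using universal_factor[OF T(2,1) objs(2) v] by blast
    have "UA (f \<cdot>\<^bsub>X\<^esub> u') \<cdot> \<eta> = UA (g \<cdot>\<^bsub>X\<^esub> v') \<cdot> \<eta>"
      using U_comp[OF u'(1) f] U_comp[OF v'(1) g] C.comp_assoc[OF \<eta> U_hom[OF u'(1)] U_hom[OF f]]
        C.comp_assoc[OF \<eta> U_hom[OF v'(1)] U_hom[OF g]] u' v' e by simp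
    then have "f \<cdot>\<^bsub>X\<^esub> u' = g \<cdot>\<^bsub>X\<^esub> v'"
      using universal_ext[OF T(2) X.comp_hom[OF u'(1) f] X.comp_hom[OF v'(1) g]] by blast
    then obtain h where h: "h \<in> hom X T' W" "p \<cdot>\<^bsub>X\<^esub> h = u'" "q \<cdot>\<^bsub>X\<^esub> h = v'"
      using X.pullback_lift[OF P H(1,2) u'(1) v'(1)] by blast
    have "UA p \<cdot> (UA h \<cdot> \<eta>) = u" "UA q \<cdot> (UA h \<cdot> \<eta>) = v"
      using C.comp_assoc[OF \<eta> U_hom[OF h(1)] U_hom[OF H(1)]] C.comp_assoc[OF \<eta> U_hom[OF h(1)] U_hom[OF H(2)]]
        U_comp[OF h(1) H(1)] U_comp[OF h(1) H(2)] h u' v' by simp_all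
    then show "\<exists>h \<in> hom C T (UO W). UA p \<cdot> h = u \<and> UA q \<cdot> h = v"
      using C.comp_hom[OF \<eta> U_hom[OF h(1)]] by blast
  next
    fix T h k assume hk: "h \<in> hom C T (UO W)" "k \<in> hom C T (UO W)"
      "UA p \<cdot> h = UA p \<cdot> k" "UA q \<cdot> h = UA q \<cdot> k"
    have "is_mono_span X A B (p, q)" using X.mono_spanI[OF H(1,2)] X.pullback_unique[OF P H(1,2)] by blast
    from C.mono_span_cancel[OF U_mono_span[OF this], of h T k] show "h = k"
      using hk C.hom_dom[OF U_hom[OF H(1)]] by simp
  qed
qed

lemma U_mono:
  assumes m: "is_mono X m"
  shows "is_mono C (UA m)"
proof -
  have mh: "m \<in> hom X (Dom X m) (Cod X m)" using m X.arr_hom by (auto simp: is_mono_def)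
  have "is_mono_span X (Cod X m) (Cod X m) (m, m)"
    using X.mono_spanI[OF mh mh] X.mono_cancel[OF m mh] by blast
  from U_mono_span[OF this] show ?thesis
    using C.monoI[OF U_hom[OF mh]] C.mono_span_cancel C.hom_dom[OF U_hom[OF mh]] by auto
qed

text \<open>Witnesses factor through the universal arrow of \<open>T\<close>, so membership at a
  stage of \<open>C\<close> is decided at its reflection in \<open>X\<close>.\<close>

lemma U_in_span:
  assumes r: "is_mono_span X A B (r1, r2)" and T: "T' \<in> Obj X" "universal T (UO T') \<eta>"
    and ab: "a \<in> hom X T' A" "b \<in> hom X T' B"
  shows "in_span C (UA r1, UA r2) T (UA a \<cdot> \<eta>) (UA b \<cdot> \<eta>) \<longleftrightarrow> in_span X (r1, r2) T' a b"
proof -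
  define R where "R = Dom X r1"
  have H: "r1 \<in> hom X R A" "r2 \<in> hom X R B" using X.mono_span_homs[OF r] by (auto simp: R_def)
  have R: "R \<in> Obj X" using X.hom_objs[OF H(1)] by simp
  note \<eta> = universal_hom[OF T(2)]
  have *: "UA (r1 \<cdot>\<^bsub>X\<^esub> x) \<cdot> \<eta> = UA r1 \<cdot> (UA x \<cdot> \<eta>)" "UA (r2 \<cdot>\<^bsub>X\<^esub> x) \<cdot> \<eta> = UA r2 \<cdot> (UA x \<cdot> \<eta>)"
    if x: "x \<in> hom X T' R" for x
    using C.comp_assoc[OF \<eta> U_hom[OF x] U_hom[OF H(1)]] C.comp_assoc[OF \<eta> U_hom[OF x] U_hom[OF H(2)]]
      U_comp[OF x H(1)] U_comp[OF x H(2)] by simp_all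
  have D: "Dom C (UA r1) = UO R" using C.hom_dom[OF U_hom[OF H(1)]] .
  show ?thesis
  proof
    assume "in_span C (UA r1, UA r2) T (UA a \<cdot> \<eta>) (UA b \<cdot> \<eta>)"
    then obtain y where y: "y \<in> hom C T (UO R)" "UA r1 \<cdot> y = UA a \<cdot> \<eta>" "UA r2 \<cdot> y = UA b \<cdot> \<eta>"
      by (auto simp: in_span_def D)
    obtain x where x: "x \<in> hom X T' R" "UA x \<cdot> \<eta> = y" using universal_factor[OF T(2,1) R y(1)] by blast
    have "r1 \<cdot>\<^bsub>X\<^esub> x = a" "r2 \<cdot>\<^bsub>X\<^esub> x = b"
      using universal_ext[OF T(2) X.comp_hom[OF x(1) H(1)] ab(1)]
        universal_ext[OF T(2) X.comp_hom[OF x(1) H(2)] ab(2)] *[OF x(1)] x y by simp_all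
    then show "in_span X (r1, r2) T' a b" using x(1) by (auto simp: in_span_def R_def)
  next
    assume "in_span X (r1, r2) T' a b"
    then obtain x where x: "x \<in> hom X T' R" "r1 \<cdot>\<^bsub>X\<^esub> x = a" "r2 \<cdot>\<^bsub>X\<^esub> x = b"
      by (auto simp: in_span_def R_def)
    then show "in_span C (UA r1, UA r2) T (UA a \<cdot> \<eta>) (UA b \<cdot> \<eta>)"
      using *[OF x(1)] C.comp_hom[OF \<eta> U_hom[OF x(1)]] by (auto simp: in_span_def D)
  qed
qed

text \<open>The elements in one instance of a law share a stage \<open>T\<close>, so they all factor
  through one reflection, and there the law holds in \<open>X\<close>.\<close>

lemma U_equivalence_relation:
  assumes r: "is_equivalence_relation X A (r1, r2)"
  shows "is_equivalence_relation C (UO A) (UA r1, UA r2)"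
proof -
  have ms: "is_mono_span X A A (r1, r2)"
    and rf: "\<And>T a. a \<in> hom X T A \<Longrightarrow> in_span X (r1, r2) T a a"
    and sy: "\<And>T a b. in_span X (r1, r2) T a b \<Longrightarrow> in_span X (r1, r2) T b a"
    and tr: "\<And>T a b c. in_span X (r1, r2) T a b \<Longrightarrow> in_span X (r1, r2) T b c \<Longrightarrow> in_span X (r1, r2) T a c"
    using r unfolding X.equivalence_relation_iff by blast+
  have A: "A \<in> Obj X" using X.mono_span_homs[OF ms] X.hom_objs by blast
  have msC: "is_mono_span C (UO A) (UO A) (UA r1, UA r2)" using U_mono_span[OF ms] .
  have rep: "\<exists>T' \<eta> a'. T' \<in> Obj X \<and> universal T (UO T') \<eta> \<and> a' \<in> hom X T' A \<and> UA a' \<cdot> \<eta> = a"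
    if "a \<in> hom C T (UO A)" for T a
    using reflection[of T] C.hom_objs[OF that] universal_factor[OF _ _ A that] by blast
  show ?thesis
    unfolding C.equivalence_relation_iff
  proof (intro conjI allI impI)
    fix T a assume "a \<in> hom C T (UO A)"
    then show "in_span C (UA r1, UA r2) T a a" using rep rf U_in_span[OF ms] by metis
  next
    fix T a b assume s: "in_span C (UA r1, UA r2) T a b"
    note h = C.in_span_homs[OF msC s]
    obtain T' \<eta> a' where T: "T' \<in> Obj X" "universal T (UO T') \<eta>" and a': "a' \<in> hom X T' A" "UA a' \<cdot> \<eta> = a"
      using rep[OF h(1)] by blast
    obtain b' where b': "b' \<in> hom X T' A" "UA b' \<cdot> \<eta> = b" using universal_factor[OF T(2,1) A h(2)] by blast
    show "in_span C (UA r1, UA r2) T b a"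
      using U_in_span[OF ms T a'(1) b'(1)] U_in_span[OF ms T b'(1) a'(1)] sy s a' b' by simp
  next
    fix T a b c assume s: "in_span C (UA r1, UA r2) T a b" "in_span C (UA r1, UA r2) T b c"
    note h = C.in_span_homs[OF msC s(1)] C.in_span_homs[OF msC s(2)]
    obtain T' \<eta> a' where T: "T' \<in> Obj X" "universal T (UO T') \<eta>" and a': "a' \<in> hom X T' A" "UA a' \<cdot> \<eta> = a"
      using rep[OF h(1)] by blast
    obtain b' where b': "b' \<in> hom X T' A" "UA b' \<cdot> \<eta> = b" using universal_factor[OF T(2,1) A h(2)] by blast
    obtain c' where c': "c' \<in> hom X T' A" "UA c' \<cdot> \<eta> = c" using universal_factor[OF T(2,1) A h(4)] by blast
    show "in_span C (UA r1, UA r2) T a c"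
      using U_in_span[OF ms T a'(1) b'(1)] U_in_span[OF ms T b'(1) c'(1)] U_in_span[OF ms T a'(1) c'(1)]
        tr s a' b' c' by metis
  qed (rule msC)
qed

text \<open>The limit \<open>L\<close> taken in \<open>C\<close> is isomorphic to its reflection
  \<open>A\<close>, since its projections factor through \<open>\<eta>\<close> and form a cone on
  \<open>A\<close>; hence \<open>A\<close> is the limit in \<open>X\<close>.\<close>

lemma X_finite_limits:
  assumes C: "has_finite_limits C"
  shows "has_finite_limits X"
  unfolding has_finite_limits_def
proof (intro allI impI, elim conjE)
  fix J :: "(nat, nat) cat" and D assume J: "finite (Obj J)" "finite (Arr J)" and D: "is_functor J X D"
  have DJ: "category J" and Dobj: "\<And>j. j \<in> Obj J \<Longrightarrow> ObjMap D j \<in> Obj X"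
    and Dhom: "\<And>i j u. u \<in> hom J i j \<Longrightarrow> ArrMap D u \<in> hom X (ObjMap D i) (ObjMap D j)"
    and Did: "\<And>j. j \<in> Obj J \<Longrightarrow> ArrMap D (Ident J j) = Ident X (ObjMap D j)"
    and Dcomp: "\<And>i j k u v. u \<in> hom J i j \<Longrightarrow> v \<in> hom J j k \<Longrightarrow> ArrMap D (v \<cdot>\<^bsub>J\<^esub> u) = ArrMap D v \<cdot>\<^bsub>X\<^esub> ArrMap D u"
    using D by (auto simp: is_functor_def)
  interpret J: category J by (rule DJ)
  let ?D = "comp_functor U D"
  have "is_functor J C ?D"
    unfolding is_functor_def comp_functor_def
    using DJ C.category_axioms Dobj U_obj Dhom U_hom Did U_ident
    by (auto simp: Dcomp U_comp[OF Dhom Dhom])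
  then obtain L \<pi> where lim: "is_limit J C ?D L \<pi>"
    using C J unfolding has_finite_limits_def by blast
  have Darr: "ArrMap D u \<in> hom X (ObjMap D (Dom J u)) (ObjMap D (Cod J u))" if "u \<in> Arr J" for u
    using Dhom J.arr_hom[OF that] .
  have L: "L \<in> Obj C" and \<pi>: "\<And>j. j \<in> Obj J \<Longrightarrow> \<pi> j \<in> hom C L (UO (ObjMap D j))"
    and \<pi>u: "\<And>u. u \<in> Arr J \<Longrightarrow> UA (ArrMap D u) \<cdot> \<pi> (Dom J u) = \<pi> (Cod J u)"
    using lim by (auto simp: is_limit_def is_cone_def comp_functor_def)
  obtain A \<eta> where A: "A \<in> Obj X" "universal L (UO A) \<eta>" using reflection[OF L] by blast
  note \<eta> = universal_hom[OF A(2)]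
  have "\<forall>j \<in> Obj J. \<exists>p. p \<in> hom X A (ObjMap D j) \<and> UA p \<cdot> \<eta> = \<pi> j"
    using universal_factor[OF A(2,1) Dobj \<pi>] by blast
  then obtain \<sigma> where \<sigma>: "\<And>j. j \<in> Obj J \<Longrightarrow> \<sigma> j \<in> hom X A (ObjMap D j)" "\<And>j. j \<in> Obj J \<Longrightarrow> UA (\<sigma> j) \<cdot> \<eta> = \<pi> j"
    by metis
  have coneX: "is_cone J X D A \<sigma>"
    unfolding is_cone_def
  proof (intro conjI ballI A(1) \<sigma>(1))
    fix u assume u: "u \<in> Arr J"
    note h = \<sigma>(1)[OF J.dom_obj[OF u]]
    have "UA (ArrMap D u \<cdot>\<^bsub>X\<^esub> \<sigma> (Dom J u)) \<cdot> \<eta> = UA (\<sigma> (Cod J u)) \<cdot> \<eta>"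
      using U_comp[OF h Darr[OF u]] C.comp_assoc[OF \<eta> U_hom[OF h] U_hom[OF Darr[OF u]]] \<pi>u[OF u]
        \<sigma>(2) J.dom_obj[OF u] J.cod_obj[OF u] by simp
    then show "ArrMap D u \<cdot>\<^bsub>X\<^esub> \<sigma> (Dom J u) = \<sigma> (Cod J u)"
      using universal_ext[OF A(2) X.comp_hom[OF h Darr[OF u]] \<sigma>(1)[OF J.cod_obj[OF u]]] by blast
  qed
  have coneC: "is_cone J C ?D (UO B) (\<lambda>j. UA (\<tau> j))" if c: "is_cone J X D B \<tau>" for B \<tau>
  proof -
    have "UA (ArrMap D u) \<cdot> UA (\<tau> (Dom J u)) = UA (\<tau> (Cod J u))" if u: "u \<in> Arr J" for u
      using U_comp[OF _ Darr[OF u], of "\<tau> (Dom J u)" B] c J.dom_obj[OF u] u by (auto simp: is_cone_def)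
    then show ?thesis using c U_obj U_hom by (auto simp: is_cone_def comp_functor_def)
  qed
  have limE: "\<exists>!h. h \<in> hom C B L \<and> (\<forall>j \<in> Obj J. \<pi> j \<cdot> h = \<tau> j)" if "is_cone J C ?D B \<tau>" for B \<tau>
    using lim that unfolding is_limit_def by blast
  have jm: "h = k" if hk: "h \<in> hom C B L" "k \<in> hom C B L" "\<forall>j \<in> Obj J. \<pi> j \<cdot> h = \<pi> j \<cdot> k" for B h k
  proof -
    have "is_cone J C ?D B (\<lambda>j. \<pi> j \<cdot> h)"
      unfolding is_cone_def
    proof (intro conjI ballI)
      show "B \<in> Obj C" using C.hom_objs[OF hk(1)] by simp
    next
      fix j assume "j \<in> Obj J" then show "\<pi> j \<cdot> h \<in> hom C B (ObjMap ?D j)"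
        using C.comp_hom[OF hk(1) \<pi>] by (simp add: comp_functor_def)
    next
      fix u assume u: "u \<in> Arr J"
      show "ArrMap ?D u \<cdot> \<pi> (Dom J u) \<cdot> h = \<pi> (Cod J u) \<cdot> h"
        using C.comp_reassoc[OF \<pi>u[OF u] hk(1) \<pi>[OF J.dom_obj[OF u]] U_hom[OF Darr[OF u]]]
        by (simp add: comp_functor_def)
    qed
    from limE[OF this] show ?thesis using hk by auto
  qed
  \<comment> \<open>The cone \<open>\<sigma>\<close> yields a candidate inverse of the universal
    arrow; one composite is settled by the limit \<open>L\<close>, the other by universality of
    \<open>\<eta>\<close>.\<close>
  obtain l where l: "l \<in> hom C (UO A) L" "\<forall>j \<in> Obj J. \<pi> j \<cdot> l = UA (\<sigma> j)"
    using limE[OF coneC[OF coneX]] by blast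
  have l\<eta>: "l \<cdot> \<eta> = Ident C L"
  proof (rule jm[OF C.comp_hom[OF \<eta> l(1)] C.ident_hom[OF L]], intro ballI)
    fix j assume j: "j \<in> Obj J"
    show "\<pi> j \<cdot> l \<cdot> \<eta> = \<pi> j \<cdot> Ident C L"
      using C.comp_reassoc[OF l(2)[rule_format, OF j] \<eta> l(1) \<pi>[OF j]] \<sigma>(2)[OF j] C.ident_right[OF \<pi>[OF j]] by simp
  qed
  obtain z where z: "z \<in> hom X A A" "UA z = \<eta> \<cdot> l"
    using U_full[OF A(1) A(1) C.comp_hom[OF l(1) \<eta>]] by blast
  have zi: "z = Ident X A"
    using universal_ext[OF A(2) z(1) X.ident_hom[OF A(1)]] z(2) C.comp_assoc[OF \<eta> l(1) \<eta>] l\<eta>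
      C.ident_right[OF \<eta>] C.ident_left[OF \<eta>] U_ident[OF A(1)] by simp
  have \<eta>l: "\<eta> \<cdot> l = Ident C (UO A)" using z zi U_ident[OF A(1)] by simp
  have "is_limit J X D A \<sigma>"
    unfolding is_limit_def
  proof (intro conjI allI impI coneX)
    fix B \<tau> assume c: "is_cone J X D B \<tau>"
    have B: "B \<in> Obj X" and \<tau>: "\<And>j. j \<in> Obj J \<Longrightarrow> \<tau> j \<in> hom X B (ObjMap D j)"
      using c by (auto simp: is_cone_def)
    obtain h where h: "h \<in> hom C (UO B) L" "\<forall>j \<in> Obj J. \<pi> j \<cdot> h = UA (\<tau> j)"
      using limE[OF coneC[OF c]] by blast
    obtain k where k: "k \<in> hom X B A" "UA k = \<eta> \<cdot> h"
      using U_full[OF B A(1) C.comp_hom[OF h(1) \<eta>]] by blast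
    show "\<exists>!h. h \<in> hom X B A \<and> (\<forall>j \<in> Obj J. \<sigma> j \<cdot>\<^bsub>X\<^esub> h = \<tau> j)"
    proof (rule ex1I[of _ k], intro conjI ballI k(1))
      fix j assume j: "j \<in> Obj J"
      have "UA (\<sigma> j \<cdot>\<^bsub>X\<^esub> k) = UA (\<tau> j)"
        using U_comp[OF k(1) \<sigma>(1)[OF j]] k(2) C.comp_assoc[OF h(1) \<eta> U_hom[OF \<sigma>(1)[OF j]]] \<sigma>(2)[OF j] h(2) j by simp
      then show "\<sigma> j \<cdot>\<^bsub>X\<^esub> k = \<tau> j" using U_faithful[OF X.comp_hom[OF k(1) \<sigma>(1)[OF j]] \<tau>[OF j]] by blast
    next
      fix x assume x: "x \<in> hom X B A \<and> (\<forall>j \<in> Obj J. \<sigma> j \<cdot>\<^bsub>X\<^esub> x = \<tau> j)"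
      have lx: "l \<cdot> UA x \<in> hom C (UO B) L" using C.comp_hom[OF U_hom l(1)] x by blast
      have "\<pi> j \<cdot> (l \<cdot> UA x) = UA (\<tau> j)" if j: "j \<in> Obj J" for j
        using C.comp_reassoc[OF l(2)[rule_format, OF j] U_hom l(1) \<pi>[OF j]] x U_comp[OF _ \<sigma>(1)[OF j]] j by metis
      then have "l \<cdot> UA x = h" using jm[OF lx h(1)] h(2) by simp
      then have "UA k = UA x"
        using k(2) C.comp_assoc[OF U_hom l(1) \<eta>, of x B] \<eta>l C.ident_left[OF U_hom, of x B A] x by simp
      then show "x = k" using U_faithful x k(1) by metis
    qed
  qed
  then show "\<exists>A \<pi>. is_limit J X D A \<pi>" by blast
qed

text \<open>All data are carried to \<open>C\<close>: the embedding preserves pullbacks and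
  monomorphisms, and being full and faithful it reflects the invertibility of
  \<open>m\<close>.\<close>

lemma X_protomodular:
  assumes "has_finite_limits X" "protomodular_category C"
  shows "protomodular_category X"
proof unfold_locales
  show "has_pullbacks X" using X.finite_limits_pullbacks assms(1) .
next
  fix p E B s f A d g assume h: "p \<in> hom X E B" "s \<in> hom X B E" "p \<cdot>\<^bsub>X\<^esub> s = Ident X B" "f \<in> hom X A B"
    and P: "is_pullback X f p d g"
  note H = X.pullback_homs[OF P h(4,1)]
  have "UA p \<cdot> UA s = Ident C (UO B)" using U_comp[OF h(2,1)] h(3) U_ident X.hom_objs[OF h(2)] by simp
  from protomodular_category.protomodular[OF assms(2) U_hom[OF h(1)] U_hom[OF h(2)] this U_hom[OF h(4)] U_pullback[OF P]]
  have j: "jointly_strongly_epic C (UA g) (UA s)" .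
  show "jointly_strongly_epic X g s"
  proof (rule X.jointly_strongly_epicI[OF H(2) h(2)])
    fix M m g' s' assume m: "is_mono X m" and mh: "m \<in> hom X M E"
      and g': "g' \<in> hom X (Dom X d) M" "m \<cdot>\<^bsub>X\<^esub> g' = g"
      and s': "s' \<in> hom X B M" "m \<cdot>\<^bsub>X\<^esub> s' = s"
    have "is_iso C (UA m)"
      using C.jointly_strongly_epicD[OF j U_mono[OF m] U_hom[OF mh] U_hom[OF g'(1)] _ U_hom[OF s'(1)]]
        U_comp[OF g'(1) mh] U_comp[OF s'(1) mh] g'(2) s'(2) by simp
    then obtain k where k: "k \<in> hom C (UO E) (UO M)" "k \<cdot> UA m = Ident C (UO M)" "UA m \<cdot> k = Ident C (UO E)"
      using C.isoE[OF _ U_hom[OF mh]] by blast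
    have EM: "E \<in> Obj X" "M \<in> Obj X" using X.hom_objs[OF mh] by auto
    obtain l where l: "l \<in> hom X E M" "UA l = k" using U_full[OF EM k(1)] by blast
    have "m \<cdot>\<^bsub>X\<^esub> l = Ident X E"
      using U_faithful[OF X.comp_hom[OF l(1) mh] X.ident_hom[OF EM(1)]] U_comp[OF l(1) mh] U_ident[OF EM(1)] l k by simp
    then show "is_iso X m" using X.mono_split_epi_iso[OF m mh l(1)] by blast
  qed
qed

text \<open>Arrows into objects of \<open>X\<close>, whether from the coequalizer \<open>Q\<close>
  in \<open>C\<close> or from the coequalizer \<open>B\<close> in \<open>X\<close>, are the arrows
  on \<open>A\<close> that identify \<open>r1\<close> with \<open>r2\<close>. So the comparison is a
  reflection of \<open>Q\<close>.\<close>

lemma X_coequalizer_universal: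
  assumes c: "is_coequalizer C (UA r1) (UA r2) c" "c \<in> hom C (UO A) Q"
    and r: "r1 \<in> hom X R A" "r2 \<in> hom X R A"
    and q: "is_coequalizer X r1 r2 q" "q \<in> hom X A B"
  obtains \<eta> where "universal Q (UO B) \<eta>" "\<eta> \<cdot> c = UA q"
proof -
  have B: "A \<in> Obj X" "B \<in> Obj X" using X.hom_objs[OF q(2)] by auto
  have "UA q \<cdot> UA r1 = UA q \<cdot> UA r2"
    using U_comp_eq_iff[OF r(1) q(2) r(2) q(2)] X.coequalizer_homs[OF q] by blast
  then obtain \<eta> where \<eta>: "\<eta> \<in> hom C Q (UO B)" "\<eta> \<cdot> c = UA q"
    using C.coequalizer_factor[OF c U_hom[OF q(2)]] by blast
  have "universal Q (UO B) \<eta>"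
  proof (rule universalI[OF B(2) \<eta>(1)])
    fix D f assume D: "D \<in> Obj X" and f: "f \<in> hom C Q (UO D)"
    obtain g where g: "g \<in> hom X A D" "UA g = f \<cdot> c" using U_full[OF B(1) D C.comp_hom[OF c(2) f]] by blast
    have "UA g \<cdot> UA r1 = UA g \<cdot> UA r2"
      using g(2) C.comp_assoc[OF U_hom[OF r(1)] c(2) f] C.comp_assoc[OF U_hom[OF r(2)] c(2) f]
        C.coequalizer_homs[OF c] by simp
    then have "g \<cdot>\<^bsub>X\<^esub> r1 = g \<cdot>\<^bsub>X\<^esub> r2" using U_comp_eq_iff[OF r(1) g(1) r(2) g(1)] by blast
    then obtain h where h: "h \<in> hom X B D" "h \<cdot>\<^bsub>X\<^esub> q = g" using X.coequalizer_factor[OF q g(1)] by blast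
    have "(UA h \<cdot> \<eta>) \<cdot> c = f \<cdot> c"
      using C.comp_assoc[OF c(2) \<eta>(1) U_hom[OF h(1)]] \<eta>(2) U_comp[OF q(2) h(1)] h(2) g(2) by simp
    then have "UA h \<cdot> \<eta> = f" using C.coequalizer_epi[OF c C.comp_hom[OF \<eta>(1) U_hom[OF h(1)]] f] by blast
    then show "\<exists>h \<in> hom X B D. UA h \<cdot> \<eta> = f" using h(1) by blast
  next
    fix D h k assume hk: "h \<in> hom X B D" "k \<in> hom X B D" "UA h \<cdot> \<eta> = UA k \<cdot> \<eta>"
    then have "UA h \<cdot> UA q = UA k \<cdot> UA q"
      using C.comp_assoc[OF c(2) \<eta>(1) U_hom[OF hk(1)]] C.comp_assoc[OF c(2) \<eta>(1) U_hom[OF hk(2)]] \<eta>(2) by simp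
    then have "h \<cdot>\<^bsub>X\<^esub> q = k \<cdot>\<^bsub>X\<^esub> q" using U_comp_eq_iff[OF q(2) hk(1) q(2) hk(2)] by blast
    then show "h = k" by (rule X.coequalizer_epi[OF q hk(1,2)])
  qed
  then show thesis using that \<eta>(2) by blast
qed

text \<open>The coequalizer formed in \<open>C\<close>, followed by its universal arrow, has the
  required property for targets in \<open>X\<close>.\<close>

lemma X_coequalizer_exists:
  assumes c: "is_coequalizer C (UA r1) (UA r2) c" "c \<in> hom C (UO A) Q"
    and r: "r1 \<in> hom X R A" "r2 \<in> hom X R A"
  shows "\<exists>q. is_coequalizer X r1 r2 q"
proof -
  have A: "A \<in> Obj X" "Q \<in> Obj C" using X.hom_objs[OF r(1)] C.hom_objs[OF c(2)] by auto
  obtain B \<eta> where B: "B \<in> Obj X" "universal Q (UO B) \<eta>" using reflection[OF A(2)] by blast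
  note \<eta> = universal_hom[OF B(2)]
  obtain q where q: "q \<in> hom X A B" "UA q = \<eta> \<cdot> c" using U_full[OF A(1) B(1) C.comp_hom[OF c(2) \<eta>]] by blast
  have "is_coequalizer X r1 r2 q"
  proof (rule X.coequalizerI[OF r q(1)])
    have "UA q \<cdot> UA r1 = UA q \<cdot> UA r2"
      using q(2) C.comp_assoc[OF U_hom[OF r(1)] c(2) \<eta>] C.comp_assoc[OF U_hom[OF r(2)] c(2) \<eta>]
        C.coequalizer_homs[OF c] by simp
    then show "q \<cdot>\<^bsub>X\<^esub> r1 = q \<cdot>\<^bsub>X\<^esub> r2" using U_comp_eq_iff[OF r(1) q(1) r(2) q(1)] by blast
  next
    fix T u assume u: "u \<in> hom X A T" "u \<cdot>\<^bsub>X\<^esub> r1 = u \<cdot>\<^bsub>X\<^esub> r2"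
    have T: "T \<in> Obj X" using X.hom_objs[OF u(1)] by simp
    have "UA u \<cdot> UA r1 = UA u \<cdot> UA r2" using U_comp_eq_iff[OF r(1) u(1) r(2) u(1)] u(2) by blast
    then obtain v where v: "v \<in> hom C Q (UO T)" "v \<cdot> c = UA u"
      using C.coequalizer_factor[OF c U_hom[OF u(1)]] by blast
    obtain h where h: "h \<in> hom X B T" "UA h \<cdot> \<eta> = v" using universal_factor[OF B(2,1) T v(1)] by blast
    have "UA (h \<cdot>\<^bsub>X\<^esub> q) = UA u"
      using U_comp[OF q(1) h(1)] q(2) C.comp_assoc[OF c(2) \<eta> U_hom[OF h(1)]] h(2) v(2) by simp
    then have "h \<cdot>\<^bsub>X\<^esub> q = u" using U_faithful[OF X.comp_hom[OF q(1) h(1)] u(1)] by blast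
    then show "\<exists>h \<in> hom X B T. h \<cdot>\<^bsub>X\<^esub> q = u" using h(1) by blast
  next
    fix T h k assume hk: "h \<in> hom X B T" "k \<in> hom X B T" "h \<cdot>\<^bsub>X\<^esub> q = k \<cdot>\<^bsub>X\<^esub> q"
    then have "(UA h \<cdot> \<eta>) \<cdot> c = (UA k \<cdot> \<eta>) \<cdot> c"
      using C.comp_assoc[OF c(2) \<eta> U_hom[OF hk(1)]] C.comp_assoc[OF c(2) \<eta> U_hom[OF hk(2)]] q(2)
        U_comp[OF q(1) hk(1)] U_comp[OF q(1) hk(2)] by simp
    then have "UA h \<cdot> \<eta> = UA k \<cdot> \<eta>"
      using C.coequalizer_epi[OF c C.comp_hom[OF \<eta> U_hom[OF hk(1)]] C.comp_hom[OF \<eta> U_hom[OF hk(2)]]] by blast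
    then show "h = k" by (rule universal_ext[OF B(2) hk(1,2)])
  qed
  then show ?thesis by blast
qed

end

text \<open>Over the universal arrow \<open>\<eta>: Q \<rightarrow> LQ\<close>, the coequalizer in \<open>X\<close> of an equivalence relation is
  \<open>\<eta>\<close> after the coequalizer in \<open>C\<close>; both factors are stable, the first by semi-left-exactness.\<close>

lemma (in semi_left_exact_embedding) X_stable_coequalizers:
  assumes ex: "exact_category C"
  shows "stable_coequalizers_of_equivalence_relations X"
proof -
  interpret C: exact_category C by (rule ex)
  \<comment> \<open>Exactness of \<open>C\<close>: the relation becomes effective there and is then
    the kernel pair of its own coequalizer.\<close>
  have quot: "\<exists>c. is_coequalizer C (UA r1) (UA r2) c \<and> is_kernel_pair C c (UA r1) (UA r2)"
    if r: "is_equivalence_relation X A (r1, r2)" for A r1 r2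
  proof -
    obtain f where f: "is_kernel_pair C f (UA r1) (UA r2)"
      using C.equivalence_relation_effective[OF U_equivalence_relation[OF r]] by blast
    then obtain c where "is_coequalizer C (UA r1) (UA r2) c" using C.kernel_pair_coequalizer by blast
    then show ?thesis using C.kernel_pair_of_coequalizer[OF f] by blast
  qed
  show ?thesis
    unfolding stable_coequalizers_of_equivalence_relations_def
  proof (intro allI impI conjI; (elim conjE)?)
    fix A r1 r2 assume r: "is_equivalence_relation X A (r1, r2)"
    then have ms: "is_mono_span X A A (r1, r2)" by (simp add: is_equivalence_relation_def)
    define R where "R = Dom X r1"
    have R: "r1 \<in> hom X R A" "r2 \<in> hom X R A" using X.mono_span_homs[OF ms] by (auto simp: R_def)
    obtain c where c: "is_coequalizer C (UA r1) (UA r2) c" "is_kernel_pair C c (UA r1) (UA r2)"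
      using quot[OF r] by blast
    define Q where "Q = Cod C c"
    have cQ: "c \<in> hom C (UO A) Q" unfolding Q_def by (rule C.coequalizer_hom[OF c(1) U_hom[OF R(1)]])
    show "\<exists>q. is_coequalizer X r1 r2 q" by (rule X_coequalizer_exists[OF c(1) cQ R])
  next
    fix A r1 r2 q f q' f' y k s1 s2
    assume r: "is_equivalence_relation X A (r1, r2)" and q: "is_coequalizer X r1 r2 q"
      and P: "is_pullback X f q q' f'" and S: "is_pullback X f (q \<cdot>\<^bsub>X\<^esub> r1) y k"
      and s1: "s1 \<in> hom X (Dom X y) (Dom X q')" "q' \<cdot>\<^bsub>X\<^esub> s1 = y" "f' \<cdot>\<^bsub>X\<^esub> s1 = r1 \<cdot>\<^bsub>X\<^esub> k"
      and s2: "s2 \<in> hom X (Dom X y) (Dom X q')" "q' \<cdot>\<^bsub>X\<^esub> s2 = y" "f' \<cdot>\<^bsub>X\<^esub> s2 = r2 \<cdot>\<^bsub>X\<^esub> k"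
    have ms: "is_mono_span X A A (r1, r2)" using r by (simp add: is_equivalence_relation_def)
    define R where "R = Dom X r1"
    have R: "r1 \<in> hom X R A" "r2 \<in> hom X R A" using X.mono_span_homs[OF ms] by (auto simp: R_def)
    define B where "B = Cod X q"
    have qh: "q \<in> hom X A B" unfolding B_def by (rule X.coequalizer_hom[OF q R(1)])
    define Y where "Y = Dom X f"
    have f: "f \<in> hom X Y B" using P by (auto simp: is_pullback_def hom_def Y_def B_def)
    define X' where "X' = Dom X q'"
    define N where "N = Dom X y"
    note H = X.pullback_homs[OF P f qh, folded X'_def]
    note K = X.pullback_homs[OF S f X.comp_hom[OF R(1) qh], folded N_def]
    have s1h: "s1 \<in> hom X N X'" and s2h: "s2 \<in> hom X N X'" using s1 s2 by (simp_all add: X'_def N_def)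
    have objs: "Y \<in> Obj X" "B \<in> Obj X" using X.hom_objs[OF f] by auto
    obtain c where c: "is_coequalizer C (UA r1) (UA r2) c" "is_kernel_pair C c (UA r1) (UA r2)"
      using quot[OF r] by blast
    define Q where "Q = Cod C c"
    have cQ: "c \<in> hom C (UO A) Q" unfolding Q_def by (rule C.coequalizer_hom[OF c(1) U_hom[OF R(1)]])
    obtain \<eta> where \<eta>: "universal Q (UO B) \<eta>" "\<eta> \<cdot> c = UA q"
      by (rule X_coequalizer_universal[OF c(1) cQ R q qh], rule that)
    note \<eta>h = universal_hom[OF \<eta>(1)]
    \<comment> \<open>The pullback of \<open>q\<close>, which is \<open>\<eta>\<close> after
      \<open>c\<close>, along \<open>f\<close> is taken in two stages: \<open>p\<close> is the
      pullback of \<open>\<eta>\<close>, and the remaining arrow \<open>c'\<close> will be the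
      pullback of \<open>c\<close>.\<close>
    obtain P0 p d where P0: "is_pullback C (UA f) \<eta> p d" "p \<in> hom C P0 (UO Y)" "d \<in> hom C P0 Q"
      "UA f \<cdot> p = \<eta> \<cdot> d"
      by (rule C.pullbackE[OF U_hom[OF f] \<eta>h], rule that)
    have p: "universal P0 (UO Y) p"
      using universal_stable[OF objs(2) \<eta>(1) objs(1) U_hom[OF f] P0(1)] C.hom_dom[OF P0(2)] by simp
    have cf': "c \<cdot> UA f' \<in> hom C (UO X') Q" using C.comp_hom[OF U_hom[OF H(2)] cQ] .
    have e1: "UA f \<cdot> UA q' = UA q \<cdot> UA f'" using U_comp_eq_iff[OF H(1) f H(2) qh] H(4) by blast
    then have "UA f \<cdot> UA q' = \<eta> \<cdot> (c \<cdot> UA f')"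
      using C.comp_assoc[OF U_hom[OF H(2)] cQ \<eta>h] \<eta>(2) by simp
    then obtain c' where c': "c' \<in> hom C (UO X') P0" "p \<cdot> c' = UA q'" "d \<cdot> c' = c \<cdot> UA f'"
      using C.pullback_lift[OF P0(1-3) U_hom[OF H(1)] cf'] by blast
    note UP = U_pullback[OF P] and US = U_pullback[OF S]
    \<comment> \<open>Cancellation for pasted pullbacks: the outer rectangle is the preserved
      pullback of \<open>q\<close> along \<open>f\<close>, and the square over \<open>\<eta>\<close>
      is a pullback.\<close>
    have "is_pullback C d c c' (UA f')"
    proof (rule C.pullbackI[OF P0(3) cQ c'(1) U_hom[OF H(2)] c'(3)])
      fix T u v assume u: "u \<in> hom C T P0" and v: "v \<in> hom C T (UO A)" and uv: "d \<cdot> u = c \<cdot> v"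
      have pu: "p \<cdot> u \<in> hom C T (UO Y)" using C.comp_hom[OF u P0(2)] .
      have "UA f \<cdot> (p \<cdot> u) = \<eta> \<cdot> (d \<cdot> u)"
        using C.comp_square[OF P0(4) u P0(2) U_hom[OF f] P0(3) \<eta>h] .
      also have "\<dots> = UA q \<cdot> v" using uv C.comp_reassoc[OF \<eta>(2) v cQ \<eta>h] by simp
      finally obtain h where h: "h \<in> hom C T (UO X')" "UA q' \<cdot> h = p \<cdot> u" "UA f' \<cdot> h = v"
        using C.pullback_lift[OF UP U_hom[OF H(1)] U_hom[OF H(2)] pu v] by blast
      have c'h: "c' \<cdot> h \<in> hom C T P0" using C.comp_hom[OF h(1) c'(1)] .
      have "p \<cdot> (c' \<cdot> h) = p \<cdot> u"
        using C.comp_reassoc[OF c'(2) h(1) c'(1) P0(2)] h(2) by simp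
      moreover have "d \<cdot> (c' \<cdot> h) = d \<cdot> u"
        using C.comp_square[OF c'(3) h(1) c'(1) P0(3) U_hom[OF H(2)] cQ] h(3) uv by simp
      ultimately have "c' \<cdot> h = u" using C.pullback_unique[OF P0(1-3) c'h u] by blast
      then show "\<exists>h \<in> hom C T (UO X'). c' \<cdot> h = u \<and> UA f' \<cdot> h = v" using h by blast
    next
      fix T h l assume hl: "h \<in> hom C T (UO X')" "l \<in> hom C T (UO X')"
        "c' \<cdot> h = c' \<cdot> l" "UA f' \<cdot> h = UA f' \<cdot> l"
      then have "UA q' \<cdot> h = UA q' \<cdot> l"
        using C.comp_reassoc[OF c'(2) hl(1) c'(1) P0(2)] C.comp_reassoc[OF c'(2) hl(2) c'(1) P0(2)] by simp
      then show "h = l" using C.pullback_unique[OF UP U_hom[OF H(1)] U_hom[OF H(2)] hl(1,2)] hl(4) by blast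
    qed
    moreover have "is_regular_epi C c" using c(1) by (auto simp: is_regular_epi_def)
    ultimately have re: "is_regular_epi C c'" using C.regular_epi_stable by blast
    obtain L a b where L: "is_pullback C c' c' a b" "a \<in> hom C L (UO X')" "b \<in> hom C L (UO X')" "c' \<cdot> a = c' \<cdot> b"
      by (rule C.pullbackE[OF c'(1) c'(1)], rule that)
    have co: "is_coequalizer C a b c'"
      using C.coequalizer_of_kernel_pair[of _ _ c' a b] re L(1)
      by (auto simp: is_kernel_pair_def is_regular_epi_def)
    \<comment> \<open>The kernel pair \<open>a\<close>, \<open>b\<close> of \<open>c'\<close>
      factors through \<open>s1\<close> and \<open>s2\<close>, so an arrow that identifies these two
      also identifies \<open>a\<close> and \<open>b\<close> and descends along
      \<open>c'\<close>.\<close>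
    have "\<exists>\<sigma> \<in> hom C L (UO N). UA s1 \<cdot> \<sigma> = a \<and> UA s2 \<cdot> \<sigma> = b"
    proof -
      have fa: "UA f' \<cdot> a \<in> hom C L (UO A)" "UA f' \<cdot> b \<in> hom C L (UO A)"
        using C.comp_hom[OF _ U_hom[OF H(2)]] L by blast+
      have "c \<cdot> (UA f' \<cdot> a) = c \<cdot> (UA f' \<cdot> b)"
        using C.comp_square[OF c'(3) L(2) c'(1) P0(3) U_hom[OF H(2)] cQ]
          C.comp_square[OF c'(3) L(3) c'(1) P0(3) U_hom[OF H(2)] cQ] L(4) by simp
      \<comment> \<open>Here effectivity enters: a pair identified by \<open>c\<close> is an element
        of the relation itself.\<close>
      then obtain z where z: "z \<in> hom C L (UO R)" "UA r1 \<cdot> z = UA f' \<cdot> a" "UA r2 \<cdot> z = UA f' \<cdot> b"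
        using C.pullback_lift[OF c(2)[unfolded is_kernel_pair_def] U_hom[OF R(1)] U_hom[OF R(2)] fa] by blast
      have qab: "UA q' \<cdot> a = UA q' \<cdot> b"
        using C.comp_reassoc[OF c'(2) L(2) c'(1) P0(2)] C.comp_reassoc[OF c'(2) L(3) c'(1) P0(2)] L(4) by simp
      have qa: "UA q' \<cdot> a \<in> hom C L (UO Y)" using C.comp_hom[OF L(2) U_hom[OF H(1)]] .
      have "UA f \<cdot> (UA q' \<cdot> a) = UA (q \<cdot>\<^bsub>X\<^esub> r1) \<cdot> z"
        using C.comp_square[OF e1 L(2) U_hom[OF H(1)] U_hom[OF f] U_hom[OF H(2)] U_hom[OF qh]] z(2)
          U_comp[OF R(1) qh] C.comp_assoc[OF z(1) U_hom[OF R(1)] U_hom[OF qh]] by simp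
      then obtain \<sigma> where \<sigma>: "\<sigma> \<in> hom C L (UO N)" "UA y \<cdot> \<sigma> = UA q' \<cdot> a" "UA k \<cdot> \<sigma> = z"
        using C.pullback_lift[OF US U_hom[OF K(1)] U_hom[OF K(2)] qa z(1)] by blast
      have "UA s1 \<cdot> \<sigma> = a"
      proof (rule C.pullback_unique[OF UP U_hom[OF H(1)] U_hom[OF H(2)] C.comp_hom[OF \<sigma>(1) U_hom[OF s1h]] L(2)])
        show "UA q' \<cdot> (UA s1 \<cdot> \<sigma>) = UA q' \<cdot> a"
          using C.comp_assoc[OF \<sigma>(1) U_hom[OF s1h] U_hom[OF H(1)]] U_comp[OF s1h H(1)] s1 \<sigma> by simp
        show "UA f' \<cdot> (UA s1 \<cdot> \<sigma>) = UA f' \<cdot> a"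
          using C.comp_assoc[OF \<sigma>(1) U_hom[OF s1h] U_hom[OF H(2)]] U_comp[OF s1h H(2)] s1 \<sigma> z
            U_comp[OF K(2) R(1)] C.comp_assoc[OF \<sigma>(1) U_hom[OF K(2)] U_hom[OF R(1)]] by simp
      qed
      moreover have "UA s2 \<cdot> \<sigma> = b"
      proof (rule C.pullback_unique[OF UP U_hom[OF H(1)] U_hom[OF H(2)] C.comp_hom[OF \<sigma>(1) U_hom[OF s2h]] L(3)])
        show "UA q' \<cdot> (UA s2 \<cdot> \<sigma>) = UA q' \<cdot> b"
          using C.comp_assoc[OF \<sigma>(1) U_hom[OF s2h] U_hom[OF H(1)]] U_comp[OF s2h H(1)] s2 \<sigma> qab by simp
        show "UA f' \<cdot> (UA s2 \<cdot> \<sigma>) = UA f' \<cdot> b"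
          using C.comp_assoc[OF \<sigma>(1) U_hom[OF s2h] U_hom[OF H(2)]] U_comp[OF s2h H(2)] s2 \<sigma> z
            U_comp[OF K(2) R(2)] C.comp_assoc[OF \<sigma>(1) U_hom[OF K(2)] U_hom[OF R(2)]] by simp
      qed
      ultimately show ?thesis using \<sigma>(1) by blast
    qed
    then obtain \<sigma> where \<sigma>: "\<sigma> \<in> hom C L (UO N)" "UA s1 \<cdot> \<sigma> = a" "UA s2 \<cdot> \<sigma> = b" by blast
    show "is_coequalizer X s1 s2 q'"
    proof (rule X.coequalizerI[OF s1h s2h H(1)])
      show "q' \<cdot>\<^bsub>X\<^esub> s1 = q' \<cdot>\<^bsub>X\<^esub> s2" using s1 s2 by simp
    next
      fix T u assume u: "u \<in> hom X X' T" "u \<cdot>\<^bsub>X\<^esub> s1 = u \<cdot>\<^bsub>X\<^esub> s2"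
      have T: "T \<in> Obj X" using X.hom_objs[OF u(1)] by simp
      have "UA u \<cdot> UA s1 = UA u \<cdot> UA s2" using U_comp_eq_iff[OF s1h u(1) s2h u(1)] u(2) by blast
      then have "UA u \<cdot> a = UA u \<cdot> b"
        using C.comp_assoc[OF \<sigma>(1) U_hom[OF s1h] U_hom[OF u(1)]] C.comp_assoc[OF \<sigma>(1) U_hom[OF s2h] U_hom[OF u(1)]]
          \<sigma>(2,3) by simp
      \<comment> \<open>Descent along the regular epimorphism \<open>c'\<close>, to be followed by
        extension along the universal arrow \<open>p\<close>, for which the target must lie in
        \<open>X\<close>.\<close>
      then obtain v where v: "v \<in> hom C P0 (UO T)" "v \<cdot> c' = UA u"
        using C.coequalizer_factor[OF co c'(1) U_hom[OF u(1)]] by blast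
      obtain h where h: "h \<in> hom X Y T" "UA h \<cdot> p = v" using universal_factor[OF p objs(1) T v(1)] by blast
      have "UA (h \<cdot>\<^bsub>X\<^esub> q') = UA u"
        using U_comp[OF H(1) h(1)] c'(2) C.comp_assoc[OF c'(1) P0(2) U_hom[OF h(1)]] h(2) v(2) by simp
      then have "h \<cdot>\<^bsub>X\<^esub> q' = u" using U_faithful[OF X.comp_hom[OF H(1) h(1)] u(1)] by blast
      then show "\<exists>h \<in> hom X Y T. h \<cdot>\<^bsub>X\<^esub> q' = u" using h(1) by blast
    next
      fix T h l assume hl: "h \<in> hom X Y T" "l \<in> hom X Y T" "h \<cdot>\<^bsub>X\<^esub> q' = l \<cdot>\<^bsub>X\<^esub> q'"
      then have "(UA h \<cdot> p) \<cdot> c' = (UA l \<cdot> p) \<cdot> c'"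
        using C.comp_assoc[OF c'(1) P0(2) U_hom[OF hl(1)]] C.comp_assoc[OF c'(1) P0(2) U_hom[OF hl(2)]] c'(2)
          U_comp[OF H(1) hl(1)] U_comp[OF H(1) hl(2)] by simp
      then have "UA h \<cdot> p = UA l \<cdot> p"
        using C.coequalizer_epi[OF co c'(1) C.comp_hom[OF P0(2) U_hom[OF hl(1)]] C.comp_hom[OF P0(2) U_hom[OF hl(2)]]]
        by blast
      then show "h = l" by (rule universal_ext[OF p hl(1,2)])
    qed
  qed
qed

lemma (in semi_left_exact_embedding) X_condition_a:
  assumes "exact_category C" "protomodular_category C"
  shows "condition_a X"
proof -
  interpret C: exact_category C by (rule assms(1))
  have lim: "has_finite_limits X" using X_finite_limits C.finite_limits .
  interpret X: finitely_complete X
    using lim X.finite_limits_pullbacks X.finite_limits_terminal by unfold_locales blast+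
  show ?thesis
    unfolding condition_a_def
    using X.stable_coequalizers_regular X_stable_coequalizers[OF assms(1)] X_protomodular[OF lim assms(2)] by blast
qed

section \<open>Exact completions, axiomatically\<close>

locale regular_embedding = full_embedding + X: regular_category X
begin

text \<open>\<open>\<rho>\<close> exhibits \<open>P\<close> as a quotient of an object of
  \<open>X\<close>, as in a cover of a sheaf by a representable one. Compatibility is tested only on
  pairs of arrows of \<open>X\<close>, so that no kernel pair in \<open>C\<close>, where limits are
  still to be constructed, is needed.\<close>

definition presentation :: "'a \<Rightarrow> 'c \<Rightarrow> 'd \<Rightarrow> bool" where
  "presentation A P \<rho> \<longleftrightarrow> A \<in> Obj X \<and> \<rho> \<in> hom C (UO A) P \<and>
    (\<forall>T. \<forall>x \<in> hom C (UO T) P. T \<in> Obj X \<longrightarrow>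
      (\<exists>T' e a. e \<in> covers X T' T \<and> a \<in> hom X T' A \<and> x \<cdot> UA e = \<rho> \<cdot> UA a)) \<and>
    (\<forall>Q. \<forall>f \<in> hom C (UO A) Q.
      (\<forall>T. \<forall>a \<in> hom X T A. \<forall>b \<in> hom X T A. \<rho> \<cdot> UA a = \<rho> \<cdot> UA b \<longrightarrow> f \<cdot> UA a = f \<cdot> UA b) \<longrightarrow>
      (\<exists>!g. g \<in> hom C P Q \<and> g \<cdot> \<rho> = f))"

end

text \<open>Up to equivalence these axioms characterize the embedding of a regular category into its
  exact completion. They allow to argue with points \<open>x: U T \<rightarrow> P\<close>, where \<open>T\<close> may be replaced by
  any cover.\<close>

locale exact_completion = regular_embedding +
  assumes presentation_exists: "P \<in> Obj C \<Longrightarrow> \<exists>A \<rho>. presentation A P \<rho>"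
    and quotient: "is_equivalence_relation X A k \<Longrightarrow> \<exists>P \<rho>. presentation A P \<rho> \<and>
      (\<forall>T. \<forall>a \<in> hom X T A. \<forall>b \<in> hom X T A. \<rho> \<cdot> UA a = \<rho> \<cdot> UA b \<longleftrightarrow> in_span X k T a b)"
    and descent: "e \<in> covers X A B \<Longrightarrow> presentation A (UO B) (UA e)"
    and comma: "A \<in> Obj X \<Longrightarrow> B \<in> Obj X \<Longrightarrow> x \<in> hom C (UO A) P \<Longrightarrow> y \<in> hom C (UO B) P \<Longrightarrow>
      \<exists>w. is_mono_span X A B w \<and>
        (\<forall>T. \<forall>a \<in> hom X T A. \<forall>b \<in> hom X T B. in_span X w T a b \<longleftrightarrow> x \<cdot> UA a = y \<cdot> UA b)"
begin

section \<open>Points, gluing and local surjectivity\<close>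

lemma point_comp: "x \<in> hom C (UO T) P \<Longrightarrow> t \<in> hom X T' T \<Longrightarrow> x \<cdot> UA t \<in> hom C (UO T') P"
  using C.comp_hom U_hom by blast

lemma point_assoc:
  "x \<in> hom C (UO T) P \<Longrightarrow> t \<in> hom X T' T \<Longrightarrow> s \<in> hom X T'' T' \<Longrightarrow> (x \<cdot> UA t) \<cdot> UA s = x \<cdot> UA (t \<cdot>\<^bsub>X\<^esub> s)"
  using C.comp_assoc[OF U_hom U_hom] U_comp by metis

lemma point_map:
  "x \<in> hom C (UO T) P \<Longrightarrow> t \<in> hom X T' T \<Longrightarrow> f \<in> hom C P Q \<Longrightarrow> f \<cdot> (x \<cdot> UA t) = (f \<cdot> x) \<cdot> UA t"
  using C.comp_assoc[OF U_hom] by blast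

lemma cover_objs: "e \<in> covers X T' T \<Longrightarrow> T \<in> Obj X \<and> T' \<in> Obj X"
  using X.hom_objs cover_hom by metis

lemma presentation_hom: "presentation A P \<rho> \<Longrightarrow> \<rho> \<in> hom C (UO A) P"
  and presentation_obj: "presentation A P \<rho> \<Longrightarrow> A \<in> Obj X"
  by (simp_all add: presentation_def)

lemma presentation_lift:
  assumes "presentation A P \<rho>" "T \<in> Obj X" "x \<in> hom C (UO T) P"
  obtains T' e a where "e \<in> covers X T' T" "a \<in> hom X T' A" "x \<cdot> UA e = \<rho> \<cdot> UA a"
  using assms unfolding presentation_def by blast

lemma presentation_ex1:
  assumes "presentation A P \<rho>" "f \<in> hom C (UO A) Q"
    and "\<And>T a b. a \<in> hom X T A \<Longrightarrow> b \<in> hom X T A \<Longrightarrow> \<rho> \<cdot> UA a = \<rho> \<cdot> UA b \<Longrightarrow> f \<cdot> UA a = f \<cdot> UA b"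
  shows "\<exists>!g. g \<in> hom C P Q \<and> g \<cdot> \<rho> = f"
  by (rule assms(1)[unfolded presentation_def, THEN conjunct2, THEN conjunct2, THEN conjunct2, rule_format,
      OF assms(2)]) (rule assms(3))

lemma presentation_factor:
  assumes "presentation A P \<rho>" "f \<in> hom C (UO A) Q"
    and "\<And>T a b. a \<in> hom X T A \<Longrightarrow> b \<in> hom X T A \<Longrightarrow> \<rho> \<cdot> UA a = \<rho> \<cdot> UA b \<Longrightarrow> f \<cdot> UA a = f \<cdot> UA b"
  shows "\<exists>g \<in> hom C P Q. g \<cdot> \<rho> = f"
proof -
  have "\<exists>!g. g \<in> hom C P Q \<and> g \<cdot> \<rho> = f" by (rule presentation_ex1[OF assms(1,2)]) (rule assms(3))
  then show ?thesis by blast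
qed

lemma presentation_epi:
  assumes "presentation A P \<rho>" "g \<in> hom C P Q" "h \<in> hom C P Q" "g \<cdot> \<rho> = h \<cdot> \<rho>"
  shows "g = h"
proof -
  note \<rho> = presentation_hom[OF assms(1)]
  have "\<exists>!x. x \<in> hom C P Q \<and> x \<cdot> \<rho> = g \<cdot> \<rho>"
    by (rule presentation_ex1[OF assms(1) C.comp_hom[OF \<rho> assms(2)]])
      (metis point_map[OF \<rho> _ assms(2)])
  then show ?thesis using assms(2-4) by auto
qed

text \<open>By the \<open>descent\<close> axiom the image of a cover of \<open>X\<close> is a
  presentation of its target, and presentations are epic.\<close>

lemma cover_cancel:
  assumes "e \<in> covers X T' T" "x \<in> hom C (UO T) P" "y \<in> hom C (UO T) P" "x \<cdot> UA e = y \<cdot> UA e"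
  shows "x = y"
  using presentation_epi[OF descent[OF assms(1)] assms(2-4)] .

text \<open>A presentation of \<open>P\<close> is itself a point, and it is epic; so it alone
  decides equality.\<close>

lemma points_ext:
  assumes f: "f \<in> hom C P Q" "g \<in> hom C P Q"
    and "\<And>T x. T \<in> Obj X \<Longrightarrow> x \<in> hom C (UO T) P \<Longrightarrow> f \<cdot> x = g \<cdot> x"
  shows "f = g"
proof -
  obtain A \<rho> where "presentation A P \<rho>" using presentation_exists C.hom_objs[OF f(1)] by blast
  then show ?thesis using presentation_epi f assms(3) presentation_hom presentation_obj by blast
qed

text \<open>An arrow is defined by a functional relation between points that is natural and local,
  as for sheaves. The value at the generic point \<open>\<rho>\<close> exists over a cover of
  \<open>A\<close>; functionality lets it descend to \<open>A\<close> and then to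
  \<open>P\<close>.\<close>

lemma glue:
  assumes PQ: "P \<in> Obj C" "Q \<in> Obj C"
    and stable: "\<And>T T' t x y. t \<in> hom X T' T \<Longrightarrow> x \<in> hom C (UO T) P \<Longrightarrow> y \<in> hom C (UO T) Q \<Longrightarrow>
      \<Phi> T x y \<Longrightarrow> \<Phi> T' (x \<cdot> UA t) (y \<cdot> UA t)"
    and local: "\<And>T T' e x y. e \<in> covers X T' T \<Longrightarrow> x \<in> hom C (UO T) P \<Longrightarrow> y \<in> hom C (UO T) Q \<Longrightarrow>
      \<Phi> T' (x \<cdot> UA e) (y \<cdot> UA e) \<Longrightarrow> \<Phi> T x y"
    and total: "\<And>T x. T \<in> Obj X \<Longrightarrow> x \<in> hom C (UO T) P \<Longrightarrow>
      \<exists>T' e y. e \<in> covers X T' T \<and> y \<in> hom C (UO T') Q \<and> \<Phi> T' (x \<cdot> UA e) y"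
    and functional: "\<And>T x y z. T \<in> Obj X \<Longrightarrow> x \<in> hom C (UO T) P \<Longrightarrow> y \<in> hom C (UO T) Q \<Longrightarrow> z \<in> hom C (UO T) Q \<Longrightarrow>
      \<Phi> T x y \<Longrightarrow> \<Phi> T x z \<Longrightarrow> y = z"
  obtains f where "f \<in> hom C P Q" "\<forall>T \<in> Obj X. \<forall>x \<in> hom C (UO T) P. \<Phi> T x (f \<cdot> x)"
proof -
  obtain A \<rho> where \<rho>: "presentation A P \<rho>" using presentation_exists PQ by blast
  note \<rho>h = presentation_hom[OF \<rho>]
  obtain A' e y where e: "e \<in> covers X A' A" and y: "y \<in> hom C (UO A') Q" and \<Phi>y: "\<Phi> A' (\<rho> \<cdot> UA e) y"
    using total[OF presentation_obj[OF \<rho>] \<rho>h] by blast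
  note eh = cover_hom[OF e] and \<rho>e = point_comp[OF \<rho>h cover_hom[OF e]]
  \<comment> \<open>The two restrictions of \<open>y\<close> are values at the same point, hence
    equal, so \<open>y\<close> descends to \<open>A\<close>; the same argument then takes
    \<open>z\<close> down to \<open>P\<close>.\<close>
  have "y \<cdot> UA a = y \<cdot> UA b"
    if ab: "a \<in> hom X T A'" "b \<in> hom X T A'" "UA e \<cdot> UA a = UA e \<cdot> UA b" for T a b
  proof -
    have "\<Phi> T ((\<rho> \<cdot> UA e) \<cdot> UA a) (y \<cdot> UA a)" "\<Phi> T ((\<rho> \<cdot> UA e) \<cdot> UA b) (y \<cdot> UA b)"
      using stable[OF _ \<rho>e y \<Phi>y] ab by blast+
    moreover have "(\<rho> \<cdot> UA e) \<cdot> UA a = (\<rho> \<cdot> UA e) \<cdot> UA b"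
      using C.comp_assoc[OF U_hom[OF ab(1)] U_hom[OF eh] \<rho>h] C.comp_assoc[OF U_hom[OF ab(2)] U_hom[OF eh] \<rho>h]
        ab(3) by simp
    ultimately show ?thesis
      using functional[OF _ point_comp[OF \<rho>e ab(1)] point_comp[OF y ab(1)] point_comp[OF y ab(2)]]
        X.hom_objs[OF ab(1)] by simp
  qed
  then obtain z where z: "z \<in> hom C (UO A) Q" "z \<cdot> UA e = y"
    using presentation_factor[OF descent[OF e] y] by blast
  have \<Phi>z: "\<Phi> A \<rho> z" using local[OF e \<rho>h z(1)] \<Phi>y z(2) by simp
  have "z \<cdot> UA a = z \<cdot> UA b"
    if ab: "a \<in> hom X T A" "b \<in> hom X T A" "\<rho> \<cdot> UA a = \<rho> \<cdot> UA b" for T a b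
    using functional[OF _ point_comp[OF \<rho>h ab(1)] point_comp[OF z(1) ab(1)] point_comp[OF z(1) ab(2)]]
      stable[OF ab(1) \<rho>h z(1) \<Phi>z] stable[OF ab(2) \<rho>h z(1) \<Phi>z] ab(3) X.hom_objs[OF ab(1)] by simp
  then obtain f where f: "f \<in> hom C P Q" "f \<cdot> \<rho> = z"
    using presentation_factor[OF \<rho> z(1)] by blast
  \<comment> \<open>Every point is locally of the form \<open>\<rho> \<cdot> UA a\<close>, where the
    value is known by stability; locality brings it back to \<open>T\<close>.\<close>
  have "\<Phi> T x (f \<cdot> x)" if T: "T \<in> Obj X" and x: "x \<in> hom C (UO T) P" for T x
  proof -
    obtain T' d a where d: "d \<in> covers X T' T" "a \<in> hom X T' A" "x \<cdot> UA d = \<rho> \<cdot> UA a"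
      by (rule presentation_lift[OF \<rho> T x], rule that)
    have "z \<cdot> UA a = (f \<cdot> x) \<cdot> UA d"
      using point_map[OF x cover_hom[OF d(1)] f(1)] point_map[OF \<rho>h d(2) f(1)] f(2) d(3) by simp
    then show ?thesis
      using local[OF d(1) x C.comp_hom[OF x f(1)]] stable[OF d(2) \<rho>h z(1) \<Phi>z] d(3) by simp
  qed
  then show thesis using that f(1) by blast
qed

text \<open>These are the regular epimorphisms of \<open>C\<close>, as is shown further below. The
  description by points is available before limits in \<open>C\<close> are, and it is visibly stable
  under pullback.\<close>

definition locally_surjective :: "'c \<Rightarrow> 'c \<Rightarrow> 'd \<Rightarrow> bool" where
  "locally_surjective P Q f \<longleftrightarrow> f \<in> hom C P Q \<and> (\<forall>T \<in> Obj X. \<forall>x \<in> hom C (UO T) Q.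
    \<exists>T' e y. e \<in> covers X T' T \<and> y \<in> hom C (UO T') P \<and> f \<cdot> y = x \<cdot> UA e)"

lemma locally_surjective_hom: "locally_surjective P Q f \<Longrightarrow> f \<in> hom C P Q"
  by (simp add: locally_surjective_def)

lemma locally_surjective_lift:
  assumes "locally_surjective P Q f" "T \<in> Obj X" "x \<in> hom C (UO T) Q"
  obtains T' e y where "e \<in> covers X T' T" "y \<in> hom C (UO T') P" "f \<cdot> y = x \<cdot> UA e"
  using assms unfolding locally_surjective_def by blast

lemma locally_surjective_epi:
  assumes f: "locally_surjective P Q f" and gh: "g \<in> hom C Q R" "h \<in> hom C Q R" "g \<cdot> f = h \<cdot> f"
  shows "g = h"
proof (rule points_ext[OF gh(1,2)])
  fix T x assume T: "T \<in> Obj X" and x: "x \<in> hom C (UO T) Q"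
  obtain T' e y where e: "e \<in> covers X T' T" "y \<in> hom C (UO T') P" "f \<cdot> y = x \<cdot> UA e"
    by (rule locally_surjective_lift[OF f T x], rule that)
  note fh = locally_surjective_hom[OF f]
  have "g \<cdot> (f \<cdot> y) = h \<cdot> (f \<cdot> y)" using C.comp_square[OF gh(3) e(2) fh gh(1) fh gh(2)] .
  then have "(g \<cdot> x) \<cdot> UA e = (h \<cdot> x) \<cdot> UA e"
    using point_map[OF x cover_hom[OF e(1)]] gh(1,2) e(3) by metis
  then show "g \<cdot> x = h \<cdot> x" using cover_cancel[OF e(1)] C.comp_hom[OF x] gh by blast
qed

text \<open>The value at a point \<open>z\<close> is the common value of \<open>h\<close> at the
  local preimages of \<open>z\<close> under \<open>f\<close>; compatibility makes it independent of
  the preimage, so that it can be glued.\<close>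

lemma locally_surjective_factor:
  assumes f: "locally_surjective P Q f" and h: "h \<in> hom C P R"
    and compat: "\<And>T x y. T \<in> Obj X \<Longrightarrow> x \<in> hom C (UO T) P \<Longrightarrow> y \<in> hom C (UO T) P \<Longrightarrow>
      f \<cdot> x = f \<cdot> y \<Longrightarrow> h \<cdot> x = h \<cdot> y"
  shows "\<exists>g \<in> hom C Q R. g \<cdot> f = h"
proof -
  note fh = locally_surjective_hom[OF f]
  have objs: "Q \<in> Obj C" "R \<in> Obj C" using C.hom_objs fh h by blast+
  \<comment> \<open>Quantification over all restrictions \<open>t\<close> and all preimages there
    makes naturality immediate and leaves locality to be checked over a pulled-back cover.\<close>
  let ?\<Phi> = "\<lambda>T z w. \<forall>T' t x. t \<in> hom X T' T \<longrightarrow> x \<in> hom C (UO T') P \<longrightarrow>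
    f \<cdot> x = z \<cdot> UA t \<longrightarrow> h \<cdot> x = w \<cdot> UA t"
  obtain g where g: "g \<in> hom C Q R" "\<forall>T \<in> Obj X. \<forall>z \<in> hom C (UO T) Q. ?\<Phi> T z (g \<cdot> z)"
  proof (rule glue[OF objs, of ?\<Phi>])
    fix T T0 t z w assume t: "t \<in> hom X T0 T" and z: "z \<in> hom C (UO T) Q" and w: "w \<in> hom C (UO T) R"
      and \<Phi>: "?\<Phi> T z w"
    show "?\<Phi> T0 (z \<cdot> UA t) (w \<cdot> UA t)"
    proof (intro allI impI)
      fix T' s x assume s: "s \<in> hom X T' T0" and x: "x \<in> hom C (UO T') P"
        and fx: "f \<cdot> x = (z \<cdot> UA t) \<cdot> UA s"
      then show "h \<cdot> x = (w \<cdot> UA t) \<cdot> UA s"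
        using \<Phi> X.comp_hom[OF s t] point_assoc[OF z t s] point_assoc[OF w t s] by simp
    qed
  next
    fix T T0 e z w assume e: "e \<in> covers X T0 T" and z: "z \<in> hom C (UO T) Q" and w: "w \<in> hom C (UO T) R"
      and \<Phi>: "?\<Phi> T0 (z \<cdot> UA e) (w \<cdot> UA e)"
    show "?\<Phi> T z w"
    proof (intro allI impI)
      fix T' t x assume t: "t \<in> hom X T' T" and x: "x \<in> hom C (UO T') P" and fx: "f \<cdot> x = z \<cdot> UA t"
      obtain S d s where d: "d \<in> covers X S T'" "s \<in> hom X S T0" "e \<cdot>\<^bsub>X\<^esub> s = t \<cdot>\<^bsub>X\<^esub> d"
        by (rule X.cover_pullback[OF e t], rule that)
      note eh = cover_hom[OF e] and dh = cover_hom[OF d(1)]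
      have "f \<cdot> (x \<cdot> UA d) = (z \<cdot> UA e) \<cdot> UA s"
        using point_map[OF x dh fh] fx point_assoc[OF z t dh] point_assoc[OF z eh d(2)] d(3) by simp
      then have "h \<cdot> (x \<cdot> UA d) = (w \<cdot> UA e) \<cdot> UA s"
        using \<Phi> d(2) point_comp[OF x dh] by blast
      then have "(h \<cdot> x) \<cdot> UA d = (w \<cdot> UA t) \<cdot> UA d"
        using point_map[OF x dh h] point_assoc[OF w t dh] point_assoc[OF w eh d(2)] d(3) by simp
      then show "h \<cdot> x = w \<cdot> UA t"
        using cover_cancel[OF d(1) C.comp_hom[OF x h] point_comp[OF w t]] by blast
    qed
  next
    fix T z assume T: "T \<in> Obj X" and z: "z \<in> hom C (UO T) Q"
    obtain T0 e y where e: "e \<in> covers X T0 T" "y \<in> hom C (UO T0) P" "f \<cdot> y = z \<cdot> UA e"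
      by (rule locally_surjective_lift[OF f T z], rule that)
    \<comment> \<open>Compatibility turns the value at the one preimage \<open>y\<close> into the
      value at every preimage of a restriction.\<close>
    have "?\<Phi> T0 (z \<cdot> UA e) (h \<cdot> y)"
    proof (intro allI impI)
      fix T' t x assume t: "t \<in> hom X T' T0" and x: "x \<in> hom C (UO T') P"
        and fx: "f \<cdot> x = (z \<cdot> UA e) \<cdot> UA t"
      have "f \<cdot> x = f \<cdot> (y \<cdot> UA t)" using fx e(3) point_map[OF e(2) t fh] by simp
      then show "h \<cdot> x = (h \<cdot> y) \<cdot> UA t"
        using compat[OF _ x point_comp[OF e(2) t]] X.hom_objs[OF t] point_map[OF e(2) t h] by simp
    qed
    then show "\<exists>T' e y. e \<in> covers X T' T \<and> y \<in> hom C (UO T') R \<and> ?\<Phi> T' (z \<cdot> UA e) y"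
      using e(1) C.comp_hom[OF e(2) h] by blast
  next
    fix T z w w' assume T: "T \<in> Obj X" and z: "z \<in> hom C (UO T) Q"
      and w: "w \<in> hom C (UO T) R" "w' \<in> hom C (UO T) R" and \<Phi>: "?\<Phi> T z w" "?\<Phi> T z w'"
    obtain T0 e y where e: "e \<in> covers X T0 T" "y \<in> hom C (UO T0) P" "f \<cdot> y = z \<cdot> UA e"
      by (rule locally_surjective_lift[OF f T z], rule that)
    have "h \<cdot> y = w \<cdot> UA e" "h \<cdot> y = w' \<cdot> UA e"
      using \<Phi> cover_hom[OF e(1)] e(2,3) by blast+
    then show "w = w'" using cover_cancel[OF e(1) w] by simp
  qed (rule that)
  have "g \<cdot> f = h"
  proof (rule points_ext[OF C.comp_hom[OF fh g(1)] h])
    fix T x assume T: "T \<in> Obj X" and x: "x \<in> hom C (UO T) P"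
    note i = X.ident_hom[OF T]
    have U1: "y \<cdot> UA (Ident X T) = y" if "y \<in> hom C (UO T) S" for y S
      using U_ident[OF T] C.ident_right[OF that] by simp
    have fx: "f \<cdot> x \<in> hom C (UO T) Q" and gfx: "g \<cdot> (f \<cdot> x) \<in> hom C (UO T) R"
      using C.comp_hom x fh g(1) by blast+
    have "h \<cdot> x = g \<cdot> (f \<cdot> x)"
      using g(2)[rule_format, OF T fx i x] U1[OF fx] U1[OF gfx] by simp
    then show "(g \<cdot> f) \<cdot> x = h \<cdot> x" using C.comp_assoc[OF x fh g(1)] by simp
  qed
  then show ?thesis using g(1) by blast
qed

text \<open>The identity of \<open>P\<close> factors through \<open>f\<close>, because points with
  the same image are equal for monic \<open>f\<close>. This retraction is a two-sided inverse, since
  \<open>f\<close> is epic.\<close>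

lemma locally_surjective_mono_iso:
  assumes f: "locally_surjective P Q f" and m: "is_mono C f"
  shows "is_iso C f"
proof -
  note fh = locally_surjective_hom[OF f]
  have objs: "P \<in> Obj C" "Q \<in> Obj C" using C.hom_objs[OF fh] by auto
  obtain g where g: "g \<in> hom C Q P" "g \<cdot> f = Ident C P"
    using locally_surjective_factor[OF f C.ident_hom[OF objs(1)]] C.mono_cancel[OF m fh] by metis
  have "(f \<cdot> g) \<cdot> f = Ident C Q \<cdot> f"
    using C.comp_assoc[OF fh g(1) fh] g(2) C.ident_left[OF fh] C.ident_right[OF fh] by simp
  then have "f \<cdot> g = Ident C Q"
    using locally_surjective_epi[OF f C.comp_hom[OF g(1) fh] C.ident_hom[OF objs(2)]] by blast
  then show ?thesis using C.isoI[OF fh g] by blast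
qed

text \<open>Lifts are demanded only for points and only over a cover. Joint monicity on points makes
  the local lifts unique, hence they glue to an arrow from an arbitrary vertex
  \<open>S\<close>.\<close>

lemma pullbackI_points:
  assumes h: "f \<in> hom C P R" "g \<in> hom C Q R" "p \<in> hom C V P" "q \<in> hom C V Q" "f \<cdot> p = g \<cdot> q"
    and lift: "\<And>T u v. T \<in> Obj X \<Longrightarrow> u \<in> hom C (UO T) P \<Longrightarrow> v \<in> hom C (UO T) Q \<Longrightarrow> f \<cdot> u = g \<cdot> v \<Longrightarrow>
      \<exists>T' e w. e \<in> covers X T' T \<and> w \<in> hom C (UO T') V \<and> p \<cdot> w = u \<cdot> UA e \<and> q \<cdot> w = v \<cdot> UA e"
    and uniq: "\<And>T x y. T \<in> Obj X \<Longrightarrow> x \<in> hom C (UO T) V \<Longrightarrow> y \<in> hom C (UO T) V \<Longrightarrow>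
      p \<cdot> x = p \<cdot> y \<Longrightarrow> q \<cdot> x = q \<cdot> y \<Longrightarrow> x = y"
  shows "is_pullback C f g p q"
proof (rule C.pullbackI[OF h])
  fix S u v assume u: "u \<in> hom C S P" and v: "v \<in> hom C S Q" and e: "f \<cdot> u = g \<cdot> v"
  have objs: "S \<in> Obj C" "V \<in> Obj C" using C.hom_objs u h(3) by blast+
  let ?\<Phi> = "\<lambda>T x w. p \<cdot> w = u \<cdot> x \<and> q \<cdot> w = v \<cdot> x"
  obtain k where k: "k \<in> hom C S V" "\<forall>T \<in> Obj X. \<forall>x \<in> hom C (UO T) S. ?\<Phi> T x (k \<cdot> x)"
  proof (rule glue[OF objs, of ?\<Phi>])
    fix T T' t x w assume t: "t \<in> hom X T' T" and x: "x \<in> hom C (UO T) S" and w: "w \<in> hom C (UO T) V"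
      and "?\<Phi> T x w"
    then show "?\<Phi> T' (x \<cdot> UA t) (w \<cdot> UA t)"
      using point_map[OF w t h(3)] point_map[OF w t h(4)] point_map[OF x t u] point_map[OF x t v] by simp
  next
    fix T T' t x w assume t: "t \<in> covers X T' T" and x: "x \<in> hom C (UO T) S" and w: "w \<in> hom C (UO T) V"
      and "?\<Phi> T' (x \<cdot> UA t) (w \<cdot> UA t)"
    then have "(p \<cdot> w) \<cdot> UA t = (u \<cdot> x) \<cdot> UA t" "(q \<cdot> w) \<cdot> UA t = (v \<cdot> x) \<cdot> UA t"
      using point_map[OF w cover_hom[OF t] h(3)] point_map[OF w cover_hom[OF t] h(4)]
        point_map[OF x cover_hom[OF t] u] point_map[OF x cover_hom[OF t] v] by simp_all
    then show "?\<Phi> T x w"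
      using cover_cancel[OF t C.comp_hom[OF w h(3)] C.comp_hom[OF x u]]
        cover_cancel[OF t C.comp_hom[OF w h(4)] C.comp_hom[OF x v]] by blast
  next
    fix T x assume T: "T \<in> Obj X" and x: "x \<in> hom C (UO T) S"
    obtain T' d w where d: "d \<in> covers X T' T" "w \<in> hom C (UO T') V" "p \<cdot> w = (u \<cdot> x) \<cdot> UA d"
      "q \<cdot> w = (v \<cdot> x) \<cdot> UA d"
      using lift[OF T C.comp_hom[OF x u] C.comp_hom[OF x v] C.comp_square[OF e x u h(1) v h(2)]] by blast
    then show "\<exists>T' e y. e \<in> covers X T' T \<and> y \<in> hom C (UO T') V \<and> ?\<Phi> T' (x \<cdot> UA e) y"
      using point_map[OF x cover_hom[OF d(1)] u] point_map[OF x cover_hom[OF d(1)] v] by metis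
  next
    fix T x y z assume "T \<in> Obj X" "y \<in> hom C (UO T) V" "z \<in> hom C (UO T) V" "?\<Phi> T x y" "?\<Phi> T x z"
    then show "y = z" using uniq by simp
  qed (rule that)
  have "p \<cdot> k = u"
    by (rule points_ext[OF C.comp_hom[OF k(1) h(3)] u]) (use k C.comp_assoc[OF _ k(1) h(3)] in simp)
  moreover have "q \<cdot> k = v"
    by (rule points_ext[OF C.comp_hom[OF k(1) h(4)] v]) (use k C.comp_assoc[OF _ k(1) h(4)] in simp)
  ultimately show "\<exists>k \<in> hom C S V. p \<cdot> k = u \<and> q \<cdot> k = v" using k(1) by blast
next
  fix S a b assume ab: "a \<in> hom C S V" "b \<in> hom C S V" "p \<cdot> a = p \<cdot> b" "q \<cdot> a = q \<cdot> b"
  show "a = b"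
  proof (rule points_ext[OF ab(1,2)])
    fix T x assume T: "T \<in> Obj X" and x: "x \<in> hom C (UO T) S"
    show "a \<cdot> x = b \<cdot> x"
      using uniq[OF T C.comp_hom[OF x ab(1)] C.comp_hom[OF x ab(2)]]
        C.comp_square[OF ab(3) x ab(1) h(3) ab(2) h(3)] C.comp_square[OF ab(4) x ab(1) h(4) ab(2) h(4)] by blast
  qed
qed

section \<open>Finite limits and effective equivalence relations in \<open>C\<close>\<close>

lemma presentation_lift2:
  assumes \<rho>: "presentation A P \<rho>" and \<sigma>: "presentation B Q \<sigma>"
    and T: "T \<in> Obj X" and x: "x \<in> hom C (UO T) P" and y: "y \<in> hom C (UO T) Q"
  obtains T' e a b where "e \<in> covers X T' T" "a \<in> hom X T' A" "b \<in> hom X T' B"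
    "x \<cdot> UA e = \<rho> \<cdot> UA a" "y \<cdot> UA e = \<sigma> \<cdot> UA b"
proof -
  obtain T1 d a where d: "d \<in> covers X T1 T" "a \<in> hom X T1 A" "x \<cdot> UA d = \<rho> \<cdot> UA a"
    by (rule presentation_lift[OF \<rho> T x], rule that)
  note dh = cover_hom[OF d(1)]
  have T1: "T1 \<in> Obj X" using cover_objs[OF d(1)] by simp
  obtain T2 e b where e: "e \<in> covers X T2 T1" "b \<in> hom X T2 B" "(y \<cdot> UA d) \<cdot> UA e = \<sigma> \<cdot> UA b"
    by (rule presentation_lift[OF \<sigma> T1 point_comp[OF y dh]], rule that)
  note eh = cover_hom[OF e(1)]
  have "x \<cdot> UA (d \<cdot>\<^bsub>X\<^esub> e) = \<rho> \<cdot> UA (a \<cdot>\<^bsub>X\<^esub> e)" "y \<cdot> UA (d \<cdot>\<^bsub>X\<^esub> e) = \<sigma> \<cdot> UA b"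
    using point_assoc[OF x dh eh] point_assoc[OF y dh eh] point_assoc[OF presentation_hom[OF \<rho>] d(2) eh] d(3) e(3)
    by simp_all
  then show thesis using that[OF X.cover_comp[OF e(1) d(1)] X.comp_hom[OF eh d(2)] e(2)] by blast
qed

text \<open>The terminal object of \<open>X\<close> stays terminal: every point has exactly one
  value there, so the trivial relation can be glued.\<close>

lemma C_terminal: "\<exists>t \<in> Obj C. \<forall>S \<in> Obj C. \<exists>!h. h \<in> hom C S t"
proof -
  obtain t where t: "t \<in> Obj X" "\<And>T. T \<in> Obj X \<Longrightarrow> \<exists>!h. h \<in> hom X T t" using X.terminal by blast
  have pt: "\<exists>!x. x \<in> hom C (UO T) (UO t)" if T: "T \<in> Obj X" for T
    using t(2)[OF T] U_hom U_full[OF T t(1)] by metis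
  have "\<exists>!h. h \<in> hom C S (UO t)" if S: "S \<in> Obj C" for S
  proof -
    obtain f where f: "f \<in> hom C S (UO t)"
    proof (rule glue[OF S U_obj[OF t(1)], of "\<lambda>_ _ _. True"])
      fix T x assume T: "T \<in> Obj X" "x \<in> hom C (UO T) S"
      then show "\<exists>T' e y. e \<in> covers X T' T \<and> y \<in> hom C (UO T') (UO t) \<and> True"
        using pt X.cover_ident by blast
    qed (use pt in blast)+
    moreover have "g = f" if g: "g \<in> hom C S (UO t)" for g
      by (rule points_ext[OF g f]) (use pt C.comp_hom[OF _ f] C.comp_hom[OF _ g] in blast)
    ultimately show ?thesis by blast
  qed
  then show ?thesis using U_obj[OF t(1)] by blast
qed

text \<open>Cover \<open>P\<close> by \<open>A\<close> and \<open>Q\<close> by \<open>B\<close>. The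
  object \<open>W\<close> of pairs that agree in \<open>R\<close> exists in \<open>X\<close>, and
  the pullback is its quotient by the pairs of elements with the same image in \<open>P\<close> and
  in \<open>Q\<close>.\<close>

lemma C_pullbacks: "has_pullbacks C"
  unfolding has_pullbacks_def
proof (intro ballI impI)
  fix f g assume fg: "f \<in> Arr C" "g \<in> Arr C" "Cod C f = Cod C g"
  define P Q R where "P = Dom C f" and "Q = Dom C g" and "R = Cod C f"
  have f: "f \<in> hom C P R" and g: "g \<in> hom C Q R" using fg by (auto simp: hom_def P_def Q_def R_def)
  have "P \<in> Obj C" "Q \<in> Obj C" using C.hom_objs f g by blast+
  then obtain A \<rho> B \<sigma> where \<rho>: "presentation A P \<rho>" and \<sigma>: "presentation B Q \<sigma>"
    using presentation_exists by blast
  note \<rho>h = presentation_hom[OF \<rho>] and \<sigma>h = presentation_hom[OF \<sigma>]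
  have AB: "A \<in> Obj X" "B \<in> Obj X" using presentation_obj \<rho> \<sigma> by blast+
  have f\<rho>: "f \<cdot> \<rho> \<in> hom C (UO A) R" and g\<sigma>: "g \<cdot> \<sigma> \<in> hom C (UO B) R"
    using C.comp_hom \<rho>h \<sigma>h f g by blast+
  obtain w where w: "is_mono_span X A B w"
    and wi: "\<And>T a b. a \<in> hom X T A \<Longrightarrow> b \<in> hom X T B \<Longrightarrow>
      in_span X w T a b \<longleftrightarrow> (f \<cdot> \<rho>) \<cdot> UA a = (g \<cdot> \<sigma>) \<cdot> UA b"
    using comma[OF AB f\<rho> g\<sigma>] by blast
  define W w1 w2 where "W = Dom X (fst w)" and "w1 = fst w" and "w2 = snd w"
  have w1: "w1 \<in> hom X W A" and w2: "w2 \<in> hom X W B"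
    using X.mono_span_homs[OF w] by (auto simp: W_def w1_def w2_def)
  have W: "W \<in> Obj X" using X.hom_objs[OF w1] by simp
  define x1 x2 where "x1 = \<rho> \<cdot> UA w1" and "x2 = \<sigma> \<cdot> UA w2"
  have x1: "x1 \<in> hom C (UO W) P" and x2: "x2 \<in> hom C (UO W) Q"
    unfolding x1_def x2_def using point_comp \<rho>h \<sigma>h w1 w2 by blast+
  obtain k where k: "is_mono_span X W W k"
    "\<And>T a b. a \<in> hom X T W \<Longrightarrow> b \<in> hom X T W \<Longrightarrow> in_span X k T a b \<longleftrightarrow> x1 \<cdot> UA a = x1 \<cdot> UA b"
    using comma[OF W W x1 x1] by blast
  obtain l where l: "is_mono_span X W W l"
    "\<And>T a b. a \<in> hom X T W \<Longrightarrow> b \<in> hom X T W \<Longrightarrow> in_span X l T a b \<longleftrightarrow> x2 \<cdot> UA a = x2 \<cdot> UA b"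
    using comma[OF W W x2 x2] by blast
  \<comment> \<open>Equality of both projections, as a relation of \<open>X\<close> on
    \<open>W\<close>; its quotient \<open>V\<close> is the pullback.\<close>
  obtain m where m: "is_mono_span X W W m" "\<And>T a b. in_span X m T a b \<longleftrightarrow> in_span X k T a b \<and> in_span X l T a b"
    by (rule X.mono_span_intersection[OF k(1) l(1)], rule that)
  have "is_equivalence_relation X W m"
    by (rule X.equivalence_relation_eqI[OF m(1), of "\<lambda>T a. (x1 \<cdot> UA a, x2 \<cdot> UA a)"])
      (use m(2) k(2) l(2) in simp)
  then obtain V \<tau> where \<tau>: "presentation W V \<tau>" and \<tau>i: "\<And>T a b. a \<in> hom X T W \<Longrightarrow> b \<in> hom X T W \<Longrightarrow>
      \<tau> \<cdot> UA a = \<tau> \<cdot> UA b \<longleftrightarrow> x1 \<cdot> UA a = x1 \<cdot> UA b \<and> x2 \<cdot> UA a = x2 \<cdot> UA b"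
    using quotient[of W m] by (simp add: m(2) k(2) l(2)) blast
  note \<tau>h = presentation_hom[OF \<tau>]
  obtain p where p: "p \<in> hom C V P" "p \<cdot> \<tau> = x1" using presentation_factor[OF \<tau> x1] \<tau>i by blast
  obtain q where q: "q \<in> hom C V Q" "q \<cdot> \<tau> = x2" using presentation_factor[OF \<tau> x2] \<tau>i by blast
  have p\<tau>: "p \<cdot> (\<tau> \<cdot> UA a) = x1 \<cdot> UA a" "q \<cdot> (\<tau> \<cdot> UA a) = x2 \<cdot> UA a"
    if "a \<in> hom X T W" for T a
    using point_map[OF \<tau>h that p(1)] point_map[OF \<tau>h that q(1)] p(2) q(2) by simp_all
  have x1a: "x1 \<cdot> UA a = \<rho> \<cdot> UA (w1 \<cdot>\<^bsub>X\<^esub> a)" "x2 \<cdot> UA a = \<sigma> \<cdot> UA (w2 \<cdot>\<^bsub>X\<^esub> a)"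
    if "a \<in> hom X T W" for T a
    using point_assoc[OF \<rho>h w1 that] point_assoc[OF \<sigma>h w2 that] by (simp_all add: x1_def x2_def)
  have "is_pullback C f g p q"
  proof (rule pullbackI_points[OF f g p(1) q(1)])
    have "(f \<cdot> \<rho>) \<cdot> UA w1 = (g \<cdot> \<sigma>) \<cdot> UA w2"
      using X.in_span_legs[OF w] wi[OF w1 w2] by (simp add: W_def w1_def w2_def)
    then have "f \<cdot> x1 = g \<cdot> x2"
      unfolding x1_def x2_def using point_map[OF \<rho>h w1 f] point_map[OF \<sigma>h w2 g] by simp
    then have "(f \<cdot> p) \<cdot> \<tau> = (g \<cdot> q) \<cdot> \<tau>"
      using C.comp_assoc[OF \<tau>h p(1) f] C.comp_assoc[OF \<tau>h q(1) g] p(2) q(2) by simp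
    then show "f \<cdot> p = g \<cdot> q"
      using presentation_epi[OF \<tau> C.comp_hom[OF p(1) f] C.comp_hom[OF q(1) g]] by blast
  next
    fix T u v assume T: "T \<in> Obj X" and u: "u \<in> hom C (UO T) P" and v: "v \<in> hom C (UO T) Q"
      and uv: "f \<cdot> u = g \<cdot> v"
    obtain T2 d a b where d: "d \<in> covers X T2 T" "a \<in> hom X T2 A" "b \<in> hom X T2 B"
      "u \<cdot> UA d = \<rho> \<cdot> UA a" "v \<cdot> UA d = \<sigma> \<cdot> UA b"
      by (rule presentation_lift2[OF \<rho> \<sigma> T u v], rule that)
    note dh = cover_hom[OF d(1)]
    have "(f \<cdot> \<rho>) \<cdot> UA a = (g \<cdot> \<sigma>) \<cdot> UA b"
      using point_map[OF \<rho>h d(2) f] point_map[OF \<sigma>h d(3) g] d(4,5) uv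
        point_map[OF u dh f] point_map[OF v dh g] by simp
    then obtain c where c: "c \<in> hom X T2 W" "w1 \<cdot>\<^bsub>X\<^esub> c = a" "w2 \<cdot>\<^bsub>X\<^esub> c = b"
      using wi[OF d(2,3)] by (auto simp: in_span_def W_def w1_def w2_def)
    have "p \<cdot> (\<tau> \<cdot> UA c) = u \<cdot> UA d" "q \<cdot> (\<tau> \<cdot> UA c) = v \<cdot> UA d"
      using p\<tau>[OF c(1)] x1a[OF c(1)] c(2,3) d(4,5) by simp_all
    then show "\<exists>T' e w. e \<in> covers X T' T \<and> w \<in> hom C (UO T') V \<and> p \<cdot> w = u \<cdot> UA e \<and> q \<cdot> w = v \<cdot> UA e"
      using d(1) point_comp[OF \<tau>h c(1)] by blast
  next
    fix T x y assume T: "T \<in> Obj X" and x: "x \<in> hom C (UO T) V" and y: "y \<in> hom C (UO T) V"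
      and e: "p \<cdot> x = p \<cdot> y" "q \<cdot> x = q \<cdot> y"
    obtain T2 d a b where d: "d \<in> covers X T2 T" "a \<in> hom X T2 W" "b \<in> hom X T2 W"
      "x \<cdot> UA d = \<tau> \<cdot> UA a" "y \<cdot> UA d = \<tau> \<cdot> UA b"
      by (rule presentation_lift2[OF \<tau> \<tau> T x y], rule that)
    note dh = cover_hom[OF d(1)]
    have "x1 \<cdot> UA a = x1 \<cdot> UA b" "x2 \<cdot> UA a = x2 \<cdot> UA b"
      using p\<tau>[OF d(2)] p\<tau>[OF d(3)] d(4,5) e point_map[OF x dh p(1)] point_map[OF y dh p(1)]
        point_map[OF x dh q(1)] point_map[OF y dh q(1)] by simp_all
    then have "x \<cdot> UA d = y \<cdot> UA d" using \<tau>i[OF d(2,3)] d(4,5) by simp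
    then show "x = y" by (rule cover_cancel[OF d(1) x y])
  qed
  then show "\<exists>p q. is_pullback C f g p q" by blast
qed

sublocale C: finitely_complete C
  using C_pullbacks C_terminal by unfold_locales

text \<open>The counterpart of \<open>mono_span_local\<close> for a cover that comes from
  \<open>X\<close>. Its image in \<open>C\<close> is not yet known to be a regular epimorphism, so
  the witness descends by the \<open>descent\<close> axiom instead.\<close>

lemma span_point_local:
  assumes r: "is_mono_span C P Q r" and e: "e \<in> covers X T' T"
    and x: "x \<in> hom C (UO T) P" and y: "y \<in> hom C (UO T) Q"
    and s: "in_span C r (UO T') (x \<cdot> UA e) (y \<cdot> UA e)"
  shows "in_span C r (UO T) x y"
proof -
  note H = C.mono_span_homs[OF r] and eh = cover_hom[OF e]
  obtain z where z: "z \<in> hom C (UO T') (Dom C (fst r))" "fst r \<cdot> z = x \<cdot> UA e" "snd r \<cdot> z = y \<cdot> UA e"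
    using s by (auto simp: in_span_def)
  have "z \<cdot> UA a = z \<cdot> UA b"
    if ab: "a \<in> hom X S T'" "b \<in> hom X S T'" "UA e \<cdot> UA a = UA e \<cdot> UA b" for S a b
  proof (rule C.mono_span_cancel[OF r point_comp[OF z(1) ab(1)] point_comp[OF z(1) ab(2)]])
    show "fst r \<cdot> z \<cdot> UA a = fst r \<cdot> z \<cdot> UA b"
      using C.comp_square[OF z(2) U_hom[OF ab(1)] z(1) H(1) U_hom[OF eh] x]
        C.comp_square[OF z(2) U_hom[OF ab(2)] z(1) H(1) U_hom[OF eh] x] ab(3) by simp
    show "snd r \<cdot> z \<cdot> UA a = snd r \<cdot> z \<cdot> UA b"
      using C.comp_square[OF z(3) U_hom[OF ab(1)] z(1) H(2) U_hom[OF eh] y]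
        C.comp_square[OF z(3) U_hom[OF ab(2)] z(1) H(2) U_hom[OF eh] y] ab(3) by simp
  qed
  then obtain w where w: "w \<in> hom C (UO T) (Dom C (fst r))" "w \<cdot> UA e = z"
    using presentation_factor[OF descent[OF e] z(1)] by blast
  have "fst r \<cdot> w = x" "snd r \<cdot> w = y"
    using cover_cancel[OF e C.comp_hom[OF w(1) H(1)] x] cover_cancel[OF e C.comp_hom[OF w(1) H(2)] y]
      point_map[OF w(1) eh H(1)] point_map[OF w(1) eh H(2)] w(2) z(2,3) by simp_all
  then show ?thesis using w(1) by (auto simp: in_span_def)
qed

text \<open>A relation on \<open>P\<close> need not come from \<open>X\<close>, but its restriction
  to \<open>A\<close> does: two elements are related if, locally, some element of a presentation
  \<open>B\<close> of the relation lies over both. This is an image, formed in \<open>X\<close>, of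
  a pullback of two comma relations.\<close>

lemma restricted_relation:
  assumes r: "is_mono_span C P P r" and \<rho>: "presentation A P \<rho>"
  obtains k where "is_mono_span X A A k"
    "\<And>T a b. a \<in> hom X T A \<Longrightarrow> b \<in> hom X T A \<Longrightarrow>
      in_span X k T a b \<longleftrightarrow> in_span C r (UO T) (\<rho> \<cdot> UA a) (\<rho> \<cdot> UA b)"
proof -
  define R where "R = Dom C (fst r)"
  note H = C.mono_span_homs[OF r, folded R_def] and \<rho>h = presentation_hom[OF \<rho>] and A = presentation_obj[OF \<rho>]
  have "R \<in> Obj C" using C.hom_objs[OF H(1)] by simp
  then obtain B \<sigma> where \<sigma>: "presentation B R \<sigma>" using presentation_exists by blast
  note \<sigma>h = presentation_hom[OF \<sigma>] and B = presentation_obj[OF \<sigma>]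
  note s = C.comp_hom[OF \<sigma>h H(1)] C.comp_hom[OF \<sigma>h H(2)]
  obtain w where w: "is_mono_span X B A w" "\<And>T c a. c \<in> hom X T B \<Longrightarrow> a \<in> hom X T A \<Longrightarrow>
      in_span X w T c a \<longleftrightarrow> (fst r \<cdot> \<sigma>) \<cdot> UA c = \<rho> \<cdot> UA a"
    using comma[OF B A s(1) \<rho>h] by blast
  obtain v where v: "is_mono_span X B A v" "\<And>T c a. c \<in> hom X T B \<Longrightarrow> a \<in> hom X T A \<Longrightarrow>
      in_span X v T c a \<longleftrightarrow> (snd r \<cdot> \<sigma>) \<cdot> UA c = \<rho> \<cdot> UA a"
    using comma[OF B A s(2) \<rho>h] by blast
  note W = X.mono_span_homs[OF w(1)] and V = X.mono_span_homs[OF v(1)]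
  \<comment> \<open>Elements of the two comma relations that share their component in
    \<open>B\<close>.\<close>
  obtain Z \<alpha> \<beta> where Z: "is_pullback X (fst w) (fst v) \<alpha> \<beta>" "\<alpha> \<in> hom X Z (Dom X (fst w))"
    "\<beta> \<in> hom X Z (Dom X (fst v))" "fst w \<cdot>\<^bsub>X\<^esub> \<alpha> = fst v \<cdot>\<^bsub>X\<^esub> \<beta>"
    by (rule X.pullbackE[OF W(1) V(1)], rule that)
  note w\<alpha> = X.comp_hom[OF Z(2) W(2)] and v\<beta> = X.comp_hom[OF Z(3) V(2)]
  obtain k c where k: "is_mono_span X A A k" "c \<in> covers X Z (Dom X (fst k))"
    "fst k \<cdot>\<^bsub>X\<^esub> c = snd w \<cdot>\<^bsub>X\<^esub> \<alpha>" "snd k \<cdot>\<^bsub>X\<^esub> c = snd v \<cdot>\<^bsub>X\<^esub> \<beta>"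
    by (rule X.image_span[OF w\<alpha> v\<beta>], rule that)
  have "in_span X k T a b \<longleftrightarrow> in_span C r (UO T) (\<rho> \<cdot> UA a) (\<rho> \<cdot> UA b)"
    if ab: "a \<in> hom X T A" "b \<in> hom X T A" for T a b
  proof
    note \<rho>a = point_comp[OF \<rho>h ab(1)] and \<rho>b = point_comp[OF \<rho>h ab(2)]
    {
      assume "in_span X k T a b"
      then obtain T' d x where d: "d \<in> covers X T' T" and x: "x \<in> hom X T' Z"
        and xa: "(snd w \<cdot>\<^bsub>X\<^esub> \<alpha>) \<cdot>\<^bsub>X\<^esub> x = a \<cdot>\<^bsub>X\<^esub> d" and xb: "(snd v \<cdot>\<^bsub>X\<^esub> \<beta>) \<cdot>\<^bsub>X\<^esub> x = b \<cdot>\<^bsub>X\<^esub> d"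
        using X.in_image_span[OF w\<alpha> v\<beta> k ab] by blast
      note dh = cover_hom[OF d] and \<alpha>x = X.comp_hom[OF x Z(2)] and \<beta>x = X.comp_hom[OF x Z(3)]
      define c where "c = fst w \<cdot>\<^bsub>X\<^esub> (\<alpha> \<cdot>\<^bsub>X\<^esub> x)"
      have c: "c \<in> hom X T' B" unfolding c_def using X.comp_hom[OF \<alpha>x W(1)] .
      have cv: "c = fst v \<cdot>\<^bsub>X\<^esub> (\<beta> \<cdot>\<^bsub>X\<^esub> x)"
        unfolding c_def using X.comp_square[OF Z(4) x Z(2) W(1) Z(3) V(1)] .
      have "in_span X w T' c (a \<cdot>\<^bsub>X\<^esub> d)"
        unfolding in_span_def using \<alpha>x c_def xa X.comp_assoc[OF x Z(2) W(2)] by auto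
      then have 1: "(fst r \<cdot> \<sigma>) \<cdot> UA c = \<rho> \<cdot> UA (a \<cdot>\<^bsub>X\<^esub> d)"
        using w(2)[OF c X.comp_hom[OF dh ab(1)]] by simp
      have "in_span X v T' c (b \<cdot>\<^bsub>X\<^esub> d)"
        unfolding in_span_def using \<beta>x cv xb X.comp_assoc[OF x Z(3) V(2)] by auto
      then have 2: "(snd r \<cdot> \<sigma>) \<cdot> UA c = \<rho> \<cdot> UA (b \<cdot>\<^bsub>X\<^esub> d)"
        using v(2)[OF c X.comp_hom[OF dh ab(2)]] by simp
      have "in_span C r (UO T') ((\<rho> \<cdot> UA a) \<cdot> UA d) ((\<rho> \<cdot> UA b) \<cdot> UA d)"
        unfolding in_span_def R_def[symmetric]
        using point_comp[OF \<sigma>h c] point_map[OF \<sigma>h c H(1)] point_map[OF \<sigma>h c H(2)] 1 2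
          point_assoc[OF \<rho>h ab(1) dh] point_assoc[OF \<rho>h ab(2) dh] by force
      then show "in_span C r (UO T) (\<rho> \<cdot> UA a) (\<rho> \<cdot> UA b)"
        by (rule span_point_local[OF r d \<rho>a \<rho>b])
    next
      assume "in_span C r (UO T) (\<rho> \<cdot> UA a) (\<rho> \<cdot> UA b)"
      then obtain z where z: "z \<in> hom C (UO T) R" "fst r \<cdot> z = \<rho> \<cdot> UA a" "snd r \<cdot> z = \<rho> \<cdot> UA b"
        by (auto simp: in_span_def R_def)
      have T: "T \<in> Obj X" using X.hom_objs[OF ab(1)] by simp
      obtain T' d c where d: "d \<in> covers X T' T" "c \<in> hom X T' B" "z \<cdot> UA d = \<sigma> \<cdot> UA c"
        by (rule presentation_lift[OF \<sigma> T z(1)], rule that)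
      note dh = cover_hom[OF d(1)]
      note ad = X.comp_hom[OF dh ab(1)] and bd = X.comp_hom[OF dh ab(2)]
      have "(fst r \<cdot> \<sigma>) \<cdot> UA c = \<rho> \<cdot> UA (a \<cdot>\<^bsub>X\<^esub> d)" "(snd r \<cdot> \<sigma>) \<cdot> UA c = \<rho> \<cdot> UA (b \<cdot>\<^bsub>X\<^esub> d)"
        using point_map[OF \<sigma>h d(2) H(1)] point_map[OF \<sigma>h d(2) H(2)] d(3) point_map[OF z(1) dh H(1)]
          point_map[OF z(1) dh H(2)] z(2,3) point_assoc[OF \<rho>h ab(1) dh] point_assoc[OF \<rho>h ab(2) dh] by simp_all
      then have "in_span X w T' c (a \<cdot>\<^bsub>X\<^esub> d)" "in_span X v T' c (b \<cdot>\<^bsub>X\<^esub> d)"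
        using w(2)[OF d(2) ad] v(2)[OF d(2) bd] by simp_all
      then obtain x y where x: "x \<in> hom X T' (Dom X (fst w))" "fst w \<cdot>\<^bsub>X\<^esub> x = c" "snd w \<cdot>\<^bsub>X\<^esub> x = a \<cdot>\<^bsub>X\<^esub> d"
        and y: "y \<in> hom X T' (Dom X (fst v))" "fst v \<cdot>\<^bsub>X\<^esub> y = c" "snd v \<cdot>\<^bsub>X\<^esub> y = b \<cdot>\<^bsub>X\<^esub> d"
        unfolding in_span_def by blast
      obtain u where u: "u \<in> hom X T' Z" "\<alpha> \<cdot>\<^bsub>X\<^esub> u = x" "\<beta> \<cdot>\<^bsub>X\<^esub> u = y"
        using X.pullback_lift[OF Z(1-3) x(1) y(1)] x(2) y(2) by auto
      have "(snd w \<cdot>\<^bsub>X\<^esub> \<alpha>) \<cdot>\<^bsub>X\<^esub> u = a \<cdot>\<^bsub>X\<^esub> d" "(snd v \<cdot>\<^bsub>X\<^esub> \<beta>) \<cdot>\<^bsub>X\<^esub> u = b \<cdot>\<^bsub>X\<^esub> d"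
        using X.comp_assoc[OF u(1) Z(2) W(2)] X.comp_assoc[OF u(1) Z(3) V(2)] u x y by simp_all
      then show "in_span X k T a b" using X.in_image_span[OF w\<alpha> v\<beta> k ab] d(1) u(1) by blast
    }
  qed
  then show thesis using that[OF k(1)] by blast
qed

text \<open>The relation is restricted to a presentation of \<open>P\<close>, where the
  \<open>quotient\<close> axiom applies. The quotient map of \<open>A\<close> factors through
  \<open>P\<close>, because elements identified in \<open>P\<close> are related by
  reflexivity.\<close>

lemma C_effective:
  assumes r: "is_equivalence_relation C P (r1, r2)"
  obtains Q f where "locally_surjective P Q f" "is_kernel_pair C f r1 r2"
proof -
  have ms: "is_mono_span C P P (r1, r2)"
    and rf: "\<And>T a. a \<in> hom C T P \<Longrightarrow> in_span C (r1, r2) T a a"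
    and sy: "\<And>T a b. in_span C (r1, r2) T a b \<Longrightarrow> in_span C (r1, r2) T b a"
    and tr: "\<And>T a b c. in_span C (r1, r2) T a b \<Longrightarrow> in_span C (r1, r2) T b c \<Longrightarrow> in_span C (r1, r2) T a c"
    using r unfolding C.equivalence_relation_iff by blast+
  define R where "R = Dom C r1"
  have H: "r1 \<in> hom C R P" "r2 \<in> hom C R P" using C.mono_span_homs[OF ms] by (auto simp: R_def)
  have "P \<in> Obj C" using C.hom_objs[OF H(1)] by simp
  then obtain A \<rho> where \<rho>: "presentation A P \<rho>" using presentation_exists by blast
  note \<rho>h = presentation_hom[OF \<rho>]
  obtain k where k: "is_mono_span X A A k" and ki: "\<And>T a b. a \<in> hom X T A \<Longrightarrow> b \<in> hom X T A \<Longrightarrow>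
      in_span X k T a b \<longleftrightarrow> in_span C (r1, r2) (UO T) (\<rho> \<cdot> UA a) (\<rho> \<cdot> UA b)"
    by (rule restricted_relation[OF ms \<rho>], rule that)
  have "is_equivalence_relation X A k"
    unfolding X.equivalence_relation_iff
  proof (intro conjI allI impI k)
    fix T a assume "a \<in> hom X T A"
    then show "in_span X k T a a" using ki rf point_comp[OF \<rho>h] by blast
  next
    fix T a b assume "in_span X k T a b"
    then show "in_span X k T b a" using ki sy X.in_span_homs[OF k] by blast
  next
    fix T a b c assume ab: "in_span X k T a b" and bc: "in_span X k T b c"
    note h = X.in_span_homs[OF k ab] X.in_span_homs[OF k bc]
    show "in_span X k T a c" using ab bc ki[OF h(1,2)] ki[OF h(3,4)] ki[OF h(1,4)] tr by blast
  qed
  then obtain Q \<tau> where \<tau>: "presentation A Q \<tau>" and \<tau>i: "\<And>T a b. a \<in> hom X T A \<Longrightarrow> b \<in> hom X T A \<Longrightarrow>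
      \<tau> \<cdot> UA a = \<tau> \<cdot> UA b \<longleftrightarrow> in_span X k T a b"
    using quotient by blast
  note \<tau>h = presentation_hom[OF \<tau>]
  have "\<tau> \<cdot> UA a = \<tau> \<cdot> UA b"
    if "a \<in> hom X T A" "b \<in> hom X T A" "\<rho> \<cdot> UA a = \<rho> \<cdot> UA b" for T a b
    using \<tau>i[OF that(1,2)] ki[OF that(1,2)] rf[OF point_comp[OF \<rho>h that(2)]] that(3) by simp
  then obtain f where f: "f \<in> hom C P Q" "f \<cdot> \<rho> = \<tau>" using presentation_factor[OF \<rho> \<tau>h] by blast
  have f\<rho>: "f \<cdot> (\<rho> \<cdot> UA a) = \<tau> \<cdot> UA a" if "a \<in> hom X T A" for T a
    using point_map[OF \<rho>h that f(1)] f(2) by simp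
  have "locally_surjective P Q f"
    unfolding locally_surjective_def
  proof (intro conjI ballI f(1))
    fix T x assume x: "T \<in> Obj X" "x \<in> hom C (UO T) Q"
    obtain T' e a where "e \<in> covers X T' T" "a \<in> hom X T' A" "x \<cdot> UA e = \<tau> \<cdot> UA a"
      by (rule presentation_lift[OF \<tau> x], rule that)
    then show "\<exists>T' e y. e \<in> covers X T' T \<and> y \<in> hom C (UO T') P \<and> f \<cdot> y = x \<cdot> UA e"
      using f\<rho> point_comp[OF \<rho>h] by metis
  qed
  moreover have "is_kernel_pair C f r1 r2"
    unfolding is_kernel_pair_def
  proof (rule pullbackI_points[OF f(1) f(1) H])
    show "f \<cdot> r1 = f \<cdot> r2"
    proof (rule points_ext[OF C.comp_hom[OF H(1) f(1)] C.comp_hom[OF H(2) f(1)]])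
      fix T z assume T: "T \<in> Obj X" and z: "z \<in> hom C (UO T) R"
      note rz = C.comp_hom[OF z H(1)] C.comp_hom[OF z H(2)]
      obtain T' e a b where e: "e \<in> covers X T' T" "a \<in> hom X T' A" "b \<in> hom X T' A"
        "(r1 \<cdot> z) \<cdot> UA e = \<rho> \<cdot> UA a" "(r2 \<cdot> z) \<cdot> UA e = \<rho> \<cdot> UA b"
        by (rule presentation_lift2[OF \<rho> \<rho> T rz], rule that)
      note eh = cover_hom[OF e(1)]
      have "in_span C (r1, r2) (UO T') (\<rho> \<cdot> UA a) (\<rho> \<cdot> UA b)"
        unfolding in_span_def
        using point_comp[OF z eh] point_map[OF z eh H(1)] point_map[OF z eh H(2)] e(4,5) by (auto simp: R_def)
      then have "\<tau> \<cdot> UA a = \<tau> \<cdot> UA b" using \<tau>i ki e(2,3) by blast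
      then have "f \<cdot> ((r1 \<cdot> z) \<cdot> UA e) = f \<cdot> ((r2 \<cdot> z) \<cdot> UA e)" using e(2-5) f\<rho> by simp
      then have "f \<cdot> (r1 \<cdot> z) = f \<cdot> (r2 \<cdot> z)"
        using point_map[OF rz(1) eh f(1)] point_map[OF rz(2) eh f(1)]
          cover_cancel[OF e(1) C.comp_hom[OF rz(1) f(1)] C.comp_hom[OF rz(2) f(1)]] by simp
      then show "(f \<cdot> r1) \<cdot> z = (f \<cdot> r2) \<cdot> z"
        using C.comp_assoc[OF z H(1) f(1)] C.comp_assoc[OF z H(2) f(1)] by simp
    qed
  next
    fix T u v assume T: "T \<in> Obj X" and u: "u \<in> hom C (UO T) P" and v: "v \<in> hom C (UO T) P"
      and uv: "f \<cdot> u = f \<cdot> v"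
    obtain T' e a b where e: "e \<in> covers X T' T" "a \<in> hom X T' A" "b \<in> hom X T' A"
      "u \<cdot> UA e = \<rho> \<cdot> UA a" "v \<cdot> UA e = \<rho> \<cdot> UA b"
      by (rule presentation_lift2[OF \<rho> \<rho> T u v], rule that)
    note eh = cover_hom[OF e(1)]
    have "\<tau> \<cdot> UA a = \<tau> \<cdot> UA b"
      using f\<rho>[OF e(2)] f\<rho>[OF e(3)] e(4,5) point_map[OF u eh f(1)] point_map[OF v eh f(1)] uv by simp
    then have "in_span C (r1, r2) (UO T') (u \<cdot> UA e) (v \<cdot> UA e)"
      using \<tau>i[OF e(2,3)] ki[OF e(2,3)] e(4,5) by simp
    then show "\<exists>T' e w. e \<in> covers X T' T \<and> w \<in> hom C (UO T') R \<and> r1 \<cdot> w = u \<cdot> UA e \<and> r2 \<cdot> w = v \<cdot> UA e"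
      using e(1) by (auto simp: in_span_def R_def)
  next
    fix T x y assume "x \<in> hom C (UO T) R" "y \<in> hom C (UO T) R" "r1 \<cdot> x = r1 \<cdot> y" "r2 \<cdot> x = r2 \<cdot> y"
    then show "x = y" using C.mono_span_cancel[OF ms] by (simp add: R_def)
  qed
  ultimately show thesis using that by blast
qed

section \<open>Regular epimorphisms are the locally surjective arrows\<close>

lemma locally_surjective_coequalizer:
  assumes f: "locally_surjective P Q f" and k: "is_kernel_pair C f p q"
  shows "is_coequalizer C p q f"
proof -
  note fh = locally_surjective_hom[OF f]
  note H = C.pullback_homs[OF k[unfolded is_kernel_pair_def] fh fh]
  show ?thesis
  proof (rule C.coequalizerI[OF H(1,2) fh H(4)])
    fix S h assume h: "h \<in> hom C P S" "h \<cdot> p = h \<cdot> q"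
    show "\<exists>g \<in> hom C Q S. g \<cdot> f = h"
    proof (rule locally_surjective_factor[OF f h(1)])
      fix T x y assume xy: "x \<in> hom C (UO T) P" "y \<in> hom C (UO T) P" "f \<cdot> x = f \<cdot> y"
      then have "in_span C (p, q) (UO T) x y" using C.kernel_pair_in_span[OF k fh xy(1,2)] by simp
      then obtain z where "z \<in> hom C (UO T) (Dom C p)" "p \<cdot> z = x" "q \<cdot> z = y"
        by (auto simp: in_span_def)
      then show "h \<cdot> x = h \<cdot> y" using C.comp_square[OF h(2) _ H(1) h(1) H(2) h(1)] by blast
    qed
  qed (rule locally_surjective_epi[OF f])
qed

lemma locally_surjective_regular_epi:
  assumes f: "locally_surjective P Q f"
  shows "is_regular_epi C f"
proof -
  note fh = locally_surjective_hom[OF f]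
  obtain K p q where "is_pullback C f f p q" "p \<in> hom C K P" "q \<in> hom C K P" "f \<cdot> p = f \<cdot> q"
    by (rule C.pullbackE[OF fh fh], rule that)
  then show ?thesis
    using locally_surjective_coequalizer[OF f] by (auto simp: is_regular_epi_def is_kernel_pair_def)
qed

text \<open>A regular epimorphism and the locally surjective quotient by its kernel pair are
  coequalizers of the same pair, so their targets are isomorphic under \<open>P\<close> and local
  surjectivity carries over.\<close>

lemma regular_epi_locally_surjective:
  assumes e: "is_regular_epi C e" and eh: "e \<in> hom C P Q"
  shows "locally_surjective P Q e"
proof -
  obtain u v where c: "is_coequalizer C u v e" using e by (auto simp: is_regular_epi_def)
  obtain K p q where K: "is_pullback C e e p q" "p \<in> hom C K P" "q \<in> hom C K P" "e \<cdot> p = e \<cdot> q"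
    by (rule C.pullbackE[OF eh eh], rule that)
  then have k: "is_kernel_pair C e p q" by (simp add: is_kernel_pair_def)
  note co = C.coequalizer_of_kernel_pair[OF c k]
  obtain Q' f where f: "locally_surjective P Q' f" "is_kernel_pair C f p q"
    by (rule C_effective[OF C.kernel_pair_equivalence_relation[OF k eh]], rule that)
  note fh = locally_surjective_hom[OF f(1)] and fc = locally_surjective_coequalizer[OF f]
  obtain g where g: "g \<in> hom C Q' Q" "g \<cdot> f = e" using C.coequalizer_factor[OF fc fh eh K(4)] by blast
  obtain h where h: "h \<in> hom C Q Q'" "h \<cdot> e = f"
    using C.coequalizer_factor[OF co eh fh] C.coequalizer_homs(3)[OF fc fh] by blast
  have Q: "Q \<in> Obj C" using C.hom_objs[OF eh] by simp
  have "(g \<cdot> h) \<cdot> e = Ident C Q \<cdot> e"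
    using C.comp_assoc[OF eh h(1) g(1)] h(2) g(2) C.ident_left[OF eh] by simp
  then have gh: "g \<cdot> h = Ident C Q"
    using C.coequalizer_epi[OF co eh C.comp_hom[OF h(1) g(1)] C.ident_hom[OF Q]] by blast
  show ?thesis
    unfolding locally_surjective_def
  proof (intro conjI ballI eh)
    fix T x assume T: "T \<in> Obj X" and x: "x \<in> hom C (UO T) Q"
    obtain T' d y where d: "d \<in> covers X T' T" "y \<in> hom C (UO T') P" "f \<cdot> y = (h \<cdot> x) \<cdot> UA d"
      by (rule locally_surjective_lift[OF f(1) T C.comp_hom[OF x h(1)]], rule that)
    have "e \<cdot> y = g \<cdot> (f \<cdot> y)" using C.comp_reassoc[OF g(2) d(2) fh g(1)] by simp
    also have "\<dots> = (g \<cdot> (h \<cdot> x)) \<cdot> UA d"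
      using d(3) point_map[OF C.comp_hom[OF x h(1)] cover_hom[OF d(1)] g(1)] by simp
    also have "\<dots> = x \<cdot> UA d" using C.comp_reassoc[OF gh x h(1) g(1)] C.ident_left[OF x] by simp
    finally show "\<exists>T' e' y. e' \<in> covers X T' T \<and> y \<in> hom C (UO T') P \<and> e \<cdot> y = x \<cdot> UA e'" using d(1,2) by blast
  qed
qed

lemma C_exact: "exact_category C"
proof unfold_locales
  show "has_finite_limits C" by (rule C.finite_limits)
next
  fix f p q assume k: "is_kernel_pair C f p q"
  then have "f \<in> hom C (Dom C f) (Cod C f)"
    by (simp add: is_kernel_pair_def is_pullback_def C.arr_hom)
  from C.kernel_pair_equivalence_relation[OF k this]
  obtain Q g where "locally_surjective (Dom C f) Q g" "is_kernel_pair C g p q"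
    by (rule C_effective)
  then show "\<exists>e. is_coequalizer C p q e" using locally_surjective_coequalizer by blast
next
  fix e f e' f' assume e: "is_regular_epi C e" and P: "is_pullback C f e e' f'"
  define A Q Y where "A = Dom C e" and "Q = Cod C e" and "Y = Dom C f"
  have eh: "e \<in> hom C A Q" using C.regular_epi_hom[OF e] by (simp add: A_def Q_def)
  have f: "f \<in> hom C Y Q" using P by (auto simp: is_pullback_def hom_def Y_def Q_def)
  note H = C.pullback_homs[OF P f eh]
  \<comment> \<open>A local preimage of \<open>f \<cdot> x\<close> under \<open>e\<close>, together
    with the restriction of \<open>x\<close>, is a point of the pullback.\<close>
  have "locally_surjective (Dom C e') Y e'"
    unfolding locally_surjective_def
  proof (intro conjI ballI H(1))
    fix T x assume T: "T \<in> Obj X" and x: "x \<in> hom C (UO T) Y"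
    obtain T' d y where d: "d \<in> covers X T' T" "y \<in> hom C (UO T') A" "e \<cdot> y = (f \<cdot> x) \<cdot> UA d"
      by (rule locally_surjective_lift[OF regular_epi_locally_surjective[OF e eh] T C.comp_hom[OF x f]], rule that)
    note xd = point_comp[OF x cover_hom[OF d(1)]]
    have "f \<cdot> (x \<cdot> UA d) = e \<cdot> y" using d(3) point_map[OF x cover_hom[OF d(1)] f] by simp
    then show "\<exists>T' d y. d \<in> covers X T' T \<and> y \<in> hom C (UO T') (Dom C e') \<and> e' \<cdot> y = x \<cdot> UA d"
      using C.pullback_lift[OF P H(1,2) xd d(2)] d(1) by blast
  qed
  then show "is_regular_epi C e'" by (rule locally_surjective_regular_epi)
next
  fix A r1 r2 assume "is_equivalence_relation C A (r1, r2)"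
  then obtain Q f where "locally_surjective A Q f" "is_kernel_pair C f r1 r2" by (rule C_effective)
  then show "\<exists>f. is_kernel_pair C f r1 r2" by blast
qed

text \<open>Protomodularity is a local property: after restriction to a cover \<open>T1\<close> over which the section
  lifts to the presentation \<open>\<rho>: U G \<rightarrow> Q\<close>, it is inherited from the split epimorphism \<open>W \<rightarrow> T1\<close> of \<open>X\<close>,
  where \<open>W\<close> is the pullback of \<open>p \<rho>\<close>.\<close>

lemma C_protomodular:
  assumes "protomodular_category X"
  shows "protomodular_category C"
proof unfold_locales
  show "has_pullbacks C" by (rule C_pullbacks)
next
  fix p Q B s f A d g
  assume p: "p \<in> hom C Q B" and s: "s \<in> hom C B Q" and ps: "p \<cdot> s = Ident C B"
    and f: "f \<in> hom C A B" and P: "is_pullback C f p d g"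
  define D where "D = Dom C d"
  note H = C.pullback_homs[OF P f p, folded D_def]
  show "jointly_strongly_epic C g s"
  proof (rule C.jointly_strongly_epicI[OF H(2) s])
    fix M m g' s' assume m: "is_mono C m" and mh: "m \<in> hom C M Q" and g': "g' \<in> hom C D M" "m \<cdot> g' = g"
      and s': "s' \<in> hom C B M" "m \<cdot> s' = s"
    obtain G \<rho> where \<rho>: "presentation G Q \<rho>" using presentation_exists C.hom_objs[OF mh] by blast
    obtain A0 \<alpha> where \<alpha>: "presentation A0 A \<alpha>" using presentation_exists C.hom_objs[OF f] by blast
    obtain H0 \<mu> where \<mu>: "presentation H0 M \<mu>" using presentation_exists C.hom_objs[OF mh] by blast
    note \<rho>h = presentation_hom[OF \<rho>] and \<alpha>h = presentation_hom[OF \<alpha>] and \<mu>h = presentation_hom[OF \<mu>]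
    note p\<rho> = C.comp_hom[OF \<rho>h p] and f\<alpha> = C.comp_hom[OF \<alpha>h f] and m\<mu> = C.comp_hom[OF \<mu>h mh]
    \<comment> \<open>For the monomorphism \<open>m\<close> this gives invertibility, so a single
      point \<open>x\<close> of \<open>Q\<close> is to be lifted to \<open>M\<close> over some
      cover.\<close>
    have "locally_surjective M Q m"
      unfolding locally_surjective_def
    proof (intro conjI ballI mh)
      fix T x assume T: "T \<in> Obj X" and x: "x \<in> hom C (UO T) Q"
      define b where "b = p \<cdot> x"
      have b: "b \<in> hom C (UO T) B" unfolding b_def by (rule C.comp_hom[OF x p])
      \<comment> \<open>Over \<open>T1\<close> the value of the section \<open>s\<close> at the base
        point of \<open>x\<close> is represented by an arrow \<open>t0\<close> of
        \<open>X\<close>.\<close>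
      obtain T1 e1 t0 where e1: "e1 \<in> covers X T1 T" "t0 \<in> hom X T1 G"
        "(s \<cdot> b) \<cdot> UA e1 = \<rho> \<cdot> UA t0"
        by (rule presentation_lift[OF \<rho> T C.comp_hom[OF b s]], rule that)
      note e1h = cover_hom[OF e1(1)]
      have T1: "T1 \<in> Obj X" using cover_objs[OF e1(1)] by simp
      define b1 where "b1 = b \<cdot> UA e1"
      have b1: "b1 \<in> hom C (UO T1) B" unfolding b1_def by (rule point_comp[OF b e1h])
      have sb1: "s \<cdot> b1 = \<rho> \<cdot> UA t0" unfolding b1_def using e1(3) point_map[OF b e1h s] by simp
      \<comment> \<open>\<open>W\<close> is the fibre product of \<open>T1\<close> and
        \<open>G\<close> over \<open>B\<close>; it exists in \<open>X\<close> by the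
        \<open>comma\<close> axiom although \<open>B\<close> need not come from
        \<open>X\<close>.\<close>
      obtain w where w: "is_mono_span X T1 G w" and wi: "\<And>S \<tau> \<gamma>. \<tau> \<in> hom X S T1 \<Longrightarrow> \<gamma> \<in> hom X S G \<Longrightarrow>
          in_span X w S \<tau> \<gamma> \<longleftrightarrow> b1 \<cdot> UA \<tau> = (p \<cdot> \<rho>) \<cdot> UA \<gamma>"
        using comma[OF T1 presentation_obj[OF \<rho>] b1 p\<rho>] by blast
      define W w1 w2 where "W = Dom X (fst w)" and "w1 = fst w" and "w2 = snd w"
      have w1: "w1 \<in> hom X W T1" and w2: "w2 \<in> hom X W G"
        using X.mono_span_homs[OF w] by (auto simp: W_def w1_def w2_def)
      have W: "W \<in> Obj X" using X.hom_objs[OF w1] by simp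
      have wD: "\<exists>z \<in> hom X S W. w1 \<cdot>\<^bsub>X\<^esub> z = \<tau> \<and> w2 \<cdot>\<^bsub>X\<^esub> z = \<gamma>"
        if "\<tau> \<in> hom X S T1" "\<gamma> \<in> hom X S G" "b1 \<cdot> UA \<tau> = (p \<cdot> \<rho>) \<cdot> UA \<gamma>" for S \<tau> \<gamma>
        using wi[OF that(1,2)] that(3) by (auto simp: in_span_def W_def w1_def w2_def)
      have wI: "b1 \<cdot> UA (w1 \<cdot>\<^bsub>X\<^esub> z) = (p \<cdot> \<rho>) \<cdot> UA (w2 \<cdot>\<^bsub>X\<^esub> z)" if z: "z \<in> hom X S W" for S z
        using wi[OF X.comp_hom[OF z w1] X.comp_hom[OF z w2]] z
        by (auto simp: in_span_def W_def w1_def w2_def)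
      \<comment> \<open>As \<open>p \<cdot> s\<close> is an identity, \<open>t0\<close> lies over
        \<open>b1\<close>; paired with the identity of \<open>T1\<close> it gives the section
        \<open>\<sigma>\<close> of \<open>w1\<close>.\<close>
      have "b1 \<cdot> UA (Ident X T1) = (p \<cdot> \<rho>) \<cdot> UA t0"
        using C.comp_assoc[OF U_hom[OF e1(2)] \<rho>h p] sb1 C.comp_reassoc[OF ps b1 s p] C.ident_left[OF b1]
          C.ident_right[OF b1] U_ident[OF T1] by simp
      then obtain \<sigma> where \<sigma>: "\<sigma> \<in> hom X T1 W" "w1 \<cdot>\<^bsub>X\<^esub> \<sigma> = Ident X T1" "w2 \<cdot>\<^bsub>X\<^esub> \<sigma> = t0"
        using wD[OF X.ident_hom[OF T1] e1(2)] by blast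
      \<comment> \<open>The fibre product of \<open>A0\<close> and \<open>T1\<close> over
        \<open>B\<close>. Its projection to \<open>T1\<close> is the arrow along which
        \<open>w1\<close> is pulled back when protomodularity of \<open>X\<close> is
        applied.\<close>
      obtain v where v: "is_mono_span X A0 T1 v" and vi: "\<And>S a \<tau>. a \<in> hom X S A0 \<Longrightarrow> \<tau> \<in> hom X S T1 \<Longrightarrow>
          in_span X v S a \<tau> \<longleftrightarrow> (f \<cdot> \<alpha>) \<cdot> UA a = b1 \<cdot> UA \<tau>"
        using comma[OF presentation_obj[OF \<alpha>] T1 f\<alpha> b1] by blast
      note V = X.mono_span_homs[OF v]
      obtain D0 d0 g0 where D0: "is_pullback X (snd v) w1 d0 g0" "d0 \<in> hom X D0 (Dom X (fst v))" "g0 \<in> hom X D0 W"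
        "snd v \<cdot>\<^bsub>X\<^esub> d0 = w1 \<cdot>\<^bsub>X\<^esub> g0"
        by (rule X.pullbackE[OF V(2) w1], rule that)
      have jse: "jointly_strongly_epic X g0 \<sigma>"
        using protomodular_category.protomodular[OF assms w1 \<sigma>(1,2) V(2) D0(1)] .
      define \<rho>2 where "\<rho>2 = \<rho> \<cdot> UA w2"
      have \<rho>2: "\<rho>2 \<in> hom C (UO W) Q" unfolding \<rho>2_def by (rule point_comp[OF \<rho>h w2])
      have \<rho>2z: "\<rho>2 \<cdot> UA z = \<rho> \<cdot> UA (w2 \<cdot>\<^bsub>X\<^esub> z)" if "z \<in> hom X S W" for S z
        unfolding \<rho>2_def using point_assoc[OF \<rho>h w2 that] .
      \<comment> \<open>The preimage of \<open>M\<close> in \<open>W\<close>: \<open>y\<close> pairs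
        elements of \<open>W\<close> with representatives in the presentation \<open>H0\<close> of
        \<open>M\<close>, and \<open>M0\<close> will be its image in \<open>W\<close>.\<close>
      obtain y where y: "is_mono_span X W H0 y" and yi: "\<And>S z h. z \<in> hom X S W \<Longrightarrow> h \<in> hom X S H0 \<Longrightarrow>
          in_span X y S z h \<longleftrightarrow> \<rho>2 \<cdot> UA z = (m \<cdot> \<mu>) \<cdot> UA h"
        using comma[OF W presentation_obj[OF \<mu>] \<rho>2 m\<mu>] by blast
      note Y = X.mono_span_homs[OF y]
      obtain M0 c m0 where M0: "c \<in> covers X (Dom X (fst y)) M0" "m0 \<in> hom X M0 W" "is_mono X m0"
        "m0 \<cdot>\<^bsub>X\<^esub> c = fst y"
        by (rule X.image_factorization[OF Y(1)], rule that)
      note ch = cover_hom[OF M0(1)]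
      \<comment> \<open>Membership in \<open>M0\<close> can be decided in \<open>C\<close>: an
        element of \<open>W\<close> lies there as soon as its image in \<open>Q\<close> lies in
        \<open>M\<close>.\<close>
      have factor: "\<exists>z' \<in> hom X S M0. m0 \<cdot>\<^bsub>X\<^esub> z' = z"
        if z: "z \<in> hom X S W" and q: "q \<in> hom C (UO S) M" "m \<cdot> q = \<rho>2 \<cdot> UA z" for S z q
      proof -
        have S: "S \<in> Obj X" using X.hom_objs[OF z] by simp
        obtain S' d h where d: "d \<in> covers X S' S" "h \<in> hom X S' H0" "q \<cdot> UA d = \<mu> \<cdot> UA h"
          by (rule presentation_lift[OF \<mu> S q(1)], rule that)
        note dh = cover_hom[OF d(1)] and zd = X.comp_hom[OF cover_hom[OF d(1)] z]
        have "\<rho>2 \<cdot> UA (z \<cdot>\<^bsub>X\<^esub> d) = (m \<cdot> \<mu>) \<cdot> UA h"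
          using point_assoc[OF \<rho>2 z dh] q(2) point_map[OF q(1) dh mh] d(3) point_map[OF \<mu>h d(2) mh] by simp
        then obtain u where u: "u \<in> hom X S' (Dom X (fst y))" "fst y \<cdot>\<^bsub>X\<^esub> u = z \<cdot>\<^bsub>X\<^esub> d"
          using yi[OF zd d(2)] by (auto simp: in_span_def)
        have "m0 \<cdot>\<^bsub>X\<^esub> (c \<cdot>\<^bsub>X\<^esub> u) = z \<cdot>\<^bsub>X\<^esub> d" using X.comp_reassoc[OF M0(4) u(1) ch M0(2)] u(2) by simp
        then show ?thesis
          using X.regular_epi_lift_mono[OF cover_regular_epi[OF d(1)] dh M0(2,3) X.comp_hom[OF u(1) ch] z] by blast
      qed
      \<comment> \<open>\<open>D0\<close> lies over \<open>A\<close> and over \<open>Q\<close>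
        compatibly, which gives a point of the pullback \<open>D\<close>; \<open>g'\<close> sends it
        into \<open>M\<close>.\<close>
      have "\<exists>z' \<in> hom X D0 M0. m0 \<cdot>\<^bsub>X\<^esub> z' = g0"
      proof -
        note vd = X.comp_hom[OF D0(2) V(1)] and vd2 = X.comp_hom[OF D0(2) V(2)]
        have q: "\<rho>2 \<cdot> UA g0 \<in> hom C (UO D0) Q" using point_comp[OF \<rho>2 D0(3)] .
        have a: "\<alpha> \<cdot> UA (fst v \<cdot>\<^bsub>X\<^esub> d0) \<in> hom C (UO D0) A" using point_comp[OF \<alpha>h vd] .
        have "in_span X v D0 (fst v \<cdot>\<^bsub>X\<^esub> d0) (snd v \<cdot>\<^bsub>X\<^esub> d0)" using D0(2) by (auto simp: in_span_def)
        then have "(f \<cdot> \<alpha>) \<cdot> UA (fst v \<cdot>\<^bsub>X\<^esub> d0) = b1 \<cdot> UA (w1 \<cdot>\<^bsub>X\<^esub> g0)"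
          using vi[OF vd vd2] D0(4) by simp
        then have "f \<cdot> (\<alpha> \<cdot> UA (fst v \<cdot>\<^bsub>X\<^esub> d0)) = p \<cdot> (\<rho>2 \<cdot> UA g0)"
          using wI[OF D0(3)] \<rho>2z[OF D0(3)] point_map[OF \<alpha>h vd f] point_map[OF \<rho>h X.comp_hom[OF D0(3) w2] p] by simp
        then obtain \<delta> where \<delta>: "\<delta> \<in> hom C (UO D0) D" "g \<cdot> \<delta> = \<rho>2 \<cdot> UA g0"
          using C.pullback_lift[OF P H(1,2) a q] by blast
        then show ?thesis
          using factor[OF D0(3) C.comp_hom[OF \<delta>(1) g'(1)]] C.comp_reassoc[OF g'(2) \<delta>(1) g'(1) mh] by simp
      qed
      then obtain k1 where k1: "k1 \<in> hom X D0 M0" "m0 \<cdot>\<^bsub>X\<^esub> k1 = g0" by blast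
      \<comment> \<open>The section lands in \<open>M0\<close> because \<open>s\<close> factors
        through \<open>M\<close>.\<close>
      have "m \<cdot> (s' \<cdot> b1) = \<rho>2 \<cdot> UA \<sigma>"
        using C.comp_reassoc[OF s'(2) b1 s'(1) mh] sb1 \<rho>2z[OF \<sigma>(1)] \<sigma>(3) by simp
      then obtain k2 where k2: "k2 \<in> hom X T1 M0" "m0 \<cdot>\<^bsub>X\<^esub> k2 = \<sigma>"
        using factor[OF \<sigma>(1) C.comp_hom[OF b1 s'(1)]] by blast
      \<comment> \<open>Protomodularity of \<open>X\<close> makes \<open>M0\<close> all of
        \<open>W\<close>, so every element of \<open>W\<close> has its image locally in
        \<open>M\<close>.\<close>
      have "is_iso X m0" using X.jointly_strongly_epicD[OF jse M0(3,2) k1 k2] .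
      then obtain k where k: "k \<in> hom X W M0" "m0 \<cdot>\<^bsub>X\<^esub> k = Ident X W" using X.isoE[OF _ M0(2)] by blast
      note x1 = point_comp[OF x e1h]
      obtain T2 e2 \<gamma> where e2: "e2 \<in> covers X T2 T1" "\<gamma> \<in> hom X T2 G" "(x \<cdot> UA e1) \<cdot> UA e2 = \<rho> \<cdot> UA \<gamma>"
        by (rule presentation_lift[OF \<rho> T1 x1], rule that)
      note e2h = cover_hom[OF e2(1)]
      have "b1 \<cdot> UA e2 = (p \<cdot> \<rho>) \<cdot> UA \<gamma>"
        using point_map[OF \<rho>h e2(2) p] e2(3)[symmetric] point_map[OF x1 e2h p] point_map[OF x e1h p]
        by (simp add: b1_def b_def)
      \<comment> \<open>Locally \<open>x\<close> is represented by an element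
        \<open>\<gamma>\<close> of \<open>G\<close> over its own base point, hence by an element
        \<open>z\<close> of \<open>W\<close>.\<close>
      then obtain z where z: "z \<in> hom X T2 W" "w2 \<cdot>\<^bsub>X\<^esub> z = \<gamma>" using wD[OF e2h e2(2)] by blast
      note kz = X.comp_hom[OF z(1) k(1)]
      have mkz: "m0 \<cdot>\<^bsub>X\<^esub> (k \<cdot>\<^bsub>X\<^esub> z) = z" using X.comp_reassoc[OF k(2) z(1) k(1) M0(2)] X.ident_left[OF z(1)] by simp
      obtain T3 e3 u where e3: "e3 \<in> covers X T3 T2" "u \<in> hom X T3 (Dom X (fst y))" "c \<cdot>\<^bsub>X\<^esub> u = (k \<cdot>\<^bsub>X\<^esub> z) \<cdot>\<^bsub>X\<^esub> e3"
        by (rule X.cover_pullback[OF M0(1) kz], rule that)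
      note e3h = cover_hom[OF e3(1)] and yu = X.comp_hom[OF e3(2) Y(1)] and yu2 = X.comp_hom[OF e3(2) Y(2)]
      have y1u: "fst y \<cdot>\<^bsub>X\<^esub> u = z \<cdot>\<^bsub>X\<^esub> e3"
        using X.comp_reassoc[OF M0(4) e3(2) ch M0(2)] e3(3) X.comp_reassoc[OF mkz e3h kz M0(2)] by simp
      have "in_span X y T3 (fst y \<cdot>\<^bsub>X\<^esub> u) (snd y \<cdot>\<^bsub>X\<^esub> u)" using e3(2) by (auto simp: in_span_def)
      then have "(m \<cdot> \<mu>) \<cdot> UA (snd y \<cdot>\<^bsub>X\<^esub> u) = \<rho>2 \<cdot> UA (z \<cdot>\<^bsub>X\<^esub> e3)" using yi[OF yu yu2] y1u by simp
      also have "\<dots> = (\<rho> \<cdot> UA \<gamma>) \<cdot> UA e3"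
        using point_assoc[OF \<rho>2 z(1) e3h] \<rho>2z[OF z(1)] z(2) by simp
      also have "\<dots> = x \<cdot> UA ((e1 \<cdot>\<^bsub>X\<^esub> e2) \<cdot>\<^bsub>X\<^esub> e3)"
        using e2(3)[symmetric] point_assoc[OF x e1h e2h] point_assoc[OF x X.comp_hom[OF e2h e1h] e3h] by simp
      finally have "m \<cdot> (\<mu> \<cdot> UA (snd y \<cdot>\<^bsub>X\<^esub> u)) = x \<cdot> UA ((e1 \<cdot>\<^bsub>X\<^esub> e2) \<cdot>\<^bsub>X\<^esub> e3)"
        using point_map[OF \<mu>h yu2 mh] by simp
      moreover have "(e1 \<cdot>\<^bsub>X\<^esub> e2) \<cdot>\<^bsub>X\<^esub> e3 \<in> covers X T3 T"
        using X.cover_comp[OF e3(1) X.cover_comp[OF e2(1) e1(1)]] .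
      ultimately show "\<exists>T' e y. e \<in> covers X T' T \<and> y \<in> hom C (UO T') M \<and> m \<cdot> y = x \<cdot> UA e"
        using point_comp[OF \<mu>h yu2] by blast
    qed
    then show "is_iso C m" by (rule locally_surjective_mono_iso[OF _ m])
  qed
qed

text \<open>With \<open>P\<close> the quotient of \<open>A\<close> by \<open>k\<close>, an arrow
  from \<open>P\<close> to an object of \<open>X\<close> is an arrow from \<open>A\<close> that
  identifies the legs of \<open>k\<close>; so the coequalizer \<open>q\<close> of these legs in
  \<open>X\<close> represents such arrows. The unit is locally surjective because \<open>q\<close>
  is a cover.\<close>

lemma reflection_along_coequalizer:
  assumes st: "stable_coequalizers_of_equivalence_relations X" and P: "P \<in> Obj C"
  obtains B \<eta> where "B \<in> Obj X" "universal P (UO B) \<eta>" "locally_surjective P (UO B) \<eta>"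
    "\<And>Y f p q. Y \<in> Obj X \<Longrightarrow> f \<in> hom C (UO Y) (UO B) \<Longrightarrow> is_pullback C f \<eta> p q \<Longrightarrow> universal (Dom C p) (UO Y) p"
proof -
  obtain A \<rho> where \<rho>: "presentation A P \<rho>" using presentation_exists[OF P] by blast
  note \<rho>h = presentation_hom[OF \<rho>] and A = presentation_obj[OF \<rho>]
  \<comment> \<open>The equality of \<open>P\<close>, pulled back to \<open>A\<close>, is a relation
    of \<open>X\<close>.\<close>
  obtain k where k: "is_mono_span X A A k" and ki: "\<And>T a b. a \<in> hom X T A \<Longrightarrow> b \<in> hom X T A \<Longrightarrow>
      in_span X k T a b \<longleftrightarrow> \<rho> \<cdot> UA a = \<rho> \<cdot> UA b"
    using comma[OF A A \<rho>h \<rho>h] by blast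
  define K k1 k2 where "K = Dom X (fst k)" and "k1 = fst k" and "k2 = snd k"
  have k12: "k1 \<in> hom X K A" "k2 \<in> hom X K A" and kk: "k = (k1, k2)"
    using X.mono_span_homs[OF k] by (auto simp: K_def k1_def k2_def)
  have er: "is_equivalence_relation X A (k1, k2)"
    using X.equivalence_relation_eqI[OF k, of "\<lambda>T a. \<rho> \<cdot> UA a"] ki kk by blast
  have \<rho>k: "\<rho> \<cdot> UA k1 = \<rho> \<cdot> UA k2"
    using ki[OF k12] X.in_span_legs[OF k] by (simp add: K_def k1_def k2_def)
  obtain q where q: "is_coequalizer X k1 k2 q"
    using st er unfolding stable_coequalizers_of_equivalence_relations_def by blast
  define B where "B = Cod X q"
  have qh: "q \<in> hom X A B" unfolding B_def by (rule X.coequalizer_hom[OF q k12(1)])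
  have qc: "q \<in> covers X A B" using q qh by (auto simp: covers_def is_regular_epi_def)
  have B: "B \<in> Obj X" using X.hom_objs[OF qh] by simp
  have "UA q \<cdot> UA a = UA q \<cdot> UA b"
    if "a \<in> hom X T A" "b \<in> hom X T A" "\<rho> \<cdot> UA a = \<rho> \<cdot> UA b" for T a b
    using X.equivalence_relation_in_span_coequalizer[OF q qh] ki[OF that(1,2)] that(3) kk
      U_comp_eq_iff[OF that(1) qh that(2) qh] by simp
  then obtain \<eta> where \<eta>: "\<eta> \<in> hom C P (UO B)" "\<eta> \<cdot> \<rho> = UA q"
    using presentation_factor[OF \<rho> U_hom[OF qh]] by blast
  have \<eta>\<rho>: "\<eta> \<cdot> (\<rho> \<cdot> UA a) = UA (q \<cdot>\<^bsub>X\<^esub> a)" if "a \<in> hom X T A" for T a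
    using point_map[OF \<rho>h that \<eta>(1)] \<eta>(2) U_comp[OF that qh] by simp
  have uni: "universal P (UO B) \<eta>"
  proof (rule universalI[OF B \<eta>(1)])
    fix E f assume E: "E \<in> Obj X" and f: "f \<in> hom C P (UO E)"
    obtain g where g: "g \<in> hom X A E" "UA g = f \<cdot> \<rho>" using U_full[OF A E C.comp_hom[OF \<rho>h f]] by blast
    have "UA g \<cdot> UA k1 = UA g \<cdot> UA k2"
      using g(2) point_map[OF \<rho>h k12(1) f] point_map[OF \<rho>h k12(2) f] \<rho>k by simp
    then have "g \<cdot>\<^bsub>X\<^esub> k1 = g \<cdot>\<^bsub>X\<^esub> k2" using U_comp_eq_iff[OF k12(1) g(1) k12(2) g(1)] by blast
    then obtain h where h: "h \<in> hom X B E" "h \<cdot>\<^bsub>X\<^esub> q = g" using X.coequalizer_factor[OF q qh g(1)] by blast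
    have "(UA h \<cdot> \<eta>) \<cdot> \<rho> = f \<cdot> \<rho>"
      using C.comp_assoc[OF \<rho>h \<eta>(1) U_hom[OF h(1)]] \<eta>(2) U_comp[OF qh h(1)] h(2) g(2) by simp
    then show "\<exists>h \<in> hom X B E. UA h \<cdot> \<eta> = f"
      using presentation_epi[OF \<rho> C.comp_hom[OF \<eta>(1) U_hom[OF h(1)]] f] h(1) by blast
  next
    fix E h l assume hl: "h \<in> hom X B E" "l \<in> hom X B E" "UA h \<cdot> \<eta> = UA l \<cdot> \<eta>"
    then have "UA h \<cdot> UA q = UA l \<cdot> UA q"
      using C.comp_assoc[OF \<rho>h \<eta>(1) U_hom[OF hl(1)]] C.comp_assoc[OF \<rho>h \<eta>(1) U_hom[OF hl(2)]] \<eta>(2) by simp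
    then have "h \<cdot>\<^bsub>X\<^esub> q = l \<cdot>\<^bsub>X\<^esub> q" using U_comp_eq_iff[OF qh hl(1) qh hl(2)] by blast
    then show "h = l" by (rule X.coequalizer_epi[OF q qh hl(1,2)])
  qed
  have ls: "locally_surjective P (UO B) \<eta>"
    unfolding locally_surjective_def
  proof (intro conjI ballI \<eta>(1))
    fix T x assume T: "T \<in> Obj X" and x: "x \<in> hom C (UO T) (UO B)"
    obtain t where t: "t \<in> hom X T B" "UA t = x" using U_full[OF T B x] by blast
    obtain T' e a where e: "e \<in> covers X T' T" "a \<in> hom X T' A" "q \<cdot>\<^bsub>X\<^esub> a = t \<cdot>\<^bsub>X\<^esub> e"
      by (rule X.cover_pullback[OF qc t(1)], rule that)
    then have "\<eta> \<cdot> (\<rho> \<cdot> UA a) = x \<cdot> UA e"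
      using \<eta>\<rho>[OF e(2)] U_comp[OF cover_hom[OF e(1)] t(1)] t(2) by simp
    then show "\<exists>T' e y. e \<in> covers X T' T \<and> y \<in> hom C (UO T') P \<and> \<eta> \<cdot> y = x \<cdot> UA e"
      using e(1) point_comp[OF \<rho>h e(2)] by blast
  qed
  \<comment> \<open>The comparison \<open>c\<close> from \<open>X'\<close> to the pullback
    \<open>D\<close> is locally surjective and identifies \<open>s1\<close> with \<open>s2\<close>,
    while \<open>q'\<close> is their coequalizer by hypothesis; so an arrow from \<open>D\<close> to
    an object of \<open>X\<close> factors through \<open>p\<close>.\<close>
  have stable: "universal (Dom C p) (UO Y) p"
    if Y: "Y \<in> Obj X" and F: "F \<in> hom C (UO Y) (UO B)" and PB: "is_pullback C F \<eta> p r" for Y F p r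
  proof -
    define D where "D = Dom C p"
    obtain f where f: "f \<in> hom X Y B" "UA f = F" using U_full[OF Y B F] by blast
    note H = C.pullback_homs[OF PB F \<eta>(1), folded D_def]
    obtain X' q' f' where X': "is_pullback X f q q' f'" "q' \<in> hom X X' Y" "f' \<in> hom X X' A" "f \<cdot>\<^bsub>X\<^esub> q' = q \<cdot>\<^bsub>X\<^esub> f'"
      by (rule X.pullbackE[OF f(1) qh], rule that)
    note qk = X.comp_hom[OF k12(1) qh]
    obtain S y l where S: "is_pullback X f (q \<cdot>\<^bsub>X\<^esub> k1) y l" "y \<in> hom X S Y" "l \<in> hom X S K"
      "f \<cdot>\<^bsub>X\<^esub> y = (q \<cdot>\<^bsub>X\<^esub> k1) \<cdot>\<^bsub>X\<^esub> l"
      by (rule X.pullbackE[OF f(1) qk], rule that)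
    have l: "k1 \<cdot>\<^bsub>X\<^esub> l \<in> hom X S A" "k2 \<cdot>\<^bsub>X\<^esub> l \<in> hom X S A" using X.comp_hom[OF S(3)] k12 by blast+
    have "f \<cdot>\<^bsub>X\<^esub> y = q \<cdot>\<^bsub>X\<^esub> (k1 \<cdot>\<^bsub>X\<^esub> l)" "f \<cdot>\<^bsub>X\<^esub> y = q \<cdot>\<^bsub>X\<^esub> (k2 \<cdot>\<^bsub>X\<^esub> l)"
      using S(4) X.comp_assoc[OF S(3) k12(1) qh] X.comp_assoc[OF S(3) k12(2) qh] X.coequalizer_homs(3)[OF q qh] by simp_all
    then obtain s1 s2 where s1: "s1 \<in> hom X S X'" "q' \<cdot>\<^bsub>X\<^esub> s1 = y" "f' \<cdot>\<^bsub>X\<^esub> s1 = k1 \<cdot>\<^bsub>X\<^esub> l"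
      and s2: "s2 \<in> hom X S X'" "q' \<cdot>\<^bsub>X\<^esub> s2 = y" "f' \<cdot>\<^bsub>X\<^esub> s2 = k2 \<cdot>\<^bsub>X\<^esub> l"
      using X.pullback_lift[OF X'(1-3) S(2) l(1)] X.pullback_lift[OF X'(1-3) S(2) l(2)] by blast
    have co: "is_coequalizer X s1 s2 q'"
      using st er q X'(1) S(1) s1 s2 X.hom_dom[OF S(2)] X.hom_dom[OF X'(2)]
      unfolding stable_coequalizers_of_equivalence_relations_def by blast
    note \<rho>f' = C.comp_hom[OF U_hom[OF X'(3)] \<rho>h]
    have "F \<cdot> UA q' = \<eta> \<cdot> (\<rho> \<cdot> UA f')" using \<eta>\<rho>[OF X'(3)] U_comp[OF X'(2) f(1)] f(2) X'(4) by simp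
    then obtain c where c: "c \<in> hom C (UO X') D" "p \<cdot> c = UA q'" "r \<cdot> c = \<rho> \<cdot> UA f'"
      using C.pullback_lift[OF PB H(1,2) U_hom[OF X'(2)] \<rho>f'] by blast
    have pc: "p \<cdot> (c \<cdot> UA t) = UA (q' \<cdot>\<^bsub>X\<^esub> t)" "r \<cdot> (c \<cdot> UA t) = \<rho> \<cdot> UA (f' \<cdot>\<^bsub>X\<^esub> t)"
      if "t \<in> hom X T X'" for T t
      using point_map[OF c(1) that H(1)] point_map[OF c(1) that H(2)] c(2,3) U_comp[OF that X'(2)]
        point_assoc[OF \<rho>h X'(3) that] by simp_all
    \<comment> \<open>A point of \<open>D\<close> consists of points of \<open>Y\<close> and
      \<open>P\<close> that agree in \<open>B\<close>; lifting the latter to \<open>A\<close> over a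
      cover gives a point of \<open>X'\<close>.\<close>
    have lsc: "locally_surjective (UO X') D c"
      unfolding locally_surjective_def
    proof (intro conjI ballI c(1))
      fix T x assume T: "T \<in> Obj X" and x: "x \<in> hom C (UO T) D"
      note px = C.comp_hom[OF x H(1)] and rx = C.comp_hom[OF x H(2)]
      obtain t where t: "t \<in> hom X T Y" "UA t = p \<cdot> x" using U_full[OF T Y px] by blast
      obtain T' e a where e: "e \<in> covers X T' T" "a \<in> hom X T' A" "(r \<cdot> x) \<cdot> UA e = \<rho> \<cdot> UA a"
        by (rule presentation_lift[OF \<rho> T rx], rule that)
      note eh = cover_hom[OF e(1)] and te = X.comp_hom[OF cover_hom[OF e(1)] t(1)]
      have "UA (q \<cdot>\<^bsub>X\<^esub> a) = (\<eta> \<cdot> (r \<cdot> x)) \<cdot> UA e"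
        using \<eta>\<rho>[OF e(2)] e(3) point_map[OF rx eh \<eta>(1)] by simp
      also have "\<dots> = (F \<cdot> UA t) \<cdot> UA e"
        using C.comp_square[OF H(4) x H(1) F H(2) \<eta>(1)] t(2) by simp
      also have "\<dots> = UA (f \<cdot>\<^bsub>X\<^esub> (t \<cdot>\<^bsub>X\<^esub> e))"
        using f(2) U_comp[OF t(1) f(1)] U_comp[OF eh X.comp_hom[OF t(1) f(1)]] X.comp_assoc[OF eh t(1) f(1)] by simp
      finally have "f \<cdot>\<^bsub>X\<^esub> (t \<cdot>\<^bsub>X\<^esub> e) = q \<cdot>\<^bsub>X\<^esub> a"
        using U_faithful[OF X.comp_hom[OF te f(1)] X.comp_hom[OF e(2) qh]] by simp
      then obtain \<zeta> where \<zeta>: "\<zeta> \<in> hom X T' X'" "q' \<cdot>\<^bsub>X\<^esub> \<zeta> = t \<cdot>\<^bsub>X\<^esub> e" "f' \<cdot>\<^bsub>X\<^esub> \<zeta> = a"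
        using X.pullback_lift[OF X'(1-3) te e(2)] by blast
      have "c \<cdot> UA \<zeta> = x \<cdot> UA e"
      proof (rule C.pullback_unique[OF PB H(1,2) point_comp[OF c(1) \<zeta>(1)] point_comp[OF x eh]])
        show "p \<cdot> c \<cdot> UA \<zeta> = p \<cdot> x \<cdot> UA e"
          using pc(1)[OF \<zeta>(1)] \<zeta>(2) U_comp[OF eh t(1)] t(2) point_map[OF x eh H(1)] by simp
        show "r \<cdot> c \<cdot> UA \<zeta> = r \<cdot> x \<cdot> UA e"
          using pc(2)[OF \<zeta>(1)] \<zeta>(3) e(3) point_map[OF x eh H(2)] by simp
      qed
      then show "\<exists>T' e y. e \<in> covers X T' T \<and> y \<in> hom C (UO T') (UO X') \<and> c \<cdot> y = x \<cdot> UA e"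
        using e(1) U_hom[OF \<zeta>(1)] by blast
    qed
    have cs: "c \<cdot> UA s1 = c \<cdot> UA s2"
    proof (rule C.pullback_unique[OF PB H(1,2) point_comp[OF c(1) s1(1)] point_comp[OF c(1) s2(1)]])
      show "p \<cdot> c \<cdot> UA s1 = p \<cdot> c \<cdot> UA s2"
        using pc(1)[OF s1(1)] pc(1)[OF s2(1)] s1(2) s2(2) by simp
      show "r \<cdot> c \<cdot> UA s1 = r \<cdot> c \<cdot> UA s2"
        using pc(2)[OF s1(1)] pc(2)[OF s2(1)] s1(3) s2(3) \<rho>k
          point_assoc[OF \<rho>h k12(1) S(3)] point_assoc[OF \<rho>h k12(2) S(3)] by simp
    qed
    have objX': "X' \<in> Obj X" using X.hom_objs[OF X'(2)] by simp
    have "universal D (UO Y) p"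
    proof (rule universalI[OF Y H(1)])
      fix E g assume E: "E \<in> Obj X" and g: "g \<in> hom C D (UO E)"
      obtain u where u: "u \<in> hom X X' E" "UA u = g \<cdot> c" using U_full[OF objX' E C.comp_hom[OF c(1) g]] by blast
      have "UA u \<cdot> UA s1 = UA u \<cdot> UA s2"
        using u(2) point_map[OF c(1) s1(1) g] point_map[OF c(1) s2(1) g] cs by simp
      then have "u \<cdot>\<^bsub>X\<^esub> s1 = u \<cdot>\<^bsub>X\<^esub> s2" using U_comp_eq_iff[OF s1(1) u(1) s2(1) u(1)] by blast
      then obtain h where h: "h \<in> hom X Y E" "h \<cdot>\<^bsub>X\<^esub> q' = u" using X.coequalizer_factor[OF co X'(2) u(1)] by blast
      have "(UA h \<cdot> p) \<cdot> c = g \<cdot> c"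
        using C.comp_assoc[OF c(1) H(1) U_hom[OF h(1)]] c(2) U_comp[OF X'(2) h(1)] h(2) u(2) by simp
      then show "\<exists>h \<in> hom X Y E. UA h \<cdot> p = g"
        using locally_surjective_epi[OF lsc C.comp_hom[OF H(1) U_hom[OF h(1)]] g] h(1) by blast
    next
      fix E h l assume hl: "h \<in> hom X Y E" "l \<in> hom X Y E" "UA h \<cdot> p = UA l \<cdot> p"
      then have "UA h \<cdot> UA q' = UA l \<cdot> UA q'"
        using C.comp_assoc[OF c(1) H(1) U_hom[OF hl(1)]] C.comp_assoc[OF c(1) H(1) U_hom[OF hl(2)]] c(2) by simp
      then have "h \<cdot>\<^bsub>X\<^esub> q' = l \<cdot>\<^bsub>X\<^esub> q'" using U_comp_eq_iff[OF X'(2) hl(1) X'(2) hl(2)] by blast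
      then show "h = l" by (rule X.coequalizer_epi[OF co X'(2) hl(1,2)])
    qed
    then show ?thesis by (simp add: D_def)
  qed
  show thesis by (rule that[OF B uni ls stable])
qed

end

section \<open>Calculus of relations in a regular category\<close>

text \<open>Membership in an isomorphism class of spans. By \<open>relation_member\<close> every
  representative gives the same answer, so the existential quantifier involves no choice.\<close>

definition rel_holds :: "('o, 'a) cat \<Rightarrow> 'a irel \<Rightarrow> 'o \<Rightarrow> 'a \<Rightarrow> 'a \<Rightarrow> bool" where
  "rel_holds C \<phi> T a b \<longleftrightarrow> (\<exists>r \<in> \<phi>. in_span C r T a b)"

context category
begin

lemma span_class_eq:
  assumes "is_mono_span C A B r"
  shows "span_class C A B r = {s. is_mono_span C A B s \<and> (\<forall>T a b. in_span C s T a b \<longleftrightarrow> in_span C r T a b)}"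
  unfolding span_class_def using span_le_iff assms by blast

lemma span_class_relation:
  "is_mono_span C A B r \<Longrightarrow> span_class C A B r \<in> relations C A B"
  by (simp add: relations_def)

lemma span_class_holds:
  "is_mono_span C A B r \<Longrightarrow> rel_holds C (span_class C A B r) T a b \<longleftrightarrow> in_span C r T a b"
  unfolding rel_holds_def using span_class_eq[of A B r] by blast

lemma relation_member:
  assumes "\<phi> \<in> relations C A B" "r \<in> \<phi>"
  shows "is_mono_span C A B r" "rel_holds C \<phi> T a b \<longleftrightarrow> in_span C r T a b"
proof -
  obtain s where s: "is_mono_span C A B s" "\<phi> = span_class C A B s"
    using assms(1) by (auto simp: relations_def)
  show "is_mono_span C A B r" using assms(2) s span_class_eq[OF s(1)] by simp
  show "rel_holds C \<phi> T a b \<longleftrightarrow> in_span C r T a b"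
    using assms(2) s(2) span_class_eq[OF s(1)] span_class_holds[OF s(1)] by simp
qed

lemma relation_span:
  assumes "\<phi> \<in> relations C A B"
  obtains r where "r \<in> \<phi>" "is_mono_span C A B r" "\<And>T a b. rel_holds C \<phi> T a b \<longleftrightarrow> in_span C r T a b"
proof -
  obtain r where r: "is_mono_span C A B r" "\<phi> = span_class C A B r"
    using assms by (auto simp: relations_def)
  then have "r \<in> \<phi>" by (simp add: span_class_eq)
  then show thesis using that relation_member[OF assms] by blast
qed

lemma relation_objs: "\<phi> \<in> relations C A B \<Longrightarrow> A \<in> Obj C \<and> B \<in> Obj C"
  using mono_span_homs hom_objs by (metis relation_span)

text \<open>A relation is the full class of its spans, so extensional equality is literal equality.
  This is what lets the laws of the exact completion hold as equations.\<close>

lemma relation_eqI: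
  assumes "\<phi> \<in> relations C A B" "\<psi> \<in> relations C A B"
    and "\<And>T a b. rel_holds C \<phi> T a b \<longleftrightarrow> rel_holds C \<psi> T a b"
  shows "\<phi> = \<psi>"
proof -
  obtain r where r: "is_mono_span C A B r" "\<phi> = span_class C A B r"
    using assms(1) by (auto simp: relations_def)
  obtain s where s: "is_mono_span C A B s" "\<psi> = span_class C A B s"
    using assms(2) by (auto simp: relations_def)
  show ?thesis
    using assms(3)[unfolded r(2) s(2) span_class_holds[OF r(1)] span_class_holds[OF s(1)]]
    unfolding r(2) s(2) span_class_eq[OF r(1)] span_class_eq[OF s(1)] by simp
qed

lemma rel_le_iff:
  assumes "\<phi> \<in> relations C A B" "\<psi> \<in> relations C A B"
  shows "rel_le C \<phi> \<psi> \<longleftrightarrow> (\<forall>T a b. rel_holds C \<phi> T a b \<longrightarrow> rel_holds C \<psi> T a b)"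
proof -
  have "span_le C r s \<longleftrightarrow> (\<forall>T a b. rel_holds C \<phi> T a b \<longrightarrow> rel_holds C \<psi> T a b)" if "r \<in> \<phi>" "s \<in> \<psi>" for r s
    using relation_member[OF assms(1) that(1)] relation_member[OF assms(2) that(2)] span_le_iff by simp
  moreover obtain r s where "r \<in> \<phi>" "s \<in> \<psi>" using relation_span assms by metis
  ultimately show ?thesis unfolding rel_le_def by blast
qed

lemma holds_homs:
  assumes "\<phi> \<in> relations C A B" "rel_holds C \<phi> T a b"
  shows "a \<in> hom C T A" "b \<in> hom C T B"
  using in_span_homs relation_member[OF assms(1)] assms(2) unfolding rel_holds_def by metis+

lemma holds_comp:
  assumes "\<phi> \<in> relations C A B" "rel_holds C \<phi> T a b" "t \<in> hom C T' T"
  shows "rel_holds C \<phi> T' (a \<cdot> t) (b \<cdot> t)"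
  using in_span_comp relation_member(1)[OF assms(1)] assms(2,3) unfolding rel_holds_def by blast

lemma holds_local:
  assumes "\<phi> \<in> relations C A B" "e \<in> covers C T' T" "a \<in> hom C T A" "b \<in> hom C T B"
    "rel_holds C \<phi> T' (a \<cdot> e) (b \<cdot> e)"
  shows "rel_holds C \<phi> T a b"
  using mono_span_local[OF _ assms(2-4)] relation_member(1)[OF assms(1)] assms(5) unfolding rel_holds_def by blast

lemma mono_span_swap: "is_mono_span C A B r \<Longrightarrow> is_mono_span C B A (snd r, fst r)"
proof -
  assume r: "is_mono_span C A B r"
  note H = mono_span_homs[OF r]
  show ?thesis using mono_spanI[OF H(2,1)] mono_span_cancel[OF r] by blast
qed

lemma in_span_swap: "is_mono_span C A B r \<Longrightarrow> in_span C (snd r, fst r) T b a \<longleftrightarrow> in_span C r T a b"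
  using mono_span_homs[of A B r] by (auto simp: in_span_def hom_def)

lemma rel_opp_relation:
  assumes \<phi>: "\<phi> \<in> relations C A B"
  shows "rel_opp \<phi> \<in> relations C B A" and "rel_holds C (rel_opp \<phi>) T b a \<longleftrightarrow> rel_holds C \<phi> T a b"
proof -
  obtain r where r: "r \<in> \<phi>" "is_mono_span C A B r" "\<And>T a b. rel_holds C \<phi> T a b \<longleftrightarrow> in_span C r T a b"
    by (rule relation_span[OF \<phi>], rule that)
  note ms = mono_span_swap[OF r(2)]
  have mem: "s \<in> \<phi> \<longleftrightarrow> is_mono_span C A B s \<and> (\<forall>T a b. in_span C s T a b \<longleftrightarrow> in_span C r T a b)" for s
  proof -
    obtain r0 where r0: "is_mono_span C A B r0" "\<phi> = span_class C A B r0" using \<phi> by (auto simp: relations_def)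
    show ?thesis using r(1) unfolding r0(2) span_class_eq[OF r0(1)] by simp
  qed
  have "rel_opp \<phi> = span_class C B A (snd r, fst r)"
    unfolding span_class_eq[OF ms]
  proof (rule set_eqI, rule iffI)
    fix s assume s: "s \<in> rel_opp \<phi>"
    then have "(snd s, fst s) \<in> \<phi>" by (cases s) (simp add: rel_opp_def)
    then have m: "is_mono_span C A B (snd s, fst s)"
      and i: "\<And>T a b. in_span C (snd s, fst s) T a b \<longleftrightarrow> in_span C r T a b" using mem by blast+
    show "s \<in> {s. is_mono_span C B A s \<and> (\<forall>T a b. in_span C s T a b \<longleftrightarrow> in_span C (snd r, fst r) T a b)}"
      using mono_span_swap[OF m] in_span_swap[OF m] in_span_swap[OF r(2)] i by simp
  next
    fix s assume "s \<in> {s. is_mono_span C B A s \<and> (\<forall>T a b. in_span C s T a b \<longleftrightarrow> in_span C (snd r, fst r) T a b)}"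
    then have m: "is_mono_span C B A s" and i: "\<And>T a b. in_span C s T a b \<longleftrightarrow> in_span C (snd r, fst r) T a b"
      by blast+
    have "(snd s, fst s) \<in> \<phi>"
      using mem mono_span_swap[OF m] in_span_swap[OF m] i in_span_swap[OF r(2)] by simp
    then show "s \<in> rel_opp \<phi>" by (cases s) (simp add: rel_opp_def)
  qed
  then show "rel_opp \<phi> \<in> relations C B A" "rel_holds C (rel_opp \<phi>) T b a \<longleftrightarrow> rel_holds C \<phi> T a b"
    using span_class_relation[OF ms] span_class_holds[OF ms] in_span_swap[OF r(2)] r(3) by simp_all
qed

lemma rel_graph_relation:
  assumes f: "f \<in> hom C A B"
  shows "rel_graph C f \<in> relations C A B"
    and "rel_holds C (rel_graph C f) T a b \<longleftrightarrow> a \<in> hom C T A \<and> b = f \<cdot> a"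
proof -
  have D: "Dom C f = A" "Cod C f = B" and A: "A \<in> Obj C" using f hom_objs[OF f] by (auto simp: hom_def)
  note i = ident_hom[OF A]
  have ms: "is_mono_span C A B (Ident C A, f)"
    by (rule mono_spanI[OF i f]) (metis ident_left)
  have "in_span C (Ident C A, f) T a b \<longleftrightarrow> a \<in> hom C T A \<and> b = f \<cdot> a"
    using hom_dom[OF i] ident_left by (auto simp: in_span_def)
  then show "rel_graph C f \<in> relations C A B"
    "rel_holds C (rel_graph C f) T a b \<longleftrightarrow> a \<in> hom C T A \<and> b = f \<cdot> a"
    using span_class_relation[OF ms] span_class_holds[OF ms] by (simp_all add: rel_graph_def D)
qed

end

section \<open>Composition of relations\<close>

context regular_category
begin

text \<open>Independence of choices: whichever representatives, pullback and factorization are used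
  for the composite, its elements are the pairs that locally share a middle element
  \<open>b\<close>.\<close>

lemma rel_comp_spans:
  assumes \<phi>: "\<phi> \<in> relations C A B" and \<psi>: "\<psi> \<in> relations C B D" and rs: "r \<in> \<phi>" "s \<in> \<psi>"
    and P: "is_pullback C (snd r) (fst s) p q" and e: "is_regular_epi C e" "e \<in> hom C (Dom C p) (Dom C (fst t))"
    and t: "is_mono_span C (Cod C (fst t)) (Cod C (snd t)) t" "fst t \<cdot> e = fst r \<cdot> p" "snd t \<cdot> e = snd s \<cdot> q"
  shows "is_mono_span C A D t"
    and "in_span C t T a c \<longleftrightarrow> a \<in> hom C T A \<and> c \<in> hom C T D \<and>
      (\<exists>T' d b. d \<in> covers C T' T \<and> rel_holds C \<phi> T' (a \<cdot> d) b \<and> rel_holds C \<psi> T' b (c \<cdot> d))"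
proof -
  note r = relation_member[OF \<phi> rs(1)] and s = relation_member[OF \<psi> rs(2)]
  note R = mono_span_homs[OF r(1)] and S = mono_span_homs[OF s(1)]
  note p = pullback_homs[OF P R(2) S(1)]
  note rp = comp_hom[OF p(1) R(1)] and sq = comp_hom[OF p(2) S(2)]
  \<comment> \<open>\<open>rel_comp\<close> types \<open>t\<close> only by its own codomains; the
    equations with \<open>e\<close> identify these as \<open>A\<close> and \<open>D\<close>.\<close>
  have "Cod C (fst t \<cdot> e) = Cod C (fst t)" "Cod C (snd t \<cdot> e) = Cod C (snd t)"
    using comp_hom[OF e(2)] mono_span_homs[OF t(1)] hom_cod by blast+
  then have "Cod C (fst t) = A" "Cod C (snd t) = D" using t rp sq by (auto simp: hom_def)
  then show ms: "is_mono_span C A D t" using t(1) by simp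
  have im: "in_span C t T a c \<longleftrightarrow>
    (\<exists>T' d x. d \<in> covers C T' T \<and> x \<in> hom C T' (Dom C p) \<and> (fst r \<cdot> p) \<cdot> x = a \<cdot> d \<and> (snd s \<cdot> q) \<cdot> x = c \<cdot> d)"
    if "a \<in> hom C T A" "c \<in> hom C T D"
    using in_image_span[OF rp sq ms coversI[OF e] t(2,3) that] .
  \<comment> \<open>An element of the pullback is a pair of witnesses with the same
    \<open>b\<close>; the cover \<open>d\<close> comes only from the image.\<close>
  have "(\<exists>x \<in> hom C T' (Dom C p). (fst r \<cdot> p) \<cdot> x = a' \<and> (snd s \<cdot> q) \<cdot> x = c') \<longleftrightarrow>
      (\<exists>b. rel_holds C \<phi> T' a' b \<and> rel_holds C \<psi> T' b c')" for T' a' c'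
  proof
    assume "\<exists>x \<in> hom C T' (Dom C p). (fst r \<cdot> p) \<cdot> x = a' \<and> (snd s \<cdot> q) \<cdot> x = c'"
    then obtain x where x: "x \<in> hom C T' (Dom C p)" "(fst r \<cdot> p) \<cdot> x = a'" "(snd s \<cdot> q) \<cdot> x = c'" by blast
    have 1: "in_span C r T' a' (snd r \<cdot> (p \<cdot> x))"
      unfolding in_span_def using comp_hom[OF x(1) p(1)] comp_assoc[OF x(1) p(1) R(1)] x(2) by auto
    have "in_span C s T' (fst s \<cdot> (q \<cdot> x)) c'"
      unfolding in_span_def using comp_hom[OF x(1) p(2)] comp_assoc[OF x(1) p(2) S(2)] x(3) by auto
    moreover have "snd r \<cdot> (p \<cdot> x) = fst s \<cdot> (q \<cdot> x)"
      using comp_square[OF p(4) x(1) p(1) R(2) p(2) S(1)] .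
    ultimately show "\<exists>b. rel_holds C \<phi> T' a' b \<and> rel_holds C \<psi> T' b c'" using 1 r(2) s(2) by auto
  next
    assume "\<exists>b. rel_holds C \<phi> T' a' b \<and> rel_holds C \<psi> T' b c'"
    then obtain y z where y: "y \<in> hom C T' (Dom C (fst r))" "fst r \<cdot> y = a'"
      and z: "z \<in> hom C T' (Dom C (fst s))" "snd s \<cdot> z = c'" and yz: "snd r \<cdot> y = fst s \<cdot> z"
      unfolding r(2) s(2) in_span_def by auto
    then obtain x where "x \<in> hom C T' (Dom C p)" "p \<cdot> x = y" "q \<cdot> x = z"
      using pullback_lift[OF P p(1,2) y(1) z(1)] by blast
    then show "\<exists>x \<in> hom C T' (Dom C p). (fst r \<cdot> p) \<cdot> x = a' \<and> (snd s \<cdot> q) \<cdot> x = c'"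
      using comp_assoc[OF _ p(1) R(1)] comp_assoc[OF _ p(2) S(2)] y z by auto
  qed
  then show "in_span C t T a c \<longleftrightarrow> a \<in> hom C T A \<and> c \<in> hom C T D \<and>
      (\<exists>T' d b. d \<in> covers C T' T \<and> rel_holds C \<phi> T' (a \<cdot> d) b \<and> rel_holds C \<psi> T' b (c \<cdot> d))"
    using im in_span_homs[OF ms, of T a c] by blast
qed

text \<open>One composite \<open>t\<close> is built by pullback and image. All other members of
  \<open>rel_comp\<close> have the same elements by \<open>rel_comp_spans\<close>; conversely a span
  isomorphic to \<open>t\<close> is a member, because the factorization of \<open>t\<close> can be
  continued by the isomorphism.\<close>

lemma
  assumes \<phi>: "\<phi> \<in> relations C A B" and \<psi>: "\<psi> \<in> relations C B D"
  shows rel_comp_relation: "rel_comp C \<psi> \<phi> \<in> relations C A D"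
    and rel_comp_holds: "rel_holds C (rel_comp C \<psi> \<phi>) T a c \<longleftrightarrow> a \<in> hom C T A \<and> c \<in> hom C T D \<and>
      (\<exists>T' d b. d \<in> covers C T' T \<and> rel_holds C \<phi> T' (a \<cdot> d) b \<and> rel_holds C \<psi> T' b (c \<cdot> d))"
proof -
  obtain r where r: "r \<in> \<phi>" "is_mono_span C A B r" by (rule relation_span[OF \<phi>])
  obtain s where s: "s \<in> \<psi>" "is_mono_span C B D s" by (rule relation_span[OF \<psi>])
  note R = mono_span_homs[OF r(2)] and S = mono_span_homs[OF s(2)]
  obtain P p q where P: "is_pullback C (snd r) (fst s) p q" "p \<in> hom C P (Dom C (fst r))"
    "q \<in> hom C P (Dom C (fst s))" "snd r \<cdot> p = fst s \<cdot> q"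
    by (rule pullbackE[OF R(2) S(1)], rule that)
  note rp = comp_hom[OF P(2) R(1)] and sq = comp_hom[OF P(3) S(2)]
  obtain t e where t: "is_mono_span C A D t" "e \<in> covers C P (Dom C (fst t))"
    "fst t \<cdot> e = fst r \<cdot> p" "snd t \<cdot> e = snd s \<cdot> q"
    by (rule image_span[OF rp sq], rule that)
  have eh: "e \<in> hom C (Dom C p) (Dom C (fst t))" using cover_hom[OF t(2)] hom_dom[OF P(2)] by simp
  have tms: "is_mono_span C (Cod C (fst t)) (Cod C (snd t)) t"
    using t(1) mono_span_homs[OF t(1)] hom_cod by metis
  note ti = rel_comp_spans(2)[OF \<phi> \<psi> r(1) s(1) P(1) cover_regular_epi[OF t(2)] eh tms t(3,4)]
  have "rel_comp C \<psi> \<phi> = span_class C A D t"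
    unfolding span_class_eq[OF t(1)]
  proof (rule set_eqI, rule iffI)
    fix t' assume "t' \<in> rel_comp C \<psi> \<phi>"
    then obtain r' s' p' q' e' where t': "is_mono_span C (Cod C (fst t')) (Cod C (snd t')) t'"
      and h: "r' \<in> \<phi>" "s' \<in> \<psi>" "is_pullback C (snd r') (fst s') p' q'" "is_regular_epi C e'"
        "e' \<in> hom C (Dom C p') (Dom C (fst t'))"
      and h': "fst t' \<cdot> e' = fst r' \<cdot> p'" "snd t' \<cdot> e' = snd s' \<cdot> q'"
      unfolding rel_comp_def by blast
    show "t' \<in> {s. is_mono_span C A D s \<and> (\<forall>T a b. in_span C s T a b \<longleftrightarrow> in_span C t T a b)}"
      using rel_comp_spans[OF \<phi> \<psi> h t' h'] ti by simp
  next
    fix t' assume "t' \<in> {s. is_mono_span C A D s \<and> (\<forall>T a b. in_span C s T a b \<longleftrightarrow> in_span C t T a b)}"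
    then have t': "is_mono_span C A D t'" "\<And>T a b. in_span C t' T a b \<longleftrightarrow> in_span C t T a b" by blast+
    note H = mono_span_homs[OF t(1)] and H' = mono_span_homs[OF t'(1)]
    obtain h where h: "h \<in> hom C (Dom C (fst t)) (Dom C (fst t'))" "fst t' \<cdot> h = fst t" "snd t' \<cdot> h = snd t"
      using t'(2) in_span_legs[OF t(1)] unfolding in_span_def by blast
    obtain k where k: "k \<in> hom C (Dom C (fst t')) (Dom C (fst t))" "fst t \<cdot> k = fst t'" "snd t \<cdot> k = snd t'"
      using t'(2) in_span_legs[OF t'(1)] unfolding in_span_def by blast
    have objs: "Dom C (fst t) \<in> Obj C" "Dom C (fst t') \<in> Obj C" using hom_objs[OF h(1)] by auto
    have "h \<cdot> k = Ident C (Dom C (fst t'))"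
    proof (rule mono_span_cancel[OF t'(1) comp_hom[OF k(1) h(1)] ident_hom[OF objs(2)]])
      show "fst t' \<cdot> h \<cdot> k = fst t' \<cdot> Ident C (Dom C (fst t'))"
        using comp_reassoc[OF h(2) k(1) h(1) H'(1)] k(2) ident_right[OF H'(1)] by simp
      show "snd t' \<cdot> h \<cdot> k = snd t' \<cdot> Ident C (Dom C (fst t'))"
        using comp_reassoc[OF h(3) k(1) h(1) H'(2)] k(3) ident_right[OF H'(2)] by simp
    qed
    moreover have "k \<cdot> h = Ident C (Dom C (fst t))"
    proof (rule mono_span_cancel[OF t(1) comp_hom[OF h(1) k(1)] ident_hom[OF objs(1)]])
      show "fst t \<cdot> k \<cdot> h = fst t \<cdot> Ident C (Dom C (fst t))"
        using comp_reassoc[OF k(2) h(1) k(1) H(1)] h(2) ident_right[OF H(1)] by simp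
      show "snd t \<cdot> k \<cdot> h = snd t \<cdot> Ident C (Dom C (fst t))"
        using comp_reassoc[OF k(3) h(1) k(1) H(2)] h(3) ident_right[OF H(2)] by simp
    qed
    ultimately have iso: "is_iso C h" using isoI[OF h(1) k(1)] by blast
    have "is_regular_epi C (h \<cdot> e)"
      using iso_comp_regular_epi[OF cover_regular_epi[OF t(2)] cover_hom[OF t(2)] iso h(1)] .
    moreover have "h \<cdot> e \<in> hom C (Dom C p) (Dom C (fst t'))" using comp_hom[OF eh h(1)] .
    moreover have "fst t' \<cdot> (h \<cdot> e) = fst r \<cdot> p" "snd t' \<cdot> (h \<cdot> e) = snd s \<cdot> q"
      using comp_reassoc[OF h(2) eh h(1) H'(1)] comp_reassoc[OF h(3) eh h(1) H'(2)] t(3,4) by simp_all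
    moreover have "is_mono_span C (Cod C (fst t')) (Cod C (snd t')) t'"
      using t'(1) H' hom_cod by metis
    ultimately show "t' \<in> rel_comp C \<psi> \<phi>" unfolding rel_comp_def using r(1) s(1) P(1) by blast
  qed
  then show "rel_comp C \<psi> \<phi> \<in> relations C A D"
    "rel_holds C (rel_comp C \<psi> \<phi>) T a c \<longleftrightarrow> a \<in> hom C T A \<and> c \<in> hom C T D \<and>
      (\<exists>T' d b. d \<in> covers C T' T \<and> rel_holds C \<phi> T' (a \<cdot> d) b \<and> rel_holds C \<psi> T' b (c \<cdot> d))"
    using span_class_relation[OF t(1)] span_class_holds[OF t(1)] ti by simp_all
qed

lemma rel_compI:
  assumes \<phi>: "\<phi> \<in> relations C A B" and \<psi>: "\<psi> \<in> relations C B D"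
    and h: "rel_holds C \<phi> T a b" "rel_holds C \<psi> T b c"
  shows "rel_holds C (rel_comp C \<psi> \<phi>) T a c"
proof -
  note a = holds_homs[OF \<phi> h(1)] and c = holds_homs[OF \<psi> h(2)]
  have T: "T \<in> Obj C" using hom_objs[OF a(1)] by simp
  show ?thesis
    unfolding rel_comp_holds[OF \<phi> \<psi>]
    using a(1) c(2) cover_ident[OF T] ident_right[OF a(1)] ident_right[OF c(2)] h by metis
qed

lemma rel_compE:
  assumes \<phi>: "\<phi> \<in> relations C A B" and \<psi>: "\<psi> \<in> relations C B D"
    and h: "rel_holds C (rel_comp C \<psi> \<phi>) T a c"
  obtains T' d b where "a \<in> hom C T A" "c \<in> hom C T D" "d \<in> covers C T' T"
    "rel_holds C \<phi> T' (a \<cdot> d) b" "rel_holds C \<psi> T' b (c \<cdot> d)"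
  using h unfolding rel_comp_holds[OF \<phi> \<psi>] by blast

lemma rel_comp_local:
  assumes \<phi>: "\<phi> \<in> relations C A B" and \<psi>: "\<psi> \<in> relations C B D"
    and d: "d \<in> covers C T' T" and ac: "a \<in> hom C T A" "c \<in> hom C T D"
    and h: "rel_holds C \<phi> T' (a \<cdot> d) b" "rel_holds C \<psi> T' b (c \<cdot> d)"
  shows "rel_holds C (rel_comp C \<psi> \<phi>) T a c"
  using holds_local[OF rel_comp_relation[OF \<phi> \<psi>] d ac rel_compI[OF \<phi> \<psi> h]] .

text \<open>Both sides say that two middle elements exist over some cover; the covers from the two
  composites are composed.\<close>

lemma rel_comp_assoc:
  assumes \<phi>: "\<phi> \<in> relations C A B" and \<psi>: "\<psi> \<in> relations C B D" and \<chi>: "\<chi> \<in> relations C D E"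
  shows "rel_comp C \<chi> (rel_comp C \<psi> \<phi>) = rel_comp C (rel_comp C \<chi> \<psi>) \<phi>"
proof -
  note \<psi>\<phi> = rel_comp_relation[OF \<phi> \<psi>] and \<chi>\<psi> = rel_comp_relation[OF \<psi> \<chi>]
  show ?thesis
  proof (rule relation_eqI[OF rel_comp_relation[OF \<psi>\<phi> \<chi>] rel_comp_relation[OF \<phi> \<chi>\<psi>]], rule iffI)
    fix T a c assume "rel_holds C (rel_comp C \<chi> (rel_comp C \<psi> \<phi>)) T a c"
    then obtain T1 d b where ac: "a \<in> hom C T A" "c \<in> hom C T E" and d: "d \<in> covers C T1 T"
      and ab: "rel_holds C (rel_comp C \<psi> \<phi>) T1 (a \<cdot> d) b" and bc: "rel_holds C \<chi> T1 b (c \<cdot> d)"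
      by (rule rel_compE[OF \<psi>\<phi> \<chi>])
    obtain T2 e x where e: "e \<in> covers C T2 T1" and ax: "rel_holds C \<phi> T2 ((a \<cdot> d) \<cdot> e) x"
      and xb: "rel_holds C \<psi> T2 x (b \<cdot> e)"
      by (rule rel_compE[OF \<phi> \<psi> ab], rule that)
    note dh = cover_hom[OF d] and eh = cover_hom[OF e]
    have "rel_holds C (rel_comp C \<chi> \<psi>) T2 x ((c \<cdot> d) \<cdot> e)"
      using rel_compI[OF \<psi> \<chi> xb holds_comp[OF \<chi> bc eh]] .
    then show "rel_holds C (rel_comp C (rel_comp C \<chi> \<psi>) \<phi>) T a c"
      using rel_comp_local[OF \<phi> \<chi>\<psi> cover_comp[OF e d] ac] ax comp_assoc[OF eh dh ac(1)] comp_assoc[OF eh dh ac(2)]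
      by simp
  next
    fix T a c assume "rel_holds C (rel_comp C (rel_comp C \<chi> \<psi>) \<phi>) T a c"
    then obtain T1 d b where ac: "a \<in> hom C T A" "c \<in> hom C T E" and d: "d \<in> covers C T1 T"
      and ab: "rel_holds C \<phi> T1 (a \<cdot> d) b" and bc: "rel_holds C (rel_comp C \<chi> \<psi>) T1 b (c \<cdot> d)"
      by (rule rel_compE[OF \<phi> \<chi>\<psi>])
    obtain T2 e x where e: "e \<in> covers C T2 T1" and bx: "rel_holds C \<psi> T2 (b \<cdot> e) x"
      and xc: "rel_holds C \<chi> T2 x ((c \<cdot> d) \<cdot> e)"
      by (rule rel_compE[OF \<psi> \<chi> bc], rule that)
    note dh = cover_hom[OF d] and eh = cover_hom[OF e]
    have "rel_holds C (rel_comp C \<psi> \<phi>) T2 ((a \<cdot> d) \<cdot> e) x"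
      using rel_compI[OF \<phi> \<psi> holds_comp[OF \<phi> ab eh] bx] .
    then show "rel_holds C (rel_comp C \<chi> (rel_comp C \<psi> \<phi>)) T a c"
      using rel_comp_local[OF \<psi>\<phi> \<chi> cover_comp[OF e d] ac] xc comp_assoc[OF eh dh ac(1)] comp_assoc[OF eh dh ac(2)]
      by simp
  qed
qed

text \<open>Composition with a graph is substitution. The cover in the composite disappears because
  membership in \<open>\<phi>\<close> is local.\<close>

lemma rel_comp_graph_holds:
  assumes \<phi>: "\<phi> \<in> relations C A B" and t: "t \<in> hom C A' A"
  shows "rel_holds C (rel_comp C \<phi> (rel_graph C t)) T s b \<longleftrightarrow> s \<in> hom C T A' \<and> rel_holds C \<phi> T (t \<cdot> s) b"
proof
  note g = rel_graph_relation[OF t]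
  assume "rel_holds C (rel_comp C \<phi> (rel_graph C t)) T s b"
  then obtain T' d x where sb: "s \<in> hom C T A'" "b \<in> hom C T B" and d: "d \<in> covers C T' T"
    and 1: "rel_holds C (rel_graph C t) T' (s \<cdot> d) x" and 2: "rel_holds C \<phi> T' x (b \<cdot> d)"
    by (rule rel_compE[OF g(1) \<phi>])
  have "rel_holds C \<phi> T' ((t \<cdot> s) \<cdot> d) (b \<cdot> d)"
    using 1 2 g(2) comp_assoc[OF cover_hom[OF d] sb(1) t] by simp
  then show "s \<in> hom C T A' \<and> rel_holds C \<phi> T (t \<cdot> s) b"
    using holds_local[OF \<phi> d comp_hom[OF sb(1) t] sb(2)] sb(1) by blast
next
  note g = rel_graph_relation[OF t]
  assume "s \<in> hom C T A' \<and> rel_holds C \<phi> T (t \<cdot> s) b"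
  then show "rel_holds C (rel_comp C \<phi> (rel_graph C t)) T s b"
    using rel_compI[OF g(1) \<phi>] g(2) by blast
qed

section \<open>The exact completion is a category\<close>

lemma ex_objs_iff:
  "(A, R) \<in> ex_objs C \<longleftrightarrow> R \<in> relations C A A \<and>
    (\<forall>T a. a \<in> hom C T A \<longrightarrow> rel_holds C R T a a) \<and>
    (\<forall>T a b. rel_holds C R T a b \<longrightarrow> rel_holds C R T b a) \<and>
    (\<forall>T a b c. rel_holds C R T a b \<longrightarrow> rel_holds C R T b c \<longrightarrow> rel_holds C R T a c)"
proof (cases "R \<in> relations C A A")
  case True
  obtain r where r: "r \<in> R" "is_mono_span C A A r" by (rule relation_span[OF True])
  have "is_equivalence_relation C A s \<longleftrightarrow> is_equivalence_relation C A r" if "s \<in> R" for s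
    unfolding equivalence_relation_iff
    using relation_member[OF True that] relation_member[OF True r(1)] by simp
  then have "(\<exists>s \<in> R. is_equivalence_relation C A s) \<longleftrightarrow> is_equivalence_relation C A r" using r(1) by blast
  also have "\<dots> \<longleftrightarrow> (\<forall>T a. a \<in> hom C T A \<longrightarrow> rel_holds C R T a a) \<and>
    (\<forall>T a b. rel_holds C R T a b \<longrightarrow> rel_holds C R T b a) \<and>
    (\<forall>T a b c. rel_holds C R T a b \<longrightarrow> rel_holds C R T b c \<longrightarrow> rel_holds C R T a c)"
    unfolding equivalence_relation_iff using relation_member[OF True r(1)] by simp
  finally show ?thesis using True relation_objs[OF True] by (simp add: ex_objs_def)
qed (simp add: ex_objs_def)

lemma ex_obj_relation: "(A, R) \<in> ex_objs C \<Longrightarrow> R \<in> relations C A A"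
  and ex_obj_refl: "(A, R) \<in> ex_objs C \<Longrightarrow> a \<in> hom C T A \<Longrightarrow> rel_holds C R T a a"
  and ex_obj_sym: "(A, R) \<in> ex_objs C \<Longrightarrow> rel_holds C R T a b \<Longrightarrow> rel_holds C R T b a"
  and ex_obj_trans: "(A, R) \<in> ex_objs C \<Longrightarrow> rel_holds C R T a b \<Longrightarrow> rel_holds C R T b c \<Longrightarrow> rel_holds C R T a c"
  unfolding ex_objs_iff by blast+

text \<open>The elementwise reading of an arrow of the exact completion: closed under both
  equivalence relations, total up to a cover, single-valued up to \<open>S\<close>.\<close>

definition functional where
  "functional R S A B \<phi> \<longleftrightarrow> \<phi> \<in> relations C A B \<and>
    (\<forall>T a a' b b'. rel_holds C R T a a' \<longrightarrow> rel_holds C \<phi> T a b \<longrightarrow> rel_holds C S T b b' \<longrightarrow> rel_holds C \<phi> T a' b') \<and>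
    (\<forall>T a. a \<in> hom C T A \<longrightarrow> (\<exists>T' e b. e \<in> covers C T' T \<and> rel_holds C \<phi> T' (a \<cdot> e) b)) \<and>
    (\<forall>T a b b'. rel_holds C \<phi> T a b \<longrightarrow> rel_holds C \<phi> T a b' \<longrightarrow> rel_holds C S T b b')"

lemma functional_relation: "functional R S A B \<phi> \<Longrightarrow> \<phi> \<in> relations C A B"
  by (simp add: functional_def)

lemma functional_saturated:
  "functional R S A B \<phi> \<Longrightarrow> rel_holds C R T a a' \<Longrightarrow> rel_holds C \<phi> T a b \<Longrightarrow> rel_holds C S T b b' \<Longrightarrow> rel_holds C \<phi> T a' b'"
  unfolding functional_def by blast

lemma functional_total:
  assumes "functional R S A B \<phi>" "a \<in> hom C T A"
  obtains T' e b where "e \<in> covers C T' T" "rel_holds C \<phi> T' (a \<cdot> e) b"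
  using assms unfolding functional_def by blast

lemma functional_unique:
  "functional R S A B \<phi> \<Longrightarrow> rel_holds C \<phi> T a b \<Longrightarrow> rel_holds C \<phi> T a b' \<Longrightarrow> rel_holds C S T b b'"
  unfolding functional_def by blast

lemma functionalI:
  assumes "\<phi> \<in> relations C A B"
    and "\<And>T a a' b b'. rel_holds C R T a a' \<Longrightarrow> rel_holds C \<phi> T a b \<Longrightarrow> rel_holds C S T b b' \<Longrightarrow> rel_holds C \<phi> T a' b'"
    and "\<And>T a. a \<in> hom C T A \<Longrightarrow> \<exists>T' e b. e \<in> covers C T' T \<and> rel_holds C \<phi> T' (a \<cdot> e) b"
    and "\<And>T a b b'. rel_holds C \<phi> T a b \<Longrightarrow> rel_holds C \<phi> T a b' \<Longrightarrow> rel_holds C S T b b'"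
  shows "functional R S A B \<phi>"
  unfolding functional_def using assms by blast

text \<open>Each of the three conditions that define an arrow corresponds to one clause of
  \<open>functional\<close>. The translation of totality relies on closure: a value of
  \<open>a\<close> is also a value of any \<open>a'\<close> that \<open>R\<close> relates to
  it.\<close>

lemma ex_arrs_iff:
  assumes A: "(A, R) \<in> ex_objs C" and B: "(B, S) \<in> ex_objs C"
  shows "((A, R), \<phi>, (B, S)) \<in> ex_arrs C \<longleftrightarrow> functional R S A B \<phi>"
proof (cases "\<phi> \<in> relations C A B")
  case \<phi>: True
  note R = ex_obj_relation[OF A] and S = ex_obj_relation[OF B]
  note o = rel_opp_relation[OF \<phi>]
  note \<phi>R = rel_comp_relation[OF R \<phi>] and S\<phi>R = rel_comp_relation[OF rel_comp_relation[OF R \<phi>] S]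
  note o\<phi> = rel_comp_relation[OF \<phi> o(1)] and \<phi>o = rel_comp_relation[OF o(1) \<phi>]
  let ?sat = "\<forall>T a a' b b'. rel_holds C R T a a' \<longrightarrow> rel_holds C \<phi> T a b \<longrightarrow> rel_holds C S T b b' \<longrightarrow> rel_holds C \<phi> T a' b'"
  let ?tot = "\<forall>T a. a \<in> hom C T A \<longrightarrow> (\<exists>T' e b. e \<in> covers C T' T \<and> rel_holds C \<phi> T' (a \<cdot> e) b)"
  let ?sv = "\<forall>T a b b'. rel_holds C \<phi> T a b \<longrightarrow> rel_holds C \<phi> T a b' \<longrightarrow> rel_holds C S T b b'"
  have sat: "rel_comp C S (rel_comp C \<phi> R) = \<phi> \<longleftrightarrow> ?sat"
  proof
    assume eq: "rel_comp C S (rel_comp C \<phi> R) = \<phi>"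
    show ?sat
    proof (intro allI impI)
      fix T a a' b b' assume "rel_holds C R T a a'" "rel_holds C \<phi> T a b" "rel_holds C S T b b'"
      then show "rel_holds C \<phi> T a' b'"
        using rel_compI[OF \<phi>R S rel_compI[OF R \<phi>]] ex_obj_sym[OF A] eq by metis
    qed
  next
    assume sat: ?sat
    show "rel_comp C S (rel_comp C \<phi> R) = \<phi>"
    proof (rule relation_eqI[OF S\<phi>R \<phi>], rule iffI)
      fix T a b assume "rel_holds C (rel_comp C S (rel_comp C \<phi> R)) T a b"
      then obtain T1 d x where ab: "a \<in> hom C T A" "b \<in> hom C T B" and d: "d \<in> covers C T1 T"
        and ax: "rel_holds C (rel_comp C \<phi> R) T1 (a \<cdot> d) x" and xb: "rel_holds C S T1 x (b \<cdot> d)"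
        by (rule rel_compE[OF \<phi>R S])
      obtain T2 e y where ad: "a \<cdot> d \<in> hom C T1 A" and e: "e \<in> covers C T2 T1"
        and ay: "rel_holds C R T2 ((a \<cdot> d) \<cdot> e) y" and yx: "rel_holds C \<phi> T2 y (x \<cdot> e)"
        by (rule rel_compE[OF R \<phi> ax], rule that)
      note bd = comp_hom[OF cover_hom[OF d] ab(2)]
      have "rel_holds C \<phi> T2 ((a \<cdot> d) \<cdot> e) ((b \<cdot> d) \<cdot> e)"
        using sat ex_obj_sym[OF A ay] yx holds_comp[OF S xb cover_hom[OF e]] by blast
      then have "rel_holds C \<phi> T1 (a \<cdot> d) (b \<cdot> d)" by (rule holds_local[OF \<phi> e ad bd])
      then show "rel_holds C \<phi> T a b" by (rule holds_local[OF \<phi> d ab])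
    next
      fix T a b assume h: "rel_holds C \<phi> T a b"
      note ab = holds_homs[OF \<phi> h]
      show "rel_holds C (rel_comp C S (rel_comp C \<phi> R)) T a b"
        using rel_compI[OF \<phi>R S rel_compI[OF R \<phi> ex_obj_refl[OF A ab(1)] h] ex_obj_refl[OF B ab(2)]] .
    qed
  qed
  have tot: "rel_le C R (rel_comp C (rel_opp \<phi>) \<phi>) \<longleftrightarrow> ?tot" if sat: ?sat
    unfolding rel_le_iff[OF R o\<phi>]
  proof
    assume le: "\<forall>T a b. rel_holds C R T a b \<longrightarrow> rel_holds C (rel_comp C (rel_opp \<phi>) \<phi>) T a b"
    show ?tot
    proof (intro allI impI)
      fix T a assume "a \<in> hom C T A"
      then have "rel_holds C (rel_comp C (rel_opp \<phi>) \<phi>) T a a" using le ex_obj_refl[OF A] by blast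
      then show "\<exists>T' e b. e \<in> covers C T' T \<and> rel_holds C \<phi> T' (a \<cdot> e) b"
        using rel_compE[OF \<phi> o(1)] by metis
    qed
  next
    assume tot: ?tot
    show "\<forall>T a b. rel_holds C R T a b \<longrightarrow> rel_holds C (rel_comp C (rel_opp \<phi>) \<phi>) T a b"
    proof (intro allI impI)
      fix T a a' assume h: "rel_holds C R T a a'"
      note aa = holds_homs[OF R h]
      obtain T' e b where e: "e \<in> covers C T' T" "rel_holds C \<phi> T' (a \<cdot> e) b" using tot aa(1) by blast
      have "rel_holds C \<phi> T' (a' \<cdot> e) b"
        using sat holds_comp[OF R h cover_hom[OF e(1)]] e(2) ex_obj_refl[OF B holds_homs(2)[OF \<phi> e(2)]] by blast
      then show "rel_holds C (rel_comp C (rel_opp \<phi>) \<phi>) T a a'"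
        using rel_comp_local[OF \<phi> o(1) e(1) aa e(2)] o(2) by blast
    qed
  qed
  have sv: "rel_le C (rel_comp C \<phi> (rel_opp \<phi>)) S \<longleftrightarrow> ?sv"
    unfolding rel_le_iff[OF \<phi>o S]
  proof
    assume le: "\<forall>T a b. rel_holds C (rel_comp C \<phi> (rel_opp \<phi>)) T a b \<longrightarrow> rel_holds C S T a b"
    show ?sv using rel_compI[OF o(1) \<phi>] o(2) le by blast
  next
    assume sv: ?sv
    show "\<forall>T a b. rel_holds C (rel_comp C \<phi> (rel_opp \<phi>)) T a b \<longrightarrow> rel_holds C S T a b"
    proof (intro allI impI)
      fix T b b' assume "rel_holds C (rel_comp C \<phi> (rel_opp \<phi>)) T b b'"
      then obtain T' d a where bb: "b \<in> hom C T B" "b' \<in> hom C T B" and d: "d \<in> covers C T' T"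
        and h: "rel_holds C (rel_opp \<phi>) T' (b \<cdot> d) a" "rel_holds C \<phi> T' a (b' \<cdot> d)"
        by (rule rel_compE[OF o(1) \<phi>])
      then have "rel_holds C S T' (b \<cdot> d) (b' \<cdot> d)" using sv o(2) by blast
      then show "rel_holds C S T b b'" by (rule holds_local[OF S d bb])
    qed
  qed
  show ?thesis
    unfolding ex_arrs_def functional_def using A B \<phi> sat tot sv by auto
qed (simp add: ex_arrs_def functional_def)

lemma functional_comp_left:
  assumes A: "(A, R) \<in> ex_objs C" and B: "(B, S) \<in> ex_objs C" and f: "functional R S A B \<phi>"
  shows "rel_comp C S \<phi> = \<phi>"
proof -
  note \<phi> = functional_relation[OF f] and S = ex_obj_relation[OF B]
  show ?thesis
  proof (rule relation_eqI[OF rel_comp_relation[OF \<phi> S] \<phi>], rule iffI)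
    fix T a b assume "rel_holds C (rel_comp C S \<phi>) T a b"
    then obtain T' d x where ab: "a \<in> hom C T A" "b \<in> hom C T B" and d: "d \<in> covers C T' T"
      and h: "rel_holds C \<phi> T' (a \<cdot> d) x" "rel_holds C S T' x (b \<cdot> d)"
      by (rule rel_compE[OF \<phi> S])
    have "rel_holds C \<phi> T' (a \<cdot> d) (b \<cdot> d)"
      using functional_saturated[OF f ex_obj_refl[OF A] h] holds_homs(1)[OF \<phi> h(1)] by blast
    then show "rel_holds C \<phi> T a b" by (rule holds_local[OF \<phi> d ab])
  next
    fix T a b assume h: "rel_holds C \<phi> T a b"
    then show "rel_holds C (rel_comp C S \<phi>) T a b"
      using rel_compI[OF \<phi> S h ex_obj_refl[OF B]] holds_homs(2)[OF \<phi> h] by blast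
  qed
qed

lemma functional_comp_right:
  assumes A: "(A, R) \<in> ex_objs C" and B: "(B, S) \<in> ex_objs C" and f: "functional R S A B \<phi>"
  shows "rel_comp C \<phi> R = \<phi>"
proof -
  note \<phi> = functional_relation[OF f] and R = ex_obj_relation[OF A]
  show ?thesis
  proof (rule relation_eqI[OF rel_comp_relation[OF R \<phi>] \<phi>], rule iffI)
    fix T a b assume "rel_holds C (rel_comp C \<phi> R) T a b"
    then obtain T' d x where ab: "a \<in> hom C T A" "b \<in> hom C T B" and d: "d \<in> covers C T' T"
      and h: "rel_holds C R T' (a \<cdot> d) x" "rel_holds C \<phi> T' x (b \<cdot> d)"
      by (rule rel_compE[OF R \<phi>])
    have "rel_holds C \<phi> T' (a \<cdot> d) (b \<cdot> d)"
      using functional_saturated[OF f ex_obj_sym[OF A h(1)] h(2) ex_obj_refl[OF B]] holds_homs(2)[OF \<phi> h(2)] by blast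
    then show "rel_holds C \<phi> T a b" by (rule holds_local[OF \<phi> d ab])
  next
    fix T a b assume h: "rel_holds C \<phi> T a b"
    then show "rel_holds C (rel_comp C \<phi> R) T a b"
      using rel_compI[OF R \<phi> ex_obj_refl[OF A] h] holds_homs(1)[OF \<phi> h] by blast
  qed
qed

lemma functional_ident:
  assumes A: "(A, R) \<in> ex_objs C"
  shows "functional R R A A R"
proof (rule functionalI[OF ex_obj_relation[OF A]])
  fix T a a' b b' assume "rel_holds C R T a a'" "rel_holds C R T a b" "rel_holds C R T b b'"
  then show "rel_holds C R T a' b'" using ex_obj_sym[OF A] ex_obj_trans[OF A] by blast
next
  fix T a assume a: "a \<in> hom C T A"
  then have "Ident C T \<in> covers C T T" "rel_holds C R T (a \<cdot> Ident C T) a"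
    using cover_ident hom_objs[OF a] ident_right[OF a] ex_obj_refl[OF A a] by auto
  then show "\<exists>T' e b. e \<in> covers C T' T \<and> rel_holds C R T' (a \<cdot> e) b" by blast
next
  fix T a b b' assume "rel_holds C R T a b" "rel_holds C R T a b'"
  then show "rel_holds C R T b b'" using ex_obj_sym[OF A] ex_obj_trans[OF A] by blast
qed

lemma functional_comp:
  assumes A: "(A, R) \<in> ex_objs C" and B: "(B, S) \<in> ex_objs C" and D: "(D, Z) \<in> ex_objs C"
    and f: "functional R S A B \<phi>" and g: "functional S Z B D \<psi>"
  shows "functional R Z A D (rel_comp C \<psi> \<phi>)"
proof -
  note \<phi> = functional_relation[OF f] and \<psi> = functional_relation[OF g]
  note R = ex_obj_relation[OF A] and S = ex_obj_relation[OF B] and Z = ex_obj_relation[OF D]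
  note \<psi>\<phi> = rel_comp_relation[OF \<phi> \<psi>]
  show ?thesis
  proof (rule functionalI[OF \<psi>\<phi>])
    fix T a a' c c' assume aa: "rel_holds C R T a a'" and ac: "rel_holds C (rel_comp C \<psi> \<phi>) T a c"
      and cc: "rel_holds C Z T c c'"
    obtain T' d b where d: "d \<in> covers C T' T" and ab: "rel_holds C \<phi> T' (a \<cdot> d) b"
      and bc: "rel_holds C \<psi> T' b (c \<cdot> d)"
      by (rule rel_compE[OF \<phi> \<psi> ac], rule that)
    note dh = cover_hom[OF d] and b = holds_homs(2)[OF \<phi> ab]
    have "rel_holds C \<phi> T' (a' \<cdot> d) b" "rel_holds C \<psi> T' b (c' \<cdot> d)"
      using functional_saturated[OF f holds_comp[OF R aa dh] ab ex_obj_refl[OF B b]]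
        functional_saturated[OF g ex_obj_refl[OF B b] bc holds_comp[OF Z cc dh]] by blast+
    then show "rel_holds C (rel_comp C \<psi> \<phi>) T a' c'"
      using rel_comp_local[OF \<phi> \<psi> d holds_homs(2)[OF R aa] holds_homs(2)[OF Z cc]] by blast
  next
    fix T a assume a: "a \<in> hom C T A"
    obtain T1 d b where d: "d \<in> covers C T1 T" and ab: "rel_holds C \<phi> T1 (a \<cdot> d) b"
      by (rule functional_total[OF f a])
    obtain T2 e c where e: "e \<in> covers C T2 T1" and bc: "rel_holds C \<psi> T2 (b \<cdot> e) c"
      by (rule functional_total[OF g holds_homs(2)[OF \<phi> ab]])
    have "rel_holds C (rel_comp C \<psi> \<phi>) T2 (a \<cdot> (d \<cdot> e)) c"
      using rel_compI[OF \<phi> \<psi> holds_comp[OF \<phi> ab cover_hom[OF e]] bc] comp_assoc[OF cover_hom[OF e] cover_hom[OF d] a]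
      by simp
    then show "\<exists>T' e c. e \<in> covers C T' T \<and> rel_holds C (rel_comp C \<psi> \<phi>) T' (a \<cdot> e) c"
      using cover_comp[OF e d] by blast
  next
    fix T a c c' assume ac: "rel_holds C (rel_comp C \<psi> \<phi>) T a c" and ac': "rel_holds C (rel_comp C \<psi> \<phi>) T a c'"
    note a = holds_homs(1)[OF \<psi>\<phi> ac] and c = holds_homs(2)[OF \<psi>\<phi> ac] and c' = holds_homs(2)[OF \<psi>\<phi> ac']
    obtain T1 d1 b1 where 1: "d1 \<in> covers C T1 T" "rel_holds C \<phi> T1 (a \<cdot> d1) b1" "rel_holds C \<psi> T1 b1 (c \<cdot> d1)"
      by (rule rel_compE[OF \<phi> \<psi> ac], rule that)
    obtain T2 d2 b2 where 2: "d2 \<in> covers C T2 T" "rel_holds C \<phi> T2 (a \<cdot> d2) b2" "rel_holds C \<psi> T2 b2 (c' \<cdot> d2)"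
      by (rule rel_compE[OF \<phi> \<psi> ac'], rule that)
    \<comment> \<open>The two middle elements live over different covers and become comparable only
      over a common refinement.\<close>
    obtain T' x y where x: "x \<in> covers C T' T1" and y: "y \<in> hom C T' T2" and xy: "d1 \<cdot> x = d2 \<cdot> y"
      and d: "d1 \<cdot> x \<in> covers C T' T"
      by (rule cover_refine[OF 1(1) 2(1)])
    note xh = cover_hom[OF x] and d1 = cover_hom[OF 1(1)] and d2 = cover_hom[OF 2(1)]
    have "rel_holds C \<phi> T' (a \<cdot> (d1 \<cdot> x)) (b1 \<cdot> x)" "rel_holds C \<phi> T' (a \<cdot> (d1 \<cdot> x)) (b2 \<cdot> y)"
      using holds_comp[OF \<phi> 1(2) xh] holds_comp[OF \<phi> 2(2) y] comp_assoc[OF xh d1 a] comp_assoc[OF y d2 a] xy by simp_all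
    then have bb: "rel_holds C S T' (b2 \<cdot> y) (b1 \<cdot> x)" using functional_unique[OF f] by blast
    have "rel_holds C \<psi> T' (b1 \<cdot> x) (c \<cdot> (d1 \<cdot> x))" "rel_holds C \<psi> T' (b2 \<cdot> y) (c' \<cdot> (d1 \<cdot> x))"
      using holds_comp[OF \<psi> 1(3) xh] holds_comp[OF \<psi> 2(3) y] comp_assoc[OF xh d1 c] comp_assoc[OF y d2 c'] xy by simp_all
    then have "rel_holds C Z T' (c \<cdot> (d1 \<cdot> x)) (c' \<cdot> (d1 \<cdot> x))"
      using functional_unique[OF g] functional_saturated[OF g bb] ex_obj_refl[OF D] holds_homs(2)[OF \<psi>] by blast
    then show "rel_holds C Z T c c'" by (rule holds_local[OF Z d c c'])
  qed
qed

section \<open>Arrows and category laws of the exact completion\<close>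

lemma hom_ex_reg:
  "f \<in> hom (ex_reg C) P Q \<longleftrightarrow> (\<exists>\<phi>. f = (P, \<phi>, Q) \<and> (P, \<phi>, Q) \<in> ex_arrs C)"
  by (cases f) (auto simp: hom_def ex_reg_def)

lemma hom_ex_regE:
  assumes "f \<in> hom (ex_reg C) (A, R) (B, S)"
  obtains \<phi> where "f = ((A, R), \<phi>, (B, S))" "functional R S A B \<phi>" "(A, R) \<in> ex_objs C" "(B, S) \<in> ex_objs C"
proof -
  obtain \<phi> where \<phi>: "f = ((A, R), \<phi>, (B, S))" "((A, R), \<phi>, (B, S)) \<in> ex_arrs C"
    using assms unfolding hom_ex_reg by blast
  then have o: "(A, R) \<in> ex_objs C" "(B, S) \<in> ex_objs C" by (simp_all add: ex_arrs_def)
  show thesis using that[OF \<phi>(1) _ o] \<phi>(2) ex_arrs_iff[OF o] by simp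
qed

lemma hom_ex_regI:
  "(A, R) \<in> ex_objs C \<Longrightarrow> (B, S) \<in> ex_objs C \<Longrightarrow> functional R S A B \<phi> \<Longrightarrow>
    ((A, R), \<phi>, (B, S)) \<in> hom (ex_reg C) (A, R) (B, S)"
  unfolding hom_ex_reg using ex_arrs_iff[of A R B S] by simp

lemma comp_ex_reg: "(Q, \<psi>, P') \<cdot>\<^bsub>ex_reg C\<^esub> (P, \<phi>, Q') = (P, rel_comp C \<psi> \<phi>, P')"
  by (simp add: ex_reg_def)

lemma obj_ex_reg: "Obj (ex_reg C) = ex_objs C"
  by (simp add: ex_reg_def)

lemma category_ex_reg: "category (ex_reg C)"
proof
  fix f assume "f \<in> Arr (ex_reg C)"
  then show "Dom (ex_reg C) f \<in> Obj (ex_reg C)" "Cod (ex_reg C) f \<in> Obj (ex_reg C)"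
    by (auto simp: ex_reg_def ex_arrs_def)
next
  fix P assume P: "P \<in> Obj (ex_reg C)"
  obtain A R where AR: "P = (A, R)" by (cases P)
  then show "Ident (ex_reg C) P \<in> hom (ex_reg C) P P"
    using P functional_ident hom_ex_regI by (simp add: obj_ex_reg ex_reg_def[THEN arg_cong[of _ _ Ident]])
next
  fix f g P Q V assume f: "f \<in> hom (ex_reg C) P Q" and g: "g \<in> hom (ex_reg C) Q V"
  obtain A R B S D Z where P: "P = (A, R)" "Q = (B, S)" "V = (D, Z)" by (cases P, cases Q, cases V)
  obtain \<phi> where \<phi>: "f = ((A, R), \<phi>, (B, S))" "functional R S A B \<phi>" "(A, R) \<in> ex_objs C" "(B, S) \<in> ex_objs C"
    using f unfolding P by (rule hom_ex_regE)
  obtain \<psi> where \<psi>: "g = ((B, S), \<psi>, (D, Z))" "functional S Z B D \<psi>" "(B, S) \<in> ex_objs C" "(D, Z) \<in> ex_objs C"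
    using g unfolding P by (rule hom_ex_regE)
  show "g \<cdot>\<^bsub>ex_reg C\<^esub> f \<in> hom (ex_reg C) P V"
    unfolding \<phi>(1) \<psi>(1) comp_ex_reg P
    using hom_ex_regI[OF \<phi>(3) \<psi>(4) functional_comp[OF \<phi>(3,4) \<psi>(4) \<phi>(2) \<psi>(2)]] .
next
  fix f g h P Q V W assume f: "f \<in> hom (ex_reg C) P Q" and g: "g \<in> hom (ex_reg C) Q V" and h: "h \<in> hom (ex_reg C) V W"
  obtain A R B S D Z E Y where P: "P = (A, R)" "Q = (B, S)" "V = (D, Z)" "W = (E, Y)"
    by (cases P, cases Q, cases V, cases W)
  obtain \<phi> where \<phi>: "f = ((A, R), \<phi>, (B, S))" "functional R S A B \<phi>"
    using f unfolding P by (rule hom_ex_regE)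
  obtain \<psi> where \<psi>: "g = ((B, S), \<psi>, (D, Z))" "functional S Z B D \<psi>"
    using g unfolding P by (rule hom_ex_regE)
  obtain \<chi> where \<chi>: "h = ((D, Z), \<chi>, (E, Y))" "functional Z Y D E \<chi>"
    using h unfolding P by (rule hom_ex_regE)
  show "h \<cdot>\<^bsub>ex_reg C\<^esub> g \<cdot>\<^bsub>ex_reg C\<^esub> f = (h \<cdot>\<^bsub>ex_reg C\<^esub> g) \<cdot>\<^bsub>ex_reg C\<^esub> f"
    unfolding \<phi>(1) \<psi>(1) \<chi>(1) comp_ex_reg
    using rel_comp_assoc functional_relation \<phi>(2) \<psi>(2) \<chi>(2) by blast
next
  fix f P Q assume f: "f \<in> hom (ex_reg C) P Q"
  obtain A R B S where P: "P = (A, R)" "Q = (B, S)" by (cases P, cases Q)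
  obtain \<phi> where \<phi>: "f = ((A, R), \<phi>, (B, S))" "functional R S A B \<phi>" "(A, R) \<in> ex_objs C" "(B, S) \<in> ex_objs C"
    using f unfolding P by (rule hom_ex_regE)
  have i: "Ident (ex_reg C) (A, R) = ((A, R), R, (A, R))" for A R by (simp add: ex_reg_def)
  show "Ident (ex_reg C) Q \<cdot>\<^bsub>ex_reg C\<^esub> f = f" "f \<cdot>\<^bsub>ex_reg C\<^esub> Ident (ex_reg C) P = f"
    unfolding \<phi>(1) P i comp_ex_reg
    using functional_comp_left[OF \<phi>(3,4,2)] functional_comp_right[OF \<phi>(3,4,2)] by simp_all
qed

end

section \<open>The exact completion satisfies the axioms\<close>

context regular_category
begin

abbreviation diagonal where "diagonal A \<equiv> rel_graph C (Ident C A)"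

lemma diagonal_holds:
  assumes "A \<in> Obj C"
  shows "rel_holds C (diagonal A) T a b \<longleftrightarrow> a \<in> hom C T A \<and> b = a"
  using rel_graph_relation(2)[OF ident_hom[OF assms]] ident_left by metis

lemma diagonal_ex_obj: "A \<in> Obj C \<Longrightarrow> (A, diagonal A) \<in> ex_objs C"
  unfolding ex_objs_iff using rel_graph_relation(1)[OF ident_hom] by (simp add: diagonal_holds)

lemma functional_graph:
  assumes f: "f \<in> hom C A B"
  shows "functional (diagonal A) (diagonal B) A B (rel_graph C f)"
proof -
  have o: "A \<in> Obj C" "B \<in> Obj C" using hom_objs[OF f] by auto
  note g = rel_graph_relation[OF f]
  show ?thesis
  proof (rule functionalI[OF g(1)])
    fix T a assume a: "a \<in> hom C T A"
    then have "Ident C T \<in> covers C T T" "rel_holds C (rel_graph C f) T (a \<cdot> Ident C T) (f \<cdot> a)"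
      using cover_ident hom_objs[OF a] ident_right[OF a] by (simp_all add: g(2))
    then show "\<exists>T' e b. e \<in> covers C T' T \<and> rel_holds C (rel_graph C f) T' (a \<cdot> e) b" by blast
  qed (use comp_hom[OF _ f] in \<open>auto simp: diagonal_holds o g(2)\<close>)
qed

text \<open>Unique choice: the value at the generic element exists over a cover \<open>e\<close>,
  and single-valuedness makes it agree on the pair that \<open>e\<close> coequalizes, so it descends
  to an arrow of the category.\<close>

lemma functional_diagonal:
  assumes o: "A \<in> Obj C" "B \<in> Obj C" and \<phi>: "functional (diagonal A) (diagonal B) A B \<phi>"
  shows "\<exists>h \<in> hom C A B. \<phi> = rel_graph C h"
proof -
  note r = functional_relation[OF \<phi>] and i = ident_hom[OF o(1)]
  obtain T e b where e: "e \<in> covers C T A" and b: "rel_holds C \<phi> T (Ident C A \<cdot> e) b"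
    by (rule functional_total[OF \<phi> i])
  note eh = cover_hom[OF e] and bh = holds_homs(2)[OF r b]
  have eb: "rel_holds C \<phi> T e b" using b ident_left[OF eh] by simp
  have sv: "y = y'" if "rel_holds C \<phi> S x y" "rel_holds C \<phi> S x y'" for S x y y'
    using functional_unique[OF \<phi> that] diagonal_holds[OF o(2)] by simp
  obtain u v where c: "is_coequalizer C u v e" using cover_regular_epi[OF e] by (auto simp: is_regular_epi_def)
  note uv = coequalizer_homs[OF c eh]
  have "b \<cdot> u = b \<cdot> v"
    using holds_comp[OF r eb uv(1)] holds_comp[OF r eb uv(2)] uv(3) sv by simp
  then obtain h where h: "h \<in> hom C A B" "h \<cdot> e = b" using coequalizer_factor[OF c eh bh] by blast
  have ih: "rel_holds C \<phi> A (Ident C A) h"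
    using holds_local[OF r e i h(1)] ident_left[OF eh] eb h(2) by simp
  have ah: "rel_holds C \<phi> S a (h \<cdot> a)" if "a \<in> hom C S A" for S a
    using holds_comp[OF r ih that] ident_left[OF that] by simp
  have "\<phi> = rel_graph C h"
  proof (rule relation_eqI[OF r rel_graph_relation(1)[OF h(1)]])
    fix S a b
    show "rel_holds C \<phi> S a b \<longleftrightarrow> rel_holds C (rel_graph C h) S a b"
      unfolding rel_graph_relation(2)[OF h(1)] using ah sv holds_homs(1)[OF r, of S a b] by blast
  qed
  then show ?thesis using h(1) by blast
qed

section \<open>The embedding is full and faithful\<close>

lemma ex_embedding_obj: "ObjMap (ex_embedding C) A = (A, diagonal A)"
  by (simp add: ex_embedding_def Let_def)

lemma ex_embedding_arr:
  "f \<in> hom C A B \<Longrightarrow> ArrMap (ex_embedding C) f = ((A, diagonal A), rel_graph C f, (B, diagonal B))"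
  by (simp add: ex_embedding_def Let_def hom_def)

lemma rel_graph_comp:
  assumes f: "f \<in> hom C A B" and g: "g \<in> hom C B D"
  shows "rel_graph C (g \<cdot> f) = rel_comp C (rel_graph C g) (rel_graph C f)"
proof (rule relation_eqI[OF rel_graph_relation(1)[OF comp_hom[OF f g]]
      rel_comp_relation[OF rel_graph_relation(1)[OF f] rel_graph_relation(1)[OF g]]])
  show "rel_holds C (rel_graph C (g \<cdot> f)) T a b \<longleftrightarrow>
    rel_holds C (rel_comp C (rel_graph C g) (rel_graph C f)) T a b" for T a b
    unfolding rel_comp_graph_holds[OF rel_graph_relation(1)[OF g] f] rel_graph_relation(2)[OF g]
      rel_graph_relation(2)[OF comp_hom[OF f g]]
    using comp_hom[OF _ f] comp_assoc[OF _ f g] by auto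
qed

lemma ex_embedding_functor: "is_functor C (ex_reg C) (ex_embedding C)"
  unfolding is_functor_def
proof (intro conjI ballI allI category_axioms category_ex_reg)
  fix A assume A: "A \<in> Obj C"
  show "ObjMap (ex_embedding C) A \<in> Obj (ex_reg C)"
    using diagonal_ex_obj[OF A] by (simp add: ex_embedding_obj obj_ex_reg)
  show "ArrMap (ex_embedding C) (Ident C A) = Ident (ex_reg C) (ObjMap (ex_embedding C) A)"
    using ex_embedding_arr[OF ident_hom[OF A]] by (simp add: ex_embedding_obj ex_reg_def)
next
  fix A B f assume f: "f \<in> hom C A B"
  show "ArrMap (ex_embedding C) f \<in> hom (ex_reg C) (ObjMap (ex_embedding C) A) (ObjMap (ex_embedding C) B)"
    unfolding ex_embedding_arr[OF f] ex_embedding_obj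
    using hom_ex_regI[OF diagonal_ex_obj diagonal_ex_obj functional_graph[OF f]] hom_objs[OF f] by blast
next
  fix A B D f g assume fg: "f \<in> hom C A B" "g \<in> hom C B D"
  show "ArrMap (ex_embedding C) (g \<cdot> f) =
      ArrMap (ex_embedding C) g \<cdot>\<^bsub>ex_reg C\<^esub> ArrMap (ex_embedding C) f"
    unfolding ex_embedding_arr[OF fg(1)] ex_embedding_arr[OF fg(2)] ex_embedding_arr[OF comp_hom[OF fg]]
      comp_ex_reg rel_graph_comp[OF fg] ..
qed

lemma ex_embedding_full:
  assumes "A \<in> Obj C" "B \<in> Obj C"
    "f \<in> hom (ex_reg C) (ObjMap (ex_embedding C) A) (ObjMap (ex_embedding C) B)"
  shows "\<exists>h \<in> hom C A B. ArrMap (ex_embedding C) h = f"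
proof -
  obtain \<phi> where \<phi>: "f = ((A, diagonal A), \<phi>, (B, diagonal B))" "functional (diagonal A) (diagonal B) A B \<phi>"
    using assms(3) unfolding ex_embedding_obj by (rule hom_ex_regE)
  then show ?thesis using functional_diagonal[OF assms(1,2)] ex_embedding_arr by blast
qed

lemma ex_embedding_fully_faithful: "fully_faithful C (ex_reg C) (ex_embedding C)"
  unfolding fully_faithful_def
proof (intro conjI ballI ex_embedding_functor)
  fix A B assume o: "A \<in> Obj C" "B \<in> Obj C"
  have "inj_on (ArrMap (ex_embedding C)) (hom C A B)"
  proof (rule inj_onI)
    fix f g assume f: "f \<in> hom C A B" and g: "g \<in> hom C A B"
      and "ArrMap (ex_embedding C) f = ArrMap (ex_embedding C) g"
    then have "rel_graph C f = rel_graph C g" by (simp add: ex_embedding_arr)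
    \<comment> \<open>The common graph is evaluated at the generic element, where it returns
      \<open>f\<close>.\<close>
    then have "Ident C A \<in> hom C A A \<and> f \<cdot> Ident C A = g \<cdot> Ident C A"
      using rel_graph_relation(2)[OF f, of A "Ident C A" "f \<cdot> Ident C A"]
        rel_graph_relation(2)[OF g, of A "Ident C A" "f \<cdot> Ident C A"] ident_hom[OF o(1)] by simp
    then show "f = g" using ident_right[OF f] ident_right[OF g] by simp
  qed
  moreover have "ArrMap (ex_embedding C) ` hom C A B =
      hom (ex_reg C) (ObjMap (ex_embedding C) A) (ObjMap (ex_embedding C) B)"
    using ex_embedding_full[OF o] ex_embedding_functor unfolding is_functor_def by blast
  ultimately show "bij_betw (ArrMap (ex_embedding C)) (hom C A B)
      (hom (ex_reg C) (ObjMap (ex_embedding C) A) (ObjMap (ex_embedding C) B))"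
    by (simp add: bij_betw_def)
qed

text \<open>A common value over a cover suffices, since values are unique up to \<open>S\<close> and
  functional relations are closed under \<open>S\<close>. The right side is itself a relation of the
  base category, which is how the \<open>comma\<close> axiom is met.\<close>

lemma point_eq_iff:
  assumes o: "A \<in> Obj C" "A' \<in> Obj C" "(B, S) \<in> ex_objs C"
    and \<phi>: "functional (diagonal A) S A B \<phi>" and \<psi>: "functional (diagonal A') S A' B \<psi>"
    and a: "a \<in> hom C T A" and b: "b \<in> hom C T A'"
  shows "rel_comp C \<phi> (rel_graph C a) = rel_comp C \<psi> (rel_graph C b) \<longleftrightarrow>
    rel_holds C (rel_comp C (rel_opp \<psi>) \<phi>) T a b"
proof
  note r\<phi> = functional_relation[OF \<phi>] and r\<psi> = functional_relation[OF \<psi>]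
  note o\<psi> = rel_opp_relation[OF r\<psi>] and S = ex_obj_relation[OF o(3)]
  {
    assume eq: "rel_comp C \<phi> (rel_graph C a) = rel_comp C \<psi> (rel_graph C b)"
    obtain T' e c where e: "e \<in> covers C T' T" and c: "rel_holds C \<phi> T' (a \<cdot> e) c"
      by (rule functional_total[OF \<phi> a])
    have "rel_holds C \<psi> T' (b \<cdot> e) c"
      using rel_comp_graph_holds[OF r\<phi> a] rel_comp_graph_holds[OF r\<psi> b] eq c cover_hom[OF e] by metis
    then show "rel_holds C (rel_comp C (rel_opp \<psi>) \<phi>) T a b"
      using rel_comp_local[OF r\<phi> o\<psi>(1) e a b c] o\<psi>(2) by blast
  next
    assume h: "rel_holds C (rel_comp C (rel_opp \<psi>) \<phi>) T a b"
    obtain T' d z where d: "d \<in> covers C T' T" and az: "rel_holds C \<phi> T' (a \<cdot> d) z"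
      and "rel_holds C (rel_opp \<psi>) T' z (b \<cdot> d)"
      by (rule rel_compE[OF r\<phi> o\<psi>(1) h], rule that)
    then have bz: "rel_holds C \<psi> T' (b \<cdot> d) z" using o\<psi>(2) by blast
    \<comment> \<open>One inclusion between the two functional relations, stated so that exchanging
      the roles gives the other.\<close>
    have key: "rel_holds C \<chi>' W (y \<cdot> s) c"
      if \<chi>: "functional (diagonal D) S D B \<chi>" and \<chi>': "functional (diagonal D') S D' B \<chi>'"
        and D: "D' \<in> Obj C" and x: "x \<in> hom C T D" and y: "y \<in> hom C T D'"
        and xz: "rel_holds C \<chi> T' (x \<cdot> d) z" and yz: "rel_holds C \<chi>' T' (y \<cdot> d) z"
        and s: "s \<in> hom C W T" and xc: "rel_holds C \<chi> W (x \<cdot> s) c" for D D' \<chi> \<chi>' W x y s c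
    proof -
      note r\<chi> = functional_relation[OF \<chi>] and r\<chi>' = functional_relation[OF \<chi>']
      note dh = cover_hom[OF d] and ch = holds_homs(2)[OF r\<chi> xc]
      obtain V e t where e: "e \<in> covers C V W" and t: "t \<in> hom C V T'" and et: "d \<cdot> t = s \<cdot> e"
        by (rule cover_pullback[OF d s])
      note eh = cover_hom[OF e]
      have xe: "(x \<cdot> d) \<cdot> t = (x \<cdot> s) \<cdot> e" "(y \<cdot> d) \<cdot> t = (y \<cdot> s) \<cdot> e"
        using comp_assoc[OF t dh x] comp_assoc[OF eh s x] comp_assoc[OF t dh y] comp_assoc[OF eh s y] et by simp_all
      have "rel_holds C S V (z \<cdot> t) (c \<cdot> e)"
        using functional_unique[OF \<chi>] holds_comp[OF r\<chi> xz t] holds_comp[OF r\<chi> xc eh] xe by simp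
      moreover have yt: "rel_holds C \<chi>' V ((y \<cdot> s) \<cdot> e) (z \<cdot> t)"
        using holds_comp[OF r\<chi>' yz t] xe by simp
      moreover have "rel_holds C (diagonal D') V ((y \<cdot> s) \<cdot> e) ((y \<cdot> s) \<cdot> e)"
        using diagonal_holds[OF D] holds_homs(1)[OF r\<chi>' yt] by simp
      ultimately have "rel_holds C \<chi>' V ((y \<cdot> s) \<cdot> e) (c \<cdot> e)"
        using functional_saturated[OF \<chi>'] by blast
      then show ?thesis by (rule holds_local[OF r\<chi>' e comp_hom[OF s y] ch])
    qed
    show "rel_comp C \<phi> (rel_graph C a) = rel_comp C \<psi> (rel_graph C b)"
    proof (rule relation_eqI[OF rel_comp_relation[OF rel_graph_relation(1)[OF a] r\<phi>]
          rel_comp_relation[OF rel_graph_relation(1)[OF b] r\<psi>]])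
      show "rel_holds C (rel_comp C \<phi> (rel_graph C a)) W s c \<longleftrightarrow> rel_holds C (rel_comp C \<psi> (rel_graph C b)) W s c"
        for W s c
        unfolding rel_comp_graph_holds[OF r\<phi> a] rel_comp_graph_holds[OF r\<psi> b]
        using key[OF \<phi> \<psi> o(2) a b az bz] key[OF \<psi> \<phi> o(1) b a bz az] by blast
    qed
  }
qed

text \<open>The equality of composites is evaluated at the identity of \<open>T\<close>.\<close>

lemma point_eq_transfer:
  assumes \<phi>: "functional R S A B \<phi>" and a: "a \<in> hom C T A" "a' \<in> hom C T A"
    and eq: "rel_comp C \<phi> (rel_graph C a) = rel_comp C \<phi> (rel_graph C a')" and h: "rel_holds C \<phi> T a b"
  shows "rel_holds C \<phi> T a' b"
proof -
  note r = functional_relation[OF \<phi>]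
  have T: "T \<in> Obj C" using hom_objs[OF a(1)] by simp
  have "rel_holds C (rel_comp C \<phi> (rel_graph C a)) T (Ident C T) b"
    unfolding rel_comp_graph_holds[OF r a(1)] using ident_hom[OF T] ident_right[OF a(1)] h by simp
  then show ?thesis
    unfolding eq rel_comp_graph_holds[OF r a(2)] using ident_right[OF a(2)] by simp
qed

lemma regular_embedding_ex: "regular_embedding C (ex_reg C) (ex_embedding C)"
  by (intro regular_embedding.intro full_embedding.intro full_embedding_axioms.intro category_axioms
      category_ex_reg ex_embedding_fully_faithful regular_category_axioms)

interpretation ex: regular_embedding C "ex_reg C" "ex_embedding C"
  by (rule regular_embedding_ex)

section \<open>Quotient maps and descent in the exact completion\<close>

lemma ex_point_comp:
  "a \<in> hom C T A \<Longrightarrow> ((A, diagonal A), \<phi>, Q) \<cdot>\<^bsub>ex_reg C\<^esub> ArrMap (ex_embedding C) a =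
    ((T, diagonal T), rel_comp C \<phi> (rel_graph C a), Q)"
  by (simp add: ex_embedding_arr comp_ex_reg)

text \<open>\<open>R\<close> itself, read as an arrow from the discrete object on \<open>A\<close>,
  is the quotient map onto \<open>(A, R)\<close>.\<close>

lemma functional_projection:
  assumes A: "(A, R) \<in> ex_objs C"
  shows "functional (diagonal A) R A A R"
proof -
  note R = ex_obj_relation[OF A]
  have o: "A \<in> Obj C" using relation_objs[OF R] by simp
  note f = functional_ident[OF A]
  show ?thesis
  proof (rule functionalI[OF R])
    fix T a a' b b' assume "rel_holds C (diagonal A) T a a'" "rel_holds C R T a b" "rel_holds C R T b b'"
    then show "rel_holds C R T a' b'" using ex_obj_trans[OF A] by (simp add: diagonal_holds[OF o])
  next
    fix T a assume "a \<in> hom C T A"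
    then show "\<exists>T' e b. e \<in> covers C T' T \<and> rel_holds C R T' (a \<cdot> e) b" using functional_total[OF f] by metis
  qed (rule functional_unique[OF f])
qed

text \<open>A common value over a cover gives relatedness there by symmetry and transitivity, and
  relatedness descends.\<close>

lemma projection_eq_iff:
  assumes A: "(A, R) \<in> ex_objs C" and a: "a \<in> hom C T A" "b \<in> hom C T A"
  shows "rel_comp C R (rel_graph C a) = rel_comp C R (rel_graph C b) \<longleftrightarrow> rel_holds C R T a b"
proof -
  note R = ex_obj_relation[OF A] and f = functional_projection[OF A]
  have o: "A \<in> Obj C" using relation_objs[OF R] by simp
  note oR = rel_opp_relation[OF R]
  have "rel_holds C (rel_comp C (rel_opp R) R) T a b \<longleftrightarrow> rel_holds C R T a b"
  proof
    assume "rel_holds C (rel_comp C (rel_opp R) R) T a b"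
    then obtain T' d c where d: "d \<in> covers C T' T" "rel_holds C R T' (a \<cdot> d) c" "rel_holds C (rel_opp R) T' c (b \<cdot> d)"
      by (rule rel_compE[OF R oR(1)], blast)
    then have "rel_holds C R T' (a \<cdot> d) (b \<cdot> d)" using oR(2) ex_obj_sym[OF A] ex_obj_trans[OF A] by blast
    then show "rel_holds C R T a b" by (rule holds_local[OF R d(1) a])
  next
    assume "rel_holds C R T a b"
    then show "rel_holds C (rel_comp C (rel_opp R) R) T a b"
      using rel_compI[OF R oR(1)] oR(2) ex_obj_refl[OF A a(2)] by blast
  qed
  then show ?thesis using point_eq_iff[OF o o A f f a] by blast
qed

text \<open>An arrow on \<open>A\<close> that respects \<open>R\<close> factors as the same relation
  read as an arrow on \<open>(A, R)\<close>: compatibility supplies closure under \<open>R\<close>,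
  the one clause that changes. Uniqueness holds because composition with the quotient map leaves a
  functional relation unchanged.\<close>

lemma ex_presentation:
  assumes A: "(A, R) \<in> ex_objs C"
  shows "ex.presentation A (A, R) ((A, diagonal A), R, (A, R))"
proof -
  note R = ex_obj_relation[OF A] and f = functional_projection[OF A]
  have o: "A \<in> Obj C" using relation_objs[OF R] by simp
  note d = diagonal_ex_obj[OF o]
  have \<rho>: "((A, diagonal A), R, (A, R)) \<in> hom (ex_reg C) (ObjMap (ex_embedding C) A) (A, R)"
    unfolding ex_embedding_obj by (rule hom_ex_regI[OF d A f])
  show ?thesis
    unfolding ex.presentation_def
  proof (intro conjI allI ballI impI o \<rho>)
    fix T x assume x: "x \<in> hom (ex_reg C) (ObjMap (ex_embedding C) T) (A, R)" and T: "T \<in> Obj C"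
    obtain \<phi> where \<phi>: "x = ((T, diagonal T), \<phi>, (A, R))" "functional (diagonal T) R T A \<phi>"
      using x unfolding ex_embedding_obj by (rule hom_ex_regE)
    note r = functional_relation[OF \<phi>(2)]
    \<comment> \<open>A value of the point at the identity of \<open>T\<close>, available over a
      cover, is the required lift to \<open>A\<close>.\<close>
    obtain T' e a where e: "e \<in> covers C T' T" and a: "rel_holds C \<phi> T' (Ident C T \<cdot> e) a"
      by (rule functional_total[OF \<phi>(2) ident_hom[OF T]])
    note eh = cover_hom[OF e] and ah = holds_homs(2)[OF r a]
    have "rel_holds C (rel_comp C (rel_opp R) \<phi>) T' e a"
      using rel_compI[OF r rel_opp_relation(1)[OF R]] rel_opp_relation(2)[OF R] a ident_left[OF eh]
        ex_obj_refl[OF A ah] by metis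
    then have "rel_comp C \<phi> (rel_graph C e) = rel_comp C R (rel_graph C a)"
      using point_eq_iff[OF T o A \<phi>(2) f eh ah] by blast
    then show "\<exists>T' e a. e \<in> covers C T' T \<and> a \<in> hom C T' A \<and>
        x \<cdot>\<^bsub>ex_reg C\<^esub> ArrMap (ex_embedding C) e =
        ((A, diagonal A), R, (A, R)) \<cdot>\<^bsub>ex_reg C\<^esub> ArrMap (ex_embedding C) a"
      using e ah ex_point_comp[OF eh] ex_point_comp[OF ah] unfolding \<phi>(1) by metis
  next
    fix Q x assume x: "x \<in> hom (ex_reg C) (ObjMap (ex_embedding C) A) Q"
      and compat: "\<forall>T. \<forall>a \<in> hom C T A. \<forall>b \<in> hom C T A.
        ((A, diagonal A), R, (A, R)) \<cdot>\<^bsub>ex_reg C\<^esub> ArrMap (ex_embedding C) a =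
        ((A, diagonal A), R, (A, R)) \<cdot>\<^bsub>ex_reg C\<^esub> ArrMap (ex_embedding C) b \<longrightarrow>
        x \<cdot>\<^bsub>ex_reg C\<^esub> ArrMap (ex_embedding C) a = x \<cdot>\<^bsub>ex_reg C\<^esub> ArrMap (ex_embedding C) b"
    obtain B S where Q: "Q = (B, S)" by (cases Q)
    obtain \<phi> where \<phi>: "x = ((A, diagonal A), \<phi>, (B, S))" "functional (diagonal A) S A B \<phi>" "(B, S) \<in> ex_objs C"
      using x unfolding ex_embedding_obj Q by (rule hom_ex_regE)
    note r = functional_relation[OF \<phi>(2)]
    have fn: "functional R S A B \<phi>"
    proof (rule functionalI[OF r])
      fix T a a' b b' assume aa: "rel_holds C R T a a'" and ab: "rel_holds C \<phi> T a b" and bb: "rel_holds C S T b b'"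
      note ah = holds_homs[OF R aa]
      have "rel_comp C R (rel_graph C a) = rel_comp C R (rel_graph C a')"
        using projection_eq_iff[OF A ah] aa by blast
      then have "rel_comp C \<phi> (rel_graph C a) = rel_comp C \<phi> (rel_graph C a')"
        using compat[rule_format, OF ah] unfolding \<phi>(1) ex_point_comp[OF ah(1)] ex_point_comp[OF ah(2)] by simp
      then have "rel_holds C \<phi> T a' b" using point_eq_transfer[OF \<phi>(2) ah] ab by blast
      then show "rel_holds C \<phi> T a' b'"
        using functional_saturated[OF \<phi>(2)] bb diagonal_holds[OF o] ah(2) by blast
    next
      fix T a assume "a \<in> hom C T A"
      then show "\<exists>T' e b. e \<in> covers C T' T \<and> rel_holds C \<phi> T' (a \<cdot> e) b" using functional_total[OF \<phi>(2)] by metis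
    qed (rule functional_unique[OF \<phi>(2)])
    show "\<exists>!g. g \<in> hom (ex_reg C) (A, R) Q \<and> g \<cdot>\<^bsub>ex_reg C\<^esub> ((A, diagonal A), R, (A, R)) = x"
    proof (rule ex1I[of _ "((A, R), \<phi>, (B, S))"])
      show "((A, R), \<phi>, (B, S)) \<in> hom (ex_reg C) (A, R) Q \<and>
        ((A, R), \<phi>, (B, S)) \<cdot>\<^bsub>ex_reg C\<^esub> ((A, diagonal A), R, (A, R)) = x"
        unfolding Q comp_ex_reg \<phi>(1) using hom_ex_regI[OF A \<phi>(3) fn] functional_comp_right[OF A \<phi>(3) fn] by simp
    next
      fix g assume g: "g \<in> hom (ex_reg C) (A, R) Q \<and> g \<cdot>\<^bsub>ex_reg C\<^esub> ((A, diagonal A), R, (A, R)) = x"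
      then have "g \<in> hom (ex_reg C) (A, R) (B, S)" unfolding Q by blast
      then obtain \<psi> where \<psi>: "g = ((A, R), \<psi>, (B, S))" "functional R S A B \<psi>"
        by (rule hom_ex_regE)
      then have "rel_comp C \<psi> R = \<phi>" using g unfolding \<psi>(1) comp_ex_reg \<phi>(1) by simp
      then show "g = ((A, R), \<phi>, (B, S))" using functional_comp_right[OF A \<phi>(3) \<psi>(2)] \<psi>(1) by simp
    qed
  qed
qed

text \<open>The factorization of \<open>\<phi>\<close> through the graph of \<open>e\<close> is
  \<open>\<phi>\<close> after the opposite of that graph: its values at \<open>b\<close> are the
  values of \<open>\<phi>\<close> at local preimages of \<open>b\<close>, and these do not depend on
  the preimage.\<close>

lemma ex_descent:
  assumes e: "e \<in> covers C A B"
  shows "ex.presentation A (ObjMap (ex_embedding C) B) (ArrMap (ex_embedding C) e)"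
proof -
  note eh = cover_hom[OF e]
  have o: "A \<in> Obj C" "B \<in> Obj C" using hom_objs[OF eh] by auto
  note ge = rel_graph_relation[OF eh] and oe = rel_opp_relation[OF rel_graph_relation(1)[OF eh]]
  show ?thesis
    unfolding ex.presentation_def
  proof (intro conjI allI ballI impI o(1) ex.U_hom[OF eh])
    fix T x assume x: "x \<in> hom (ex_reg C) (ObjMap (ex_embedding C) T) (ObjMap (ex_embedding C) B)"
      and T: "T \<in> Obj C"
    obtain h where h: "h \<in> hom C T B" "ArrMap (ex_embedding C) h = x" using ex_embedding_full[OF T o(2) x] by blast
    obtain T' d a where d: "d \<in> covers C T' T" "a \<in> hom C T' A" "e \<cdot> a = h \<cdot> d"
      by (rule cover_pullback[OF e h(1)])
    then show "\<exists>T' d a. d \<in> covers C T' T \<and> a \<in> hom C T' A \<and> x \<cdot>\<^bsub>ex_reg C\<^esub> ArrMap (ex_embedding C) d =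
        ArrMap (ex_embedding C) e \<cdot>\<^bsub>ex_reg C\<^esub> ArrMap (ex_embedding C) a"
      using ex.U_comp[OF cover_hom[OF d(1)] h(1)] ex.U_comp[OF d(2) eh] h(2) by metis
  next
    fix Q x assume x: "x \<in> hom (ex_reg C) (ObjMap (ex_embedding C) A) Q"
      and compat: "\<forall>T. \<forall>a \<in> hom C T A. \<forall>b \<in> hom C T A.
        ArrMap (ex_embedding C) e \<cdot>\<^bsub>ex_reg C\<^esub> ArrMap (ex_embedding C) a =
        ArrMap (ex_embedding C) e \<cdot>\<^bsub>ex_reg C\<^esub> ArrMap (ex_embedding C) b \<longrightarrow>
        x \<cdot>\<^bsub>ex_reg C\<^esub> ArrMap (ex_embedding C) a = x \<cdot>\<^bsub>ex_reg C\<^esub> ArrMap (ex_embedding C) b"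
    obtain D S where Q: "Q = (D, S)" by (cases Q)
    obtain \<phi> where \<phi>: "x = ((A, diagonal A), \<phi>, (D, S))" "functional (diagonal A) S A D \<phi>" "(D, S) \<in> ex_objs C"
      using x unfolding ex_embedding_obj Q by (rule hom_ex_regE)
    note r = functional_relation[OF \<phi>(2)] and S = ex_obj_relation[OF \<phi>(3)]
    have transfer: "rel_holds C \<phi> T a' c" if a: "a \<in> hom C T A" "a' \<in> hom C T A" "e \<cdot> a = e \<cdot> a'"
      and ac: "rel_holds C \<phi> T a c" for T a a' c
    proof -
      have "ArrMap (ex_embedding C) e \<cdot>\<^bsub>ex_reg C\<^esub> ArrMap (ex_embedding C) a =
        ArrMap (ex_embedding C) e \<cdot>\<^bsub>ex_reg C\<^esub> ArrMap (ex_embedding C) a'"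
        using ex.U_comp[OF a(1) eh] ex.U_comp[OF a(2) eh] a(3) by simp
      then have "rel_comp C \<phi> (rel_graph C a) = rel_comp C \<phi> (rel_graph C a')"
        using compat[rule_format, OF a(1,2)] unfolding \<phi>(1) ex_point_comp[OF a(1)] ex_point_comp[OF a(2)] by simp
      then show ?thesis using point_eq_transfer[OF \<phi>(2) a(1,2)] ac by blast
    qed
    define \<psi> where "\<psi> = rel_comp C \<phi> (rel_opp (rel_graph C e))"
    have r\<psi>: "\<psi> \<in> relations C B D" unfolding \<psi>_def by (rule rel_comp_relation[OF oe(1) r])
    have \<psi>I: "rel_holds C \<psi> T (e \<cdot> a) c" if "rel_holds C \<phi> T a c" for T a c
      unfolding \<psi>_def using rel_compI[OF oe(1) r _ that] oe(2) ge(2) holds_homs(1)[OF r that] by blast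
    have \<psi>E: "\<exists>T' d a. d \<in> covers C T' T \<and> b \<in> hom C T B \<and> c \<in> hom C T D \<and> a \<in> hom C T' A \<and>
        e \<cdot> a = b \<cdot> d \<and> rel_holds C \<phi> T' a (c \<cdot> d)"
      if "rel_holds C \<psi> T b c" for T b c
      using that unfolding \<psi>_def rel_comp_holds[OF oe(1) r] oe(2) ge(2) by metis
    have \<psi>e: "rel_holds C \<psi> T (e \<cdot> a) c \<longleftrightarrow> rel_holds C \<phi> T a c" if a: "a \<in> hom C T A" for T a c
    proof
      assume "rel_holds C \<psi> T (e \<cdot> a) c"
      then obtain T' d a' where d: "d \<in> covers C T' T" and c: "c \<in> hom C T D" and a': "a' \<in> hom C T' A"
        and ea: "e \<cdot> a' = (e \<cdot> a) \<cdot> d" and h: "rel_holds C \<phi> T' a' (c \<cdot> d)"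
        using \<psi>E by blast
      have "rel_holds C \<phi> T' (a \<cdot> d) (c \<cdot> d)"
        using transfer[OF a' comp_hom[OF cover_hom[OF d] a] _ h] ea comp_assoc[OF cover_hom[OF d] a eh] by simp
      then show "rel_holds C \<phi> T a c" by (rule holds_local[OF r d a c])
    qed (rule \<psi>I)
    have fn: "functional (diagonal B) S B D \<psi>"
    proof (rule functionalI[OF r\<psi>])
      fix T b b' c c' assume bb: "rel_holds C (diagonal B) T b b'" and bc: "rel_holds C \<psi> T b c"
        and cc: "rel_holds C S T c c'"
      obtain T' d a where d: "d \<in> covers C T' T" and b: "b \<in> hom C T B" and a: "a \<in> hom C T' A"
        and ea: "e \<cdot> a = b \<cdot> d" and h: "rel_holds C \<phi> T' a (c \<cdot> d)"
        using \<psi>E[OF bc] by blast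
      have "rel_holds C \<phi> T' a (c' \<cdot> d)"
        using functional_saturated[OF \<phi>(2) _ h holds_comp[OF S cc cover_hom[OF d]]] a diagonal_holds[OF o(1)] by blast
      then have "rel_holds C \<psi> T' (b \<cdot> d) (c' \<cdot> d)" using \<psi>I ea by metis
      then show "rel_holds C \<psi> T b' c'"
        using holds_local[OF r\<psi> d b holds_homs(2)[OF S cc]] bb by (simp add: diagonal_holds[OF o(2)])
    next
      fix T b assume b: "b \<in> hom C T B"
      obtain T1 d a where d: "d \<in> covers C T1 T" "a \<in> hom C T1 A" "e \<cdot> a = b \<cdot> d"
        by (rule cover_pullback[OF e b])
      obtain T2 f c where f: "f \<in> covers C T2 T1" "rel_holds C \<phi> T2 (a \<cdot> f) c"
        by (rule functional_total[OF \<phi>(2) d(2)])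
      have "e \<cdot> (a \<cdot> f) = b \<cdot> (d \<cdot> f)"
        using comp_square[OF d(3) cover_hom[OF f(1)] d(2) eh cover_hom[OF d(1)] b] .
      then show "\<exists>T' f c. f \<in> covers C T' T \<and> rel_holds C \<psi> T' (b \<cdot> f) c"
        using \<psi>I[OF f(2)] cover_comp[OF f(1) d(1)] by metis
    next
      fix T b c c' assume bc: "rel_holds C \<psi> T b c" and bc': "rel_holds C \<psi> T b c'"
      obtain T1 d1 a1 where 1: "d1 \<in> covers C T1 T" "b \<in> hom C T B" "c \<in> hom C T D" "a1 \<in> hom C T1 A"
        "e \<cdot> a1 = b \<cdot> d1" "rel_holds C \<phi> T1 a1 (c \<cdot> d1)" using \<psi>E[OF bc] by blast
      note d1 = cover_hom[OF 1(1)]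
      have "rel_holds C \<psi> T1 (e \<cdot> a1) (c' \<cdot> d1)" using holds_comp[OF r\<psi> bc' d1] 1(5) by simp
      then have "rel_holds C S T1 (c \<cdot> d1) (c' \<cdot> d1)"
        using functional_unique[OF \<phi>(2) 1(6)] \<psi>e[OF 1(4)] by blast
      then show "rel_holds C S T c c'" by (rule holds_local[OF S 1(1,3) holds_homs(2)[OF r\<psi> bc']])
    qed
    have \<psi>g: "rel_comp C \<chi> (rel_graph C e) = \<phi> \<longleftrightarrow> (\<forall>T a c. a \<in> hom C T A \<longrightarrow> rel_holds C \<chi> T (e \<cdot> a) c = rel_holds C \<phi> T a c)"
      if \<chi>: "\<chi> \<in> relations C B D" for \<chi>
    proof
      assume "rel_comp C \<chi> (rel_graph C e) = \<phi>"
      then show "\<forall>T a c. a \<in> hom C T A \<longrightarrow> rel_holds C \<chi> T (e \<cdot> a) c = rel_holds C \<phi> T a c"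
        using rel_comp_graph_holds[OF \<chi> eh] by blast
    next
      assume *: "\<forall>T a c. a \<in> hom C T A \<longrightarrow> rel_holds C \<chi> T (e \<cdot> a) c = rel_holds C \<phi> T a c"
      show "rel_comp C \<chi> (rel_graph C e) = \<phi>"
        by (rule relation_eqI[OF rel_comp_relation[OF ge(1) \<chi>] r])
          (use * holds_homs(1)[OF r] rel_comp_graph_holds[OF \<chi> eh] in blast)
    qed
    show "\<exists>!g. g \<in> hom (ex_reg C) (ObjMap (ex_embedding C) B) Q \<and> g \<cdot>\<^bsub>ex_reg C\<^esub> ArrMap (ex_embedding C) e = x"
      unfolding Q ex_embedding_obj ex_embedding_arr[OF eh]
    proof (rule ex1I[of _ "((B, diagonal B), \<psi>, (D, S))"])
      show "((B, diagonal B), \<psi>, (D, S)) \<in> hom (ex_reg C) (B, diagonal B) (D, S) \<and>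
        ((B, diagonal B), \<psi>, (D, S)) \<cdot>\<^bsub>ex_reg C\<^esub> ((A, diagonal A), rel_graph C e, (B, diagonal B)) = x"
        using hom_ex_regI[OF diagonal_ex_obj[OF o(2)] \<phi>(3) fn] \<psi>g[OF r\<psi>] \<psi>e by (simp add: comp_ex_reg \<phi>(1))
    next
      fix g assume g: "g \<in> hom (ex_reg C) (B, diagonal B) (D, S) \<and>
        g \<cdot>\<^bsub>ex_reg C\<^esub> ((A, diagonal A), rel_graph C e, (B, diagonal B)) = x"
      from g[THEN conjunct1]
      obtain \<chi> where \<chi>: "g = ((B, diagonal B), \<chi>, (D, S))" "functional (diagonal B) S B D \<chi>"
        by (rule hom_ex_regE)
      note r\<chi> = functional_relation[OF \<chi>(2)]
      have "rel_comp C \<chi> (rel_graph C e) = \<phi>" using g unfolding \<chi>(1) comp_ex_reg \<phi>(1) by simp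
      then have \<chi>e: "rel_holds C \<chi> T (e \<cdot> a) c = rel_holds C \<psi> T (e \<cdot> a) c" if "a \<in> hom C T A" for T a c
        using \<psi>g[OF r\<chi>] \<psi>e that by blast
      \<comment> \<open>Relations from \<open>B\<close> are determined by their elements of the form
        \<open>e \<cdot> a\<close>, since every element of \<open>B\<close> lifts over a
        cover.\<close>
      have le: "rel_holds C \<chi>2 T b c" if h: "rel_holds C \<chi>1 T b c" and r12: "\<chi>1 \<in> relations C B D" "\<chi>2 \<in> relations C B D"
        and eq: "\<And>T a c. a \<in> hom C T A \<Longrightarrow> rel_holds C \<chi>1 T (e \<cdot> a) c = rel_holds C \<chi>2 T (e \<cdot> a) c" for \<chi>1 \<chi>2 T b c
      proof -
        note bc = holds_homs[OF r12(1) h]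
        obtain T' d a where d: "d \<in> covers C T' T" "a \<in> hom C T' A" "e \<cdot> a = b \<cdot> d"
          by (rule cover_pullback[OF e bc(1)])
        have "rel_holds C \<chi>2 T' (b \<cdot> d) (c \<cdot> d)"
          using holds_comp[OF r12(1) h cover_hom[OF d(1)]] eq[OF d(2)] d(3) by simp
        then show ?thesis by (rule holds_local[OF r12(2) d(1) bc])
      qed
      have "\<chi> = \<psi>"
        by (rule relation_eqI[OF r\<chi> r\<psi>], rule iffI; erule le) (simp_all add: r\<chi> r\<psi> \<chi>e)
      then show "g = ((B, diagonal B), \<psi>, (D, S))" using \<chi>(1) by simp
    qed
  qed
qed

theorem exact_completion_ex_reg: "exact_completion C (ex_reg C) (ex_embedding C)"
proof unfold_locales
  fix P assume P: "P \<in> Obj (ex_reg C)"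
  obtain A R where "P = (A, R)" by (cases P)
  then show "\<exists>A \<rho>. ex.presentation A P \<rho>" using ex_presentation[of A R] P unfolding obj_ex_reg by blast
next
  fix A k assume k: "is_equivalence_relation C A k"
  then have ms: "is_mono_span C A A k" by (simp add: is_equivalence_relation_def)
  define R where "R = span_class C A A k"
  have R: "R \<in> relations C A A" "\<And>T a b. rel_holds C R T a b \<longleftrightarrow> in_span C k T a b"
    unfolding R_def using span_class_relation[OF ms] span_class_holds[OF ms] by blast+
  have A: "(A, R) \<in> ex_objs C"
    unfolding ex_objs_iff R(2) using R(1) k unfolding equivalence_relation_iff by blast
  have "((A, diagonal A), R, (A, R)) \<cdot>\<^bsub>ex_reg C\<^esub> ArrMap (ex_embedding C) a =
        ((A, diagonal A), R, (A, R)) \<cdot>\<^bsub>ex_reg C\<^esub> ArrMap (ex_embedding C) b \<longleftrightarrow> in_span C k T a b"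
    if "a \<in> hom C T A" "b \<in> hom C T A" for T a b
    unfolding ex_point_comp[OF that(1)] ex_point_comp[OF that(2)]
    using projection_eq_iff[OF A that] R(2) by simp
  then show "\<exists>P \<rho>. ex.presentation A P \<rho> \<and> (\<forall>T. \<forall>a \<in> hom C T A. \<forall>b \<in> hom C T A.
      \<rho> \<cdot>\<^bsub>ex_reg C\<^esub> ArrMap (ex_embedding C) a = \<rho> \<cdot>\<^bsub>ex_reg C\<^esub> ArrMap (ex_embedding C) b \<longleftrightarrow> in_span C k T a b)"
    using ex_presentation[OF A] by blast
next
  fix e A B assume "e \<in> covers C A B"
  then show "ex.presentation A (ObjMap (ex_embedding C) B) (ArrMap (ex_embedding C) e)" by (rule ex_descent)
next
  fix A B P x y assume o: "A \<in> Obj C" "B \<in> Obj C"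
    and x: "x \<in> hom (ex_reg C) (ObjMap (ex_embedding C) A) P"
    and y: "y \<in> hom (ex_reg C) (ObjMap (ex_embedding C) B) P"
  obtain D S where P: "P = (D, S)" by (cases P)
  obtain \<phi> where \<phi>: "x = ((A, diagonal A), \<phi>, (D, S))" "functional (diagonal A) S A D \<phi>" "(D, S) \<in> ex_objs C"
    using x unfolding ex_embedding_obj P by (rule hom_ex_regE)
  obtain \<psi> where \<psi>: "y = ((B, diagonal B), \<psi>, (D, S))" "functional (diagonal B) S B D \<psi>"
    using y unfolding ex_embedding_obj P by (rule hom_ex_regE)
  \<comment> \<open>The comma object of the two points is the relation of having a common value over
    a cover.\<close>
  obtain w where w: "is_mono_span C A B w"
    "\<And>T a b. rel_holds C (rel_comp C (rel_opp \<psi>) \<phi>) T a b \<longleftrightarrow> in_span C w T a b"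
    by (rule relation_span[OF rel_comp_relation[OF functional_relation[OF \<phi>(2)]
          rel_opp_relation(1)[OF functional_relation[OF \<psi>(2)]]]], rule that)
  have "in_span C w T a b \<longleftrightarrow> x \<cdot>\<^bsub>ex_reg C\<^esub> ArrMap (ex_embedding C) a = y \<cdot>\<^bsub>ex_reg C\<^esub> ArrMap (ex_embedding C) b"
    if "a \<in> hom C T A" "b \<in> hom C T B" for T a b
    unfolding \<phi>(1) \<psi>(1) ex_point_comp[OF that(1)] ex_point_comp[OF that(2)] w(2)[symmetric]
    using point_eq_iff[OF o \<phi>(3,2) \<psi>(2) that] hom_dom[OF that(1)] by simp
  then show "\<exists>w. is_mono_span C A B w \<and> (\<forall>T. \<forall>a \<in> hom C T A. \<forall>b \<in> hom C T B. in_span C w T a b \<longleftrightarrow>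
      x \<cdot>\<^bsub>ex_reg C\<^esub> ArrMap (ex_embedding C) a = y \<cdot>\<^bsub>ex_reg C\<^esub> ArrMap (ex_embedding C) b)"
    using w(1) by blast
qed

end

section \<open>Reflections and semi-left-exactness\<close>

lemma hom_full_subcat: "hom (full_subcat C S) A B = {f \<in> hom C A B. A \<in> S \<and> B \<in> S}"
  by (auto simp: hom_def full_subcat_def)

lemma full_subcat_simps [simp]:
  "Obj (full_subcat C S) = S" "Comp (full_subcat C S) = Comp C" "Ident (full_subcat C S) = Ident C"
  "Dom (full_subcat C S) = Dom C" "Cod (full_subcat C S) = Cod C"
  by (simp_all add: full_subcat_def)

lemma (in category) category_full_subcat:
  assumes "S \<subseteq> Obj C"
  shows "category (full_subcat C S)"
proof unfold_locales
  fix f assume "f \<in> Arr (full_subcat C S)"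
  then show "Dom (full_subcat C S) f \<in> Obj (full_subcat C S)" "Cod (full_subcat C S) f \<in> Obj (full_subcat C S)"
    by (auto simp: full_subcat_def)
qed (use assms in \<open>auto simp: hom_full_subcat intro: ident_hom comp_hom comp_assoc ident_left ident_right\<close>)

lemma (in category) full_subcat_iso_iff:
  assumes "f \<in> hom (full_subcat C S) A B"
  shows "is_iso (full_subcat C S) f \<longleftrightarrow> is_iso C f"
proof -
  have f: "f \<in> hom C A B" "A \<in> S" "B \<in> S" using assms by (auto simp: hom_full_subcat)
  have "f \<in> Arr (full_subcat C S)" using assms by (simp add: hom_def)
  then show ?thesis
    unfolding is_iso_def using f by (simp add: hom_full_subcat hom_dom[OF f(1)] hom_cod[OF f(1)] hom_arr[OF f(1)])
qed

text \<open>If \<open>g\<close> is invertible, a square over it carries no more information than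
  \<open>p\<close>. This is applied to the image of a pullback under a reflector, where
  \<open>g\<close> is the image of a unit.\<close>

lemma (in category) pullback_along_iso:
  assumes h: "f \<in> hom C A Z" "g \<in> hom C B Z" "p \<in> hom C P A" "q \<in> hom C P B" "f \<cdot> p = g \<cdot> q"
    and g: "is_iso C g"
  shows "is_pullback C f g p q \<longleftrightarrow> is_iso C p"
proof
  obtain k where k: "k \<in> hom C Z B" "k \<cdot> g = Ident C B" "g \<cdot> k = Ident C Z" using isoE[OF g h(2)] by blast
  have kg: "k \<cdot> (g \<cdot> x) = x" if "x \<in> hom C T B" for x T
    using comp_reassoc[OF k(2) that h(2) k(1)] ident_left[OF that] by simp
  have gk: "g \<cdot> (k \<cdot> x) = x" if "x \<in> hom C T Z" for x T
    using comp_reassoc[OF k(3) that k(1) h(2)] ident_left[OF that] by simp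
  {
    assume P: "is_pullback C f g p q"
    have objs: "A \<in> Obj C" "P \<in> Obj C" using hom_objs[OF h(3)] by auto
    have kf: "k \<cdot> f \<in> hom C A B" using comp_hom[OF h(1) k(1)] .
    have "f \<cdot> Ident C A = g \<cdot> (k \<cdot> f)" using gk[OF h(1)] ident_right[OF h(1)] by simp
    then obtain l where l: "l \<in> hom C A P" "p \<cdot> l = Ident C A" "q \<cdot> l = k \<cdot> f"
      using pullback_lift[OF P h(3,4) ident_hom[OF objs(1)] kf] by blast
    have "l \<cdot> p = Ident C P"
    proof (rule pullback_unique[OF P h(3,4) comp_hom[OF h(3) l(1)] ident_hom[OF objs(2)]])
      show "p \<cdot> l \<cdot> p = p \<cdot> Ident C P"
        using comp_reassoc[OF l(2) h(3) l(1) h(3)] ident_left[OF h(3)] ident_right[OF h(3)] by simp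
      show "q \<cdot> l \<cdot> p = q \<cdot> Ident C P"
        using comp_reassoc[OF l(3) h(3) l(1) h(4)] comp_assoc[OF h(3) h(1) k(1)] h(5) kg[OF h(4)]
          ident_right[OF h(4)] by simp
    qed
    then show "is_iso C p" using isoI[OF h(3) l(1)] l(2) by blast
  next
    assume "is_iso C p"
    then obtain l where l: "l \<in> hom C A P" "l \<cdot> p = Ident C P" "p \<cdot> l = Ident C A" using isoE[OF _ h(3)] by blast
    show "is_pullback C f g p q"
    proof (rule pullbackI[OF h])
      fix T u v assume u: "u \<in> hom C T A" and v: "v \<in> hom C T B" and uv: "f \<cdot> u = g \<cdot> v"
      have lu: "l \<cdot> u \<in> hom C T P" using comp_hom[OF u l(1)] .
      have pl: "p \<cdot> (l \<cdot> u) = u" using comp_reassoc[OF l(3) u l(1) h(3)] ident_left[OF u] by simp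
      then have "g \<cdot> (q \<cdot> (l \<cdot> u)) = g \<cdot> v"
        using comp_square[OF h(5) lu h(3,1,4,2)] uv by simp
      then have "q \<cdot> (l \<cdot> u) = v" using kg[OF comp_hom[OF lu h(4)]] kg[OF v] by metis
      then show "\<exists>h \<in> hom C T P. p \<cdot> h = u \<and> q \<cdot> h = v" using pl lu by blast
    next
      fix T x y assume xy: "x \<in> hom C T P" "y \<in> hom C T P" "p \<cdot> x = p \<cdot> y"
      have "l \<cdot> (p \<cdot> x) = x" "l \<cdot> (p \<cdot> y) = y"
        using comp_reassoc[OF l(2) xy(1) h(3) l(1)] comp_reassoc[OF l(2) xy(2) h(3) l(1)]
          ident_left[OF xy(1)] ident_left[OF xy(2)] by simp_all
      then show "x = y" using xy(3) by metis
    qed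
  }
qed

section \<open>Reflections with a chosen reflector\<close>

locale reflection = category +
  fixes S L \<eta>
  assumes reflection: "is_reflection C S L \<eta>"
begin

lemma S_objs: "S \<subseteq> Obj C"
  using reflection by (simp add: is_reflection_def)

lemma L_obj: "Q \<in> Obj C \<Longrightarrow> ObjMap L Q \<in> S"
  using reflection by (simp add: is_reflection_def is_functor_def)

lemma L_hom: "f \<in> hom C P Q \<Longrightarrow> ArrMap L f \<in> hom C (ObjMap L P) (ObjMap L Q)"
  using reflection by (simp add: is_reflection_def is_functor_def hom_full_subcat)

lemma L_comp: "f \<in> hom C P Q \<Longrightarrow> g \<in> hom C Q R \<Longrightarrow> ArrMap L (g \<cdot> f) = ArrMap L g \<cdot> ArrMap L f"
  using reflection unfolding is_reflection_def is_functor_def by simp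

lemma unit_hom: "Q \<in> Obj C \<Longrightarrow> \<eta> Q \<in> hom C Q (ObjMap L Q)"
  using reflection by (simp add: is_reflection_def nat_trans_def id_functor_def)

lemma unit_natural: "f \<in> hom C P Q \<Longrightarrow> ArrMap L f \<cdot> \<eta> P = \<eta> Q \<cdot> f"
  using reflection unfolding is_reflection_def nat_trans_def id_functor_def by simp

lemma unit_universal: "Q \<in> Obj C \<Longrightarrow> universal_arrow C S Q (ObjMap L Q) (\<eta> Q)"
  using reflection unit_hom L_obj unfolding is_reflection_def universal_arrow_def by blast

lemma univ_factor: "universal_arrow C S Q A u \<Longrightarrow> B \<in> S \<Longrightarrow> f \<in> hom C Q B \<Longrightarrow> \<exists>h \<in> hom C A B. h \<cdot> u = f"
  unfolding universal_arrow_def by blast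

lemma univ_hom: "universal_arrow C S Q A u \<Longrightarrow> u \<in> hom C Q A"
  by (simp add: universal_arrow_def)

lemma univ_ext:
  assumes "universal_arrow C S Q A u" "B \<in> S" "h \<in> hom C A B" "k \<in> hom C A B" "h \<cdot> u = k \<cdot> u"
  shows "h = k"
proof -
  have "\<exists>!x. x \<in> hom C A B \<and> x \<cdot> u = h \<cdot> u"
    using assms(1,2) comp_hom[OF univ_hom[OF assms(1)] assms(3)] unfolding universal_arrow_def by blast
  then show ?thesis using assms(3-5) by auto
qed

lemma unit_iso:
  assumes B: "B \<in> S"
  shows "is_iso C (\<eta> B)"
proof -
  have o: "B \<in> Obj C" using S_objs B by blast
  note i = ident_hom[OF o] and u = unit_universal[OF o] and h = unit_hom[OF o] and l = L_obj[OF o]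
  obtain k where k: "k \<in> hom C (ObjMap L B) B" "k \<cdot> \<eta> B = Ident C B" using univ_factor[OF u B i] by blast
  have LB: "ObjMap L B \<in> Obj C" using l S_objs by blast
  have "(\<eta> B \<cdot> k) \<cdot> \<eta> B = Ident C (ObjMap L B) \<cdot> \<eta> B"
    using comp_assoc[OF h k(1) h] k(2) ident_right[OF h] ident_left[OF h] by simp
  then have "\<eta> B \<cdot> k = Ident C (ObjMap L B)" using univ_ext[OF u l comp_hom[OF k(1) h] ident_hom[OF LB]] by blast
  then show ?thesis using isoI[OF h k(1,2)] by blast
qed

lemma L_unit_iso:
  assumes Q: "Q \<in> Obj C"
  shows "is_iso C (ArrMap L (\<eta> Q))"
proof -
  note h = unit_hom[OF Q]
  have l: "ObjMap L Q \<in> S" using L_obj[OF Q] .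
  then have o: "ObjMap L Q \<in> Obj C" using S_objs by blast
  \<comment> \<open>The image of a unit is the unit of the reflected object: by naturality both have
    the same composite with \<open>\<eta> Q\<close>.\<close>
  have "ArrMap L (\<eta> Q) = \<eta> (ObjMap L Q)"
    using univ_ext[OF unit_universal[OF Q] L_obj[OF o] L_hom[OF h] unit_hom[OF o] unit_natural[OF h]] .
  then show ?thesis using unit_iso[OF l] by simp
qed

text \<open>Since \<open>B\<close> lies in \<open>S\<close>, its unit is invertible, and by
  naturality \<open>p\<close> is the unit of \<open>D\<close> followed by \<open>ArrMap L p\<close>
  and the inverse \<open>j\<close> of the unit of \<open>B\<close>. So \<open>ArrMap L p\<close>
  measures how far \<open>p\<close> is from a reflection.\<close>

lemma universal_iff_iso:
  assumes p: "p \<in> hom C D B" and B: "B \<in> S"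
  shows "universal_arrow C S D B p \<longleftrightarrow> is_iso C (ArrMap L p)"
proof
  have o: "D \<in> Obj C" "B \<in> Obj C" using hom_objs[OF p] by auto
  note \<eta>D = unit_hom[OF o(1)] and \<eta>B = unit_hom[OF o(2)] and uD = unit_universal[OF o(1)]
  note lD = L_obj[OF o(1)] and lB = L_obj[OF o(2)] and Lp = L_hom[OF p]
  have lo: "ObjMap L D \<in> Obj C" "ObjMap L B \<in> Obj C" using lD lB S_objs by blast+
  obtain j where j: "j \<in> hom C (ObjMap L B) B" "j \<cdot> \<eta> B = Ident C B" "\<eta> B \<cdot> j = Ident C (ObjMap L B)"
    using isoE[OF unit_iso[OF B] \<eta>B] by blast
  have jp: "j \<cdot> (ArrMap L p \<cdot> \<eta> D) = p"
    using unit_natural[OF p] comp_reassoc[OF j(2) p \<eta>B j(1)] ident_left[OF p] by simp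
  {
    assume u: "universal_arrow C S D B p"
    obtain k where k: "k \<in> hom C B (ObjMap L D)" "k \<cdot> p = \<eta> D" using univ_factor[OF u lD \<eta>D] by blast
    note kj = comp_hom[OF j(1) k(1)]
    have "((k \<cdot> j) \<cdot> ArrMap L p) \<cdot> \<eta> D = Ident C (ObjMap L D) \<cdot> \<eta> D"
      using comp_assoc[OF \<eta>D Lp kj] comp_assoc[OF comp_hom[OF \<eta>D Lp] j(1) k(1)] jp k(2) ident_left[OF \<eta>D] by simp
    then have 1: "(k \<cdot> j) \<cdot> ArrMap L p = Ident C (ObjMap L D)"
      using univ_ext[OF uD lD comp_hom[OF Lp kj] ident_hom[OF lo(1)]] by blast
    have "(ArrMap L p \<cdot> k) \<cdot> p = \<eta> B \<cdot> p"
      using comp_assoc[OF p k(1) Lp] k(2) unit_natural[OF p] by simp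
    then have "ArrMap L p \<cdot> k = \<eta> B" using univ_ext[OF u lB comp_hom[OF k(1) Lp] \<eta>B] by blast
    then have "ArrMap L p \<cdot> (k \<cdot> j) = Ident C (ObjMap L B)" using comp_assoc[OF j(1) k(1) Lp] j(3) by simp
    then show "is_iso C (ArrMap L p)" using isoI[OF Lp kj 1] by blast
  next
    assume "is_iso C (ArrMap L p)"
    then obtain l where l: "l \<in> hom C (ObjMap L B) (ObjMap L D)" "l \<cdot> ArrMap L p = Ident C (ObjMap L D)"
      "ArrMap L p \<cdot> l = Ident C (ObjMap L B)" using isoE[OF _ Lp] by blast
    note l\<eta> = comp_hom[OF \<eta>B l(1)]
    have \<eta>p: "(l \<cdot> \<eta> B) \<cdot> p = \<eta> D"
      using comp_assoc[OF p \<eta>B l(1)] unit_natural[OF p] comp_reassoc[OF l(2) \<eta>D Lp l(1)] ident_left[OF \<eta>D] by simp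
    have jL: "(j \<cdot> ArrMap L p) \<cdot> (l \<cdot> \<eta> B) = Ident C B"
      using comp_assoc[OF l\<eta> Lp j(1)] comp_reassoc[OF l(3) \<eta>B l(1) Lp] ident_left[OF \<eta>B] j(2) by simp
    have "\<exists>!h. h \<in> hom C B E \<and> h \<cdot> p = g" if E: "E \<in> S" and g: "g \<in> hom C D E" for E g
    proof -
      obtain h where h: "h \<in> hom C (ObjMap L D) E" "h \<cdot> \<eta> D = g" using univ_factor[OF uD E g] by blast
      show ?thesis
      proof (rule ex1I[of _ "h \<cdot> (l \<cdot> \<eta> B)"])
        show "h \<cdot> (l \<cdot> \<eta> B) \<in> hom C B E \<and> (h \<cdot> (l \<cdot> \<eta> B)) \<cdot> p = g"
          using comp_hom[OF l\<eta> h(1)] comp_assoc[OF p l\<eta> h(1)] \<eta>p h(2) by simp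
      next
        fix x assume x: "x \<in> hom C B E \<and> x \<cdot> p = g"
        then have xh: "x \<in> hom C B E" and xp: "x \<cdot> p = g" by auto
        note jLp = comp_hom[OF Lp j(1)]
        have "(x \<cdot> (j \<cdot> ArrMap L p)) \<cdot> \<eta> D = h \<cdot> \<eta> D"
          using comp_assoc[OF \<eta>D jLp xh] comp_assoc[OF \<eta>D Lp j(1)] jp xp h(2) by simp
        then have "x \<cdot> (j \<cdot> ArrMap L p) = h" using univ_ext[OF uD E comp_hom[OF jLp xh] h(1)] by blast
        then have "h \<cdot> (l \<cdot> \<eta> B) = x \<cdot> ((j \<cdot> ArrMap L p) \<cdot> (l \<cdot> \<eta> B))" using comp_assoc[OF l\<eta> jLp xh] by simp
        then show "x = h \<cdot> (l \<cdot> \<eta> B)" using jL ident_right[OF xh] by simp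
      qed
    qed
    then show "universal_arrow C S D B p" using p B unfolding universal_arrow_def by blast
  }
qed

text \<open>In the image square \<open>ArrMap L (\<eta> Q)\<close> is invertible, so the square is a
  pullback exactly if \<open>ArrMap L p\<close> is invertible, that is, if \<open>p\<close> is
  universal.\<close>

lemma semi_left_exact_iff:
  "semi_left_exact C S L \<eta> \<longleftrightarrow> (\<forall>Q \<in> Obj C. \<forall>B \<in> S. \<forall>f \<in> hom C B (ObjMap L Q). \<forall>p q.
    is_pullback C f (\<eta> Q) p q \<longrightarrow> universal_arrow C S (Dom C p) B p)"
proof -
  interpret D: category "full_subcat C S" by (rule category_full_subcat[OF S_objs])
  have "is_pullback (full_subcat C S) (ArrMap L f) (ArrMap L (\<eta> Q)) (ArrMap L p) (ArrMap L q) \<longleftrightarrow>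
      universal_arrow C S (Dom C p) B p"
    if Q: "Q \<in> Obj C" and B: "B \<in> S" and f: "f \<in> hom C B (ObjMap L Q)" and P: "is_pullback C f (\<eta> Q) p q"
    for Q B f p q
  proof -
    note h = unit_hom[OF Q]
    note H = pullback_homs[OF P f h]
    have LD: "ArrMap L g \<in> hom (full_subcat C S) (ObjMap L A) (ObjMap L A')" if "g \<in> hom C A A'" for g A A'
      using L_hom[OF that] L_obj hom_objs[OF that] by (simp add: hom_full_subcat)
    have "ArrMap L f \<cdot>\<^bsub>full_subcat C S\<^esub> ArrMap L p = ArrMap L (\<eta> Q) \<cdot>\<^bsub>full_subcat C S\<^esub> ArrMap L q"
      using L_comp[OF H(1) f] L_comp[OF H(2) h] H(4) by simp
    then have "is_pullback (full_subcat C S) (ArrMap L f) (ArrMap L (\<eta> Q)) (ArrMap L p) (ArrMap L q) \<longleftrightarrow>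
        is_iso (full_subcat C S) (ArrMap L p)"
      using D.pullback_along_iso[OF LD[OF f] LD[OF h] LD[OF H(1)] LD[OF H(2)]] L_unit_iso[OF Q]
        full_subcat_iso_iff[OF LD[OF h]] by blast
    then show ?thesis using full_subcat_iso_iff[OF LD[OF H(1)]] universal_iff_iso[OF H(1) B] by simp
  qed
  then show ?thesis unfolding semi_left_exact_def by blast
qed

end

text \<open>Naturality of \<open>\<eta>\<close> dictates the action of the reflector on arrows;
  unique extension along universal arrows justifies the definite description in \<open>F\<close> and
  gives functoriality.\<close>

lemma (in category) reflection_from_universal:
  assumes S: "S \<subseteq> Obj C" and u: "\<And>Q. Q \<in> Obj C \<Longrightarrow> universal_arrow C S Q (B Q) (\<eta> Q)"
  shows "\<exists>L. is_reflection C S L \<eta> \<and> ObjMap L = B"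
proof -
  have BS: "Q \<in> Obj C \<Longrightarrow> B Q \<in> S" and \<eta>h: "Q \<in> Obj C \<Longrightarrow> \<eta> Q \<in> hom C Q (B Q)" for Q
    using u unfolding universal_arrow_def by blast+
  define F where "F f = (THE h. h \<in> hom C (B (Dom C f)) (B (Cod C f)) \<and> h \<cdot> \<eta> (Dom C f) = \<eta> (Cod C f) \<cdot> f)" for f
  have ex1: "\<exists>!h. h \<in> hom C (B P) (B Q) \<and> h \<cdot> \<eta> P = \<eta> Q \<cdot> f" if f: "f \<in> hom C P Q" for f P Q
  proof -
    have "P \<in> Obj C" "Q \<in> Obj C" using hom_objs[OF f] by auto
    then show ?thesis using u[of P] BS[of Q] comp_hom[OF f \<eta>h] unfolding universal_arrow_def by blast
  qed
  have F: "F f \<in> hom C (B P) (B Q) \<and> F f \<cdot> \<eta> P = \<eta> Q \<cdot> f" if f: "f \<in> hom C P Q" for f P Q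
    using theI'[OF ex1[OF f]] by (simp add: F_def hom_dom[OF f] hom_cod[OF f])
  have Fu: "h = F f" if f: "f \<in> hom C P Q" and h: "h \<in> hom C (B P) (B Q)" "h \<cdot> \<eta> P = \<eta> Q \<cdot> f" for f h P Q
    using ex1[OF f] F[OF f] h by auto
  have Fid: "F (Ident C Q) = Ident C (B Q)" if Q: "Q \<in> Obj C" for Q
  proof -
    have "B Q \<in> Obj C" using BS[OF Q] S by blast
    then show ?thesis
      using Fu[OF ident_hom[OF Q] ident_hom] ident_left[OF \<eta>h[OF Q]] ident_right[OF \<eta>h[OF Q]] by simp
  qed
  have Fcomp: "F (g \<cdot> f) = F g \<cdot> F f" if f: "f \<in> hom C P Q" and g: "g \<in> hom C Q R" for f g P Q R
  proof -
    have o: "P \<in> Obj C" "Q \<in> Obj C" "R \<in> Obj C" using hom_objs f g by blast+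
    note Ff = F[OF f] and Fg = F[OF g]
    have "(F g \<cdot> F f) \<cdot> \<eta> P = \<eta> R \<cdot> (g \<cdot> f)"
      using comp_assoc[OF \<eta>h[OF o(1)] Ff[THEN conjunct1] Fg[THEN conjunct1]] Ff
        comp_assoc[OF f \<eta>h[OF o(2)] Fg[THEN conjunct1]] Fg comp_assoc[OF f g \<eta>h[OF o(3)]] by simp
    then show ?thesis
      using Fu[OF comp_hom[OF f g] comp_hom[OF Ff[THEN conjunct1] Fg[THEN conjunct1]]] by simp
  qed
  define L where "L = \<lparr>ObjMap = B, ArrMap = F\<rparr>"
  note D = category_full_subcat[OF S]
  have "is_functor C (full_subcat C S) L"
    unfolding is_functor_def L_def
    using category_axioms D BS F hom_objs by (auto simp: hom_full_subcat Fid Fcomp)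
  moreover have "is_functor C C L"
    unfolding is_functor_def L_def
    using category_axioms BS S F by (auto simp: Fid Fcomp)
  moreover have "is_functor C C id_functor"
    unfolding is_functor_def id_functor_def using category_axioms by simp
  ultimately have "is_reflection C S L \<eta>"
    unfolding is_reflection_def nat_trans_def
    using S \<eta>h F u by (auto simp: L_def id_functor_def universal_arrow_def)
  then show ?thesis by (auto simp: L_def)
qed

section \<open>Equivalences of categories\<close>

lemma is_functor_comp:
  assumes F: "is_functor A B F" and G: "is_functor B D G"
  shows "is_functor A D (comp_functor G F)"
proof -
  have "ArrMap G (ArrMap F (g \<cdot>\<^bsub>A\<^esub> f)) = ArrMap G (ArrMap F g) \<cdot>\<^bsub>D\<^esub> ArrMap G (ArrMap F f)"
    if fg: "f \<in> hom A P Q" "g \<in> hom A Q R" for f g P Q R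
  proof -
    have "ArrMap F f \<in> hom B (ObjMap F P) (ObjMap F Q)" "ArrMap F g \<in> hom B (ObjMap F Q) (ObjMap F R)"
      "ArrMap F (g \<cdot>\<^bsub>A\<^esub> f) = ArrMap F g \<cdot>\<^bsub>B\<^esub> ArrMap F f"
      using F fg unfolding is_functor_def by blast+
    then show ?thesis using G unfolding is_functor_def by simp
  qed
  then show ?thesis using F G by (simp add: is_functor_def comp_functor_def)
qed

text \<open>The object map may identify objects, so an inverse is obtained by choosing a preimage
  \<open>V B\<close> of each object together with preimages of arrows; \<open>V (UO A)\<close> is
  only isomorphic to \<open>A\<close>.\<close>

lemma (in full_embedding) equivalent_image: "equivalent_cats X (full_subcat C (UO ` Obj X))"
proof -
  let ?D = "full_subcat C (UO ` Obj X)"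
  have sub: "UO ` Obj X \<subseteq> Obj C" using U_obj by blast
  interpret D: category ?D by (rule C.category_full_subcat[OF sub])
  define V where "V B = (SOME A. A \<in> Obj X \<and> UO A = B)" for B
  have V: "V B \<in> Obj X \<and> UO (V B) = B" if "B \<in> UO ` Obj X" for B
    unfolding V_def using someI_ex[of "\<lambda>A. A \<in> Obj X \<and> UO A = B"] that by blast
  define W where "W g = (SOME f. f \<in> hom X (V (Dom C g)) (V (Cod C g)) \<and> UA f = g)" for g
  have W: "W g \<in> hom X (V A) (V B)" "UA (W g) = g" if g: "g \<in> hom C A B" and AB: "A \<in> UO ` Obj X" "B \<in> UO ` Obj X" for g A B
  proof -
    have "\<exists>f. f \<in> hom X (V A) (V B) \<and> UA f = g" using U_full[of "V A" "V B" g] V[OF AB(1)] V[OF AB(2)] g by auto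
    from someI_ex[OF this] show "W g \<in> hom X (V A) (V B)" "UA (W g) = g"
      by (simp_all add: W_def C.hom_dom[OF g] C.hom_cod[OF g])
  qed
  define F where "F = \<lparr>ObjMap = UO, ArrMap = UA\<rparr>"
  define G where "G = \<lparr>ObjMap = V, ArrMap = W\<rparr>"
  have F: "is_functor X ?D F"
    unfolding is_functor_def F_def
    using X.category_axioms D.category_axioms U_hom X.hom_objs by (auto simp: hom_full_subcat U_ident U_comp)
  have G: "is_functor ?D X G"
    unfolding is_functor_def
  proof (intro conjI ballI allI X.category_axioms D.category_axioms)
    fix B assume B: "B \<in> Obj ?D"
    then show "ObjMap G B \<in> Obj X" using V by (simp add: G_def)
    have VB: "V B \<in> Obj X" "UO (V B) = B" using B V by simp_all
    have iB: "Ident C B \<in> hom C B B" using C.ident_hom B sub by auto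
    show "ArrMap G (Ident ?D B) = Ident X (ObjMap G B)"
      using U_faithful[OF W(1)[OF iB] X.ident_hom[OF VB(1)]] W(2)[OF iB] U_ident[OF VB(1)] VB(2) B
      by (simp add: G_def)
  next
    fix A B f assume "f \<in> hom ?D A B"
    then show "ArrMap G f \<in> hom X (ObjMap G A) (ObjMap G B)" using W(1) by (auto simp: G_def hom_full_subcat)
  next
    fix A B E f g assume fg: "f \<in> hom ?D A B" "g \<in> hom ?D B E"
    then have f: "f \<in> hom C A B" and g: "g \<in> hom C B E"
      and o: "A \<in> UO ` Obj X" "B \<in> UO ` Obj X" "E \<in> UO ` Obj X" by (auto simp: hom_full_subcat)
    note Wf = W[OF f o(1,2)] and Wg = W[OF g o(2,3)] and Wgf = W[OF C.comp_hom[OF f g] o(1,3)]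
    show "ArrMap G (g \<cdot>\<^bsub>?D\<^esub> f) = ArrMap G g \<cdot>\<^bsub>X\<^esub> ArrMap G f"
      using U_faithful[OF Wgf(1) X.comp_hom[OF Wf(1) Wg(1)]] Wgf(2) U_comp[OF Wf(1) Wg(1)] Wf(2) Wg(2)
      by (simp add: G_def)
  qed
  have GF: "naturally_isomorphic X X (comp_functor G F) id_functor"
  proof -
    have VU: "V (UO A) \<in> Obj X" "UO (V (UO A)) = UO A" if "A \<in> Obj X" for A using V that by blast+
    have iU: "Ident C (UO A) \<in> hom C (UO (V (UO A))) (UO A)" if "A \<in> Obj X" for A
      using C.ident_hom[OF U_obj[OF that]] VU[OF that] by simp
    \<comment> \<open>The comparison is the arrow of \<open>X\<close> lying over an identity of
      \<open>C\<close>; it exists because \<open>V (UO A)\<close> and \<open>A\<close> have the same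
      image.\<close>
    define \<tau> where "\<tau> A = (SOME t. t \<in> hom X (V (UO A)) A \<and> UA t = Ident C (UO A))" for A
    have \<tau>: "\<tau> A \<in> hom X (V (UO A)) A" "UA (\<tau> A) = Ident C (UO A)" if A: "A \<in> Obj X" for A
    proof -
      have "\<exists>t. t \<in> hom X (V (UO A)) A \<and> UA t = Ident C (UO A)" using U_full[OF VU(1)[OF A] A iU[OF A]] by blast
      from someI_ex[OF this] show "\<tau> A \<in> hom X (V (UO A)) A" "UA (\<tau> A) = Ident C (UO A)" by (simp_all add: \<tau>_def)
    qed
    have iso: "is_iso X (\<tau> A)" if A: "A \<in> Obj X" for A
    proof -
      have "Ident C (UO A) \<in> hom C (UO A) (UO (V (UO A)))" using iU[OF A] VU[OF A] by simp
      then obtain t where t: "t \<in> hom X A (V (UO A))" "UA t = Ident C (UO A)"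
        using U_full[OF A VU(1)[OF A]] by blast
      have ii: "Ident C (UO A) \<cdot> Ident C (UO A) = Ident C (UO A)"
        using C.ident_left[OF C.ident_hom[OF U_obj[OF A]]] .
      have "t \<cdot>\<^bsub>X\<^esub> \<tau> A = Ident X (V (UO A))" "\<tau> A \<cdot>\<^bsub>X\<^esub> t = Ident X A"
        using U_faithful[OF X.comp_hom[OF \<tau>(1)[OF A] t(1)] X.ident_hom[OF VU(1)[OF A]]]
          U_faithful[OF X.comp_hom[OF t(1) \<tau>(1)[OF A]] X.ident_hom[OF A]]
          U_comp[OF \<tau>(1)[OF A] t(1)] U_comp[OF t(1) \<tau>(1)[OF A]] t(2) \<tau>(2)[OF A] ii
          U_ident[OF VU(1)[OF A]] U_ident[OF A] VU(2)[OF A] by simp_all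
      then show ?thesis using X.isoI[OF \<tau>(1)[OF A] t(1)] by blast
    qed
    have nat: "\<tau> B \<cdot>\<^bsub>X\<^esub> W (UA f) = f \<cdot>\<^bsub>X\<^esub> \<tau> A" if f: "f \<in> hom X A B" for f A B
    proof -
      have o: "A \<in> Obj X" "B \<in> Obj X" using X.hom_objs[OF f] by auto
      have Wf: "W (UA f) \<in> hom X (V (UO A)) (V (UO B))" "UA (W (UA f)) = UA f"
        using W[OF U_hom[OF f]] o by blast+
      show ?thesis
        using U_faithful[OF X.comp_hom[OF Wf(1) \<tau>(1)[OF o(2)]] X.comp_hom[OF \<tau>(1)[OF o(1)] f]]
          U_comp[OF Wf(1) \<tau>(1)[OF o(2)]] U_comp[OF \<tau>(1)[OF o(1)] f] Wf(2) \<tau>(2) o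
          C.ident_left[OF U_hom[OF f]] C.ident_right[OF U_hom[OF f]] by simp
    qed
    have "is_functor X X (comp_functor G F)" by (rule is_functor_comp[OF F G])
    moreover have "is_functor X X id_functor"
      unfolding is_functor_def id_functor_def using X.category_axioms by simp
    ultimately have "nat_trans X X (comp_functor G F) id_functor \<tau>"
      unfolding nat_trans_def using \<tau>(1) nat by (auto simp: comp_functor_def id_functor_def F_def G_def)
    then show ?thesis unfolding naturally_isomorphic_def using iso by blast
  qed
  have FG: "naturally_isomorphic ?D ?D (comp_functor F G) id_functor"
  proof -
    have "is_functor ?D ?D (comp_functor F G)" by (rule is_functor_comp[OF G F])
    moreover have "is_functor ?D ?D id_functor"
      unfolding is_functor_def id_functor_def using D.category_axioms by simp
    ultimately have "nat_trans ?D ?D (comp_functor F G) id_functor (Ident C)"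
      unfolding nat_trans_def using V W C.ident_hom sub C.ident_left C.ident_right
      by (auto simp: comp_functor_def id_functor_def F_def G_def hom_full_subcat image_subset_iff)
    moreover have "is_iso ?D (Ident C B)" if B: "B \<in> Obj ?D" for B
    proof -
      have i: "Ident C B \<in> hom ?D B B" using D.ident_hom[OF B] by simp
      show ?thesis using D.isoI[OF i i] D.ident_left[OF i] by simp
    qed
    ultimately show ?thesis unfolding naturally_isomorphic_def by blast
  qed
  show ?thesis unfolding equivalent_cats_def using F G GF FG by blast
qed

text \<open>Naturality recovers \<open>f\<close> from \<open>ArrMap G (ArrMap F f)\<close> by
  conjugation with the isomorphisms \<open>\<tau>\<close>.\<close>

lemma faithful_if_retract:
  assumes F: "is_functor A B F" and G: "is_functor B A G"
    and n: "naturally_isomorphic A A (comp_functor G F) id_functor"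
    and fg: "f \<in> hom A P Q" "g \<in> hom A P Q" "ArrMap F f = ArrMap F g"
  shows "f = g"
proof -
  interpret A: category A using F by (simp add: is_functor_def)
  obtain \<tau> where \<tau>: "nat_trans A A (comp_functor G F) id_functor \<tau>" "\<forall>P \<in> Obj A. is_iso A (\<tau> P)"
    using n by (auto simp: naturally_isomorphic_def)
  have P: "P \<in> Obj A" using A.hom_objs[OF fg(1)] by simp
  have nat: "\<tau> Q \<cdot>\<^bsub>A\<^esub> ArrMap G (ArrMap F h) = h \<cdot>\<^bsub>A\<^esub> \<tau> P" if "h \<in> hom A P Q" for h
    using \<tau>(1) that unfolding nat_trans_def by (simp add: comp_functor_def id_functor_def)
  have \<tau>P: "\<tau> P \<in> hom A (ObjMap G (ObjMap F P)) P"
    using \<tau>(1) P unfolding nat_trans_def by (simp add: comp_functor_def id_functor_def)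
  obtain k where k: "k \<in> hom A P (ObjMap G (ObjMap F P))" "\<tau> P \<cdot>\<^bsub>A\<^esub> k = Ident A P"
    using A.isoE[OF _ \<tau>P] \<tau>(2) P by blast
  have "(f \<cdot>\<^bsub>A\<^esub> \<tau> P) \<cdot>\<^bsub>A\<^esub> k = (g \<cdot>\<^bsub>A\<^esub> \<tau> P) \<cdot>\<^bsub>A\<^esub> k" using nat[OF fg(1)] nat[OF fg(2)] fg(3) by simp
  then show ?thesis
    using A.comp_assoc[OF k(1) \<tau>P fg(1)] A.comp_assoc[OF k(1) \<tau>P fg(2)] k(2) A.ident_right fg(1,2) by metis
qed

text \<open>For fullness, \<open>ArrMap G u\<close> is conjugated to an arrow \<open>f\<close>. Then
  \<open>ArrMap F f\<close> and \<open>u\<close> have the same image under \<open>G\<close>, which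
  is faithful by \<open>faithful_if_retract\<close> with the roles exchanged.\<close>

lemma equivalence_fully_faithful:
  assumes F: "is_functor A B F" and G: "is_functor B A G"
    and GF: "naturally_isomorphic A A (comp_functor G F) id_functor"
    and FG: "naturally_isomorphic B B (comp_functor F G) id_functor"
  shows "fully_faithful A B F"
  unfolding fully_faithful_def bij_betw_def
proof (intro conjI ballI F)
  fix P Q assume o: "P \<in> Obj A" "Q \<in> Obj A"
  interpret A: category A using F by (simp add: is_functor_def)
  interpret B: category B using F by (simp add: is_functor_def)
  have Fh: "f \<in> hom A P Q \<Longrightarrow> ArrMap F f \<in> hom B (ObjMap F P) (ObjMap F Q)" for f P Q
    using F by (simp add: is_functor_def)
  have Gh: "f \<in> hom B P Q \<Longrightarrow> ArrMap G f \<in> hom A (ObjMap G P) (ObjMap G Q)" for f P Q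
    using G by (simp add: is_functor_def)
  show "inj_on (ArrMap F) (hom A P Q)" using faithful_if_retract[OF F G GF] by (auto intro: inj_onI)
  show "ArrMap F ` hom A P Q = hom B (ObjMap F P) (ObjMap F Q)"
  proof (intro equalityI subsetI)
    fix u assume u: "u \<in> hom B (ObjMap F P) (ObjMap F Q)"
    obtain \<tau> where \<tau>: "nat_trans A A (comp_functor G F) id_functor \<tau>" "\<forall>P \<in> Obj A. is_iso A (\<tau> P)"
      using GF by (auto simp: naturally_isomorphic_def)
    have \<tau>h: "\<tau> P \<in> hom A (ObjMap G (ObjMap F P)) P" if "P \<in> Obj A" for P
      using \<tau>(1) that unfolding nat_trans_def by (simp add: comp_functor_def id_functor_def)
    obtain k where k: "k \<in> hom A P (ObjMap G (ObjMap F P))" "k \<cdot>\<^bsub>A\<^esub> \<tau> P = Ident A (ObjMap G (ObjMap F P))"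
      using A.isoE[OF _ \<tau>h[OF o(1)]] \<tau>(2) o(1) by blast
    obtain l where l: "l \<in> hom A Q (ObjMap G (ObjMap F Q))" "l \<cdot>\<^bsub>A\<^esub> \<tau> Q = Ident A (ObjMap G (ObjMap F Q))"
      using A.isoE[OF _ \<tau>h[OF o(2)]] \<tau>(2) o(2) by blast
    note Gu = Gh[OF u]
    note \<tau>G = A.comp_hom[OF Gu \<tau>h[OF o(2)]]
    define f where "f = (\<tau> Q \<cdot>\<^bsub>A\<^esub> ArrMap G u) \<cdot>\<^bsub>A\<^esub> k"
    have f: "f \<in> hom A P Q" unfolding f_def using A.comp_hom[OF k(1) \<tau>G] .
    note GFf = Gh[OF Fh[OF f]]
    have "\<tau> Q \<cdot>\<^bsub>A\<^esub> ArrMap G (ArrMap F f) = f \<cdot>\<^bsub>A\<^esub> \<tau> P"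
      using \<tau>(1) f unfolding nat_trans_def by (simp add: comp_functor_def id_functor_def)
    also have "\<dots> = \<tau> Q \<cdot>\<^bsub>A\<^esub> ArrMap G u"
      unfolding f_def using A.comp_assoc[OF \<tau>h[OF o(1)] k(1) \<tau>G] k(2) A.ident_right[OF \<tau>G] by simp
    finally have "l \<cdot>\<^bsub>A\<^esub> (\<tau> Q \<cdot>\<^bsub>A\<^esub> ArrMap G (ArrMap F f)) = l \<cdot>\<^bsub>A\<^esub> (\<tau> Q \<cdot>\<^bsub>A\<^esub> ArrMap G u)" by simp
    then have "ArrMap G (ArrMap F f) = ArrMap G u"
      using A.comp_reassoc[OF l(2) GFf \<tau>h[OF o(2)] l(1)] A.comp_reassoc[OF l(2) Gu \<tau>h[OF o(2)] l(1)]
        A.ident_left[OF GFf] A.ident_left[OF Gu] by simp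
    then have "ArrMap F f = u" using faithful_if_retract[OF G F FG Fh[OF f] u] by blast
    then show "u \<in> ArrMap F ` hom A P Q" using f by blast
  qed (use Fh in blast)
qed

text \<open>The functor of an equivalence reaches the objects of \<open>S\<close> only up to
  isomorphism. A reflection of \<open>Q\<close> into its image is therefore the unit followed by
  such an isomorphism, and stability has to be carried from the units to arbitrary universal
  arrows.\<close>

lemma semi_localization_embedding:
  assumes X: "category X" and C: "category C" and s: "is_semi_localization X C"
  shows "\<exists>U. semi_left_exact_embedding X C U"
proof -
  interpret X: category X by (rule X)
  obtain S L \<eta> where sl: "is_reflection C S L \<eta>" "semi_left_exact C S L \<eta>" and eq: "equivalent_cats X (full_subcat C S)"
    using s unfolding is_semi_localization_def semi_localization_subcat_def by blast
  interpret C: category C by (rule C)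
  interpret R: reflection C S L \<eta> by unfold_locales (rule sl(1))
  let ?D = "full_subcat C S"
  interpret D: category ?D by (rule C.category_full_subcat[OF R.S_objs])
  obtain F G where F: "is_functor X ?D F" and G: "is_functor ?D X G"
    and GF: "naturally_isomorphic X X (comp_functor G F) id_functor"
    and FG: "naturally_isomorphic ?D ?D (comp_functor F G) id_functor"
    using eq unfolding equivalent_cats_def by blast
  have FS: "A \<in> Obj X \<Longrightarrow> ObjMap F A \<in> S" for A using F by (simp add: is_functor_def)
  have homD: "A \<in> Obj X \<Longrightarrow> B \<in> Obj X \<Longrightarrow> hom ?D (ObjMap F A) (ObjMap F B) = hom C (ObjMap F A) (ObjMap F B)" for A B
    using FS by (auto simp: hom_full_subcat)
  have "is_functor X C F"
    using F R.S_objs C.category_axioms unfolding is_functor_def by (auto simp: hom_full_subcat)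
  then have ff: "fully_faithful X C F"
    using equivalence_fully_faithful[OF F G GF FG] homD unfolding fully_faithful_def by simp
  interpret E: full_embedding X C F by unfold_locales (rule ff)
  have sub: "ObjMap F ` Obj X \<subseteq> S" using FS by blast
  have univ_sub: "E.universal Q B u" if "universal_arrow C S Q B u" "B \<in> ObjMap F ` Obj X" for Q B u
    using that sub unfolding universal_arrow_def by blast
  have rep: "\<exists>A \<in> Obj X. \<exists>i. i \<in> hom C Q (ObjMap F A) \<and> is_iso C i" if Q: "Q \<in> S" for Q
  proof -
    obtain \<sigma> where \<sigma>: "nat_trans ?D ?D (comp_functor F G) id_functor \<sigma>" "\<forall>Q \<in> Obj ?D. is_iso ?D (\<sigma> Q)"
      using FG by (auto simp: naturally_isomorphic_def)
    have A: "ObjMap G Q \<in> Obj X" using G Q by (simp add: is_functor_def)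
    have \<sigma>h: "\<sigma> Q \<in> hom ?D (ObjMap F (ObjMap G Q)) Q"
      using \<sigma>(1) Q unfolding nat_trans_def by (simp add: comp_functor_def id_functor_def)
    obtain i where i: "i \<in> hom ?D Q (ObjMap F (ObjMap G Q))" "i \<cdot>\<^bsub>C\<^esub> \<sigma> Q = Ident C (ObjMap F (ObjMap G Q))"
      "\<sigma> Q \<cdot>\<^bsub>C\<^esub> i = Ident C Q"
      using D.isoE[OF _ \<sigma>h] \<sigma>(2) Q by auto
    have "is_iso C i" using C.isoI[of i Q "ObjMap F (ObjMap G Q)" "\<sigma> Q"] i \<sigma>h by (simp add: hom_full_subcat)
    then show ?thesis using A i(1) by (auto simp: hom_full_subcat)
  qed
  have iso_univ: "universal_arrow C S Q B (i \<cdot>\<^bsub>C\<^esub> \<eta> Q)"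
    if Q: "Q \<in> Obj C" and i: "i \<in> hom C (ObjMap L Q) B" "is_iso C i" and B: "B \<in> S" for Q B i
  proof -
    note h = R.unit_hom[OF Q]
    obtain j where j: "j \<in> hom C B (ObjMap L Q)" "j \<cdot>\<^bsub>C\<^esub> i = Ident C (ObjMap L Q)" "i \<cdot>\<^bsub>C\<^esub> j = Ident C B"
      using C.isoE[OF i(2,1)] by blast
    have "\<exists>!k. k \<in> hom C B E \<and> k \<cdot>\<^bsub>C\<^esub> (i \<cdot>\<^bsub>C\<^esub> \<eta> Q) = g" if E: "E \<in> S" and g: "g \<in> hom C Q E" for E g
    proof -
      obtain k where k: "k \<in> hom C (ObjMap L Q) E" "k \<cdot>\<^bsub>C\<^esub> \<eta> Q = g"
        using R.univ_factor[OF R.unit_universal[OF Q] E g] by blast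
      have ji: "j \<cdot>\<^bsub>C\<^esub> (i \<cdot>\<^bsub>C\<^esub> \<eta> Q) = \<eta> Q" using C.comp_reassoc[OF j(2) h i(1) j(1)] C.ident_left[OF h] by simp
      show ?thesis
      proof (rule ex1I[of _ "k \<cdot>\<^bsub>C\<^esub> j"])
        show "k \<cdot>\<^bsub>C\<^esub> j \<in> hom C B E \<and> (k \<cdot>\<^bsub>C\<^esub> j) \<cdot>\<^bsub>C\<^esub> i \<cdot>\<^bsub>C\<^esub> \<eta> Q = g"
          using C.comp_hom[OF j(1) k(1)] C.comp_assoc[OF C.comp_hom[OF h i(1)] j(1) k(1)] ji k(2) by simp
      next
        fix x assume "x \<in> hom C B E \<and> x \<cdot>\<^bsub>C\<^esub> i \<cdot>\<^bsub>C\<^esub> \<eta> Q = g"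
        then have x: "x \<in> hom C B E" "x \<cdot>\<^bsub>C\<^esub> (i \<cdot>\<^bsub>C\<^esub> \<eta> Q) = g" by auto
        have "(x \<cdot>\<^bsub>C\<^esub> i) \<cdot>\<^bsub>C\<^esub> \<eta> Q = k \<cdot>\<^bsub>C\<^esub> \<eta> Q" using C.comp_assoc[OF h i(1) x(1)] x(2) k(2) by simp
        then have "x \<cdot>\<^bsub>C\<^esub> i = k"
          using R.univ_ext[OF R.unit_universal[OF Q] E C.comp_hom[OF i(1) x(1)] k(1)] by blast
        then show "x = k \<cdot>\<^bsub>C\<^esub> j" using C.comp_assoc[OF j(1) i(1) x(1)] j(3) C.ident_right[OF x(1)] by simp
      qed
    qed
    then show ?thesis using B C.comp_hom[OF h i(1)] unfolding universal_arrow_def by blast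
  qed
  have "semi_left_exact_embedding X C F"
  proof unfold_locales
    fix Q assume Q: "Q \<in> Obj C"
    obtain A i where A: "A \<in> Obj X" "i \<in> hom C (ObjMap L Q) (ObjMap F A)" "is_iso C i"
      using rep[OF R.L_obj[OF Q]] by blast
    then show "\<exists>A \<in> Obj X. \<exists>\<eta>. E.universal Q (ObjMap F A) \<eta>"
      using univ_sub[OF iso_univ[OF Q A(2,3) FS[OF A(1)]]] by blast
  next
    fix A Q u Y f p q assume A: "A \<in> Obj X" and u: "E.universal Q (ObjMap F A) u" and Y: "Y \<in> Obj X"
      and f: "f \<in> hom C (ObjMap F Y) (ObjMap F A)" and P: "is_pullback C f u p q"
    have uh: "u \<in> hom C Q (ObjMap F A)" using u by (simp add: universal_arrow_def)
    have Q: "Q \<in> Obj C" using C.hom_objs[OF uh] by simp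
    note h = R.unit_hom[OF Q] and L = R.L_obj[OF Q]
    obtain j where j: "j \<in> hom C (ObjMap L Q) (ObjMap F A)" "j \<cdot>\<^bsub>C\<^esub> \<eta> Q = u"
      using R.univ_factor[OF R.unit_universal[OF Q] FS[OF A] uh] by blast
    obtain A0 i where A0: "A0 \<in> Obj X" "i \<in> hom C (ObjMap L Q) (ObjMap F A0)" "is_iso C i" using rep[OF L] by blast
    obtain i' where i': "i' \<in> hom C (ObjMap F A0) (ObjMap L Q)" "i' \<cdot>\<^bsub>C\<^esub> i = Ident C (ObjMap L Q)"
      using C.isoE[OF A0(3,2)] by blast
    obtain m where m: "m \<in> hom X A A0" "ArrMap F m \<cdot>\<^bsub>C\<^esub> u = i \<cdot>\<^bsub>C\<^esub> \<eta> Q"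
      using E.universal_factor[OF u A A0(1) C.comp_hom[OF h A0(2)]] by blast
    \<comment> \<open>\<open>k\<close> and \<open>j\<close> compare the universal arrow
      \<open>u\<close> with the unit of \<open>Q\<close>: composition with \<open>k\<close> turns
      \<open>u\<close> into the unit, and \<open>j\<close> undoes it.\<close>
    define k where "k = i' \<cdot>\<^bsub>C\<^esub> ArrMap F m"
    have k: "k \<in> hom C (ObjMap F A) (ObjMap L Q)" unfolding k_def using C.comp_hom[OF E.U_hom[OF m(1)] i'(1)] .
    have ku: "k \<cdot>\<^bsub>C\<^esub> u = \<eta> Q"
      unfolding k_def using C.comp_assoc[OF uh E.U_hom[OF m(1)] i'(1)] m(2) C.comp_reassoc[OF i'(2) h A0(2) i'(1)]
        C.ident_left[OF h] by simp
    have "(j \<cdot>\<^bsub>C\<^esub> k) \<cdot>\<^bsub>C\<^esub> u = u" using C.comp_assoc[OF uh k j(1)] ku j(2) by simp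
    moreover obtain jk where jk: "jk \<in> hom X A A" "ArrMap F jk = j \<cdot>\<^bsub>C\<^esub> k"
      using E.U_full[OF A A C.comp_hom[OF k j(1)]] by blast
    ultimately have "jk = Ident X A"
      using E.universal_ext[OF u jk(1) X.ident_hom[OF A]] E.U_ident[OF A] C.ident_left[OF uh] by simp
    then have jk1: "j \<cdot>\<^bsub>C\<^esub> k = Ident C (ObjMap F A)" using jk(2) E.U_ident[OF A] by simp
    note H = C.pullback_homs[OF P f uh] and kf = C.comp_hom[OF f k]
    have jkx: "j \<cdot>\<^bsub>C\<^esub> (k \<cdot>\<^bsub>C\<^esub> x) = x" if "x \<in> hom C T (ObjMap F A)" for x T
      using C.comp_reassoc[OF jk1 that k j(1)] C.ident_left[OF that] by simp
    \<comment> \<open>The given pullback of \<open>u\<close> is also a pullback of the unit, along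
      \<open>k\<close> after \<open>f\<close>, so semi-left-exactness applies to it.\<close>
    have "is_pullback C (k \<cdot>\<^bsub>C\<^esub> f) (\<eta> Q) p q"
    proof (rule C.pullbackI[OF kf h H(1,2)])
      show "(k \<cdot>\<^bsub>C\<^esub> f) \<cdot>\<^bsub>C\<^esub> p = \<eta> Q \<cdot>\<^bsub>C\<^esub> q"
        using C.comp_assoc[OF H(1) f k] H(4) C.comp_reassoc[OF ku H(2) uh k] by simp
    next
      fix T a b assume a: "a \<in> hom C T (ObjMap F Y)" and b: "b \<in> hom C T Q" and ab: "(k \<cdot>\<^bsub>C\<^esub> f) \<cdot>\<^bsub>C\<^esub> a = \<eta> Q \<cdot>\<^bsub>C\<^esub> b"
      have "f \<cdot>\<^bsub>C\<^esub> a = j \<cdot>\<^bsub>C\<^esub> (\<eta> Q \<cdot>\<^bsub>C\<^esub> b)"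
        using jkx[OF C.comp_hom[OF a f]] C.comp_assoc[OF a f k] ab by simp
      then have "f \<cdot>\<^bsub>C\<^esub> a = u \<cdot>\<^bsub>C\<^esub> b" using C.comp_reassoc[OF j(2) b h j(1)] by simp
      then show "\<exists>h \<in> hom C T (Dom C p). p \<cdot>\<^bsub>C\<^esub> h = a \<and> q \<cdot>\<^bsub>C\<^esub> h = b"
        using C.pullback_lift[OF P H(1,2) a b] by blast
    qed (rule C.pullback_unique[OF P H(1,2)])
    then have "universal_arrow C S (Dom C p) (ObjMap F Y) p"
      using sl(2) kf Q FS[OF Y] unfolding R.semi_left_exact_iff by blast
    then show "E.universal (Dom C p) (ObjMap F Y) p" using univ_sub Y by blast
  qed
  then show ?thesis by blast
qed

section \<open>Comparison of the conditions\<close>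

lemma condition_b_imp_a:
  assumes "category X" "condition_b TYPE(('p, 'b) cat) X"
  shows "condition_a X"
proof -
  obtain C :: "('p, 'b) cat" where C: "exact_category C" "protomodular_category C" "is_semi_localization X C"
    using assms(2) by (auto simp: condition_b_def)
  have "category C" using C(2) by (simp add: protomodular_category_def)
  then obtain U where "semi_left_exact_embedding X C U"
    using semi_localization_embedding[OF assms(1) _ C(3)] by blast
  then show ?thesis using semi_left_exact_embedding.X_condition_a C(1,2) by blast
qed

lemma condition_c_imp_b: "condition_c TYPE(('p, 'b) cat) X \<Longrightarrow> condition_b TYPE(('p, 'b) cat) X"
  unfolding condition_b_def condition_c_def is_semi_localization_def is_semi_localization_regepi_units_def by blast

text \<open>The full image of the embedding is equivalent to \<open>X\<close>, and the completion of
  any regular category is exact.\<close>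

lemma condition_d_imp_b:
  fixes X :: "('o, 'a) cat"
  assumes "condition_d X"
  shows "condition_b TYPE((('o, 'a) ex_obj, ('o, 'a) ex_arr) cat) X"
proof -
  interpret regular_category X using assms by (simp add: condition_d_def)
  interpret ex: exact_completion X "ex_reg X" "ex_embedding X" by (rule exact_completion_ex_reg)
  have "is_semi_localization X (ex_reg X)"
    using assms ex.equivalent_image
    unfolding condition_d_def is_semi_localization_via_def is_semi_localization_def by blast
  then show ?thesis using assms ex.C_exact unfolding condition_d_def condition_b_def by blast
qed

text \<open>One family of universal arrows serves both conditions: local surjectivity makes the
  units regular epimorphisms, and stability under pullback is semi-left-exactness.\<close>

lemma condition_a_imp_c_d:
  fixes X :: "('o, 'a) cat"
  assumes a: "condition_a X"
  shows "condition_c TYPE((('o, 'a) ex_obj, ('o, 'a) ex_arr) cat) X \<and> condition_d X"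
proof -
  interpret regular_category X using a by (simp add: condition_a_def)
  have proto: "protomodular_category X" and st: "stable_coequalizers_of_equivalence_relations X"
    using a by (simp_all add: condition_a_def)
  interpret ex: exact_completion X "ex_reg X" "ex_embedding X" by (rule exact_completion_ex_reg)
  let ?S = "ObjMap (ex_embedding X) ` Obj X"
  \<comment> \<open>Everything wanted of the unit at \<open>P\<close>, bundled so that
    \<open>B\<close> and \<open>\<eta>\<close> are chosen together.\<close>
  let ?good = "\<lambda>P B \<eta>. B \<in> ?S \<and> ex.universal P B \<eta> \<and> ex.locally_surjective P B \<eta> \<and>
    (\<forall>Y \<in> ?S. \<forall>f \<in> hom (ex_reg X) Y B. \<forall>p q. is_pullback (ex_reg X) f \<eta> p q \<longrightarrow>
      ex.universal (Dom (ex_reg X) p) Y p)"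
  have "\<exists>B \<eta>. ?good P B \<eta>" if P: "P \<in> Obj (ex_reg X)" for P
  proof -
    obtain A \<eta> where A: "A \<in> Obj X" "ex.universal P (ex.UO A) \<eta>" "ex.locally_surjective P (ex.UO A) \<eta>"
      "\<And>Y f p q. Y \<in> Obj X \<Longrightarrow> f \<in> hom (ex_reg X) (ex.UO Y) (ex.UO A) \<Longrightarrow> is_pullback (ex_reg X) f \<eta> p q \<Longrightarrow>
        ex.universal (Dom (ex_reg X) p) (ex.UO Y) p"
      by (rule ex.reflection_along_coequalizer[OF st P], rule that)
    then have "?good P (ex.UO A) \<eta>" by (intro conjI ballI allI impI) (auto intro: A(4))
    then show ?thesis by blast
  qed
  then obtain B \<eta> where good: "\<And>P. P \<in> Obj (ex_reg X) \<Longrightarrow> ?good P (B P) (\<eta> P)" by metis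
  have S: "?S \<subseteq> Obj (ex_reg X)" using ex.U_obj by blast
  obtain L where L: "is_reflection (ex_reg X) ?S L \<eta>" "ObjMap L = B"
    using ex.C.reflection_from_universal[OF S, of B \<eta>] good by blast
  interpret R: reflection "ex_reg X" ?S L \<eta> by unfold_locales (rule L(1))
  have "semi_left_exact (ex_reg X) ?S L \<eta>"
    unfolding R.semi_left_exact_iff L(2) using good by blast
  then have sl: "semi_localization_subcat (ex_reg X) ?S L \<eta>"
    using L(1) by (simp add: semi_localization_subcat_def)
  have "\<forall>P \<in> Obj (ex_reg X). is_regular_epi (ex_reg X) (\<eta> P)"
    using good ex.locally_surjective_regular_epi by blast
  then have "is_semi_localization_regepi_units X (ex_reg X)"
    unfolding is_semi_localization_regepi_units_def using sl ex.equivalent_image by blast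
  moreover have "is_semi_localization_via X (ex_reg X) (ex_embedding X)"
    unfolding is_semi_localization_via_def using sl ex.fully_faithful by blast
  ultimately show ?thesis
    using ex.C_exact ex.C_protomodular[OF proto] regular_category_axioms
    unfolding condition_c_def condition_d_def by blast
qed

theorem theorem5p1:
  fixes X :: "('o, 'a) cat"
  assumes "category X"
  shows "(condition_a X \<longleftrightarrow> condition_b TYPE((('o, 'a) ex_obj, ('o, 'a) ex_arr) cat) X) \<and>
    (condition_b TYPE((('o, 'a) ex_obj, ('o, 'a) ex_arr) cat) X \<longleftrightarrow>
      condition_c TYPE((('o, 'a) ex_obj, ('o, 'a) ex_arr) cat) X) \<and>
    (condition_c TYPE((('o, 'a) ex_obj, ('o, 'a) ex_arr) cat) X \<longleftrightarrow> condition_d X) \<and>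
    (condition_b TYPE(('p, 'b) cat) X \<longrightarrow> condition_a X) \<and>
    (condition_c TYPE(('p, 'b) cat) X \<longrightarrow> condition_a X)"
  \<comment> \<open>Condition (a) yields (c) and (d), each of these yields (b), and (b) yields (a);
    the implications from (c) to (b) and from (b) to (a) hold for every choice of the types of the
    witness.\<close>
  using condition_b_imp_a[OF assms, where 'p = 'p and 'b = 'b]
    condition_b_imp_a[OF assms, where 'p = "('o, 'a) ex_obj" and 'b = "('o, 'a) ex_arr"]
    condition_c_imp_b[where X = X and 'p = 'p and 'b = 'b]
    condition_c_imp_b[where X = X and 'p = "('o, 'a) ex_obj" and 'b = "('o, 'a) ex_arr"]
    condition_d_imp_b[of X] condition_a_imp_c_d[of X] by blast

end
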